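(* Let $p$ be an odd prime, $A$ the mod $p$ Steenrod algebra and $P=\widetilde H^*(B\mathbb{Z}/p;\mathbb{F}_p)$. Then $\operatorname{Ext}_A^{1,*}(P,\mathbb{F}_p)$ has an $\mathbb{F}_p$-basis consisting of all the elements in the following list: 1. $\alpha_0\widehat h_i=\left[\lambda^0_{-1}ab^{[(p-1)p^i-1]}\right]$, $i\ge1$; 2. $\alpha_0\widehat h_i(k)=\left[\lambda^0_{-1}ab^{[kp^i-1]}\right]$, $i\ge1$, $1\le k<p-1$; 3. $\widehat\alpha(\ell)=\left[\lambda^0_{-1}ab^{[p+\ell]}+(\ell+1)\lambda^0_0ab^{[\ell+1]}\right]$, $0\le\ell<p-2$; 4. $h_i\widehat h_i(1)=\left[\lambda^1_{p^i-1}ab^{[p^i-1]}\right]$, $i\ge0$; 5. $h_i\widehat h_j=\left[\lambda^1_{p^i-1}ab^{[(p-1)p^j-1]}\right]$, $i,j\ge0$, $j\ne i,i+1$; 6. $h_i\widehat h_j(k)=\left[\lambda^1_{p^i-1}ab^{[kp^j-1]}\right]$, $i,j\ge0$, $j\ne i,i+1$, $1\le k<p-1$; 7. $\widehat d_i(k)=(\mathcal{P}^0)^{i-1}\left(\left[\lambda^1_{p-1}ab^{[kp+p-2]}\right]\right)$, $i\ge1$, $1\le k\le p-1$; 8. $\widehat k_i(k)=(\mathcal{P}^0)^i\left(\left[\sum_{j=0}^k\frac1{j+1}\lambda^1_jab^{[(k-j)p+j]}\right]\right)$, $i\ge0$, $1\le k<p-1$; 9. $\widehat p_i(r)=(\mathcal{P}^0)^i\left(\left[\sum_{j=0}^{p-1-r}\frac{\binom{r+j}{j}}{j+1}\lambda^1_jab^{[(p-j-1)p+r+j]}\right]\right)$,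 $i\ge0$, $1\le r<p-1$. Moreover, the decomposable elements in $\operatorname{Ext}_A^{s,s+t}(P,\mathbb{F}_p)$ for $s\le1$ satisfy only the following relations: - $h_i\widehat h_{i+1}=0$, $i\ge0$; - $h_i\widehat h_{i+1}(k)=0$, $i\ge0$, $1\le k<p-1$; - $h_i\widehat h_i=0$, $i\ge0$; - $h_i\widehat h_i(k)=0$, $i\ge0$, $2\le k<p-1$; - $\alpha_0\widehat h_0=0$; and - $\alpha_0\widehat h_0(k)=0$, $1\le k<p-1$.
   Context: $H^*(B\mathbb{Z}/p;\mathbb{F}_p)=E(x)\otimes\mathbb{F}_p[y]$, $|x|=1$, $y=\beta x$. $H=P^\#=\widetilde H_*(B\mathbb{Z}/p;\mathbb{F}_p)$ has basis $\{a^\epsilon b^{[t]}:\epsilon\in\{0,1\},t\ge0,t+\epsilon>0\}$ dual to $\{x^\epsilon y^t\}$, with the dual right $A$-action. The lambda algebra $\Lambda$ (in the opposite convention of Priddy) is the graded associative unital differential $\mathbb{F}_p$-algebra generated by $\lambda^1_{i-1}=\lambda_{i-1}$ ($i\ge1$) of degree $2i(p-1)-1$ and $\lambda^0_{i-1}=\mu_{i-1}$ ($i\ge0$) of degree $2i(p-1)$, with relations, for $n\ge0$: for $m\ge1$, $\sum_{i+j=n}\binom{n}{i}\lambda_{i-1+pm}\lambda_{j-1+m}=0$ and $\sum_{i+j=n}\binom{n}{i}(\lambda_{i-1+pm}\mu_{j-1+m}-\mu_{i-1+pm}\lambda_{j-1+m})=0$; for $m\ge0$, $\sum_{i+j=n}\binom{n}{i}\lambda_{i+pm}\mu_{j-1+m}=0$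 and $\sum_{i+j=n}\binom{n}{i}\mu_{i+pm}\mu_{j-1+m}=0$. The differential is $d(\lambda_{n-1})=\sum_{i+j=n}\binom ni\lambda_{i-1}\lambda_{j-1}$, $d(\mu_{n-1})=\sum_{i+j=n}\binom ni(\lambda_{i-1}\mu_{j-1}-\mu_{i-1}\lambda_{j-1})$ (with $\lambda_{-1}=0$), $d(\sigma\tau)=(-1)^{\deg\sigma}\sigma d(\tau)+d(\sigma)\tau$. $\Lambda_s$ is the span of monomials of length $s$. For a left $A$-module $M$, $\operatorname{Ext}_A^{s}(M,\mathbb{F}_p)$ is the cohomology at $\Lambda_s\otimes M^\#$ of the complex $\Lambda\otimes M^\#$ with $d(\lambda\otimes h)=d(\lambda)\otimes h+\sum_{i-\epsilon\ge0}(-1)^{\deg\lambda+(1-\epsilon)\deg h}\lambda\lambda^\epsilon_{i-1}\otimes h\beta^{1-\epsilon}P^i$ ($\epsilon\in\{0,1\}$); a class in $\operatorname{Ext}_A^{s,s+t}$ is represented by a cocycle of total degree $t$. $[z]$ denotes the class of a cocycle $z$, and $\otimes$ is omitted from notation. $\alpha_0=[\lambda^0_{-1}]$, $h_i=[\lambda^1_{p^i-1}]\in\operatorname{Ext}_A^1(\mathbb{F}_p,\mathbb{F}_p)$; $\widehat h_i=[ab^{[(p-1)p^i-1]}]$ and $\widehat h_i(k)=[ab^{[kp^i-1]}]$ ($1\le k<p-1$) in $\operatorname{Ext}_A^0(P,\mathbb{F}_p)$; products are induced by multiplication on the left by $\Lambda$. The decomposable elements referred to are the products of $\alpha_0$ and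 the $h_i$ with the $\widehat h_j$ and $\widehat h_j(k)$. $\mathcal{P}^0$ on $\operatorname{Ext}_A^s(P,\mathbb{F}_p)$ is induced by the chain map $\widetilde{\mathcal{P}}^0$ on $\Lambda\otimes H$ sending $\lambda^{\epsilon_1}_{i_1-1}\cdots\lambda^{\epsilon_s}_{i_s-1}\otimes a^\epsilon b^{[t]}$ to $\lambda^1_{pi_1-1}\cdots\lambda^1_{pi_s-1}\otimes ab^{[p(t+1)-1]}$ if $\epsilon_1=\dots=\epsilon_s=\epsilon=1$ and to $0$ otherwise. *)

theory Defs
  imports
    "HOL-Library.Poly_Mapping"
    "HOL-Library.Product_Plus"
    "Berlekamp_Zassenhaus.Finite_Field"
begin

section \<open>Additive maps on finitely supported functions\<close>

definition pm_ext :: "('a \<Rightarrow> 'k::zero \<Rightarrow> 'c::comm_monoid_add) \<Rightarrow> ('a \<Rightarrow>\<^sub>0 'k) \<Rightarrow> 'c" where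
  "pm_ext f x = (\<Sum>w\<in>Poly_Mapping.keys x. f w (Poly_Mapping.lookup x w))"

lemma pm_ext_superset:
  assumes "finite A" "Poly_Mapping.keys x \<subseteq> A" "\<And>w. f w 0 = 0"
  shows "pm_ext f x = (\<Sum>w\<in>A. f w (Poly_Mapping.lookup x w))"
  unfolding pm_ext_def
  using assms by (intro sum.mono_neutral_left) (auto simp: in_keys_iff)

lemma pm_ext_single [simp]: "f w 0 = 0 \<Longrightarrow> pm_ext f (Poly_Mapping.single w c) = f w c"
  by (cases "c = 0") (auto simp: pm_ext_def)

lemma pm_ext_zero [simp]: "pm_ext f 0 = 0"
  by (simp add: pm_ext_def)

lemma pm_ext_add:
  fixes x :: "'a \<Rightarrow>\<^sub>0 'k::comm_monoid_add" and f :: "'a \<Rightarrow> 'k \<Rightarrow> 'c::comm_monoid_add"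
  assumes "\<And>w. f w 0 = 0" "\<And>w a b. f w (a + b) = f w a + f w b"
  shows "pm_ext f (x + y) = pm_ext f x + pm_ext f y"
proof -
  let ?A = "Poly_Mapping.keys x \<union> Poly_Mapping.keys y"
  have "pm_ext f (x + y) = (\<Sum>w\<in>?A. f w (Poly_Mapping.lookup (x + y) w))"
    by (rule pm_ext_superset) (auto simp: assms keys_add)
  also have "\<dots> = (\<Sum>w\<in>?A. f w (Poly_Mapping.lookup x w)) + (\<Sum>w\<in>?A. f w (Poly_Mapping.lookup y w))"
    by (simp add: lookup_add assms sum.distrib)
  also have "(\<Sum>w\<in>?A. f w (Poly_Mapping.lookup x w)) = pm_ext f x"
    by (rule pm_ext_superset[symmetric]) (auto simp: assms)
  also have "(\<Sum>w\<in>?A. f w (Poly_Mapping.lookup y w)) = pm_ext f y"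
    by (rule pm_ext_superset[symmetric]) (auto simp: assms)
  finally show ?thesis .
qed

lemma pm_sum_single: "x = pm_ext Poly_Mapping.single x"
  by (rule poly_mapping_eqI)
     (auto simp: pm_ext_def lookup_sum lookup_single when_def in_keys_iff sum.delta)

lemma pm_induct [case_names zero single add]:
  fixes x :: "'a \<Rightarrow>\<^sub>0 'k::comm_monoid_add"
  assumes "P 0" "\<And>w c. P (Poly_Mapping.single w c)" "\<And>x y. P x \<Longrightarrow> P y \<Longrightarrow> P (x + y)"
  shows "P x"
proof -
  have "P (\<Sum>w\<in>A. Poly_Mapping.single w (Poly_Mapping.lookup x w))" if "finite A" for A
    using that by induction (auto intro: assms)
  then have "P (pm_ext Poly_Mapping.single x)"
    by (simp add: pm_ext_def)
  then show ?thesis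
    by (simp flip: pm_sum_single)
qed

lemma additive_diff:
  fixes F :: "'a::ab_group_add \<Rightarrow> 'b::ab_group_add"
  assumes "\<And>x y. F (x + y) = F x + F y"
  shows "F 0 = 0" "F (- x) = - F x" "F (x - y) = F x - F y" "F (sum h A) = (\<Sum>i\<in>A. F (h i))"
proof -
  show *: "F 0 = 0" using assms[of 0 0] by simp
  show **: "F (- x) = - F x" for x
    using assms[of x "- x"] * by (simp add: eq_neg_iff_add_eq_0 add.commute)
  show "F (x - y) = F x - F y"
    using assms[of x "- y"] ** by simp
  show "F (sum h A) = (\<Sum>i\<in>A. F (h i))"
    by (induction A rule: infinite_finite_induct) (auto simp: * assms)
qed

section \<open>The lambda algebra\<close>

text \<open>\<open>Lam n\<close> is $\lambda_n = \lambda^1_n$, whereas \<open>Mu n\<close> is $\mu_{n-1} = \lambda^0_{n-1}$,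
  whose subscripts start at $-1$.\<close>

datatype lgen = Lam nat | Mu nat

datatype lword = Word (letters: "lgen list")

instantiation lword :: monoid_add
begin
definition "0 = Word []"
definition "v + w = Word (letters v @ letters w)"
instance
  by standard (auto simp: zero_lword_def plus_lword_def)
end

lemma letters_zero [simp]: "letters 0 = []"
  and letters_plus [simp]: "letters (v + w) = letters v @ letters w"
  by (simp_all add: zero_lword_def plus_lword_def)

lemma lword_add_eq_0_iff [simp]: "(v::lword) + w = 0 \<longleftrightarrow> v = 0 \<and> w = 0"
  by (cases v; cases w) (auto simp: zero_lword_def plus_lword_def)

text \<open>The free associative algebra on the generators, i.e. the monoid algebra of the free monoid.\<close>

type_synonym 'p free_alg = "lword \<Rightarrow>\<^sub>0 'p mod_ring"

definition fscal :: "'p::prime_card mod_ring \<Rightarrow> 'p free_alg" where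
  "fscal c = Poly_Mapping.single 0 c"

text \<open>\<open>flam i\<close> is $\lambda_{i-1}$, with $\lambda_{-1} = 0$; \<open>fmu i\<close> is $\mu_{i-1}$.\<close>

definition flam :: "nat \<Rightarrow> 'p::prime_card free_alg" where
  "flam i = (if i = 0 then 0 else Poly_Mapping.single (Word [Lam (i - 1)]) 1)"

definition fmu :: "nat \<Rightarrow> 'p::prime_card free_alg" where
  "fmu i = Poly_Mapping.single (Word [Mu i]) 1"

inductive_set lambda_rels :: "'p::prime_card free_alg set" where
  lam_lam: "m \<ge> 1 \<Longrightarrow>
    (\<Sum>i\<le>n. of_nat (n choose i) * (flam (i + CARD('p) * m) * flam (n - i + m))) \<in> lambda_rels"
| lam_mu_mu_lam: "m \<ge> 1 \<Longrightarrow>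
    (\<Sum>i\<le>n. of_nat (n choose i) *
      (flam (i + CARD('p) * m) * fmu (n - i + m) - fmu (i + CARD('p) * m) * flam (n - i + m)))
    \<in> lambda_rels"
| lam_mu: "(\<Sum>i\<le>n. of_nat (n choose i) * (flam (i + CARD('p) * m + 1) * fmu (n - i + m))) \<in> lambda_rels"
| mu_mu: "(\<Sum>i\<le>n. of_nat (n choose i) * (fmu (i + CARD('p) * m + 1) * fmu (n - i + m))) \<in> lambda_rels"

text \<open>The two-sided ideal generated by the relations.\<close>

inductive_set lambda_ideal :: "'p::prime_card free_alg set" where
  zero: "0 \<in> lambda_ideal"
| rel: "r \<in> lambda_rels \<Longrightarrow> a * r * b \<in> lambda_ideal"
| add: "x \<in> lambda_ideal \<Longrightarrow> y \<in> lambda_ideal \<Longrightarrow> x + y \<in> lambda_ideal"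

lemma ideal_rel: "r \<in> lambda_rels \<Longrightarrow> r \<in> lambda_ideal"
  using lambda_ideal.rel[of r 1 1] by simp

lemma ideal_mult_left: "x \<in> lambda_ideal \<Longrightarrow> a * x \<in> lambda_ideal"
proof (induction rule: lambda_ideal.induct)
  case (rel r b c)
  then show ?case using lambda_ideal.rel[of r "a * b" c] by (simp add: mult.assoc)
qed (auto simp: distrib_left intro: lambda_ideal.intros)

lemma ideal_mult_right: "x \<in> lambda_ideal \<Longrightarrow> x * a \<in> lambda_ideal"
proof (induction rule: lambda_ideal.induct)
  case (rel r b c)
  then show ?case using lambda_ideal.rel[of r b "c * a"] by (simp add: mult.assoc)
qed (auto simp: distrib_right intro: lambda_ideal.intros)

lemma ideal_uminus: "x \<in> lambda_ideal \<Longrightarrow> - x \<in> lambda_ideal"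
  using ideal_mult_left[of x "- 1"] by simp

lemma ideal_diff: "x \<in> lambda_ideal \<Longrightarrow> y \<in> lambda_ideal \<Longrightarrow> x - y \<in> lambda_ideal"
  using lambda_ideal.add[of x "- y"] ideal_uminus[of y] by simp

lemma ideal_sum: "(\<And>i. i \<in> A \<Longrightarrow> f i \<in> lambda_ideal) \<Longrightarrow> sum f A \<in> lambda_ideal"
  by (induction A rule: infinite_finite_induct) (auto intro: lambda_ideal.intros)

lemma lookup_mult_0:
  fixes f g :: "'p::prime_card free_alg"
  shows "Poly_Mapping.lookup (f * g) 0 = Poly_Mapping.lookup f 0 * Poly_Mapping.lookup g 0"
proof (induction f rule: pm_induct)
  case (single v c)
  show ?case
  proof (induction g rule: pm_induct)
    case (single w d)
    then show ?case
      by (auto simp: mult_single lookup_single when_def)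
  qed (auto simp: lookup_add distrib_left)
qed (auto simp: lookup_add distrib_right)

lemma fmu_0: "Poly_Mapping.lookup (fmu i) 0 = 0" and flam_0: "Poly_Mapping.lookup (flam i) 0 = 0"
  by (auto simp: fmu_def flam_def lookup_single zero_lword_def)

lemma lambda_rels_0: "r \<in> lambda_rels \<Longrightarrow> Poly_Mapping.lookup r 0 = 0"
  by (induction rule: lambda_rels.induct)
     (auto simp: lookup_sum lookup_mult_0 lookup_minus fmu_0 flam_0)

lemma lambda_ideal_0: "x \<in> lambda_ideal \<Longrightarrow> Poly_Mapping.lookup x 0 = 0"
  by (induction rule: lambda_ideal.induct) (simp_all add: lookup_mult_0 lookup_add lambda_rels_0)

lemma one_notin_ideal: "1 \<notin> lambda_ideal"
  using lambda_ideal_0[of 1] by auto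

quotient_type 'p lambda = "'p::prime_card free_alg" / "\<lambda>x y. x - y \<in> lambda_ideal"
proof (rule equivpI)
  show "reflp (\<lambda>x y::'p free_alg. x - y \<in> lambda_ideal)"
    by (auto intro!: reflpI lambda_ideal.zero)
  show "symp (\<lambda>x y::'p free_alg. x - y \<in> lambda_ideal)"
  proof (rule sympI)
    fix x y :: "'p free_alg"
    assume "x - y \<in> lambda_ideal"
    from ideal_uminus[OF this] show "y - x \<in> lambda_ideal" by simp
  qed
  show "transp (\<lambda>x y::'p free_alg. x - y \<in> lambda_ideal)"
  proof (rule transpI)
    fix x y z :: "'p free_alg"
    assume "x - y \<in> lambda_ideal" "y - z \<in> lambda_ideal"
    from lambda_ideal.add[OF this] show "x - z \<in> lambda_ideal" by simp
  qed
qed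

instantiation lambda :: (prime_card) ring_1
begin

lift_definition zero_lambda :: "'a lambda" is 0 .
lift_definition one_lambda :: "'a lambda" is 1 .
lift_definition plus_lambda :: "'a lambda \<Rightarrow> 'a lambda \<Rightarrow> 'a lambda" is "(+)"
  by (simp add: add_diff_add lambda_ideal.add)
lift_definition minus_lambda :: "'a lambda \<Rightarrow> 'a lambda \<Rightarrow> 'a lambda" is "(-)"
proof -
  fix x x' y y' :: "'a free_alg"
  assume "x - x' \<in> lambda_ideal" "y - y' \<in> lambda_ideal"
  then have "(x - x') - (y - y') \<in> lambda_ideal"
    by (rule ideal_diff)
  then show "x - y - (x' - y') \<in> lambda_ideal"
    by (simp add: algebra_simps)
qed
lift_definition uminus_lambda :: "'a lambda \<Rightarrow> 'a lambda" is uminus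
proof -
  fix x y :: "'a free_alg"
  assume "x - y \<in> lambda_ideal"
  then have "- (x - y) \<in> lambda_ideal"
    by (rule ideal_uminus)
  then show "- x - - y \<in> lambda_ideal"
    by simp
qed
lift_definition times_lambda :: "'a lambda \<Rightarrow> 'a lambda \<Rightarrow> 'a lambda" is "(*)"
proof -
  fix x x' y y' :: "'a free_alg"
  assume "x - x' \<in> lambda_ideal" "y - y' \<in> lambda_ideal"
  then have "(x - x') * y + x' * (y - y') \<in> lambda_ideal"
    by (intro lambda_ideal.add ideal_mult_left ideal_mult_right)
  then show "x * y - x' * y' \<in> lambda_ideal"
    by (simp add: algebra_simps)
qed

instance
proof
  fix a b c :: "'a lambda"
  show "a + b + c = a + (b + c)" by transfer (simp add: add.assoc lambda_ideal.zero)
  show "a + b = b + a" by transfer (simp add: add.commute lambda_ideal.zero)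
  show "0 + a = a" by transfer (simp add: lambda_ideal.zero)
  show "- a + a = 0" by transfer (simp add: lambda_ideal.zero)
  show "a - b = a + - b" by transfer (simp add: lambda_ideal.zero)
  show "a * b * c = a * (b * c)" by transfer (simp add: mult.assoc lambda_ideal.zero)
  show "1 * a = a" by transfer (simp add: lambda_ideal.zero)
  show "a * 1 = a" by transfer (simp add: lambda_ideal.zero)
  show "(a + b) * c = a * c + b * c" by transfer (simp add: distrib_right lambda_ideal.zero)
  show "a * (b + c) = a * b + a * c" by transfer (simp add: distrib_left lambda_ideal.zero)
  show "(0::'a lambda) \<noteq> 1"
  proof transfer
    show "\<not> (0 - 1 :: 'a free_alg) \<in> lambda_ideal"
      using one_notin_ideal ideal_uminus[of "0 - 1 :: 'a free_alg"] by auto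
  qed
qed

end

section \<open>The differential on the free algebra\<close>

lemma fscal_simps:
  "fscal 0 = 0" "fscal 1 = 1" "fscal (a + b) = fscal a + fscal b" "fscal (- a) = - fscal a"
  "fscal (a * b) = fscal a * fscal b"
  by (simp_all add: fscal_def single_add single_uminus mult_single)

lemma fscal_commute: "x * fscal c = fscal c * x"
proof (induction x rule: pm_induct)
  case (single w d)
  then show ?case by (simp add: fscal_def mult_single mult.commute)
qed (simp_all add: distrib_left distrib_right)

lemma fscal_single: "fscal c * Poly_Mapping.single w d = Poly_Mapping.single w (c * d)"
  by (simp add: fscal_def mult_single)

definition gdeg :: "nat \<Rightarrow> lgen \<Rightarrow> nat" where
  "gdeg p g = (case g of Lam n \<Rightarrow> 2 * (n + 1) * (p - 1) - 1 | Mu n \<Rightarrow> 2 * n * (p - 1))"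

definition wdeg :: "nat \<Rightarrow> lword \<Rightarrow> nat" where
  "wdeg p w = sum_list (map (gdeg p) (letters w))"

definition free_gen :: "lgen \<Rightarrow> 'p::prime_card free_alg" where
  "free_gen g = Poly_Mapping.single (Word [g]) 1"

primrec dgen :: "lgen \<Rightarrow> 'p::prime_card free_alg" where
  "dgen (Lam k) = (\<Sum>i\<le>k + 1. of_nat ((k + 1) choose i) * (flam i * flam (k + 1 - i)))"
| "dgen (Mu n) = (\<Sum>i\<le>n. of_nat (n choose i) * (flam i * fmu (n - i) - fmu i * flam (n - i)))"

primrec dword :: "lgen list \<Rightarrow> 'p::prime_card free_alg" where
  "dword [] = 0"
| "dword (g # w) =
     (-1) ^ gdeg CARD('p) g * free_gen g * dword w + dgen g * Poly_Mapping.single (Word w) 1"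

definition free_sgn :: "'p::prime_card free_alg \<Rightarrow> 'p free_alg" where
  "free_sgn = pm_ext (\<lambda>w c. Poly_Mapping.single w ((-1) ^ wdeg CARD('p) w * c))"

definition free_d :: "'p::prime_card free_alg \<Rightarrow> 'p free_alg" where
  "free_d = pm_ext (\<lambda>w c. fscal c * dword (letters w))"

lemma free_sgn_add: "free_sgn (x + y) = free_sgn x + free_sgn y"
  unfolding free_sgn_def by (rule pm_ext_add) (auto simp: single_add distrib_left)

lemma free_d_add: "free_d (x + y) = free_d x + free_d y"
  unfolding free_d_def by (rule pm_ext_add) (auto simp: fscal_simps distrib_right)

lemmas free_sgn_additive = free_sgn_add additive_diff[of free_sgn, OF free_sgn_add]
lemmas free_d_additive = free_d_add additive_diff[of free_d, OF free_d_add]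

lemma free_sgn_single:
  "free_sgn (Poly_Mapping.single w c :: 'p::prime_card free_alg) =
     Poly_Mapping.single w ((-1) ^ wdeg CARD('p) w * c)"
  by (simp add: free_sgn_def)

lemma free_d_single: "free_d (Poly_Mapping.single w c) = fscal c * dword (letters w)"
  by (simp add: free_d_def fscal_simps)

lemma free_sgn_mult: "free_sgn (x * y) = free_sgn x * free_sgn y"
proof (induction x rule: pm_induct)
  case (single v c)
  show ?case
  proof (induction y rule: pm_induct)
    case (single w d)
    show ?case
      by (simp add: mult_single free_sgn_single wdeg_def power_add mult_ac)
  qed (simp_all add: free_sgn_additive distrib_left)
qed (simp_all add: free_sgn_additive distrib_right)

lemma free_sgn_1 [simp]: "free_sgn 1 = 1"
  using free_sgn_single[of 0 1] by (simp add: wdeg_def)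

lemma free_sgn_fscal: "free_sgn (fscal c) = fscal c"
  by (simp add: fscal_def free_sgn_single wdeg_def)

lemma single_Word_append:
  "Poly_Mapping.single (Word (v @ w)) (1::'a::prime_card mod_ring) =
     Poly_Mapping.single (Word v) 1 * Poly_Mapping.single (Word w) 1"
  by (simp add: mult_single plus_lword_def)

lemma free_sgn_Word_Cons:
  "free_sgn (Poly_Mapping.single (Word (g # v)) 1 :: 'p::prime_card free_alg) =
     (-1) ^ gdeg CARD('p) g * free_gen g * free_sgn (Poly_Mapping.single (Word v) 1)"
proof -
  have eq: "(-1) ^ n * Poly_Mapping.single w c = Poly_Mapping.single w ((-1) ^ n * c)"
    for n w and c :: "'p mod_ring"
    by (cases "even n") (auto simp: single_uminus)
  show ?thesis
    by (simp add: free_sgn_single free_gen_def mult_single wdeg_def power_add plus_lword_def mult.assoc eq)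
qed

lemma dword_append:
  "dword (v @ w) =
     free_sgn (Poly_Mapping.single (Word v) 1) * dword w + dword v * Poly_Mapping.single (Word w) 1"
proof (induction v)
  case Nil
  then show ?case by (simp flip: zero_lword_def)
next
  case (Cons g v)
  then show ?case
    by (simp add: free_sgn_Word_Cons single_Word_append distrib_left distrib_right mult.assoc)
qed

lemma free_d_mult: "free_d (x * y) = free_sgn x * free_d y + free_d x * y"
proof (induction x rule: pm_induct)
  case (single v c)
  show ?case
  proof (induction y rule: pm_induct)
    case (single w d)
    have 1: "Poly_Mapping.single v c = fscal c * Poly_Mapping.single v 1"
      "Poly_Mapping.single w d = fscal d * Poly_Mapping.single w 1"
      by (simp_all add: fscal_single)
    have 2: "free_sgn (Poly_Mapping.single v c) = fscal c * free_sgn (Poly_Mapping.single v 1)"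
      by (subst 1) (simp add: free_sgn_mult free_sgn_fscal)
    have 3: "x * (fscal d * y) = fscal d * (x * y)" for x y
      by (metis fscal_commute mult.assoc)
    have "free_d (Poly_Mapping.single v c * Poly_Mapping.single w d) =
        fscal c * (fscal d * dword (letters v @ letters w))"
      by (simp add: mult_single free_d_single fscal_simps mult.assoc)
    also have "\<dots> = fscal c * free_sgn (Poly_Mapping.single v 1) * (fscal d * dword (letters w)) +
        fscal c * dword (letters v) * (fscal d * Poly_Mapping.single w 1)"
      by (simp only: dword_append mult.assoc 3[of "free_sgn _"] 3[of "dword _"] distrib_left lword.collapse)
    also have "\<dots> = free_sgn (Poly_Mapping.single v c) * free_d (Poly_Mapping.single w d) +
        free_d (Poly_Mapping.single v c) * Poly_Mapping.single w d"
      by (simp only: 2 free_d_single 1(2)[symmetric])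
    finally show ?case .
  qed (simp_all add: free_d_additive free_sgn_additive distrib_left distrib_right add_ac)
qed (simp_all add: free_d_additive free_sgn_additive distrib_left distrib_right add_ac)

lemma gdeg_sign:
  "(-1::'a::ring_1) ^ gdeg CARD('p::prime_card) (Lam n) = - 1"
  "(-1::'a) ^ gdeg CARD('p) (Mu n) = 1"
proof -
  have "CARD('p) \<ge> 2"
    using prime_card prime_ge_2_nat by blast
  then have "(n + 1) * (CARD('p) - 1) \<ge> 1"
    by simp
  then have "odd (2 * ((n + 1) * (CARD('p) - 1)) - 1)"
    by simp
  then show "(-1::'a) ^ gdeg CARD('p) (Lam n) = - 1"
    unfolding gdeg_def by (simp only: lgen.case mult.assoc) (rule neg_one_odd_power)
qed (simp add: gdeg_def)

text \<open>Uniform notation for the generators: \<open>fg True i\<close> is $\lambda_{i-1}$ and \<open>fg False i\<close> is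
  $\mu_{i-1}$.\<close>

definition fg :: "bool \<Rightarrow> nat \<Rightarrow> 'p::prime_card free_alg" where
  "fg e i = (if e then flam i else fmu i)"

lemma fg_simps [simp]: "fg True = flam" "fg False = fmu"
  by (simp_all add: fg_def fun_eq_iff)

lemma free_sgn_fg: "free_sgn (fg e i) = (if e then - fg e i else fg e i)"
  by (auto simp: fg_def flam_def fmu_def free_sgn_single wdeg_def gdeg_sign single_uminus free_sgn_additive)

lemma free_d_flam: "free_d (flam n :: 'p::prime_card free_alg) = (\<Sum>i\<le>n. of_nat (n choose i) * (flam i * flam (n - i)))"
proof (cases n)
  case 0
  then show ?thesis by (simp add: flam_def free_d_additive)
next
  case (Suc k)
  have "flam n = (Poly_Mapping.single (Word [Lam k]) 1 :: 'p free_alg)"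
    by (simp add: flam_def Suc)
  then have "free_d (flam n :: 'p free_alg) = dgen (Lam k)"
    by (simp add: free_d_single fscal_simps del: dgen.simps flip: zero_lword_def)
  then show ?thesis
    by (simp only: dgen.simps Suc Suc_eq_plus1)
qed

lemma free_d_fmu:
  "free_d (fmu n) = (\<Sum>i\<le>n. of_nat (n choose i) * (flam i * fmu (n - i) - fmu i * flam (n - i)))"
  by (simp add: fmu_def[of n] free_d_single fscal_simps flip: zero_lword_def)

section \<open>The differential preserves the ideal of relations\<close>

text \<open>Replacing a word of length three with subscripts $a-1$, $b-1$, $c-1$ by $x_1^a x_2^b x_3^c$, a
  relation becomes $(x_1+x_2)^n (x_1^p x_2)^m$ (times $x_1$ for the last two kinds), and the
  differential substitutes $x_1 + x_2$ or $x_2 + x_3$ for a variable. That the result is again a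
  combination of relations comes down to the identity
  $(x_1+x_2)^p x_3 + x_1^p x_2 = x_1^p (x_2+x_3) + x_2^p x_3$ in characteristic $p$.\<close>

lemma add_power_prime_char:
  fixes x y :: "'a::comm_ring_1"
  assumes p: "prime p" and 0: "of_nat p = (0::'a)"
  shows "(x + y) ^ p = x ^ p + y ^ p"
proof -
  have p0: "p > 0" using p prime_gt_0_nat by blast
  have "(x + y) ^ p = (\<Sum>k\<le>p. of_nat (p choose k) * x ^ k * y ^ (p - k))"
    by (rule binomial_ring)
  also have "\<dots> = (\<Sum>k\<in>{0, p}. of_nat (p choose k) * x ^ k * y ^ (p - k))"
  proof (rule sum.mono_neutral_right)
    show "\<forall>k\<in>{..p} - {0, p}. of_nat (p choose k) * x ^ k * y ^ (p - k) = 0"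
    proof
      fix k assume "k \<in> {..p} - {0, p}"
      then have "p dvd (p choose k)"
        using p by (intro dvd_choose_prime) auto
      then obtain c where "p choose k = p * c" ..
      then have "of_nat (p choose k) = (0::'a)"
        by (simp add: 0)
      then show "of_nat (p choose k) * x ^ k * y ^ (p - k) = 0" by simp
    qed
  qed auto
  also have "\<dots> = x ^ p + y ^ p"
    using p0 by (simp add: add.commute)
  finally show ?thesis .
qed

text \<open>Words of length three in the generators with prescribed superscripts correspond to monomials in three
  commuting variables.\<close>

type_synonym 'p poly3 = "nat \<times> nat \<times> nat \<Rightarrow>\<^sub>0 'p mod_ring"

definition px1 :: "'p::prime_card poly3" where "px1 = Poly_Mapping.single (1, 0, 0) 1"
definition px2 :: "'p::prime_card poly3" where "px2 = Poly_Mapping.single (0, 1, 0) 1"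
definition px3 :: "'p::prime_card poly3" where "px3 = Poly_Mapping.single (0, 0, 1) 1"

definition word_poly :: "bool \<Rightarrow> bool \<Rightarrow> bool \<Rightarrow> 'p::prime_card poly3 \<Rightarrow> 'p free_alg" where
  "word_poly e e' e'' = pm_ext (\<lambda>(a, b, c) k. fscal k * (fg e a * fg e' b * fg e'' c))"

lemma X_power:
  "px1 ^ k = Poly_Mapping.single (k, 0, 0) 1" "px2 ^ k = Poly_Mapping.single (0, k, 0) 1"
  "px3 ^ k = Poly_Mapping.single (0, 0, k) 1"
proof -
  show "px1 ^ k = Poly_Mapping.single (k, 0, 0) 1"
    by (induction k) (simp_all add: px1_def mult_single flip: zero_prod_def)
  show "px2 ^ k = Poly_Mapping.single (0, k, 0) 1"
    by (induction k) (simp_all add: px2_def mult_single flip: zero_prod_def)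
  show "px3 ^ k = Poly_Mapping.single (0, 0, k) 1"
    by (induction k) (simp_all add: px3_def mult_single flip: zero_prod_def)
qed

lemma word_poly_add: "word_poly e e' e'' (x + y) = word_poly e e' e'' x + word_poly e e' e'' y"
  unfolding word_poly_def by (rule pm_ext_add) (auto simp: fscal_simps distrib_right)

lemmas word_poly_additive = word_poly_add additive_diff[of "word_poly _ _ _", OF word_poly_add]

lemma word_poly_of_nat: "word_poly e e' e'' (of_nat k * x) = of_nat k * word_poly e e' e'' x"
  by (induction k) (simp_all add: distrib_right word_poly_additive)

lemma word_poly_monom: "word_poly e e' e'' (px1 ^ a * px2 ^ b * px3 ^ c) = fg e a * fg e' b * fg e'' c"
  by (simp add: X_power mult_single word_poly_def fscal_simps)

lemma poly3_char: "of_nat CARD('p::prime_card) = (0 :: 'p poly3)"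
  by (metis of_nat_card_eq_0 single_of_nat single_zero)


definition pN :: "nat \<Rightarrow> 'p::prime_card poly3" where "pN n = (px1 + px2 + px3) ^ n"
definition pv12 :: "'p::prime_card poly3" where "pv12 = px1 ^ CARD('p) * px2"
definition pv23 :: "'p::prime_card poly3" where "pv23 = px2 ^ CARD('p) * px3"
definition pX :: "'p::prime_card poly3" where "pX = (px1 + px2) ^ CARD('p) * px3"
definition pY :: "'p::prime_card poly3" where "pY = px1 ^ CARD('p) * (px2 + px3)"

lemma pX_pY: "pX + pv12 = pY + (pv23 :: 'p::prime_card poly3)"
proof -
  have "(px1 + px2) ^ CARD('p) = px1 ^ CARD('p) + (px2 ^ CARD('p) :: 'p poly3)"
    by (rule add_power_prime_char[OF prime_card poly3_char])
  then show ?thesis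
    by (simp add: pX_def pY_def pv12_def pv23_def algebra_simps)
qed

definition relS :: "nat \<Rightarrow> bool \<Rightarrow> bool \<Rightarrow> nat \<Rightarrow> nat \<Rightarrow> 'p::prime_card free_alg" where
  "relS s e e' n m =
     (\<Sum>i\<le>n. of_nat (n choose i) * (fg e (i + CARD('p) * m + s) * fg e' (n - i + m)))"

lemma relS_in:
  "m \<ge> 1 \<Longrightarrow> relS 0 True True n m \<in> lambda_ideal"
    "m \<ge> 1 \<Longrightarrow> relS 0 True False n m - relS 0 False True n m \<in> lambda_ideal"
    "relS 1 True False n m \<in> lambda_ideal"
    "relS 1 False False n m \<in> lambda_ideal"
  using lambda_rels.intros(1,2)[of m n, THEN ideal_rel] lambda_rels.intros(3,4)[of n m, THEN ideal_rel]
  by (simp_all add: relS_def sum_subtractf right_diff_distrib)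

lemma word_poly_12:
  fixes e e' e'' :: bool
  shows "word_poly e e' e'' (px1 ^ s * (px1 + px2) ^ n * pv12 ^ m * px3 ^ c :: 'p::prime_card poly3) =
    relS s e e' n m * fg e'' c"
proof -
  have "px1 ^ s * (px1 + px2) ^ n * pv12 ^ m * px3 ^ c =
      (\<Sum>i\<le>n. of_nat (n choose i) * (px1 ^ (i + CARD('p) * m + s) * px2 ^ (n - i + m) * px3 ^ c) :: 'p poly3)"
    unfolding binomial_ring pv12_def sum_distrib_left sum_distrib_right
    by (intro sum.cong refl) (simp only: power_add power_mult power_mult_distrib mult_ac[where 'a = "'p poly3"])
  then show ?thesis
    by (simp only: word_poly_additive word_poly_of_nat word_poly_monom relS_def sum_distrib_right) (simp only: mult.assoc)
qed

lemma of_nat_left: "x * (of_nat k * y) = of_nat k * (x * y)" for x y :: "'a::semiring_1"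
  by (metis mult.assoc mult_of_nat_commute)

lemma word_poly_23:
  fixes e e' e'' :: bool
  shows "word_poly e e' e'' (px1 ^ a * px2 ^ s * (px2 + px3) ^ n * pv23 ^ m :: 'p::prime_card poly3) =
    fg e a * relS s e' e'' n m"
proof -
  have "px1 ^ a * px2 ^ s * (px2 + px3) ^ n * pv23 ^ m =
      (\<Sum>i\<le>n. of_nat (n choose i) * (px1 ^ a * px2 ^ (i + CARD('p) * m + s) * px3 ^ (n - i + m)) :: 'p poly3)"
    unfolding binomial_ring pv23_def sum_distrib_left sum_distrib_right
    by (intro sum.cong refl) (simp only: power_add power_mult power_mult_distrib mult_ac[where 'a = "'p poly3"])
  then show ?thesis
    by (simp only: word_poly_additive word_poly_of_nat word_poly_monom relS_def sum_distrib_left)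
       (simp only: mult.assoc of_nat_left)
qed

lemma word_poly_N12:
  "word_poly e e' e'' (pN n * (px1 ^ s * (px1 + px2) ^ j * (pv12 ^ l * pX ^ k)) :: 'p::prime_card poly3) =
     (\<Sum>i\<le>n. of_nat (n choose i) * (relS s e e' (i + CARD('p) * k + j) l * fg e'' (n - i + k)))"
proof -
  have "pN n * (px1 ^ s * (px1 + px2) ^ j * (pv12 ^ l * pX ^ k)) =
      (\<Sum>i\<le>n. of_nat (n choose i) *
        (px1 ^ s * (px1 + px2) ^ (i + CARD('p) * k + j) * pv12 ^ l * px3 ^ (n - i + k)) :: 'p poly3)"
    unfolding pN_def pX_def binomial_ring[of "px1 + px2" px3] sum_distrib_left sum_distrib_right
    by (intro sum.cong refl) (simp only: power_add power_mult power_mult_distrib mult_ac[where 'a = "'p poly3"])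
  then show ?thesis
    by (simp add: word_poly_additive word_poly_of_nat word_poly_12)
qed

lemma word_poly_N23:
  "word_poly e e' e'' (pN n * (px2 ^ s * px1 ^ j * (pv23 ^ l * pY ^ k)) :: 'p::prime_card poly3) =
     (\<Sum>i\<le>n. of_nat (n choose i) * (fg e (i + CARD('p) * k + j) * relS s e' e'' (n - i + k) l))"
proof -
  have "pN n * (px2 ^ s * px1 ^ j * (pv23 ^ l * pY ^ k)) =
      (\<Sum>i\<le>n. of_nat (n choose i) *
        (px1 ^ (i + CARD('p) * k + j) * px2 ^ s * (px2 + px3) ^ (n - i + k) * pv23 ^ l) :: 'p poly3)"
    unfolding pN_def pY_def add.assoc binomial_ring[of px1 "px2 + px3"] sum_distrib_left sum_distrib_right
    by (intro sum.cong refl) (simp only: power_add power_mult power_mult_distrib mult_ac[where 'a = "'p poly3"])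
  then show ?thesis
    by (simp add: word_poly_additive word_poly_of_nat word_poly_23)
qed

text \<open>Write \<open>A\<close> and \<open>B\<close> for the differences of \<open>S = (pX + pv12) ^ m = (pY + pv23) ^ m\<close> and
  \<open>pX ^ m\<close>, \<open>pY ^ m\<close>.\<close>

definition pS :: "nat \<Rightarrow> 'p::prime_card poly3" where "pS m = (pX + pv12) ^ m"
definition pA :: "nat \<Rightarrow> 'p::prime_card poly3" where "pA m = pS m - pX ^ m"
definition pB :: "nat \<Rightarrow> 'p::prime_card poly3" where "pB m = pS m - pY ^ m"

lemma binomial_minus:
  fixes a b :: "'a::comm_ring_1"
  shows "(b + a) ^ m - b ^ m = (\<Sum>l\<in>{1..m}. of_nat (m choose l) * (a ^ l * b ^ (m - l)))"
proof -
  have "(a + b) ^ m = (\<Sum>l\<le>m. of_nat (m choose l) * (a ^ l * b ^ (m - l)))"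
    by (simp add: binomial_ring mult.assoc)
  also have "{..m} = insert 0 {1..m}" by auto
  finally show ?thesis by (simp add: add.commute)
qed

lemma pA_sum: "pA m = (\<Sum>l\<in>{1..m}. of_nat (m choose l) * (pv12 ^ l * pX ^ (m - l)))"
  unfolding pA_def pS_def by (rule binomial_minus)

lemma pB_sum: "pB m = (\<Sum>l\<in>{1..m}. of_nat (m choose l) * (pv23 ^ l * pY ^ (m - l)))"
  unfolding pB_def pS_def pX_pY by (rule binomial_minus)

lemma SS_sum12: "pS m = (\<Sum>l\<le>m. of_nat (m choose l) * (pv12 ^ l * pX ^ (m - l)))"
  unfolding pS_def by (simp add: binomial_ring mult.assoc add.commute[of pX])

lemma SS_sum23: "pS m = (\<Sum>l\<le>m. of_nat (m choose l) * (pv23 ^ l * pY ^ (m - l)))"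
  unfolding pS_def pX_pY by (simp add: binomial_ring mult.assoc add.commute[of pY])

lemma ideal_of_nat: "x \<in> lambda_ideal \<Longrightarrow> of_nat k * x \<in> lambda_ideal"
  by (rule ideal_mult_left)

lemma mult_mult_sum:
  fixes a b :: "'a::comm_semiring_1"
  shows "a * (b * (\<Sum>l\<in>L. of_nat (c l) * t l)) = (\<Sum>l\<in>L. of_nat (c l) * (a * (b * t l)))"
  unfolding sum_distrib_left by (intro sum.cong refl) (simp only: mult_ac)

lemma word_poly_AA:
  "word_poly e e' e'' (pN n * ((px1 + px2) ^ j * pA m) :: 'p::prime_card poly3) =
    (\<Sum>l\<in>{1..m}. of_nat (m choose l) * (\<Sum>i\<le>n. of_nat (n choose i) *
       (relS 0 e e' (i + CARD('p) * (m - l) + j) l * fg e'' (n - i + (m - l)))))"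
  unfolding pA_sum mult_mult_sum word_poly_additive word_poly_of_nat
  using word_poly_N12[where 'p = 'p, of e e' e'' n 0 j]
  by (simp only: power_0 power_one_right mult_1_left mult_1_right add_0_right)

lemma word_poly_BB:
  "word_poly e e' e'' (pN n * (px1 ^ j * pB m) :: 'p::prime_card poly3) =
    (\<Sum>l\<in>{1..m}. of_nat (m choose l) * (\<Sum>i\<le>n. of_nat (n choose i) *
       (fg e (i + CARD('p) * (m - l) + j) * relS 0 e' e'' (n - i + (m - l)) l)))"
  unfolding pB_sum mult_mult_sum word_poly_additive word_poly_of_nat
  using word_poly_N23[where 'p = 'p, of e e' e'' n 0 j]
  by (simp only: power_0 power_one_right mult_1_left mult_1_right add_0_right)

lemma word_poly_SS1:
  "word_poly e e' e'' (pN n * (px1 * pS m) :: 'p::prime_card poly3) =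
    (\<Sum>l\<le>m. of_nat (m choose l) * (\<Sum>i\<le>n. of_nat (n choose i) *
       (relS 1 e e' (i + CARD('p) * (m - l)) l * fg e'' (n - i + (m - l)))))"
  unfolding SS_sum12 mult_mult_sum word_poly_additive word_poly_of_nat
  using word_poly_N12[where 'p = 'p, of e e' e'' n 1 0]
  by (simp only: power_0 power_one_right mult_1_left mult_1_right add_0_right)

lemma word_poly_SS2:
  "word_poly e e' e'' (pN n * (px2 * pS m) :: 'p::prime_card poly3) =
    (\<Sum>l\<le>m. of_nat (m choose l) * (\<Sum>i\<le>n. of_nat (n choose i) *
       (fg e (i + CARD('p) * (m - l)) * relS 1 e' e'' (n - i + (m - l)) l)))"
  unfolding SS_sum23 mult_mult_sum word_poly_additive word_poly_of_nat
  using word_poly_N23[where 'p = 'p, of e e' e'' n 1 0]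
  by (simp only: power_0 power_one_right mult_1_left mult_1_right add_0_right)

lemma word_poly_mem:
  "word_poly True True e (pN n * ((px1 + px2) ^ j * pA m)) \<in> lambda_ideal"
  "word_poly e True True (pN n * (px1 ^ j * pB m)) \<in> lambda_ideal"
  "word_poly True False e (pN n * ((px1 + px2) ^ j * pA m)) - word_poly False True e (pN n * ((px1 + px2) ^ j * pA m))
    \<in> lambda_ideal"
  "word_poly e True False (pN n * (px1 ^ j * pB m)) - word_poly e False True (pN n * (px1 ^ j * pB m))
    \<in> lambda_ideal"
  "word_poly True False e (pN n * (px1 * pS m)) \<in> lambda_ideal"
  "word_poly False False e (pN n * (px1 * pS m)) \<in> lambda_ideal"
  "word_poly e True False (pN n * (px2 * pS m)) \<in> lambda_ideal"
  "word_poly e False False (pN n * (px2 * pS m)) \<in> lambda_ideal"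
proof -
  show "word_poly True True e (pN n * ((px1 + px2) ^ j * pA m)) \<in> lambda_ideal"
    unfolding word_poly_AA
    by (intro ideal_sum ideal_of_nat, rule ideal_mult_right, rule relS_in) auto
  show "word_poly e True True (pN n * (px1 ^ j * pB m)) \<in> lambda_ideal"
    unfolding word_poly_BB
    by (intro ideal_sum ideal_of_nat, rule ideal_mult_left, rule relS_in) auto
  show "word_poly True False e (pN n * ((px1 + px2) ^ j * pA m)) -
      word_poly False True e (pN n * ((px1 + px2) ^ j * pA m)) \<in> lambda_ideal"
    unfolding word_poly_AA sum_subtractf[symmetric] right_diff_distrib[symmetric] left_diff_distrib[symmetric]
    by (intro ideal_sum ideal_of_nat, rule ideal_mult_right, rule relS_in) auto
  show "word_poly e True False (pN n * (px1 ^ j * pB m)) - word_poly e False True (pN n * (px1 ^ j * pB m))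
      \<in> lambda_ideal"
    unfolding word_poly_BB sum_subtractf[symmetric] right_diff_distrib[symmetric] left_diff_distrib[symmetric]
    by (intro ideal_sum ideal_of_nat, rule ideal_mult_left, rule relS_in) auto
  show "word_poly True False e (pN n * (px1 * pS m)) \<in> lambda_ideal"
    unfolding word_poly_SS1 by (intro ideal_sum ideal_of_nat, rule ideal_mult_right, rule relS_in)
  show "word_poly False False e (pN n * (px1 * pS m)) \<in> lambda_ideal"
    unfolding word_poly_SS1 by (intro ideal_sum ideal_of_nat, rule ideal_mult_right, rule relS_in)
  show "word_poly e True False (pN n * (px2 * pS m)) \<in> lambda_ideal"
    unfolding word_poly_SS2 by (intro ideal_sum ideal_of_nat, rule ideal_mult_left, rule relS_in)
  show "word_poly e False False (pN n * (px2 * pS m)) \<in> lambda_ideal"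
    unfolding word_poly_SS2 by (intro ideal_sum ideal_of_nat, rule ideal_mult_left, rule relS_in)
qed

definition pDr :: "bool \<Rightarrow> bool \<Rightarrow> 'p::prime_card poly3 \<Rightarrow> 'p free_alg" where
  "pDr e e' f = (if e' then word_poly e True True f else word_poly e True False f - word_poly e False True f)"

definition pDl :: "bool \<Rightarrow> bool \<Rightarrow> 'p::prime_card poly3 \<Rightarrow> 'p free_alg" where
  "pDl e e' f = (if e then word_poly True True e' f else word_poly True False e' f - word_poly False True e' f)"

lemma pDr_add: "pDr e e' (x + y) = pDr e e' x + pDr e e' y"
  and pDl_add: "pDl e e' (x + y) = pDl e e' x + pDl e e' y"
  and pD_of_nat: "pDr e e' (of_nat k * x) = of_nat k * pDr e e' x"
    "pDl e e' (of_nat k * x) = of_nat k * pDl e e' x"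
  by (simp_all add: pDr_def pDl_def word_poly_additive word_poly_of_nat right_diff_distrib)

lemmas pD_additive = pDr_add pDl_add additive_diff[of "pDr _ _", OF pDr_add] additive_diff[of "pDl _ _", OF pDl_add]

lemma fg_free_d: "fg e a * free_d (fg e' b) = pDr e e' (px1 ^ a * (px2 + px3) ^ b :: 'p::prime_card poly3)"
proof -
  have "px1 ^ a * (px2 + px3) ^ b =
      (\<Sum>i\<le>b. of_nat (b choose i) * (px1 ^ a * px2 ^ i * px3 ^ (b - i)) :: 'p poly3)"
    unfolding binomial_ring sum_distrib_left
    by (intro sum.cong refl) (simp only: mult_ac[where 'a = "'p poly3"])
  then have "word_poly e e1 e2 (px1 ^ a * (px2 + px3) ^ b :: 'p poly3) =
      (\<Sum>i\<le>b. of_nat (b choose i) * (fg e a * (fg e1 i * fg e2 (b - i))))" for e1 e2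
    by (simp only: word_poly_additive word_poly_of_nat word_poly_monom) (simp only: mult.assoc)
  then show ?thesis
    by (cases e') (simp_all only: pDr_def fg_simps if_True if_False free_d_flam free_d_fmu sum_distrib_left
        of_nat_left right_diff_distrib sum_subtractf)
qed

lemma free_d_fg: "free_d (fg e a) * fg e' b = pDl e e' ((px1 + px2) ^ a * px3 ^ b :: 'p::prime_card poly3)"
proof -
  have "(px1 + px2) ^ a * px3 ^ b =
      (\<Sum>i\<le>a. of_nat (a choose i) * (px1 ^ i * px2 ^ (a - i) * px3 ^ b) :: 'p poly3)"
    unfolding binomial_ring sum_distrib_right
    by (intro sum.cong refl) (simp only: mult_ac[where 'a = "'p poly3"])
  then have "word_poly e1 e2 e' ((px1 + px2) ^ a * px3 ^ b :: 'p poly3) =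
      (\<Sum>i\<le>a. of_nat (a choose i) * (fg e1 i * fg e2 (a - i) * fg e' b))" for e1 e2
    by (simp only: word_poly_additive word_poly_of_nat word_poly_monom)
  then show ?thesis
    by (cases e) (simp_all only: pDl_def fg_simps if_True if_False free_d_flam free_d_fmu sum_distrib_right
        mult.assoc right_diff_distrib sum_subtractf left_diff_distrib)
qed

lemma free_d_of_nat: "free_d (of_nat k * x) = of_nat k * free_d x"
  by (induction k) (simp_all add: distrib_right free_d_additive)

lemma free_d_relS:
  "free_d (relS s e e' n m :: 'p::prime_card free_alg) =
     (if e then - 1 else 1) * pDr e e' (pN n * (px1 ^ s * pY ^ m)) + pDl e e' (pN n * ((px1 + px2) ^ s * pX ^ m))"
proof -
  have "pN n * (px1 ^ s * pY ^ m) = (\<Sum>i\<le>n. of_nat (n choose i) *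
      (px1 ^ (i + CARD('p) * m + s) * (px2 + px3) ^ (n - i + m)) :: 'p poly3)"
    unfolding pN_def pY_def add.assoc binomial_ring[of px1 "px2 + px3"] sum_distrib_left sum_distrib_right
    by (intro sum.cong refl) (simp only: power_add power_mult power_mult_distrib mult_ac[where 'a = "'p poly3"])
  moreover have "pN n * ((px1 + px2) ^ s * pX ^ m) = (\<Sum>i\<le>n. of_nat (n choose i) *
      ((px1 + px2) ^ (i + CARD('p) * m + s) * px3 ^ (n - i + m)) :: 'p poly3)"
    unfolding pN_def pX_def binomial_ring[of "px1 + px2" px3] sum_distrib_left sum_distrib_right
    by (intro sum.cong refl) (simp only: power_add power_mult power_mult_distrib mult_ac[where 'a = "'p poly3"])
  moreover have "free_d (relS s e e' n m :: 'p free_alg) =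
      (\<Sum>i\<le>n. of_nat (n choose i) * ((if e then - 1 else 1) *
         (fg e (i + CARD('p) * m + s) * free_d (fg e' (n - i + m))))) +
      (\<Sum>i\<le>n. of_nat (n choose i) * (free_d (fg e (i + CARD('p) * m + s)) * fg e' (n - i + m)))"
  proof -
    have "free_d (fg e a * fg e' b :: 'p free_alg) = (if e then - 1 else 1) * (fg e a * free_d (fg e' b)) + free_d (fg e a) * fg e' b"
      for a b
      by (auto simp: free_d_mult free_sgn_fg)
    then show ?thesis
      by (simp only: relS_def free_d_additive free_d_of_nat distrib_left sum.distrib)
  qed
  ultimately show ?thesis
    by (cases e) (simp_all only: fg_free_d free_d_fg pD_additive pD_of_nat mult_minus1 if_True if_False
        mult_minus_right sum_negf mult_1_left)
qed

lemma ring_eqs: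
  fixes a s x :: "'a::comm_ring"
  shows "a * x = a * s - a * (s - x)" "a * (y * x) = a * (y * s) - a * (y * (s - x))"
    "a * ((y + z) * x) = a * (y * s) + a * (z * s) - a * ((y + z) * (s - x))"
  by (simp_all add: algebra_simps)

lemma free_d_rel:
  fixes r :: "'p::prime_card free_alg"
  assumes "r \<in> lambda_rels"
  shows "free_d r \<in> lambda_ideal"
proof -
  have main: "free_d (relS 0 True True n m :: 'p free_alg) \<in> lambda_ideal"
    "free_d (relS 0 True False n m - relS 0 False True n m :: 'p free_alg) \<in> lambda_ideal"
    "free_d (relS 1 True False n m :: 'p free_alg) \<in> lambda_ideal"
    "free_d (relS 1 False False n m :: 'p free_alg) \<in> lambda_ideal" for n m
  proof -
    define S0 S1 S2 A0 A1 B0 B1 :: "'p poly3" where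
      "S0 = pN n * pS m" and "S1 = pN n * (px1 * pS m)" and "S2 = pN n * (px2 * pS m)" and
      "A0 = pN n * pA m" and "A1 = pN n * ((px1 + px2) * pA m)" and
      "B0 = pN n * pB m" and "B1 = pN n * (px1 * pB m)"
    note defs = S0_def S1_def S2_def A0_def A1_def B0_def B1_def
    have eqs: "pN n * pY ^ m = S0 - B0" "pN n * pX ^ m = S0 - A0"
      "pN n * (px1 * pY ^ m) = S1 - B1" "pN n * ((px1 + px2) * pX ^ m) = S1 + S2 - A1"
      unfolding defs pA_def pB_def by (rule ring_eqs)+
    have mem:
      "word_poly True True e A0 \<in> lambda_ideal" "word_poly e True True B0 \<in> lambda_ideal"
      "word_poly True True e A1 \<in> lambda_ideal" "word_poly e True True B1 \<in> lambda_ideal"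
      "word_poly True False e A0 - word_poly False True e A0 \<in> lambda_ideal"
      "word_poly True False e A1 - word_poly False True e A1 \<in> lambda_ideal"
      "word_poly e True False B0 - word_poly e False True B0 \<in> lambda_ideal"
      "word_poly e True False B1 - word_poly e False True B1 \<in> lambda_ideal"
      "word_poly True False e S1 \<in> lambda_ideal" "word_poly False False e S1 \<in> lambda_ideal"
      "word_poly e True False S2 \<in> lambda_ideal" "word_poly e False False S2 \<in> lambda_ideal" for e
      using word_poly_mem(1-4)[of e n 0 m] word_poly_mem(1-4)[of e n 1 m] word_poly_mem(5-8)[of e n m]
      by (simp_all add: defs)
    note intros = lambda_ideal.add ideal_diff ideal_uminus mem
    have "free_d (relS 0 True True n m) = word_poly True True True B0 - word_poly True True True A0"
      by (simp add: free_d_relS eqs pDr_def pDl_def word_poly_additive)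
    then show "free_d (relS 0 True True n m :: 'p free_alg) \<in> lambda_ideal"
      by (simp add: intros)
    have "free_d (relS 0 True False n m - relS 0 False True n m) =
        (word_poly True True False B0 - word_poly True False True B0) + word_poly False True True B0
        - word_poly True True False A0 + (word_poly True False True A0 - word_poly False True True A0)"
      by (simp add: free_d_additive free_d_relS eqs pDr_def pDl_def word_poly_additive)
    then show "free_d (relS 0 True False n m - relS 0 False True n m :: 'p free_alg) \<in> lambda_ideal"
      by (simp only:) (intro intros)
    have "free_d (relS 1 True False n m) =
        word_poly True True False S2 + (word_poly True True False B1 - word_poly True False True B1)
        + word_poly True False True S1 - word_poly True True False A1"
      by (simp add: free_d_relS eqs pDr_def pDl_def word_poly_additive)
    then show "free_d (relS 1 True False n m :: 'p free_alg) \<in> lambda_ideal"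
      by (simp only:) (intro intros)
    have "free_d (relS 1 False False n m) =
        word_poly True False False S1 + word_poly True False False S2 - word_poly False True False S2
        - word_poly False False True S1 - (word_poly False True False B1 - word_poly False False True B1)
        - (word_poly True False False A1 - word_poly False True False A1)"
      by (simp add: free_d_relS eqs pDr_def pDl_def word_poly_additive)
    then show "free_d (relS 1 False False n m :: 'p free_alg) \<in> lambda_ideal"
      by (simp only:) (intro intros)
  qed
  show ?thesis
    using assms
  proof cases
    case (lam_lam m n)
    then show ?thesis using main(1)[of n m] by (simp add: relS_def)
  next
    case (lam_mu_mu_lam m n)
    then show ?thesis
      using main(2)[of n m] by (simp add: relS_def sum_subtractf right_diff_distrib)
  next
    case (lam_mu n m)
    then show ?thesis using main(3)[of n m] by (simp add: relS_def)
  next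
    case (mu_mu n m)
    then show ?thesis using main(4)[of n m] by (simp add: relS_def)
  qed
qed

lemma free_sgn_of_nat: "free_sgn (of_nat k) = of_nat k"
  by (induction k) (simp_all add: free_sgn_additive)

lemma free_sgn_rel:
  assumes "r \<in> lambda_rels"
  shows "free_sgn r \<in> lambda_ideal"
proof -
  have 1: "free_sgn r = r \<or> free_sgn r = - r"
    using assms
    by cases (simp_all add: free_sgn_additive free_sgn_mult free_sgn_of_nat free_sgn_fg[of True, simplified]
        free_sgn_fg[of False, simplified] sum_negf sum_subtractf right_diff_distrib)
  then show ?thesis
    using ideal_rel[OF assms] ideal_uminus by auto
qed

lemma free_sgn_ideal: "x \<in> lambda_ideal \<Longrightarrow> free_sgn x \<in> lambda_ideal"
proof (induction rule: lambda_ideal.induct)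
  case (rel r a b)
  then show ?case
    unfolding free_sgn_mult by (intro ideal_mult_left ideal_mult_right free_sgn_rel)
qed (simp_all add: free_sgn_additive lambda_ideal.intros)

lemma free_d_ideal: "x \<in> lambda_ideal \<Longrightarrow> free_d x \<in> lambda_ideal"
proof (induction rule: lambda_ideal.induct)
  case (rel r a b)
  show ?case
    unfolding free_d_mult free_sgn_mult
    by (rule lambda_ideal.add, rule ideal_mult_right, rule ideal_mult_left, rule free_sgn_rel[OF rel],
        rule ideal_mult_right, rule lambda_ideal.add, rule ideal_mult_left, rule free_d_rel[OF rel],
        rule ideal_mult_left, rule ideal_rel[OF rel])
qed (simp_all add: free_d_additive lambda_ideal.intros)

section \<open>The operation inducing the zeroth power operation\<close>

definition free_P0 :: "'p::prime_card free_alg \<Rightarrow> 'p free_alg" where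
  "free_P0 = pm_ext (\<lambda>w c. if \<exists>i. Mu i \<in> set (letters w) then 0
     else Poly_Mapping.single
       (Word (map (\<lambda>g. case g of Lam n \<Rightarrow> Lam (CARD('p) * (n + 1) - 1) | Mu n \<Rightarrow> Mu n) (letters w))) c)"

lemma free_P0_add: "free_P0 (x + y) = free_P0 x + free_P0 y"
  unfolding free_P0_def by (rule pm_ext_add) (auto simp: single_add)

lemmas free_P0_additive = free_P0_add additive_diff[of free_P0, OF free_P0_add]

lemma free_P0_single:
  "free_P0 (Poly_Mapping.single w c :: 'p::prime_card free_alg) =
    (if \<exists>i. Mu i \<in> set (letters w) then 0
     else Poly_Mapping.single
       (Word (map (\<lambda>g. case g of Lam n \<Rightarrow> Lam (CARD('p) * (n + 1) - 1) | Mu n \<Rightarrow> Mu n) (letters w))) c)"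
  by (simp add: free_P0_def)

lemma free_P0_mult: "free_P0 (x * y) = free_P0 x * free_P0 y"
proof (induction x rule: pm_induct)
  case (single v c)
  show ?case
  proof (induction y rule: pm_induct)
    case (single w d)
    show ?case
      by (auto simp: mult_single free_P0_single plus_lword_def)
  qed (simp_all add: free_P0_additive distrib_left)
qed (simp_all add: free_P0_additive distrib_right)

lemma free_P0_1: "free_P0 1 = 1"
  using free_P0_single[of 0 1] by (simp add: zero_lword_def[symmetric])

lemma free_P0_of_nat1: "free_P0 (of_nat k) = of_nat k"
  by (induction k) (simp_all add: free_P0_additive free_P0_1)

lemma free_P0_fmu: "free_P0 (fmu i) = 0"
  by (simp add: fmu_def free_P0_single)

lemma free_P0_flam: "free_P0 (flam i :: 'p::prime_card free_alg) = flam (CARD('p) * i)"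
  by (cases i) (simp_all add: flam_def free_P0_single free_P0_additive)

definition lam_poly :: "'p::prime_card poly3 \<Rightarrow> 'p free_alg" where
  "lam_poly = pm_ext (\<lambda>(a, b, c) k. fscal k * (flam a * flam b))"

lemma lam_poly_add: "lam_poly (x + y) = lam_poly x + lam_poly y"
  unfolding lam_poly_def by (rule pm_ext_add) (auto simp: fscal_simps distrib_right)

lemmas lam_poly_additive = lam_poly_add additive_diff[of lam_poly, OF lam_poly_add]

lemma lam_poly_of_nat: "lam_poly (of_nat k * x) = of_nat k * lam_poly x"
  by (induction k) (simp_all add: distrib_right lam_poly_additive)

lemma lam_poly_monom: "lam_poly (px1 ^ a * px2 ^ b) = flam a * flam b"
  by (simp add: X_power mult_single lam_poly_def fscal_simps)

lemma free_P0_lam_lam: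
  "free_P0 (relS 0 True True n m :: 'p::prime_card free_alg) =
     relS 0 True True (CARD('p) * n) (CARD('p) * m)"
proof -
  let ?p = "CARD('p)"
  have "(px1 + px2) ^ (?p * n) * (px1 ^ (?p * ?p * m) * px2 ^ (?p * m)) =
      (\<Sum>i\<le>?p * n. of_nat ((?p * n) choose i) *
        (px1 ^ (i + ?p * (?p * m)) * px2 ^ (?p * n - i + ?p * m)) :: 'p poly3)"
    unfolding binomial_ring sum_distrib_right
    by (intro sum.cong refl) (simp only: power_add mult_ac[where 'a = "'p poly3"] mult.assoc)
  moreover have "(px1 + px2) ^ (?p * n) = (px1 ^ ?p + px2 ^ ?p :: 'p poly3) ^ n"
    by (simp only: power_mult add_power_prime_char[OF prime_card poly3_char])
  moreover have "(px1 ^ ?p + px2 ^ ?p) ^ n * (px1 ^ (?p * ?p * m) * px2 ^ (?p * m)) =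
      (\<Sum>i\<le>n. of_nat (n choose i) *
        (px1 ^ (?p * (i + ?p * m)) * px2 ^ (?p * (n - i + m))) :: 'p poly3)"
    unfolding binomial_ring sum_distrib_right
    by (intro sum.cong refl)
      (simp only: power_add mult_ac[where 'a = "'p poly3"] mult.assoc power_mult distrib_left)
  ultimately have "(\<Sum>i\<le>?p * n. of_nat ((?p * n) choose i) *
        (px1 ^ (i + ?p * (?p * m)) * px2 ^ (?p * n - i + ?p * m)) :: 'p poly3) =
      (\<Sum>i\<le>n. of_nat (n choose i) *
        (px1 ^ (?p * (i + ?p * m)) * px2 ^ (?p * (n - i + m))))"
    by metis
  from arg_cong[OF this, of lam_poly] show ?thesis
    by (simp only: lam_poly_additive lam_poly_of_nat lam_poly_monom relS_def free_P0_additive free_P0_of_nat1 free_P0_mult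
        free_P0_flam fg_simps add_0_right)
qed

lemma free_P0_rel:
  fixes r :: "'p::prime_card free_alg"
  assumes "r \<in> lambda_rels"
  shows "free_P0 r \<in> lambda_ideal"
  using assms
proof cases
  case (lam_lam m n)
  then have "r = relS 0 True True n m"
    by (simp add: relS_def)
  moreover have "CARD('p) * m \<ge> 1"
    using lam_lam by simp
  ultimately show ?thesis
    by (simp add: free_P0_lam_lam relS_in)
qed (simp_all add: free_P0_additive free_P0_mult free_P0_fmu lambda_ideal.zero)

lemma free_P0_ideal: "x \<in> lambda_ideal \<Longrightarrow> free_P0 x \<in> lambda_ideal"
proof (induction rule: lambda_ideal.induct)
  case (rel r a b)
  then show ?case
    unfolding free_P0_mult by (intro ideal_mult_left ideal_mult_right free_P0_rel)
qed (simp_all add: free_P0_additive lambda_ideal.intros)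

section \<open>Structure maps of the lambda algebra\<close>

text \<open>\<open>lam i\<close> and \<open>mu i\<close> are the classes of $\lambda^1_{i-1}$ and $\lambda^0_{i-1}$; as in the
  relations, $\lambda_{-1} = 0$. \<open>lam_sgn\<close> multiplies an element of degree $n$ by $(-1)^n$.\<close>

lift_definition lscal :: "'p::prime_card mod_ring \<Rightarrow> 'p lambda" is fscal .

lift_definition lam :: "nat \<Rightarrow> 'p::prime_card lambda" is flam .

lift_definition mu :: "nat \<Rightarrow> 'p::prime_card lambda" is fmu .

lift_definition lam_d :: "'p::prime_card lambda \<Rightarrow> 'p lambda" is free_d
  using free_d_ideal by (fastforce simp flip: free_d_additive)

lift_definition lam_sgn :: "'p::prime_card lambda \<Rightarrow> 'p lambda" is free_sgn
  using free_sgn_ideal by (fastforce simp flip: free_sgn_additive)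

lift_definition lam_P0 :: "'p::prime_card lambda \<Rightarrow> 'p lambda" is free_P0
  using free_P0_ideal by (fastforce simp flip: free_P0_additive)

lemma abs_lambda_hom:
  "abs_lambda (x + y) = abs_lambda x + abs_lambda y"
  "abs_lambda (x * y) = abs_lambda x * abs_lambda y"
  by (simp_all add: plus_lambda.abs_eq times_lambda.abs_eq)

lemma abs_lambda_diff: "abs_lambda (x - y) = abs_lambda x - abs_lambda y"
  by (simp add: minus_lambda.abs_eq)

lemmas abs_lambda_sum = additive_diff(4)[of abs_lambda, OF abs_lambda_hom(1)]

lemma abs_lambda_of_nat: "abs_lambda (of_nat k) = of_nat k"
  by (induction k) (simp_all add: abs_lambda_hom one_lambda_def[symmetric] zero_lambda_def[symmetric])

lemma lam_d_lam: "lam_d (lam n) = (\<Sum>i\<le>n. of_nat (n choose i) * (lam i * lam (n - i)))"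
  by (simp add: lam_def lam_d.abs_eq free_d_flam abs_lambda_sum abs_lambda_hom abs_lambda_of_nat)

lemma lam_d_mu: "lam_d (mu n) = (\<Sum>i\<le>n. of_nat (n choose i) * (lam i * mu (n - i) - mu i * lam (n - i)))"
  by (simp add: lam_def mu_def lam_d.abs_eq free_d_fmu abs_lambda_sum abs_lambda_hom abs_lambda_diff
      abs_lambda_of_nat)

lemma lam_d_additive: "lam_d (a + b) = lam_d a + lam_d b"
  by transfer (simp add: free_d_additive lambda_ideal.zero)

lemma lam_sgn_additive: "lam_sgn (a + b) = lam_sgn a + lam_sgn b"
  by transfer (simp add: free_sgn_additive lambda_ideal.zero)

lemma lam_P0_additive: "lam_P0 (a + b) = lam_P0 a + lam_P0 b"
  by transfer (simp add: free_P0_additive lambda_ideal.zero)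

lemma lam_d_mult: "lam_d (a * b) = lam_sgn a * lam_d b + lam_d a * b"
  by transfer (simp add: free_d_mult lambda_ideal.zero)

text \<open>$\Lambda_s$, and its part of degree $t$.\<close>

definition lambda_len :: "nat \<Rightarrow> 'p::prime_card lambda set" where
  "lambda_len s = abs_lambda ` {x. \<forall>w\<in>Poly_Mapping.keys x. length (letters w) = s}"

definition lambda_bi :: "nat \<Rightarrow> nat \<Rightarrow> 'p::prime_card lambda set" where
  "lambda_bi s t = abs_lambda `
     {x. \<forall>w\<in>Poly_Mapping.keys x. length (letters w) = s \<and> wdeg CARD('p) w = t}"

section \<open>Modules over the Steenrod algebra and their duals\<close>

text \<open>A left module over the Steenrod algebra with a homogeneous basis indexed by \<open>'b\<close>, given by the
  degrees of the basis elements and the action of $\beta$ and $P^i$ on them. (Only these operations enter the complex below; the Adem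
  relations are not recorded.)\<close>

record ('b, 'p) A_module =
  mdeg :: "'b \<Rightarrow> nat"
  mbeta :: "'b \<Rightarrow> ('b \<Rightarrow>\<^sub>0 'p mod_ring)"
  mpow :: "nat \<Rightarrow> 'b \<Rightarrow> ('b \<Rightarrow>\<^sub>0 'p mod_ring)"

text \<open>\<open>dual_act h \<theta>\<close> is $h\theta$ for a dual basis element $h$ and an operation $\theta$, where
  $\langle h\theta, e\rangle = \langle h, \theta e\rangle$. The dual basis is indexed by the same type
  as the basis.\<close>

definition lin_ext :: "('b \<Rightarrow> 'c \<Rightarrow>\<^sub>0 'p::prime_card mod_ring) \<Rightarrow> ('b \<Rightarrow>\<^sub>0 'p mod_ring) \<Rightarrow> 'c \<Rightarrow>\<^sub>0 'p mod_ring"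
  where "lin_ext f = pm_ext (\<lambda>e c. Poly_Mapping.map ((*) c) (f e))"

definition dual_act :: "'b \<Rightarrow> ('b \<Rightarrow> 'b \<Rightarrow>\<^sub>0 'p::prime_card mod_ring) \<Rightarrow> 'b \<Rightarrow>\<^sub>0 'p mod_ring"
  where "dual_act h \<theta> = Abs_poly_mapping (\<lambda>e. Poly_Mapping.lookup (\<theta> e) h)"

text \<open>Basis elements of the reduced cohomology $P$ of $B\mathbb{Z}/p$: \<open>Odd t\<close> is $x y^t$ and \<open>Even t\<close> is
  $y^{t+1}$, so that the unit of the unreduced cohomology is absent. The same index stands for the
  dual basis element of the homology: $ab^{[t]}$ for \<open>Odd t\<close> and $b^{[t+1]}$ for \<open>Even t\<close>. The
  action is $\beta x = y$, $\beta y = 0$, $P^i(x^\epsilon y^t) = {t \choose i} x^\epsilon y^{t + i(p-1)}$,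
  by the Cartan formula.\<close>

datatype pbasis = Odd nat | Even nat

definition P_module :: "(pbasis, 'p::prime_card) A_module" where
  "P_module = \<lparr>
     mdeg = (\<lambda>e. case e of Odd t \<Rightarrow> 2 * t + 1 | Even t \<Rightarrow> 2 * (t + 1)),
     mbeta = (\<lambda>e. case e of Odd t \<Rightarrow> Poly_Mapping.single (Even t) 1 | Even t \<Rightarrow> 0),
     mpow = (\<lambda>i e. case e of
         Odd t \<Rightarrow> Poly_Mapping.single (Odd (t + i * (CARD('p) - 1))) (of_nat (t choose i))
       | Even t \<Rightarrow> Poly_Mapping.single (Even (t + i * (CARD('p) - 1))) (of_nat ((t + 1) choose i))) \<rparr>"

definition Fp_module :: "(unit, 'p::prime_card) A_module" where
  "Fp_module = \<lparr> mdeg = (\<lambda>_. 0), mbeta = (\<lambda>_. 0),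
     mpow = (\<lambda>i e. if i = 0 then Poly_Mapping.single e 1 else 0) \<rparr>"

section \<open>The complex computing Ext\<close>

text \<open>As $M^\#$ has the dual basis indexed by \<open>'b\<close>, the tensor product $\Lambda \otimes M^\#$ is the set
  of finitely supported functions from \<open>'b\<close> to $\Lambda$, and \<open>Poly_Mapping.single h a\<close> is
  $a \otimes h$. The sums over $i$ in the differential are infinite in general; for a nonnegatively
  graded module only the terms with $i \le |h|$ can be nonzero, since $hP^i$ has degree
  $|h| - 2i(p-1)$.\<close>

definition tensor :: "'p::prime_card lambda \<Rightarrow> ('b \<Rightarrow>\<^sub>0 'p mod_ring) \<Rightarrow> 'b \<Rightarrow>\<^sub>0 'p lambda"
  where "tensor a v = Poly_Mapping.map (\<lambda>c. a * lscal c) v"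

definition lact :: "'p::prime_card lambda \<Rightarrow> ('b \<Rightarrow>\<^sub>0 'p lambda) \<Rightarrow> 'b \<Rightarrow>\<^sub>0 'p lambda"
  where "lact a z = Poly_Mapping.map ((*) a) z"

definition cochain_d :: "('b, 'p::prime_card) A_module \<Rightarrow> ('b \<Rightarrow>\<^sub>0 'p lambda) \<Rightarrow> 'b \<Rightarrow>\<^sub>0 'p lambda" where
  "cochain_d M = pm_ext (\<lambda>h a.
     Poly_Mapping.single h (lam_d a)
     + (\<Sum>i\<le>mdeg M h.
          tensor ((-1) ^ mdeg M h * lam_sgn a * mu i) (dual_act h (\<lambda>e. lin_ext (mbeta M) (mpow M i e))))
     + (\<Sum>i=1..mdeg M h.
          tensor (lam_sgn a * lam i) (dual_act h (mpow M i))))"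

lemmas lam_d_0 = additive_diff(1)[of lam_d, OF lam_d_additive]
lemmas lam_sgn_0 = additive_diff(1)[of lam_sgn, OF lam_sgn_additive]

lemma lookup_map_zero: "f 0 = 0 \<Longrightarrow> Poly_Mapping.lookup (Poly_Mapping.map f v) k = f (Poly_Mapping.lookup v k)"
  by (simp add: Poly_Mapping.map.rep_eq when_def)

lemma lscal_simps:
  "lscal 0 = 0" "lscal 1 = 1" "lscal (a + b) = lscal a + lscal b" "lscal (a * b) = lscal a * lscal b"
  by (transfer; simp add: fscal_simps lambda_ideal.zero)+

lemma lscal_commute: "a * lscal c = lscal c * a"
  by transfer (simp add: fscal_commute lambda_ideal.zero)

lemma lookup_tensor: "Poly_Mapping.lookup (tensor a v) e = a * lscal (Poly_Mapping.lookup v e)"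
  by (simp add: tensor_def lookup_map_zero lscal_simps)

lemma lookup_lact: "Poly_Mapping.lookup (lact a z) e = a * Poly_Mapping.lookup z e"
  by (simp add: lact_def lookup_map_zero)

lemma tensor_add: "tensor (a + b) v = tensor a v + tensor b v"
  by (rule poly_mapping_eqI) (simp add: lookup_tensor lookup_add distrib_right)

lemma lact_tensor: "lact a (tensor b v) = tensor (a * b) v"
  by (rule poly_mapping_eqI) (simp add: lookup_tensor lookup_lact mult.assoc)

lemma lact_simps:
  "lact a (x + y) = lact a x + lact a y" "lact (a + b) x = lact a x + lact b x"
  "lact (a * b) x = lact a (lact b x)" "lact 1 x = x"
  "lact a (Poly_Mapping.single h b) = Poly_Mapping.single h (a * b)"
  by (rule poly_mapping_eqI; simp add: lookup_lact lookup_add distrib_left distrib_right mult.assoc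
    lookup_single when_def)+

lemma lact_sum: "lact a (sum f A) = (\<Sum>i\<in>A. lact a (f i))"
  by (rule additive_diff(4)[of "lact a"]) (rule lact_simps)

lemma tensor_0: "tensor 0 v = 0"
  by (rule poly_mapping_eqI) (simp add: lookup_tensor)

lemma lact_0: "lact a 0 = 0"
  by (rule poly_mapping_eqI) (simp add: lookup_lact)

lemma cochain_d_additive: "cochain_d M (x + y) = cochain_d M x + cochain_d M y"
  unfolding cochain_d_def
  by (rule pm_ext_add)
     (simp_all add: lam_d_additive lam_d_0 lam_sgn_additive lam_sgn_0 tensor_0
       distrib_left distrib_right single_add tensor_add sum.distrib add_ac)

lemmas cochain_d_0 = additive_diff(1)[of "cochain_d M", OF cochain_d_additive] for M
lemmas cochain_d_uminus = additive_diff(2)[of "cochain_d M", OF cochain_d_additive] for M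
lemmas cochain_d_diff = additive_diff(3)[of "cochain_d M", OF cochain_d_additive] for M

lemma lam_sgn_scal: "lam_sgn (lscal c * a) = lscal c * lam_sgn a"
  by transfer (simp add: free_sgn_mult free_sgn_fscal lambda_ideal.zero)

lemma lam_d_scal: "lam_d (lscal c * a) = lscal c * lam_d a"
proof transfer
  fix c :: "'a mod_ring" and a
  have "free_d (fscal c) = 0"
    by (simp add: fscal_def free_d_single)
  then show "free_d (fscal c * a) - fscal c * free_d a \<in> lambda_ideal"
    by (simp add: free_d_mult free_sgn_fscal lambda_ideal.zero)
qed

lemma cochain_d_scal: "cochain_d M (lact (lscal c) x) = lact (lscal c) (cochain_d M x)"
proof (induction x rule: pm_induct)
  case (single h a)
  have eq: "b * (lscal c * a) * d = lscal c * (b * a * d)" for b a d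
    by (metis lscal_commute mult.assoc)
  have eq': "lscal c * a * d = lscal c * (a * d)" for a d
    by (simp add: mult.assoc)
  show ?case
    by (simp add: lact_simps cochain_d_def lam_d_0 lam_sgn_0 tensor_0 lact_sum lact_tensor lam_d_scal lam_sgn_scal eq eq')
next
  case zero
  then show ?case by (simp add: cochain_d_0 lact_0)
qed (simp add: lact_simps cochain_d_additive)

lemma range_cochain_d_0: "0 \<in> range (cochain_d M)"
  using cochain_d_0[of M] by (metis rangeI)

lemma range_cochain_d_add: "x \<in> range (cochain_d M) \<Longrightarrow> y \<in> range (cochain_d M) \<Longrightarrow> x + y \<in> range (cochain_d M)"
  by (auto simp flip: cochain_d_additive)

lemma range_cochain_d_uminus: "x \<in> range (cochain_d M) \<Longrightarrow> - x \<in> range (cochain_d M)"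
  by (auto simp flip: cochain_d_uminus)

lemma range_cochain_d_diff: "x \<in> range (cochain_d M) \<Longrightarrow> y \<in> range (cochain_d M) \<Longrightarrow> x - y \<in> range (cochain_d M)"
  by (auto simp flip: cochain_d_diff)

lemma range_cochain_d_lscal: "x \<in> range (cochain_d M) \<Longrightarrow> lact (lscal c) x \<in> range (cochain_d M)"
  by (auto simp flip: cochain_d_scal)

lemma range_cochain_d_equivp: "equivp (\<lambda>u v. u - v \<in> range (cochain_d M))"
proof (rule equivpI)
  show "reflp (\<lambda>u v. u - v \<in> range (cochain_d M))"
    by (rule reflpI) (simp add: range_cochain_d_0)
  show "symp (\<lambda>u v. u - v \<in> range (cochain_d M))"
  proof (rule sympI)
    fix u v
    assume "u - v \<in> range (cochain_d M)"
    from range_cochain_d_uminus[OF this] show "v - u \<in> range (cochain_d M)" by simp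
  qed
  show "transp (\<lambda>u v. u - v \<in> range (cochain_d M))"
  proof (rule transpI)
    fix u v w
    assume "u - v \<in> range (cochain_d M)" "v - w \<in> range (cochain_d M)"
    from range_cochain_d_add[OF this] show "u - w \<in> range (cochain_d M)" by simp
  qed
qed

quotient_type 'p extP = "pbasis \<Rightarrow>\<^sub>0 'p::prime_card lambda" / "\<lambda>u v. u - v \<in> range (cochain_d P_module)"
  by (rule range_cochain_d_equivp)

quotient_type 'p extF = "unit \<Rightarrow>\<^sub>0 'p::prime_card lambda" / "\<lambda>u v. u - v \<in> range (cochain_d Fp_module)"
  by (rule range_cochain_d_equivp)

instantiation extP :: (prime_card) ab_group_add
begin

lift_definition zero_extP :: "'a extP" is 0 .
lift_definition plus_extP :: "'a extP \<Rightarrow> 'a extP \<Rightarrow> 'a extP" is "(+)"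
  by (simp only: add_diff_add range_cochain_d_add)
lift_definition uminus_extP :: "'a extP \<Rightarrow> 'a extP" is uminus
proof -
  fix u v :: "pbasis \<Rightarrow>\<^sub>0 'a lambda"
  assume "u - v \<in> range (cochain_d P_module)"
  from range_cochain_d_uminus[OF this] show "- u - - v \<in> range (cochain_d P_module)" by simp
qed
lift_definition minus_extP :: "'a extP \<Rightarrow> 'a extP \<Rightarrow> 'a extP" is "(-)"
proof -
  fix u u' v v' :: "pbasis \<Rightarrow>\<^sub>0 'a lambda"
  assume "u - u' \<in> range (cochain_d P_module)" "v - v' \<in> range (cochain_d P_module)"
  from range_cochain_d_diff[OF this] show "u - v - (u' - v') \<in> range (cochain_d P_module)"
    by (simp add: algebra_simps)
qed

instance
  by standard (transfer; simp add: range_cochain_d_0 add_ac)+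

end

lift_definition scale_extP :: "'p::prime_card mod_ring \<Rightarrow> 'p extP \<Rightarrow> 'p extP" is "\<lambda>c. lact (lscal c)"
proof -
  fix c :: "'p mod_ring" and u v :: "pbasis \<Rightarrow>\<^sub>0 'p lambda"
  assume "u - v \<in> range (cochain_d P_module)"
  from range_cochain_d_lscal[OF this, of c]
  show "lact (lscal c) u - lact (lscal c) v \<in> range (cochain_d P_module)"
    by (simp add: additive_diff(3)[of "lact (lscal c)", OF lact_simps(1)])
qed

interpretation extP: vector_space "scale_extP :: 'p::prime_card mod_ring \<Rightarrow> _"
  by standard (transfer; simp add: lact_simps lscal_simps range_cochain_d_0 distrib_left)+

section \<open>Ext groups\<close>

text \<open>The types \<open>extP\<close> and \<open>extF\<close> are all cochains modulo coboundaries; the Ext groups are the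
  subsets of classes of cocycles. As the differential raises the length by one, a coboundary lying in
  $\Lambda_s \otimes M^\#$ is the coboundary of an element of $\Lambda_{s-1} \otimes M^\#$.\<close>

abbreviation clsP :: "(pbasis \<Rightarrow>\<^sub>0 'p::prime_card lambda) \<Rightarrow> 'p extP" where
  "clsP \<equiv> abs_extP"

abbreviation clsF :: "(unit \<Rightarrow>\<^sub>0 'p::prime_card lambda) \<Rightarrow> 'p extF" where
  "clsF \<equiv> abs_extF"

definition cocyclesP :: "nat \<Rightarrow> (pbasis \<Rightarrow>\<^sub>0 'p::prime_card lambda) set" where
  "cocyclesP s = {z. cochain_d P_module z = 0 \<and> (\<forall>h. Poly_Mapping.lookup z h \<in> lambda_len s)}"

definition Ext_P :: "nat \<Rightarrow> 'p::prime_card extP set" where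
  "Ext_P s = clsP ` cocyclesP s"

text \<open>\<open>Ext_P_bi s u\<close> is $\mathrm{Ext}^{s,u}_A(P, F_p)$; with $u = s + t$ its classes are represented by
  cocycles of total degree $t$.\<close>

definition Ext_P_bi :: "nat \<Rightarrow> nat \<Rightarrow> 'p::prime_card extP set" where
  "Ext_P_bi s u = clsP ` {z. cochain_d P_module z = 0 \<and>
     (\<exists>t. u = s + t \<and> (\<forall>h\<in>Poly_Mapping.keys z. mdeg (P_module :: (pbasis, 'p) A_module) h \<le> t \<and>
        Poly_Mapping.lookup z h \<in> lambda_bi s (t - mdeg (P_module :: (pbasis, 'p) A_module) h)))}"

text \<open>The maps below are induced by operations on cochains which send cocycles to cocycles and
  coboundaries to coboundaries, so they do not depend on the chosen representatives.\<close>

definition ext_mult :: "'p::prime_card extF \<Rightarrow> 'p extP \<Rightarrow> 'p extP" (infixl \<open>\<odot>\<close> 70) where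
  "u \<odot> v = clsP (lact (Poly_Mapping.lookup (rep_extF u) ()) (rep_extP v))"

definition cochain_P0 :: "(pbasis \<Rightarrow>\<^sub>0 'p::prime_card lambda) \<Rightarrow> pbasis \<Rightarrow>\<^sub>0 'p lambda" where
  "cochain_P0 = pm_ext (\<lambda>h a. case h of
       Odd t \<Rightarrow> Poly_Mapping.single (Odd (CARD('p) * (t + 1) - 1)) (lam_P0 a)
     | Even t \<Rightarrow> 0)"

definition ext_P0 :: "'p::prime_card extP \<Rightarrow> 'p extP" where
  "ext_P0 u = clsP (cochain_P0 (rep_extP u))"

text \<open>\<open>ab a t\<close> is the cochain $a \otimes ab^{[t]}$.\<close>

definition ab :: "'p::prime_card lambda \<Rightarrow> nat \<Rightarrow> pbasis \<Rightarrow>\<^sub>0 'p lambda" where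
  "ab x t = Poly_Mapping.single (Odd t) x"

definition alpha0 :: "'p::prime_card extF" where
  "alpha0 = clsF (Poly_Mapping.single () (mu 0))"

definition h_cls :: "nat \<Rightarrow> 'p::prime_card extF" where
  "h_cls i = clsF (Poly_Mapping.single () (lam (CARD('p) ^ i)))"

definition h_hat :: "nat \<Rightarrow> 'p::prime_card extP" where
  "h_hat i = clsP (ab 1 ((CARD('p) - 1) * CARD('p) ^ i - 1))"

definition h_hat_k :: "nat \<Rightarrow> nat \<Rightarrow> 'p::prime_card extP" where
  "h_hat_k i k = clsP (ab 1 (k * CARD('p) ^ i - 1))"

definition alpha_hat :: "nat \<Rightarrow> 'p::prime_card extP" where
  "alpha_hat l = clsP (ab (mu 0) (CARD('p) + l) + ab (of_nat (l + 1) * mu 1) (l + 1))"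

definition d_hat :: "nat \<Rightarrow> nat \<Rightarrow> 'p::prime_card extP" where
  "d_hat i k = (ext_P0 ^^ (i - 1)) (clsP (ab (lam CARD('p)) (k * CARD('p) + CARD('p) - 2)))"

definition k_hat :: "nat \<Rightarrow> nat \<Rightarrow> 'p::prime_card extP" where
  "k_hat i k = (ext_P0 ^^ i) (clsP
     (\<Sum>j\<le>k. ab (lscal (1 / of_nat (j + 1)) * lam (j + 1)) ((k - j) * CARD('p) + j)))"

definition p_hat :: "nat \<Rightarrow> nat \<Rightarrow> 'p::prime_card extP" where
  "p_hat i r = (ext_P0 ^^ i) (clsP
     (\<Sum>j\<le>CARD('p) - 1 - r. ab (lscal (of_nat ((r + j) choose j) / of_nat (j + 1)) * lam (j + 1))
        ((CARD('p) - j - 1) * CARD('p) + r + j)))"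

text \<open>Formal products of one of $\alpha_0$, $h_i$ with one of $\hat h_j$, $\hat h_j(k)$.\<close>

datatype lfactor = Alpha0 | H nat

datatype rfactor = Hhat nat | Hhat_k nat nat

primrec lfactor_val :: "lfactor \<Rightarrow> 'p::prime_card extF" where
  "lfactor_val Alpha0 = alpha0"
| "lfactor_val (H i) = h_cls i"

primrec rfactor_val :: "rfactor \<Rightarrow> 'p::prime_card extP" where
  "rfactor_val (Hhat j) = h_hat j"
| "rfactor_val (Hhat_k j k) = h_hat_k j k"

definition formal_val :: "lfactor \<times> rfactor \<Rightarrow> 'p::prime_card extP" where
  "formal_val w = lfactor_val (fst w) \<odot> rfactor_val (snd w)"

end

theory Submission
  imports Defs "HOL-Computational_Algebra.Polynomial"
begin

text \<open>For a nonzero monomial of $\Lambda \otimes H$ let $w$ be its number of letters $\mu$, plus one if the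
  factor $a$ is missing. The differential preserves $w$ and the total degree, so a cochain of length one
  splits into pieces given by vectors of coefficients. Comparing the coefficients of the words of length two
  whose subscripts are $a - 1$ and $D - a - 1$ with the relations of $\Lambda$ turns the cocycle condition into
  binomial congruences, one for each $D$: a vector indexed by $a$ is a linear combination of the rows
  \<open>R D m\<close> of the relations.

  Let $w = 0$ and let the total degree be $2N$, with coefficients $c_i$ of $\lambda_{i-1} ab^{[N - i(p-1)]}$.
  If $p \mid N + 1$, then either $c_1 \ne 0$ and $c_i = c_1 / i$, or $c$ is supported on the multiples of $p$
  and comes from a smaller $N$ by $\mathcal{P}^0$. If $p \nmid N + 1$, the coboundary of $ab^{[N]}$ makes
  $c_1 = 0$; then $c$ is supported on the multiples of $p$, and its first nonzero entry sits at a power of $p$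
  and forces $N$ to be one of the values in the list. For $w = 1$ the coboundary of $b^{[N + 1]}$ removes
  the letters $\mu$ and leaves a vector determined by its first entry, and for $w = 2$ nothing is left.

  Linear independence can be checked for each $N$ separately. Two of the classes share the same $N$ only if
  they are $h_{m+e} \widehat h_e$ and $h_e \widehat h_{m+e}$ with $m \ge 2$, so that a few entries of the
  vectors and of the coboundary suffice to tell them apart.\<close>

section \<open>Binomial coefficients modulo $p$\<close>

text \<open>An equation in \<Lambda> only says that multipliers \<open>E m\<close> exist.
  Information comes from entries that few rows meet: none with \<open>m \<ge> 1\<close> meets entry
  0 or 1, and row \<open>m\<close> starts at entry \<open>p * m\<close> with coefficient 1. If
  \<open>q\<close> is the first nonzero entry of a cocycle with w = 0, the words of sum
  \<open>q\<close> say that \<open>lam q\<close> is itself a cycle, so \<open>q\<close> is a power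
  of \<open>p\<close>; those of sum \<open>q + 1\<close> bound \<open>N\<close>. The second test
  fails for \<open>q = p\<close>, because \<open>lam p * lam 1 = 0\<close>: the row
  \<open>R (p + 1) 1\<close> is supported at \<open>p\<close> alone. Hence the separate treatment of
  a lead at \<open>p\<close>: sum \<open>p + 2\<close> is used instead, and for large
  \<open>N\<close> the conditions become those of the case w = 1 in a smaller degree.
  \<open>D_base\<close>, \<open>P_base\<close> and \<open>HR_base\<close> enter there. P^0
  corresponds to Frobenius: the p-th power of a row is again a row. In a linear relation the
  coboundary may be that of any cochain, not only one of length zero. As \<Lambda> has no relations
  in length below two, coefficients of length one are well defined and see only the constant terms
  of that cochain.\<close>

lemma sum_eq_single:
  fixes f :: "'a \<Rightarrow> 'b::comm_monoid_add"
  assumes "finite S" "x \<in> S" "\<And>y. y \<in> S \<Longrightarrow> y \<noteq> x \<Longrightarrow> f y = 0"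
  shows "sum f S = f x"
proof -
  have "sum f S = f x + sum f (S - {x})"
    using assms by (simp add: sum.remove)
  also have "sum f (S - {x}) = 0"
    using assms by (intro sum.neutral) auto
  finally show ?thesis by simp
qed

text \<open>Only the characteristic of the coefficients enters the congruences;
  \<open>odd_card\<close> specialises the field to \<open>'p mod_ring\<close>.\<close>

locale odd_char =
  fixes p :: nat and K :: "'k::field itself"
  assumes prime_p: "prime p" and odd_p: "odd p" and char_p: "CHAR('k) = p"
begin

abbreviation bin :: "nat \<Rightarrow> nat \<Rightarrow> 'k" where "bin n k \<equiv> of_nat (n choose k)"

lemma p_ge_3: "3 \<le> p"
proof -
  have "2 \<le> p" using prime_p prime_ge_2_nat by blast
  moreover have "p \<noteq> 2" using odd_p by auto
  ultimately show ?thesis by simp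
qed

lemma of_nat_eq_0: "(of_nat n :: 'k) = 0 \<longleftrightarrow> p dvd n"
  using of_nat_eq_0_iff_char_dvd[where ?'a = 'k] by (simp add: char_p)

lemma of_nat_p [simp]: "(of_nat p :: 'k) = 0"
  by (simp add: of_nat_eq_0)

lemma of_nat_nz: "0 < n \<Longrightarrow> n < p \<Longrightarrow> (of_nat n :: 'k) \<noteq> 0"
  by (auto simp: of_nat_eq_0 dest: dvd_imp_le)

lemma of_nat_p_minus: "k \<le> p \<Longrightarrow> (of_nat (p - k) :: 'k) = - of_nat k"
  by (simp add: of_nat_diff)

lemma coeff_binomial: "coeff ([:1, 1:] ^ n) k = bin n k"
  by (cases "k \<le> n") (simp_all add: coeff_linear_poly_power coeff_eq_0 degree_linear_power binomial_eq_0)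

text \<open>Lucas' congruence, from \<open>(1 + X)^(p a + r) = (1 + X^p)^a (1 + X)^r\<close> in
  characteristic \<open>p\<close>: since \<open>r, s < p\<close>, only the summand
  \<open>i = b\<close> contributes to the coefficient of \<open>X^(p b + s)\<close>.\<close>

lemma lucas:
  assumes "r < p" "s < p"
  shows "bin (p * a + r) (p * b + s) = bin a b * bin r s"
proof -
  have X: "([:1, 1:] :: 'k poly) = 1 + monom 1 1"
    by (simp add: monom_altdef one_pCons)
  have 0: "of_nat p = (0 :: 'k poly)"
    by (simp add: of_nat_poly)
  have "[:1, 1:] ^ p = (1 + monom 1 p :: 'k poly)"
    unfolding X add_power_prime_char[OF prime_p 0] by (simp add: monom_power)
  then have "[:1, 1:] ^ (p * a + r) = (1 + monom 1 p) ^ a * ([:1, 1:] ^ r :: 'k poly)"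
    by (simp add: power_add power_mult)
  also have "(1 + monom 1 p :: 'k poly) ^ a = (\<Sum>i\<le>a. monom (bin a i) (p * i))"
    unfolding add.commute[of 1] binomial_ring
    by (simp add: monom_power of_nat_monom mult_monom mult.commute)
  finally have "bin (p * a + r) (p * b + s) =
      (\<Sum>i\<le>a. coeff (monom (bin a i) (p * i) * [:1, 1:] ^ r) (p * b + s))"
    unfolding coeff_binomial[symmetric] by (simp add: sum_distrib_right coeff_sum)
  also have "\<dots> = (\<Sum>i\<le>a. if i = b then bin a b * bin r s else 0)"
  proof (intro sum.cong refl)
    fix i
    consider "i < b" | "i = b" | "b < i" by linarith
    then show "coeff (monom (bin a i) (p * i) * [:1, 1:] ^ r) (p * b + s) =
        (if i = b then bin a b * bin r s else 0)"
    proof cases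
      case 1
      then have "p * i + p \<le> p * b"
        by (metis Suc_leI mult_Suc_right mult_le_mono2 add.commute)
      then have "r < p * b + s - p * i" using assms by linarith
      with 1 show ?thesis
        by (simp add: coeff_monom_mult coeff_binomial binomial_eq_0)
    next
      case 2
      then show ?thesis by (simp add: coeff_monom_mult coeff_binomial)
    next
      case 3
      then have "p * b + p \<le> p * i"
        by (metis Suc_leI mult_Suc_right mult_le_mono2 add.commute)
      then show ?thesis using 3 assms by (simp add: coeff_monom_mult)
    qed
  qed
  also have "\<dots> = bin a b * bin r s"
    by (simp add: binomial_eq_0)
  finally show ?thesis .
qed

lemma lucas_0: "bin (p * a) (p * b) = bin a b"
  and lucas_r0: "r < p \<Longrightarrow> bin (p * a + r) (p * b) = bin a b"
  and lucas_0s: "0 < s \<Longrightarrow> s < p \<Longrightarrow> bin (p * a) (p * b + s) = 0"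
  and lucas_rs: "r < s \<Longrightarrow> s < p \<Longrightarrow> bin (p * a + r) (p * b + s) = 0"
  using lucas[of 0 0 a b] lucas[of r 0 a b] lucas[of 0 s a b] lucas[of r s a b] p_ge_3
  by (simp_all add: binomial_eq_0)

lemma bin_mult_p:
  "bin (p * n) k = (if p dvd k then bin n (k div p) else 0)"
proof -
  have "k = p * (k div p) + k mod p" by simp
  moreover have "k mod p < p" using p_ge_3 by simp
  ultimately show ?thesis
    using lucas_0[of n "k div p"] lucas_0s[of "k mod p" n "k div p"]
    by (auto simp: dvd_eq_mod_eq_0)
qed

text \<open>The coefficient of $x_1^a x_2^{D-a}$ in $(x_1 + x_2)^{D - (p+1)m} (x_1^p x_2)^m$, i.e. of
  $\lambda_{a-1} \lambda_{D-a-1}$ in a defining relation of $\Lambda$.\<close>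

definition R :: "nat \<Rightarrow> nat \<Rightarrow> nat \<Rightarrow> 'k" where
  "R D m a = (if (p + 1) * m \<le> D \<and> p * m \<le> a then bin (D - (p + 1) * m) (a - p * m) else 0)"

lemma R_0 [simp]: "R D 0 a = bin D a"
  by (simp add: R_def)

lemma R_less: "a < p * m \<Longrightarrow> R D m a = 0"
  by (simp add: R_def)

lemma R_diag: "(p + 1) * m \<le> D \<Longrightarrow> R D m (p * m) = 1"
  by (simp add: R_def)

text \<open>The rows are triangular: row \<open>m\<close> starts at entry \<open>p * m\<close> with
  a 1. As long as \<open>v\<close> vanishes there, the multipliers are killed in increasing order of
  \<open>m\<close>.\<close>

lemma R_coeff_eq_0:
  assumes v: "\<And>a. 1 \<le> a \<Longrightarrow> a < D \<Longrightarrow> v a = (\<Sum>m=1..D. E m * R D m a)"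
    and v0: "\<And>a. 1 \<le> a \<Longrightarrow> a < q \<Longrightarrow> v a = 0"
    and q: "q \<le> D"
  shows "1 \<le> m \<Longrightarrow> p * m < q \<Longrightarrow> (p + 1) * m \<le> D \<Longrightarrow> E m = 0"
proof (induction m rule: less_induct)
  case (less m)
  have "0 = v (p * m)"
    using v0[of "p * m"] less.prems p_ge_3 by simp
  also have "\<dots> = (\<Sum>m'=1..D. E m' * R D m' (p * m))"
    using v[of "p * m"] less.prems p_ge_3 q by simp
  also have "\<dots> = E m * R D m (p * m)"
  proof (rule sum_eq_single)
    show "m \<in> {1..D}" using less.prems by simp
    fix m' assume "m' \<in> {1..D}" "m' \<noteq> m"
    then consider "m < m'" | "m' < m" "1 \<le> m'" by fastforce
    then show "E m' * R D m' (p * m) = 0"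
    proof cases
      case 1
      then show ?thesis using p_ge_3 by (simp add: R_less)
    next
      case 2
      have "p * m' < q" "(p + 1) * m' \<le> D"
        using 2 less.prems(2,3) mult_le_mono2[of m' m p] mult_le_mono2[of m' m "p+1"] by linarith+
      then show ?thesis using less.IH[of m'] 2 by simp
    qed
  qed simp
  also have "\<dots> = E m"
    using less.prems by (simp add: R_diag)
  finally show ?case by simp
qed

text \<open>Frobenius: multiplying all three arguments by \<open>p\<close> raises
  \<open>(x1 + x2)^(D - (p+1) m) (x1^p x2)^m\<close> to its p-th power. Hence also
  \<open>R_mult_p_plus1\<close>, since a p-th power has no monomial in which the exponent of x1 is 1
  modulo \<open>p\<close>.\<close>

lemma R_mult_p: "R (p * D) (p * m) (p * a) = R D m a"
proof -
  have "(p + 1) * (p * m) = p * ((p + 1) * m)" by (simp add: algebra_simps)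
  moreover have "p * D - p * ((p + 1) * m) = p * (D - (p + 1) * m)"
    "p * a - p * (p * m) = p * (a - p * m)" by (simp_all only: diff_mult_distrib2)
  ultimately show ?thesis
    using p_ge_3 lucas_0 by (simp add: R_def del: distrib_right_numeral)
qed

lemma R_mult_p_plus1: "R (p * D) (p * m) (p * a + 1) = 0"
proof (cases "(p + 1) * (p * m) \<le> p * D \<and> p * (p * m) \<le> p * a + 1")
  case True
  have "p * m \<le> a"
  proof (rule ccontr)
    assume "\<not> p * m \<le> a"
    then have "p * a + p \<le> p * (p * m)"
      by (metis Suc_leI mult_Suc_right mult_le_mono2 add.commute not_le)
    then show False using True p_ge_3 by linarith
  qed
  then have "p * (p * m) \<le> p * a" by (rule mult_le_mono2)
  then have "p * a + 1 - p * (p * m) = p * (a - p * m) + 1"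
    by (simp only: diff_mult_distrib2)
  moreover have "p * D - (p + 1) * (p * m) = p * (D - (p + 1) * m)"
    by (simp add: diff_mult_distrib2 algebra_simps)
  ultimately show ?thesis
    using lucas_0s[of 1] p_ge_3 by (simp add: R_def)
qed (auto simp: R_def)

lemma R_next: "(p + 1) * m \<le> D \<Longrightarrow> R D m (p * m + 1) = of_nat (D - (p + 1) * m)"
  by (simp add: R_def)

text \<open>A combination of rows supported on multiples of \<open>p\<close> uses only rows with
  \<open>p dvd m\<close>, which by \<open>R_mult_p\<close> are the rows for \<open>D\<close>. The
  other multipliers vanish by induction: at entry \<open>p * m + 1\<close> row \<open>m\<close> has
  coefficient \<open>-m\<close> modulo \<open>p\<close>, later rows have not started, and rows with
  \<open>p dvd m'\<close> are zero.\<close>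

lemma descent:
  assumes v: "\<And>a. 1 \<le> a \<Longrightarrow> a < p * D \<Longrightarrow> v a = (\<Sum>m=1..p * D. E m * R (p * D) m a)"
    and v0: "\<And>a. 1 \<le> a \<Longrightarrow> a < p * D \<Longrightarrow> \<not> p dvd a \<Longrightarrow> v a = 0"
  shows "\<exists>E. \<forall>a. 1 \<le> a \<longrightarrow> a < D \<longrightarrow> v (p * a) = (\<Sum>m=1..D. E m * R D m a)"
proof -
  have E: "E m * R (p * D) m a = 0" if "1 \<le> m" "\<not> p dvd m" for m a
  proof (cases "(p + 1) * m \<le> p * D")
    case True
    have "E m = 0" using that True
    proof (induction m rule: less_induct)
      case (less m)
      \<comment> \<open>The entry is in range: otherwise \<open>(p + 1) * m \<le> p * D\<close>
        leaves only \<open>m = 1\<close> and \<open>p * D = p + 1\<close>.\<close>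
      have D: "p * m + 1 < p * D"
      proof (rule ccontr)
        assume "\<not> ?thesis"
        with less.prems(3) have "m = 1" "p * D = p * m + 1"
          using less.prems(1) by auto
        then have "p dvd 1" by (metis dvd_add_right_iff dvd_triv_left)
        then show False using p_ge_3 by simp
      qed
      have "\<not> p dvd (p * m + 1)"
        using p_ge_3 by (metis dvd_add_right_iff dvd_triv_left nat_dvd_1_iff_1 numeral_le_one_iff semiring_norm(70))
      then have "0 = v (p * m + 1)"
        using v0[of "p * m + 1"] D by simp
      also have "\<dots> = (\<Sum>m'=1..p * D. E m' * R (p * D) m' (p * m + 1))"
        using v[of "p * m + 1"] D by simp
      also have "\<dots> = E m * R (p * D) m (p * m + 1)"
      proof (rule sum_eq_single)
        show "m \<in> {1..p * D}" using less.prems by simp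
        fix m' assume m': "m' \<in> {1..p * D}" "m' \<noteq> m"
        show "E m' * R (p * D) m' (p * m + 1) = 0"
        proof (cases "p dvd m'")
          case True
          then obtain k where "m' = p * k" ..
          then show ?thesis using R_mult_p_plus1[of D k m] by simp
        next
          case False
          consider "m < m'" | "m' < m" using m' by linarith
          then show ?thesis
          proof cases
            case 1
            then have "p * m + p \<le> p * m'"
              by (metis Suc_leI mult_Suc_right mult_le_mono2 add.commute)
            then have "p * m + 1 < p * m'" using p_ge_3 by linarith
            then show ?thesis by (simp add: R_less)
          next
            case 2
            have "(p + 1) * m' \<le> p * D"
              using 2 less.prems(3) mult_le_mono2[of m' m "p+1"] by simp
            then show ?thesis using less.IH[of m'] 2 m' False by simp
          qed
        qed
      qed simp
      also have "\<dots> = E m * of_nat (p * D - (p + 1) * m)"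
        using less.prems by (simp only: R_next)
      also have "(of_nat (p * D - (p + 1) * m) :: 'k) = - of_nat m"
        using less.prems(3) by (simp add: of_nat_diff)
      finally show ?case using less.prems(2) by (simp add: of_nat_eq_0)
    qed
    then show ?thesis by simp
  qed (simp add: R_def)
  show ?thesis
  proof (intro exI allI impI)
    fix a assume a: "1 \<le> a" "a < D"
    have "v (p * a) = (\<Sum>m=1..p * D. E m * R (p * D) m (p * a))"
      using v[of "p * a"] a p_ge_3 by simp
    also have "\<dots> = (\<Sum>m\<in>(*) p ` {1..D}. E m * R (p * D) m (p * a))"
    proof (rule sum.mono_neutral_right)
      show "(*) p ` {1..D} \<subseteq> {1..p * D}" using p_ge_3 by auto
      show "\<forall>m\<in>{1..p * D} - (*) p ` {1..D}. E m * R (p * D) m (p * a) = 0"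
      proof
        fix m assume m: "m \<in> {1..p * D} - (*) p ` {1..D}"
        have "\<not> p dvd m"
        proof
          assume "p dvd m"
          then obtain k where "m = p * k" ..
          with m p_ge_3 show False by auto
        qed
        then show "E m * R (p * D) m (p * a) = 0" using E m by simp
      qed
    qed simp
    also have "\<dots> = (\<Sum>m=1..D. E (p * m) * R D m a)"
      using p_ge_3 by (subst sum.reindex) (auto simp: inj_on_def R_mult_p)
    finally show "v (p * a) = (\<Sum>m=1..D. (\<lambda>m. E (p * m)) m * R D m a)" .
  qed
qed

end

section \<open>Rows of sum \<open>p * D + 1\<close>, and the binomial identity behind d^2 =
  0\<close>

context odd_char
begin

lemma not_dvd_mult_plus1: "\<not> p dvd (p * m + 1)"
  using p_ge_3 by (metis dvd_add_right_iff dvd_triv_left nat_dvd_1_iff_1 numeral_le_one_iff semiring_norm(70))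

lemma bin_nonzero: "bin n k \<noteq> 0 \<Longrightarrow> k \<le> n"
  by (metis binomial_eq_0 not_le of_nat_0)

lemma mult_p_less: "m < (m'::nat) \<Longrightarrow> p * m + p \<le> p * m'"
  by (metis Suc_leI mult_Suc_right mult_le_mono2 add.commute)

text \<open>This row is \<open>x1^p x2\<close> times the p-th power of row \<open>l\<close> for
  \<open>D - 1\<close>; the extra factor causes the shift by one in \<open>D\<close> and in
  \<open>a\<close>.\<close>

lemma R_shift: "1 \<le> D \<Longrightarrow> 1 \<le> a \<Longrightarrow> R (p * D + 1) (p * l + 1) (p * a) = R (D - 1) l (a - 1)"
proof -
  assume "1 \<le> D" "1 \<le> a"
  then obtain D' a' where D: "D = D' + 1" and a: "a = a' + 1"
    by (metis le_add_diff_inverse2)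
  have 1: "(p + 1) * (p * l + 1) = p * ((p + 1) * l) + (p + 1)" by (simp add: algebra_simps)
  have 2: "p * D + 1 = p * D' + (p + 1)" using D by simp
  have 3: "(p + 1) * (p * l + 1) \<le> p * D + 1 \<longleftrightarrow> (p + 1) * l \<le> D'"
    unfolding 1 2 using p_ge_3 by (simp del: distrib_right_numeral mult_Suc add_mult_distrib)
  have 4: "p * (p * l + 1) \<le> p * a \<longleftrightarrow> p * l \<le> a'"
    using a p_ge_3 by simp
  have 5: "p * D + 1 - (p + 1) * (p * l + 1) = p * (D' - (p + 1) * l)"
    unfolding 1 2 by (simp only: diff_mult_distrib2)
  have 6: "p * a - p * (p * l + 1) = p * (a' - p * l)"
    unfolding a by (simp add: diff_mult_distrib2 algebra_simps)
  show ?thesis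
    unfolding R_def 3 4 5 6 lucas_0 using D a by simp
qed

lemma R_shift_plus1: "R (p * D + 1) (p * l + 1) (p * a + 1) = 0"
proof (cases "(p + 1) * (p * l + 1) \<le> p * D + 1 \<and> p * (p * l + 1) \<le> p * a + 1")
  case True
  have a: "p * l + 1 \<le> a"
  proof (rule ccontr)
    assume "\<not> ?thesis"
    then have "p * a + p \<le> p * (p * l + 1)" by (intro mult_p_less) simp
    then show False using True p_ge_3 by linarith
  qed
  then have "p * (p * l + 1) \<le> p * a" by (rule mult_le_mono2)
  then have 1: "p * a + 1 - p * (p * l + 1) = p * (a - (p * l + 1)) + 1"
    by (simp only: diff_mult_distrib2)
  have "(p + 1) * (p * l + 1) = p * ((p + 1) * l + 1) + 1" by (simp add: algebra_simps)
  then have 2: "p * D + 1 - (p + 1) * (p * l + 1) = p * (D - ((p + 1) * l + 1))"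
    by (simp only: diff_mult_distrib2)
  show ?thesis
    unfolding R_def 1 2 using lucas_0s[of 1] p_ge_3 by simp
qed (auto simp: R_def)

text \<open>As \<open>descent\<close>, for sums congruent to 1 modulo \<open>p\<close>. Row
  \<open>m\<close> has coefficient \<open>-(m - 1)\<close> at entry \<open>p * m + 1\<close>, so the
  surviving rows are \<open>m = p * l + 1\<close>, now including \<open>l = 0\<close>. By
  \<open>R_shift\<close> they become rows with an additional factor x1, the shape of the relations
  among the words \<lambda>\<mu> and \<mu>\<mu>.\<close>

lemma descent_shift:
  assumes v: "\<And>a. 1 \<le> a \<Longrightarrow> a \<le> p * D \<Longrightarrow> v a = (\<Sum>m=1..p * D + 1. E m * R (p * D + 1) m a)"
    and v0: "\<And>a. 1 \<le> a \<Longrightarrow> a \<le> p * D \<Longrightarrow> \<not> p dvd a \<Longrightarrow> v a = 0"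
    and D: "1 \<le> D"
  shows "\<exists>G. \<forall>a. 1 \<le> a \<longrightarrow> a \<le> D \<longrightarrow> v (p * a) = (\<Sum>l\<le>D. G l * R (D - 1) l (a - 1))"
proof -
  have E: "E m * R (p * D + 1) m a = 0" if "1 \<le> m" "\<not> p dvd (m - 1)" for m a
  proof (cases "(p + 1) * m \<le> p * D + 1")
    case True
    have "E m = 0" using that True
    proof (induction m rule: less_induct)
      case (less m)
      have "m \<noteq> 1" using less.prems(2) by auto
      then have m2: "2 \<le> m" using less.prems(1) by linarith
      have mD: "p * m + 1 \<le> p * D"
      proof (rule ccontr)
        assume "\<not> ?thesis"
        then have "p * D \<le> p * m" by linarith
        with less.prems(3) m2 show False by simp
      qed
      have "0 = v (p * m + 1)"
        using v0[of "p * m + 1"] mD not_dvd_mult_plus1 by simp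
      also have "\<dots> = (\<Sum>m'=1..p * D + 1. E m' * R (p * D + 1) m' (p * m + 1))"
        using v[of "p * m + 1"] mD by simp
      also have "\<dots> = E m * R (p * D + 1) m (p * m + 1)"
      proof (rule sum_eq_single)
        have "m \<le> p * D + 1" using less.prems by simp
        then show "m \<in> {1..p * D + 1}" using less.prems by simp
        fix m' assume m': "m' \<in> {1..p * D + 1}" "m' \<noteq> m"
        show "E m' * R (p * D + 1) m' (p * m + 1) = 0"
        proof (cases "p dvd m' - 1")
          case True
          then obtain k where "m' - 1 = p * k" ..
          then have "m' = p * k + 1" using m' by auto
          then show ?thesis using R_shift_plus1[of D k m] by simp
        next
          case False
          consider "m < m'" | "m' < m" using m' by linarith
          then show ?thesis
          proof cases
            case 1
            then have "p * m + 1 < p * m'" using mult_p_less[of m m'] p_ge_3 by linarith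
            then show ?thesis by (simp add: R_less)
          next
            case 2
            have "(p + 1) * m' \<le> p * D + 1"
              using 2 less.prems(3) mult_le_mono2[of m' m "p+1"] by simp
            then show ?thesis using less.IH[of m'] 2 m' False by simp
          qed
        qed
      qed simp
      also have "\<dots> = E m * of_nat (p * D + 1 - (p + 1) * m)"
        using less.prems by (simp only: R_next)
      also have "(of_nat (p * D + 1 - (p + 1) * m) :: 'k) = - of_nat (m - 1)"
        using less.prems(1,3) by (simp add: of_nat_diff)
      finally show ?case using less.prems(2) by (simp add: of_nat_eq_0)
    qed
    then show ?thesis by simp
  qed (simp add: R_def)
  show ?thesis
  proof (intro exI allI impI)
    fix a assume a: "1 \<le> a" "a \<le> D"
    have "v (p * a) = (\<Sum>m=1..p * D + 1. E m * R (p * D + 1) m (p * a))"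
      using v[of "p * a"] a p_ge_3 by simp
    also have "\<dots> = (\<Sum>m\<in>(\<lambda>l. p * l + 1) ` {..D}. E m * R (p * D + 1) m (p * a))"
    proof (rule sum.mono_neutral_right)
      show "(\<lambda>l. p * l + 1) ` {..D} \<subseteq> {1..p * D + 1}" by auto
      show "\<forall>m\<in>{1..p * D + 1} - (\<lambda>l. p * l + 1) ` {..D}. E m * R (p * D + 1) m (p * a) = 0"
      proof
        fix m assume m: "m \<in> {1..p * D + 1} - (\<lambda>l. p * l + 1) ` {..D}"
        have "\<not> p dvd (m - 1)"
        proof
          assume "p dvd (m - 1)"
          then obtain k where "m - 1 = p * k" ..
          then have "m = p * k + 1" using m by auto
          with m p_ge_3 show False by auto
        qed
        then show "E m * R (p * D + 1) m (p * a) = 0" using E m by simp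
      qed
    qed simp
    also have "\<dots> = (\<Sum>l\<le>D. E (p * l + 1) * R (D - 1) l (a - 1))"
      using p_ge_3 R_shift[OF D a(1)] by (subst sum.reindex) (auto simp: inj_on_def)
    finally show "v (p * a) = (\<Sum>l\<le>D. (\<lambda>l. E (p * l + 1)) l * R (D - 1) l (a - 1))" .
  qed
qed

text \<open>\<open>T + k * (p - 1) = p * k + (T - k)\<close>; use
  \<open>(1 + x)^(p k) = (1 + x^p)^k\<close> in Vandermonde's formula.\<close>

lemma bin_shift_sum:
  assumes "k \<le> T"
  shows "bin (T + k * (p - 1)) a = (\<Sum>m\<le>k. if p * m \<le> a then bin k m * bin (T - k) (a - p * m) else 0)"
proof -
  have eq: "T + k * (p - 1) = p * k + (T - k)"
    using assms p_ge_3 by (simp add: diff_mult_distrib2)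
       (metis Nat.add_diff_assoc2 Nat.diff_add_assoc add.commute le_add1 mult.commute nat_mult_le_cancel_disj One_nat_def prime_p prime_ge_1_nat mult.right_neutral)
  have "bin (T + k * (p - 1)) a = (\<Sum>j\<le>a. bin (p * k) j * bin (T - k) (a - j))"
    unfolding eq vandermonde[symmetric] by simp
  also have "\<dots> = (\<Sum>j\<in>(*) p ` {m. p * m \<le> a}. bin (p * k) j * bin (T - k) (a - j))"
    by (rule sum.mono_neutral_right) (auto simp: bin_mult_p elim!: dvdE)
  also have "\<dots> = (\<Sum>m | p * m \<le> a. bin k m * bin (T - k) (a - p * m))"
    using p_ge_3 by (subst sum.reindex) (auto simp: inj_on_def lucas_0)
  also have "\<dots> = (\<Sum>m\<in>{..k} \<inter> {m. p * m \<le> a}. bin k m * bin (T - k) (a - p * m))"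
  proof (rule sum.mono_neutral_right)
    have "m \<le> a" if "p * m \<le> a" for m
      using that p_ge_3 mult_le_mono1[of 1 p m] by linarith
    then have "{m. p * m \<le> a} \<subseteq> {..a}" by auto
    then show "finite {m. p * m \<le> a}" by (rule finite_subset) simp
  qed (auto dest!: bin_nonzero)
  finally show ?thesis by (simp add: sum.inter_restrict)
qed

text \<open>Both sides count the triples of disjoint subsets of sizes \<open>m\<close>,
  \<open>k - m\<close> and \<open>a\<close> in a set of size \<open>T\<close>.\<close>

lemma multinomial_identity:
  fixes T k m n a :: nat
  assumes "m \<le> k" "k \<le> T"
  shows "(T choose k) * (k choose m) * (T - k choose a) = (T choose m) * (T - m choose (a + (k - m))) * (a + (k - m) choose a)"
proof (cases "a \<le> T - k")
  case True
  have "(T choose k) * (k choose m) = (T choose m) * (T - m choose (k - m))"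
    using assms by (rule choose_mult)
  moreover have "(T - m choose (a + (k - m))) * (a + (k - m) choose (k - m)) =
      (T - m choose (k - m)) * (T - m - (k - m) choose (a + (k - m) - (k - m)))"
    using True assms by (intro choose_mult) auto
  moreover have "T - m - (k - m) = T - k" using assms by simp
  moreover have "(a + (k - m) choose a) = (a + (k - m) choose (k - m))"
    by (subst binomial_symmetric) auto
  ultimately show ?thesis by simp
next
  case False
  then show ?thesis using assms by (simp add: binomial_eq_0)
qed

text \<open>The coefficient form of $d^2 = 0$: it compares the coefficients of $x_1^a x_2^{D-a}$ in
  $((1 + x_1) + x_2 (1 + x_1)^p)^T = (1 + x_1 + x_2 + x_1^p x_2)^T$.\<close>

lemma boundary_identity:
  assumes "a \<le> D"
  shows "bin (T + (D - a) * (p - 1)) a * bin T (D - a) =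
    (\<Sum>m\<le>D. bin T m * bin (T - m) (D - (p + 1) * m) * R D m a)"
proof -
  define k where "k = D - a"
  have summand: "bin T k * (if p * m \<le> a then bin k m * bin (T - k) (a - p * m) else 0) =
      bin T m * bin (T - m) (D - (p + 1) * m) * R D m a" if "k \<le> T" "m \<le> k" for m
  proof (cases "p * m \<le> a")
    case True
    have le: "(p + 1) * m \<le> D" using True that assms by (simp add: k_def)
    have n: "D - (p + 1) * m = (a - p * m) + (k - m)"
      using True that assms by (simp add: k_def)
    have "bin T k * bin k m * bin (T - k) (a - p * m) =
        bin T m * bin (T - m) (D - (p + 1) * m) * bin (D - (p + 1) * m) (a - p * m)"
      unfolding n using multinomial_identity[OF that(2,1), of "a - p * m"]
      by (simp only: of_nat_mult[symmetric])
    then show ?thesis using True le by (simp add: R_def mult.assoc del: distrib_right_numeral)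
  next
    case False
    then show ?thesis by (simp add: R_less)
  qed
  have z: "bin T m * bin (T - m) (D - (p + 1) * m) * R D m a = 0" if "k < m \<or> T < k" for m
  proof (rule ccontr)
    assume nz: "\<not> ?thesis"
    then have 1: "(p + 1) * m \<le> D" "p * m \<le> a" by (auto simp: R_def split: if_splits)
    from nz have "a - p * m \<le> D - (p + 1) * m" "m \<le> T" "D - (p + 1) * m \<le> T - m"
      using 1 by (auto simp: R_def dest!: bin_nonzero)
    moreover have "(p + 1) * m = p * m + m" by simp
    ultimately show False using that 1 assms unfolding k_def by linarith
  qed
  show ?thesis
  proof (cases "k \<le> T")
    case True
    have "bin (T + k * (p - 1)) a * bin T k =
      (\<Sum>m\<le>k. bin T k * (if p * m \<le> a then bin k m * bin (T - k) (a - p * m) else 0))"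
      unfolding bin_shift_sum[OF True] by (simp add: sum_distrib_left mult.commute)
    also have "\<dots> = (\<Sum>m\<le>k. bin T m * bin (T - m) (D - (p + 1) * m) * R D m a)"
      using True summand by (intro sum.cong refl) auto
    also have "\<dots> = (\<Sum>m\<le>D. bin T m * bin (T - m) (D - (p + 1) * m) * R D m a)"
      using z by (intro sum.mono_neutral_left) (auto simp: k_def not_le)
    finally show ?thesis by (simp add: k_def)
  next
    case False
    then have "(\<Sum>m\<le>D. bin T m * bin (T - m) (D - (p + 1) * m) * R D m a) = 0"
      using z by (intro sum.neutral) auto
    then show ?thesis using False by (simp add: k_def binomial_eq_0)
  qed
qed

end

section \<open>The cocycle conditions as binomial congruences\<close>

context odd_char
begin

text \<open>\<open>coc N c\<close> says that $\sum_i c_i \lambda_{i-1} ab^{[N - i(p-1)]}$ is a cocycle: the left-hand side is the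
  coefficient of $\lambda_{a-1} \lambda_{D-a-1}$ in the coboundary, and \<open>E m\<close> is the multiple of the relation \<open>R D m\<close>.
  \<open>bd N\<close> is the vector of the coboundary of $ab^{[N]}$.\<close>

definition coc :: "nat \<Rightarrow> (nat \<Rightarrow> 'k) \<Rightarrow> bool" where
  "coc N c \<longleftrightarrow> (\<forall>D. D * (p - 1) \<le> N \<longrightarrow> (\<exists>E. \<forall>a. 1 \<le> a \<longrightarrow> a < D \<longrightarrow>
     c D * bin D a - c a * bin (N - D * (p - 1)) (D - a) = (\<Sum>m=1..D. E m * R D m a)))"

definition bd :: "nat \<Rightarrow> nat \<Rightarrow> 'k" where
  "bd N i = bin (N - i * (p - 1)) i"

lemma cocD:
  assumes "coc N c" "D * (p - 1) \<le> N"
  obtains E where "\<And>a. 1 \<le> a \<Longrightarrow> a < D \<Longrightarrow>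
    c D * bin D a - c a * bin (N - D * (p - 1)) (D - a) = (\<Sum>m=1..D. E m * R D m a)"
  using assms unfolding coc_def by blast

lemma coc_lincomb:
  assumes "coc N c" "coc N c'"
  shows "coc N (\<lambda>i. s * c i + s' * c' i)"
  unfolding coc_def
proof (intro allI impI)
  fix D assume D: "D * (p - 1) \<le> N"
  obtain E where E: "\<And>a. 1 \<le> a \<Longrightarrow> a < D \<Longrightarrow>
    c D * bin D a - c a * bin (N - D * (p - 1)) (D - a) = (\<Sum>m=1..D. E m * R D m a)"
    using cocD[OF assms(1) D] by blast
  obtain E' where E': "\<And>a. 1 \<le> a \<Longrightarrow> a < D \<Longrightarrow>
    c' D * bin D a - c' a * bin (N - D * (p - 1)) (D - a) = (\<Sum>m=1..D. E' m * R D m a)"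
    using cocD[OF assms(2) D] by blast
  show "\<exists>E. \<forall>a. 1 \<le> a \<longrightarrow> a < D \<longrightarrow>
     (s * c D + s' * c' D) * bin D a - (s * c a + s' * c' a) * bin (N - D * (p - 1)) (D - a) =
     (\<Sum>m=1..D. E m * R D m a)"
  proof (intro exI allI impI)
    fix a assume a: "1 \<le> a" "a < D"
    have "(s * c D + s' * c' D) * bin D a - (s * c a + s' * c' a) * bin (N - D * (p - 1)) (D - a) =
      s * (c D * bin D a - c a * bin (N - D * (p - 1)) (D - a)) +
      s' * (c' D * bin D a - c' a * bin (N - D * (p - 1)) (D - a))"
      by (simp add: algebra_simps)
    also have "\<dots> = (\<Sum>m=1..D. (\<lambda>m. s * E m + s' * E' m) m * R D m a)"
      unfolding E[OF a] E'[OF a] by (simp add: sum_distrib_left sum.distrib algebra_simps)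
    finally show "(s * c D + s' * c' D) * bin D a - (s * c a + s' * c' a) * bin (N - D * (p - 1)) (D - a) = \<dots>" .
  qed
qed

lemma of_nat_shift: "D * (p - 1) \<le> N \<Longrightarrow> (of_nat (N - D * (p - 1)) :: 'k) = of_nat N + of_nat D"
  using p_ge_3 by (simp add: of_nat_diff of_nat_p_minus[of 1, simplified])

text \<open>d^2 = 0 for \<open>ab^[N]\<close>: in \<open>boundary_identity\<close> the term
  \<open>m = 0\<close> is \<open>bd N D * bin D a\<close>, and the terms with
  \<open>m \<ge> 1\<close> are the required combination of rows.\<close>

lemma bd_coc: "coc N (bd N)"
  unfolding coc_def
proof (intro allI impI)
  fix D assume D: "D * (p - 1) \<le> N"
  then obtain T where N: "N = T + D * (p - 1)" by (metis le_add_diff_inverse2)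
  show "\<exists>E. \<forall>a. 1 \<le> a \<longrightarrow> a < D \<longrightarrow>
     bd N D * bin D a - bd N a * bin (N - D * (p - 1)) (D - a) = (\<Sum>m=1..D. E m * R D m a)"
  proof (intro exI allI impI)
    fix a assume a: "1 \<le> a" "a < D"
    have "N - a * (p - 1) = T + (D - a) * (p - 1)"
      using a unfolding N by (simp add: diff_mult_distrib)
    then have "bd N a * bin (N - D * (p - 1)) (D - a) =
        (\<Sum>m\<le>D. bin T m * bin (T - m) (D - (p + 1) * m) * R D m a)"
      using boundary_identity[of a D T] a by (simp add: bd_def N)
    also have "{..D} = insert 0 {1..D}" by auto
    finally have "bd N a * bin (N - D * (p - 1)) (D - a) =
        bd N D * bin D a + (\<Sum>m=1..D. bin T m * bin (T - m) (D - (p + 1) * m) * R D m a)"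
      by (simp add: bd_def N)
    then show "bd N D * bin D a - bd N a * bin (N - D * (p - 1)) (D - a) =
        (\<Sum>m=1..D. (\<lambda>m. - (bin T m * bin (T - m) (D - (p + 1) * m))) m * R D m a)"
      by (simp add: sum_negf)
  qed
qed

text \<open>Together with \<open>bd_not_dvd\<close> this says that P^0 takes the coboundary of
  \<open>ab^[N]\<close> to that of \<open>ab^[p N + p - 1]\<close>.\<close>

lemma bd_mult_p: "bd (p * N + (p - 1)) (p * a) = bd N a"
proof (cases "a * (p - 1) \<le> N")
  case True
  then obtain T where N: "N = T + a * (p - 1)" by (metis le_add_diff_inverse2)
  have "p * N = p * T + p * a * (p - 1)"
    unfolding N by (simp only: distrib_left mult.assoc)
  then have "p * N + (p - 1) - p * a * (p - 1) = p * T + (p - 1)"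
    by simp
  then show ?thesis
    unfolding bd_def using lucas_r0[of "p - 1" T a] p_ge_3 by (simp add: N)
next
  case False
  then have "p * N + p \<le> p * (a * (p - 1))" by (intro mult_p_less) simp
  then have 1: "p * N + (p - 1) - p * a * (p - 1) = 0" unfolding mult.assoc by linarith
  have 2: "N - a * (p - 1) = 0" using False by simp
  have "a \<noteq> 0" using False by (cases "a = 0") auto
  then show ?thesis unfolding bd_def 1 2 using p_ge_3 by (simp add: binomial_eq_0)
qed

text \<open>If \<open>s > 0\<close> is the last digit of \<open>a\<close> in base \<open>p\<close>,
  the last digit of the upper index \<open>T\<close> is \<open>s - 1\<close>, so Lucas gives
  0.\<close>

lemma bd_not_dvd:
  assumes "\<not> p dvd a"
  shows "bd (p * N + (p - 1)) a = 0"
proof (cases "a * (p - 1) \<le> p * N + (p - 1)")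
  case True
  then obtain T where T: "p * N + (p - 1) = T + a * (p - 1)" by (metis le_add_diff_inverse2)
  define b s where "b = a div p" and "s = a mod p"
  have a: "a = p * b + s" by (simp add: b_def s_def)
  have s: "0 < s" "s < p" using assms p_ge_3 by (auto simp: s_def mod_greater_zero_iff_not_dvd)
  obtain t where p: "p = t + 1" using p_ge_3 by (metis le_add_diff_inverse2 le_trans one_le_numeral)
  obtain u where u: "s = u + 1" using s by (metis Suc_eq_plus1 gr0_conv_Suc)
  have "p * (N + 1) = (T + 1) + a * t"
    using T p by (simp add: algebra_simps)
  then have "p * (N + 1) + a = T + 1 + p * a"
    using p by (simp add: algebra_simps)
  then have eq: "p * (N + 1) + p * b + u = T + p * a"
    unfolding a u by simp
  have "p * a < p * (N + 1) + p * b + p" using eq s u by linarith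
  then have "p * a < p * (N + 1 + b + 1)" by (simp add: algebra_simps)
  then have "a \<le> N + 1 + b" by (simp del: mult_Suc_right)
  then obtain A where A: "N + 1 + b = A + a" by (metis le_add_diff_inverse2)
  have "p * (N + 1) + p * b = p * A + p * a"
    using arg_cong[OF A, of "(*) p"] by (simp only: distrib_left)
  then have "T = p * A + u" using eq by linarith
  then have "bin T a = 0"
    unfolding a using lucas_rs[of u s A b] s u by simp
  then show ?thesis unfolding bd_def T by simp
next
  case False
  moreover have "a \<noteq> 0" using assms by (cases "a = 0") auto
  ultimately show ?thesis by (simp add: bd_def binomial_eq_0)
qed

text \<open>Stripping \<open>j\<close> factors \<open>p\<close> with \<open>bd_mult_p\<close> and
  \<open>bd_not_dvd\<close> leaves the case \<open>N + 1 = u\<close>, where entry 1 is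
  \<open>N - (p - 1) = u - p\<close>; \<open>p < u\<close> keeps this index in range. It locates the
  first nonzero entry of a coboundary.\<close>

lemma bd_lead:
  assumes "N + 1 = p ^ j * u" "p < u" "\<not> p dvd u"
  shows "(\<forall>a. 1 \<le> a \<longrightarrow> a < p ^ j \<longrightarrow> bd N a = 0) \<and> bd N (p ^ j) = of_nat u"
  using assms(1)
proof (induction j arbitrary: N)
  case 0
  then have "N - (p - 1) = u - p" using p_ge_3 by simp
  then show ?case
    using assms by (simp add: bd_def of_nat_diff)
next
  case (Suc j)
  have "1 \<le> p ^ j * u" using assms p_ge_3 by simp
  then obtain M where M: "M + 1 = p ^ j * u" by (metis le_add_diff_inverse2)
  have N: "N = p * M + (p - 1)"
  proof -
    have "N + 1 = p * (M + 1)" using Suc.prems M by simp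
    then show ?thesis using p_ge_3 by (simp only: distrib_left)
  qed
  note IH = Suc.IH[OF M]
  show ?case
  proof (intro conjI allI impI)
    fix a assume a: "1 \<le> a" "a < p ^ Suc j"
    show "bd N a = 0"
    proof (cases "p dvd a")
      case True
      then obtain b where "a = p * b" ..
      then show ?thesis using IH a p_ge_3 unfolding N by (simp only: bd_mult_p) simp
    qed (unfold N, rule bd_not_dvd)
  next
    show "bd N (p ^ Suc j) = of_nat u"
      using IH unfolding N power_Suc bd_mult_p by simp
  qed
qed

lemma p_part: "0 < n \<Longrightarrow> \<exists>j u. n = p ^ j * u \<and> \<not> p dvd u"
  for n :: nat
  using multiplicity_decompose'[of n p] prime_p by (metis not_prime_unit not_gr_zero)

text \<open>Rows with \<open>m \<ge> 1\<close> start at \<open>p * m > 1\<close>, so entry 1 of a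
  congruence is an honest equation.\<close>

lemma sum_R_one: "(\<Sum>m=1..D. E m * R D m 1) = 0"
proof (intro sum.neutral ballI)
  fix m assume "m \<in> {1..D}"
  then have "p * 1 \<le> p * m" by (intro mult_le_mono2) simp
  then have "1 < p * m" using p_ge_3 by linarith
  then show "E m * R D m 1 = 0" by (simp only: R_less mult_zero_right)
qed

text \<open>At either end only row 0 survives (see also \<open>sum_R_top\<close>), so both ends of a
  congruence with shifted rows compute the same multiplier \<open>G 0\<close>.\<close>

lemma sum_R_bottom: "(\<Sum>m\<le>D. G m * R (D - 1) m 0) = G 0"
proof -
  have "(\<Sum>m\<le>D. G m * R (D - 1) m 0) = G 0 * R (D - 1) 0 0"
    using p_ge_3 by (intro sum_eq_single) (auto simp: R_def)
  then show ?thesis by simp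
qed

lemma sum_R_top: "(\<Sum>m\<le>D. G m * R (D - 1) m (D - 1)) = G 0"
proof -
  have "(\<Sum>m\<le>D. G m * R (D - 1) m (D - 1)) = G 0 * R (D - 1) 0 (D - 1)"
  proof (intro sum_eq_single)
    fix m assume m: "m \<in> {..D}" "m \<noteq> 0"
    show "G m * R (D - 1) m (D - 1) = 0"
    proof (cases "(p + 1) * m \<le> D - 1")
      case True
      then have "D - 1 - (p + 1) * m < D - 1 - p * m" using m by simp
      then show ?thesis by (simp add: R_def binomial_eq_0)
    qed (simp add: R_def)
  qed auto
  then show ?thesis by simp
qed

text \<open>The two conditions on \<open>g\<close> say that $\sum_i g_i \lambda_{i-1} \otimes b^{[N + 1 - i (p - 1)]}$ is a cocycle.
  They also arise from the cocycles with $\lambda$ only whose first coefficient vanishes.\<close>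

definition coc_b :: "nat \<Rightarrow> (nat \<Rightarrow> 'k) \<Rightarrow> bool" where
  "coc_b N g \<longleftrightarrow> (\<forall>D. 1 \<le> D \<longrightarrow> D * (p - 1) \<le> N \<longrightarrow>
     (\<exists>G. \<forall>a. 1 \<le> a \<longrightarrow> a \<le> D \<longrightarrow>
        g a * bin (N - D * (p - 1)) (D - a) = (\<Sum>m\<le>D. G m * R (D - 1) m (a - 1))) \<and>
     (\<exists>E. \<forall>a. 1 \<le> a \<longrightarrow> a < D \<longrightarrow>
        g D * bin D a - g a * bin (N + 1 - D * (p - 1)) (D - a) = (\<Sum>m=1..D. E m * R D m a)))"

lemma coc_b_muD:
  assumes "coc_b N g" "1 \<le> D" "D * (p - 1) \<le> N"
  obtains G where "\<And>a. 1 \<le> a \<Longrightarrow> a \<le> D \<Longrightarrow>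
    g a * bin (N - D * (p - 1)) (D - a) = (\<Sum>m\<le>D. G m * R (D - 1) m (a - 1))"
  using assms unfolding coc_b_def by blast

lemma coc_b_lamD:
  assumes "coc_b N g" "1 \<le> D" "D * (p - 1) \<le> N"
  obtains E where "\<And>a. 1 \<le> a \<Longrightarrow> a < D \<Longrightarrow>
    g D * bin D a - g a * bin (N + 1 - D * (p - 1)) (D - a) = (\<Sum>m=1..D. E m * R D m a)"
  using assms unfolding coc_b_def by blast

text \<open>The entries \<open>a = 1\<close> and \<open>a = D\<close> of the first condition are
  both equal to \<open>G 0\<close>.\<close>

lemma coc_b_determined:
  assumes "coc_b N g" "1 \<le> D" "D * (p - 1) \<le> N"
  shows "g D = g 1 * bin (N - D * (p - 1)) (D - 1)"
proof -
  obtain G where G: "\<And>a. 1 \<le> a \<Longrightarrow> a \<le> D \<Longrightarrow>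
        g a * bin (N - D * (p - 1)) (D - a) = (\<Sum>m\<le>D. G m * R (D - 1) m (a - 1))"
    using coc_b_muD[OF assms] by blast
  have "g 1 * bin (N - D * (p - 1)) (D - 1) = G 0"
    using G[of 1] assms sum_R_bottom[of G D] by simp
  moreover have "g D = G 0"
    using G[of D] assms sum_R_top[of G D] by simp
  ultimately show ?thesis by simp
qed

text \<open>Take the sum \<open>D = 2\<close>. Modulo \<open>p\<close>, entry 1 of the second
  condition gives \<open>2 * g 2 = (N + 3) * g 1\<close>, while \<open>coc_b_determined\<close>
  gives \<open>g 2 = (N + 2) * g 1\<close>; the difference is
  \<open>(N + 1) * g 1 = 0\<close>.\<close>

lemma coc_b_first:
  assumes g: "coc_b N g" and g1: "g 1 \<noteq> 0" and N: "2 * (p - 1) \<le> N"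
  shows "p dvd N + 1"
proof -
  obtain E where E: "\<And>a. 1 \<le> a \<Longrightarrow> a < 2 \<Longrightarrow>
        g 2 * bin 2 a - g a * bin (N + 1 - 2 * (p - 1)) (2 - a) = (\<Sum>m=1..2. E m * R 2 m a)"
    using coc_b_lamD[OF g, of 2] N by auto
  have "g 2 * of_nat 2 = g 1 * of_nat (N + 1 - 2 * (p - 1))"
    using E[of 1] unfolding sum_R_one by simp
  moreover have "g 2 = g 1 * of_nat (N - 2 * (p - 1))"
    using coc_b_determined[OF g, of 2] N by simp
  moreover have "N + 1 - 2 * (p - 1) = N - 2 * (p - 1) + 1" using N by simp
  ultimately have "g 1 * (of_nat (N - 2 * (p - 1)) * of_nat 2 - of_nat (N - 2 * (p - 1)) - 1) = 0"
    by (simp add: algebra_simps)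
  then have "of_nat (N - 2 * (p - 1)) * of_nat 2 - of_nat (N - 2 * (p - 1)) - 1 = (0 :: 'k)"
    using g1 by simp
  moreover have "(of_nat (N - 2 * (p - 1)) :: 'k) = of_nat N + of_nat 2"
    using of_nat_shift[OF N] .
  ultimately have "of_nat (N + 1) = (0 :: 'k)"
    by (simp add: algebra_simps)
  then show ?thesis by (simp only: of_nat_eq_0)
qed

text \<open>By Pascal's rule the formula of \<open>coc_b_determined\<close> reads
  \<open>g a = g 1 * (bd (N + 1) a - bd N a)\<close>. Combining this with the cocycle conditions of
  the two coboundaries leaves a condition on \<open>bd N\<close> alone, whose first nonzero entry is
  known from \<open>bd_lead\<close>.\<close>

lemma coc_b_bd:
  assumes g: "coc_b N g" and g1: "g 1 \<noteq> 0" and D: "D * (p - 1) \<le> N"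
  shows "\<exists>E. \<forall>a. 1 \<le> a \<longrightarrow> a < D \<longrightarrow>
    bd N a * bin (N - D * (p - 1)) (D - a - 1) = (\<Sum>m=1..D. E m * R D m a)"
proof (cases "1 \<le> D")
  case True
  define T where "T = N - D * (p - 1)"
  have T1: "N + 1 - D * (p - 1) = T + 1" using D by (simp add: T_def)
  obtain E where E: "\<And>a. 1 \<le> a \<Longrightarrow> a < D \<Longrightarrow>
        g D * bin D a - g a * bin (T + 1) (D - a) = (\<Sum>m=1..D. E m * R D m a)"
    using coc_b_lamD[OF g True D] unfolding T1 by blast
  obtain E1 where E1: "\<And>a. 1 \<le> a \<Longrightarrow> a < D \<Longrightarrow>
        bd (N + 1) D * bin D a - bd (N + 1) a * bin (T + 1) (D - a) = (\<Sum>m=1..D. E1 m * R D m a)"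
    using cocD[OF bd_coc[of "N + 1"] trans_le_add1[OF D]] unfolding T1 by blast
  obtain E2 where E2: "\<And>a. 1 \<le> a \<Longrightarrow> a < D \<Longrightarrow>
        bd N D * bin D a - bd N a * bin T (D - a) = (\<Sum>m=1..D. E2 m * R D m a)"
    using cocD[OF bd_coc[of N] D] unfolding T_def by blast
  have ga: "g a = g 1 * (bd (N + 1) a - bd N a)" if "1 \<le> a" "a \<le> D" for a
  proof -
    have a: "a * (p - 1) \<le> N" using D that(2) by (meson le_trans mult_le_mono1)
    then have "N + 1 - a * (p - 1) = Suc (N - a * (p - 1))" by simp
    moreover have "Suc (N - a * (p - 1)) choose a = (N - a * (p - 1) choose (a - 1)) + (N - a * (p - 1) choose a)"
      using that(1) by (cases a) simp_all
    ultimately show ?thesis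
      using coc_b_determined[OF g that(1) a] by (simp add: bd_def)
  qed
  note gD = ga[OF True order.refl]
  show ?thesis
  proof (intro exI allI impI)
    fix a assume a: "1 \<le> a" "a < D"
    have pascal: "bin (T + 1) (D - a) = bin T (D - a) + bin T (D - a - 1)"
      using a by (cases "D - a") simp_all
    have "g 1 * (bd N a * bin T (D - a - 1)) =
      (g D * bin D a - g a * bin (T + 1) (D - a))
      - g 1 * (bd (N + 1) D * bin D a - bd (N + 1) a * bin (T + 1) (D - a))
      + g 1 * (bd N D * bin D a - bd N a * bin T (D - a))"
      unfolding gD ga[OF a(1) less_imp_le[OF a(2)]] pascal by (simp only: algebra_simps)
    also have "\<dots> = (\<Sum>m=1..D. (E m - g 1 * E1 m + g 1 * E2 m) * R D m a)"
      unfolding E[OF a] E1[OF a] E2[OF a]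
      by (simp add: sum_distrib_left sum.distrib sum_subtractf algebra_simps)
    finally have "bd N a * bin T (D - a - 1) = (\<Sum>m=1..D. (E m - g 1 * E1 m + g 1 * E2 m) * R D m a) / g 1"
      using g1 by (simp add: field_simps)
    also have "\<dots> = (\<Sum>m=1..D. (\<lambda>m. (E m - g 1 * E1 m + g 1 * E2 m) / g 1) m * R D m a)"
      by (simp add: sum_divide_distrib)
    finally show "bd N a * bin (N - D * (p - 1)) (D - a - 1) = \<dots>" by (simp add: T_def)
  qed
qed auto

end

section \<open>The total degrees in which cocycles can occur\<close>

context odd_char
begin

text \<open>A row with \<open>(p + 1) * m \<le> q + 1\<close> that meets entry \<open>q\<close> has
  \<open>p * m < q\<close>, because \<open>p * m = q\<close> forces \<open>m = 1\<close> and
  \<open>q = p\<close>; its multiplier vanishes by \<open>R_coeff_eq_0\<close>. For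
  \<open>q = p\<close> this breaks down, as \<open>R (p + 1) 1\<close> is 1 at entry
  \<open>p\<close>.\<close>

lemma R_sum_next_zero:
  assumes v: "\<And>a. 1 \<le> a \<Longrightarrow> a < q + 1 \<Longrightarrow> v a = (\<Sum>m=1..q + 1. E m * R (q + 1) m a)"
    and v0: "\<And>a. 1 \<le> a \<Longrightarrow> a < q \<Longrightarrow> v a = 0" and q: "p < q"
  shows "v q = 0"
proof -
  have "E m * R (q + 1) m q = 0" if m: "m \<in> {1..q + 1}" for m
  proof (cases "(p + 1) * m \<le> q + 1 \<and> p * m \<le> q")
    case True
    have "p * m < q"
    proof (rule ccontr)
      assume "\<not> ?thesis"
      with True have "p * m = q" by simp
      with True have "m \<le> 1" by simp
      with m have "m = 1" by simp
      with \<open>p * m = q\<close> q show False by simp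
    qed
    then have "E m = 0"
      using R_coeff_eq_0[of "q + 1" v E q m] v v0 m True by simp
    then show ?thesis by simp
  qed (auto simp: R_def)
  then have "(\<Sum>m=1..q + 1. E m * R (q + 1) m q) = 0" by (rule sum.neutral[rule_format])
  then show ?thesis using v[of q] q by simp
qed

lemma sum_R_single:
  assumes "p \<le> D" "D < 2 * p + 2"
  shows "(\<Sum>m=1..D. E m * R D m a) = E 1 * R D 1 a"
proof (rule sum_eq_single)
  show "1 \<in> {1..D}" using assms p_ge_3 by simp
  fix m assume "m \<in> {1..D}" "m \<noteq> 1"
  then have "(p + 1) * 2 \<le> (p + 1) * m" by (intro mult_le_mono2) auto
  then show "E m * R D m a = 0" using assms by (simp add: R_def)
qed simp

text \<open>For \<open>2 * (p - 1) \<le> N\<close> write \<open>N + 1 = p^j * u\<close> with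
  \<open>p\<close> not dividing \<open>u\<close>; then \<open>j \<ge> 1\<close> by
  \<open>coc_b_first\<close>. If \<open>u > p\<close>, the first nonzero entry of
  \<open>bd N\<close> is at \<open>p^j\<close>, which contradicts \<open>coc_b_bd\<close> for a sum
  just above \<open>p^j\<close>. There remain \<open>u < p\<close> and the small
  \<open>N\<close>.\<close>

lemma coc_b_range:
  assumes g: "coc_b N g" and g1: "g 1 \<noteq> 0" and N: "p - 1 \<le> N"
  shows "N + 1 \<le> 2 * p - 2 \<or> (\<exists>k i. N + 1 = k * p ^ i \<and> 1 \<le> k \<and> k \<le> p - 1 \<and> 1 \<le> i)"
proof (cases "2 * (p - 1) \<le> N")
  case True
  have dvd: "p dvd N + 1" by (rule coc_b_first[OF g g1 True])
  obtain j u where ju: "N + 1 = p ^ j * u" "\<not> p dvd u" using p_part[of "N + 1"] by auto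
  have j: "1 \<le> j"
  proof (rule ccontr)
    assume "\<not> ?thesis"
    then have "j = 0" by simp
    then show False using ju dvd by simp
  qed
  have "u \<noteq> p" using ju(2) by auto
  moreover have "\<not> p < u"
  proof
    assume u: "p < u"
    define q where "q = p ^ j"
    have lead: "\<And>a. 1 \<le> a \<Longrightarrow> a < q \<Longrightarrow> bd N a = 0" "bd N q = of_nat u"
      using bd_lead[OF ju(1) u ju(2)] by (auto simp: q_def)
    have u0: "(of_nat u :: 'k) \<noteq> 0" using ju(2) by (simp add: of_nat_eq_0)
    have qp: "p \<le> q" unfolding q_def using j p_ge_3 by (simp add: self_le_power)
    obtain t where p: "p = t + 1" using p_ge_3 by (metis le_add_diff_inverse2 le_trans one_le_numeral)
    have "q * (p + 1) \<le> q * u" using u by (intro mult_le_mono2) simp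
    then have "q * (p + 1) \<le> N + 1" using ju by (simp add: q_def)
    then have Nq: "q * t + 2 * q \<le> N + 1" unfolding p by (simp add: algebra_simps)
    show False
    proof (cases "q = p")
      case False
      then have pq: "p < q" using qp by simp
      have "(q + 1) * (p - 1) \<le> N" using Nq pq unfolding p by simp
      then obtain E where E: "\<And>a. 1 \<le> a \<Longrightarrow> a < q + 1 \<Longrightarrow>
          bd N a * bin (N - (q + 1) * (p - 1)) (q + 1 - a - 1) = (\<Sum>m=1..q + 1. E m * R (q + 1) m a)"
        using coc_b_bd[OF g g1] by blast
      have "bd N q * bin (N - (q + 1) * (p - 1)) (q + 1 - q - 1) = 0"
        by (rule R_sum_next_zero[OF E _ pq]) (simp_all add: lead)
      then show False using u0 lead by simp
    next
      case True
      \<comment> \<open>For \<open>q = p\<close> the sum \<open>p + 1\<close> says nothing. For the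
        sum \<open>p + 2\<close> the single row \<open>R (p + 2) 1\<close> is 1 at both
        \<open>p\<close> and \<open>p + 1\<close>, while \<open>bd N (p + 1) = 0\<close>.\<close>
      have D: "(p + 2) * (p - 1) \<le> N" using Nq True unfolding p by simp
      then obtain E where E: "\<And>a. 1 \<le> a \<Longrightarrow> a < p + 2 \<Longrightarrow>
          bd N a * bin (N - (p + 2) * (p - 1)) (p + 2 - a - 1) = (\<Sum>m=1..p + 2. E m * R (p + 2) m a)"
        using coc_b_bd[OF g g1] by blast
      have s: "(\<Sum>m=1..p + 2. E m * R (p + 2) m a) = E 1 * R (p + 2) 1 a" for a
        using p_ge_3 by (intro sum_R_single) auto
      have N1: "(of_nat N :: 'k) + 1 = 0" using dvd of_nat_eq_0[of "N + 1"] by (simp add: add.commute)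
      obtain M where "N + 1 = p * M" using dvd ..
      moreover from this have "M \<noteq> 0" by (cases "M = 0") auto
      ultimately obtain M' where "N + 1 = p * (M' + 1)" by (metis Suc_eq_plus1 not0_implies_Suc)
      then have NM: "N = p * M' + (p - 1)" using p_ge_3 by (simp only: distrib_left)
      have "bd N p * of_nat (N - (p + 2) * (p - 1)) = E 1"
        using E[of p] p_ge_3 unfolding s by (simp add: R_def)
      moreover have "bd N (p + 1) = E 1"
        using E[of "p + 1"] p_ge_3 unfolding s by (simp add: R_def)
      moreover have "bd N (p + 1) = 0"
        unfolding NM using not_dvd_mult_plus1[of 1] by (intro bd_not_dvd) simp
      moreover have "(of_nat (N - (p + 2) * (p - 1)) :: 'k) = 1"
        unfolding of_nat_shift[OF D] using N1 by (simp add: algebra_simps)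
      ultimately show False using lead u0 True by simp
    qed
  qed
  ultimately have "u \<le> p - 1" by linarith
  moreover have "1 \<le> u" using ju by (cases u) auto
  ultimately show ?thesis using ju j by (metis mult.commute)
next
  case False
  then have "N + 1 \<le> 2 * p - 2" by simp
  then show ?thesis ..
qed

text \<open>Entry 1 of the condition for \<open>D\<close>, which no row meets.\<close>

lemma coc_low:
  assumes "coc N c" "2 \<le> D" "D * (p - 1) \<le> N"
  shows "c D * of_nat D = c 1 * bin (N - D * (p - 1)) (D - 1)"
proof -
  obtain E where "\<And>a. 1 \<le> a \<Longrightarrow> a < D \<Longrightarrow>
    c D * bin D a - c a * bin (N - D * (p - 1)) (D - a) = (\<Sum>m=1..D. E m * R D m a)"
    using cocD[OF assms(1,3)] by blast
  from this[of 1] show ?thesis using assms(2) unfolding sum_R_one by simp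
qed

lemma coc_support:
  assumes "coc N c" "c 1 = 0" "1 \<le> D" "D * (p - 1) \<le> N" "\<not> p dvd D"
  shows "c D = 0"
proof (cases "D = 1")
  case True
  then show ?thesis using assms(2) by simp
next
  case False
  then show ?thesis
    using coc_low[OF assms(1), of D] assms by (simp add: of_nat_eq_0)
qed

text \<open>Undoes P^0: \<open>c\<close> is supported on the multiples of \<open>p\<close> by
  \<open>coc_support\<close>, and Lucas turns the conditions for \<open>p * D\<close> into those for
  \<open>D\<close>.\<close>

lemma coc_descent:
  assumes c: "coc (p * N + (p - 1)) c" and c1: "c 1 = 0"
  shows "coc N (\<lambda>a. c (p * a))"
  unfolding coc_def
proof (intro allI impI)
  fix D assume D: "D * (p - 1) \<le> N"
  then obtain T where N: "N = T + D * (p - 1)" by (metis le_add_diff_inverse2)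
  have "p * N = p * T + p * D * (p - 1)"
    unfolding N by (simp only: distrib_left mult.assoc)
  then have T: "p * N + (p - 1) - p * D * (p - 1) = p * T + (p - 1)" and
    D': "p * D * (p - 1) \<le> p * N + (p - 1)" by simp_all
  define v where "v a = c (p * D) * bin (p * D) a - c a * bin (p * T + (p - 1)) (p * D - a)" for a
  obtain E where E: "\<And>a. 1 \<le> a \<Longrightarrow> a < p * D \<Longrightarrow> v a = (\<Sum>m=1..p * D. E m * R (p * D) m a)"
    using cocD[OF c D'] unfolding T v_def by blast
  have v0: "v a = 0" if "1 \<le> a" "a < p * D" "\<not> p dvd a" for a
  proof -
    have "a * (p - 1) \<le> p * D * (p - 1)" using that(2) by (intro mult_le_mono1) simp
    also note D'
    finally show ?thesis
      using coc_support[OF c c1 that(1) _ that(3)] that by (simp add: v_def bin_mult_p)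
  qed
  have "v (p * a) = c (p * D) * bin D a - c (p * a) * bin T (D - a)" for a
    using lucas_r0[of "p - 1" T "D - a"] p_ge_3
    by (simp add: v_def lucas_0 diff_mult_distrib2[symmetric])
  then show "\<exists>E. \<forall>a. 1 \<le> a \<longrightarrow> a < D \<longrightarrow>
     c (p * D) * bin D a - c (p * a) * bin (N - D * (p - 1)) (D - a) = (\<Sum>m=1..D. E m * R D m a)"
    using descent[OF E v0] by (simp add: N)
qed

text \<open>The hypothesis says that the differential of \<open>lam q\<close> is a combination of
  relations, so that \<open>lam q\<close> is a cycle. Entry 1 gives \<open>p dvd q\<close>, and
  \<open>descent\<close> passes to \<open>q div p\<close>.\<close>

lemma prime_power_of_primitive:
  assumes "\<And>a. 1 \<le> a \<Longrightarrow> a < q \<Longrightarrow> bin q a = (\<Sum>m=1..q. E m * R q m a)" "1 \<le> q"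
  shows "\<exists>j. q = p ^ j"
  using assms
proof (induction q arbitrary: E rule: less_induct)
  case (less q)
  show ?case
  proof (cases "q = 1")
    case True
    then show ?thesis by (intro exI[of _ 0]) simp
  next
    case False
    then have "bin q 1 = 0"
      using less.prems(1)[of 1] less.prems(2) unfolding sum_R_one by simp
    then have "p dvd q" by (simp add: of_nat_eq_0)
    then obtain q' where q: "q = p * q'" ..
    have q1: "1 \<le> q'" using less.prems(2) unfolding q by (cases "q' = 0") auto
    then have "q' < q" using p_ge_3 unfolding q by simp
    moreover have "\<exists>E. \<forall>a. 1 \<le> a \<longrightarrow> a < q' \<longrightarrow> bin q (p * a) = (\<Sum>m=1..q'. E m * R q' m a)"
      by (rule descent[of q' "bin q" E]) (use less.prems(1) in \<open>auto simp: q bin_mult_p\<close>)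
    then obtain E' where "\<And>a. 1 \<le> a \<Longrightarrow> a < q' \<Longrightarrow> bin q' a = (\<Sum>m=1..q'. E' m * R q' m a)"
      unfolding q lucas_0 by blast
    ultimately obtain j where "q' = p ^ j" using less.IH q1 by blast
    then show ?thesis unfolding q by (intro exI[of _ "Suc j"]) simp
  qed
qed

text \<open>Both conclusions test the first nonzero entry \<open>q\<close>. For
  \<open>D = q + 1\<close> its factor is \<open>N + q + 1\<close>, which is \<open>N + 1\<close>
  modulo \<open>p\<close> and so nonzero, and the test fails; hence this sum is out of range. For
  \<open>D = q\<close> the condition makes \<open>lam q\<close> a cycle. The assumption
  \<open>cp\<close> excludes \<open>q = p\<close>, where the first test gives nothing.\<close>

lemma coc_lead:
  assumes c: "coc N c" and N: "\<not> p dvd N + 1" and c1: "c 1 = 0" and cp: "p * (p - 1) \<le> N \<Longrightarrow> c p = 0"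
    and q: "1 \<le> q" "q * (p - 1) \<le> N" "c q \<noteq> 0" and min: "\<And>a. 1 \<le> a \<Longrightarrow> a < q \<Longrightarrow> c a = 0"
  shows "N < (q + 1) * (p - 1) \<and> (\<exists>j\<ge>2. q = p ^ j)"
proof
  have dvd: "p dvd q" using coc_support[OF c c1 q(1,2)] q(3) by blast
  then have "p \<le> q" using q(1) by (intro dvd_imp_le) auto
  moreover have "p \<noteq> q" using cp q(2,3) by blast
  ultimately have pq: "p < q" by simp
  obtain k where "q = p * k" using dvd ..
  then have ndvd: "\<not> p dvd q + 1" using not_dvd_mult_plus1[of k] by simp
  show "N < (q + 1) * (p - 1)"
  proof (rule ccontr)
    assume "\<not> ?thesis"
    then have D: "(q + 1) * (p - 1) \<le> N" by simp
    have c0: "c (q + 1) = 0" by (rule coc_support[OF c c1 _ D ndvd]) simp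
    obtain E where E: "\<And>a. 1 \<le> a \<Longrightarrow> a < q + 1 \<Longrightarrow>
      c (q + 1) * bin (q + 1) a - c a * bin (N - (q + 1) * (p - 1)) (q + 1 - a) =
      (\<Sum>m=1..q + 1. E m * R (q + 1) m a)"
      using cocD[OF c D] by blast
    have "c (q + 1) * bin (q + 1) q - c q * bin (N - (q + 1) * (p - 1)) (q + 1 - q) = 0"
      by (rule R_sum_next_zero[OF E _ pq]) (simp_all add: c0[simplified] min)
    then have "(of_nat (N - (q + 1) * (p - 1)) :: 'k) = 0" using c0 q(3) by simp
    then have "of_nat (N + 1) + of_nat q = (0 :: 'k)"
      unfolding of_nat_shift[OF D] by (simp add: algebra_simps)
    moreover have "of_nat q = (0 :: 'k)" using dvd by (simp add: of_nat_eq_0)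
    ultimately have "of_nat (N + 1) = (0 :: 'k)" by simp
    then show False using N by (simp only: of_nat_eq_0)
  qed
  obtain E where E: "\<And>a. 1 \<le> a \<Longrightarrow> a < q \<Longrightarrow>
      c q * bin q a - c a * bin (N - q * (p - 1)) (q - a) = (\<Sum>m=1..q. E m * R q m a)"
    using cocD[OF c q(2)] by blast
  have "bin q a = (\<Sum>m=1..q. (E m / c q) * R q m a)" if a: "1 \<le> a" "a < q" for a
  proof -
    have "c q * bin q a = (\<Sum>m=1..q. E m * R q m a)" using E[OF a] min[OF a] by simp
    then have "bin q a = (\<Sum>m=1..q. E m * R q m a) / c q" using q(3) by (simp add: field_simps)
    then show ?thesis by (simp add: sum_divide_distrib)
  qed
  then have "\<exists>j. q = p ^ j"
    using q(1) by (rule prime_power_of_primitive)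
  then obtain j where j: "q = p ^ j" ..
  have "j \<noteq> 0" using j pq p_ge_3 by (cases "j = 0") auto
  moreover have "j \<noteq> 1" using j pq by (cases "j = 1") auto
  ultimately show "\<exists>j\<ge>2. q = p ^ j" using j by (intro exI[of _ j]) auto
qed

text \<open>For \<open>D = p + 2\<close> the entries \<open>p + 1\<close> and \<open>p\<close> give
  \<open>bin T 2 = 0\<close> with \<open>T = N + 2\<close> modulo \<open>p\<close>, so
  \<open>p dvd N + 2\<close>. Writing \<open>N = p * (L + 1) + (p - 2)\<close>, the vector
  \<open>\<lambda>a. c (p * a)\<close> satisfies \<open>coc_b L\<close>, and the two alternatives
  are those of \<open>coc_b_range\<close> for \<open>L\<close>.\<close>

lemma coc_lead_p:
  assumes c: "coc N c" and N: "\<not> p dvd N + 1" and c1: "c 1 = 0" and cp: "c p \<noteq> 0"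
    and D0: "(p + 2) * (p - 1) \<le> N"
  shows "(\<exists>k. 1 \<le> k \<and> k \<le> p - 1 \<and> N + 1 = p * p + k * p - 1) \<or>
    (\<exists>k m. 1 \<le> k \<and> k \<le> p - 1 \<and> 2 \<le> m \<and> N + 1 = k * p ^ m + (p - 1))"
proof -
  have "\<not> p dvd p + 2"
  proof
    assume "p dvd p + 2"
    then have "p dvd 2" by (metis dvd_add_triv_left_iff)
    then show False using p_ge_3 by (auto dest: dvd_imp_le)
  qed
  then have coeff2: "c (p + 2) = 0" using coc_support[OF c c1 _ D0] by simp
  have "(p + 1) * (p - 1) \<le> (p + 2) * (p - 1)" by (intro mult_le_mono1) simp
  then have "(p + 1) * (p - 1) \<le> N" using D0 by (rule le_trans)
  then have c1': "c (p + 1) = 0" using coc_support[OF c c1, of "p + 1"] not_dvd_mult_plus1[of 1] by simp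
  define T where "T = N - (p + 2) * (p - 1)"
  obtain E where E: "\<And>a. 1 \<le> a \<Longrightarrow> a < p + 2 \<Longrightarrow>
    c (p + 2) * bin (p + 2) a - c a * bin T (p + 2 - a) = (\<Sum>m=1..p + 2. E m * R (p + 2) m a)"
    using cocD[OF c D0] unfolding T_def by blast
  have s: "(\<Sum>m=1..p + 2. E m * R (p + 2) m a) = E 1 * R (p + 2) 1 a" for a
    using p_ge_3 by (intro sum_R_single) auto
  have "E 1 = 0"
    using E[of "p + 1"] p_ge_3 unfolding s by (simp add: R_def coeff2[simplified] c1'[simplified])
  moreover have "- (c p * bin T 2) = E 1"
    using E[of p] p_ge_3 unfolding s by (simp add: R_def coeff2[simplified])
  ultimately have "bin T 2 = 0" using cp by simp
  moreover have "2 * (T choose 2) = T * (T - 1)"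
    by (cases T) (simp_all add: choose_two)
  ultimately have "of_nat (T * (T - 1)) = (0 :: 'k)"
    by (metis mult_zero_right of_nat_mult)
  then have "p dvd T * (T - 1)" by (simp only: of_nat_eq_0)
  then have "p dvd T \<or> p dvd T - 1" using prime_p by (simp add: prime_dvd_mult_iff)
  moreover have TN: "(of_nat T :: 'k) = of_nat N + 2"
    unfolding T_def of_nat_shift[OF D0] by simp
  moreover have "\<not> (p dvd T - 1 \<and> 1 \<le> T)"
  proof
    assume T: "p dvd T - 1 \<and> 1 \<le> T"
    then have "of_nat (T - 1) = (0 :: 'k)" by (simp only: of_nat_eq_0)
    moreover have "(of_nat T :: 'k) = of_nat (T - 1) + 1" using T by (simp add: of_nat_diff)
    ultimately have "of_nat N + 2 = (1 :: 'k)" using TN by simp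
    then have "of_nat N + 2 - 1 = (1 - 1 :: 'k)" by (simp only:)
    then have "of_nat (N + 1) = (0 :: 'k)" by simp
    then show False using N by (simp only: of_nat_eq_0)
  qed
  ultimately have "p dvd T" by (cases "T = 0") auto
  then have "of_nat (N + 2) = (0 :: 'k)" using TN of_nat_eq_0[of T] by (simp add: algebra_simps)
  then have "p dvd N + 2" by (simp only: of_nat_eq_0)
  then obtain M0 where "N + 2 = p * M0" ..
  moreover from this have "M0 \<noteq> 0" by (cases "M0 = 0") auto
  ultimately obtain M where M: "N + 2 = p * (M + 1)" by (metis Suc_eq_plus1 not0_implies_Suc)
  then have NM: "N = p * M + (p - 2)" using p_ge_3 by (simp only: distrib_left)
  obtain t where p: "p = t + 1" using p_ge_3 by (metis le_add_diff_inverse2 le_trans one_le_numeral)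
  have "p \<le> M"
  proof (rule ccontr)
    assume "\<not> ?thesis"
    then have "p * (M + 1) \<le> p * p" by (intro mult_le_mono2) simp
    then have "N + 2 \<le> p * p" using M by simp
    moreover have "p * p = (p + 2) * (p - 1) + 2 - p" unfolding p by (simp add: algebra_simps)
    ultimately show False using D0 p_ge_3 by linarith
  qed
  then obtain L where L: "M = L + 1" using p_ge_3 by (metis le_add_diff_inverse2 le_trans one_le_numeral)
  have Lp: "p - 1 \<le> L" using \<open>p \<le> M\<close> L by simp
  \<comment> \<open>The sums \<open>p * D + 1\<close> give the condition with shifted rows by
    \<open>descent_shift\<close>, the sums \<open>p * D\<close> give the other one by
    \<open>descent\<close>.\<close>
  have "coc_b L (\<lambda>a. c (p * a))"
    unfolding coc_b_def
  proof (intro allI impI conjI)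
    fix D assume D: "1 \<le> D" "D * (p - 1) \<le> L"
    then obtain S where S: "L = S + D * (p - 1)" by (metis le_add_diff_inverse2)
    have pM: "p * M = p * S + p * D * (p - 1) + p"
      unfolding L S by (simp only: distrib_left mult.assoc mult_1_right)
    have "N = (p * S + p + (p - 2)) + p * D * (p - 1)"
      unfolding NM pM by linarith
    then have N0: "N - p * D * (p - 1) = p * (S + 1) + (p - 2)" "p * D * (p - 1) \<le> N"
      by simp_all
    have "(p * D + 1) * (p - 1) = p * D * (p - 1) + (p - 1)"
      by (simp only: distrib_right mult_1)
    moreover have "N = (p * S + (p - 1)) + (p * D * (p - 1) + (p - 1))"
      unfolding NM pM using p_ge_3 by linarith
    ultimately have N1: "N - (p * D + 1) * (p - 1) = p * S + (p - 1)" "(p * D + 1) * (p - 1) \<le> N"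
      by simp_all
    show "\<exists>G. \<forall>a. 1 \<le> a \<longrightarrow> a \<le> D \<longrightarrow>
      c (p * a) * bin (L - D * (p - 1)) (D - a) = (\<Sum>m\<le>D. G m * R (D - 1) m (a - 1))"
    proof -
      have c0: "c (p * D + 1) = 0"
        by (rule coc_support[OF c c1 _ N1(2) not_dvd_mult_plus1]) simp
      define v where "v a = - (c a * bin (p * S + (p - 1)) (p * D + 1 - a))" for a
      obtain E where E: "\<And>a. 1 \<le> a \<Longrightarrow> a < p * D + 1 \<Longrightarrow> v a = (\<Sum>m=1..p * D + 1. E m * R (p * D + 1) m a)"
        using cocD[OF c N1(2)] unfolding N1(1) c0 v_def by auto
      have v0: "v a = 0" if "1 \<le> a" "a \<le> p * D" "\<not> p dvd a" for a
      proof -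
        have "a * (p - 1) \<le> (p * D) * (p - 1)" using that(2) by (rule mult_le_mono1)
        then have "a * (p - 1) \<le> N" using N0(2) by (rule le_trans)
        then show ?thesis using coc_support[OF c c1 that(1) _ that(3)] by (simp add: v_def)
      qed
      have "v (p * a) = c (p * a) * bin S (D - a)" if "a \<le> D" for a
      proof -
        have "p * a \<le> p * D" using that by simp
        then have "p * D + 1 - p * a = p * (D - a) + 1" by (simp only: diff_mult_distrib2)
        \<comment> \<open>The last digits contribute \<open>bin (p - 1) 1 = -1\<close>, which
          cancels the sign in \<open>v\<close>.\<close>
        then have "bin (p * S + (p - 1)) (p * D + 1 - p * a) = bin S (D - a) * of_nat (p - 1)"
          using lucas[of "p - 1" 1 S "D - a"] p_ge_3 by simp
        then show ?thesis using of_nat_p_minus[of 1] p_ge_3 by (simp add: v_def)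
      qed
      moreover have "\<exists>G. \<forall>a. 1 \<le> a \<longrightarrow> a \<le> D \<longrightarrow> v (p * a) = (\<Sum>l\<le>D. G l * R (D - 1) l (a - 1))"
        by (rule descent_shift[OF E v0 D(1)]) auto
      ultimately show ?thesis by (auto simp: S)
    qed
    show "\<exists>E. \<forall>a. 1 \<le> a \<longrightarrow> a < D \<longrightarrow>
        c (p * D) * bin D a - c (p * a) * bin (L + 1 - D * (p - 1)) (D - a) = (\<Sum>m=1..D. E m * R D m a)"
    proof -
      define v where "v a = c (p * D) * bin (p * D) a - c a * bin (p * (S + 1) + (p - 2)) (p * D - a)" for a
      obtain E where E: "\<And>a. 1 \<le> a \<Longrightarrow> a < p * D \<Longrightarrow> v a = (\<Sum>m=1..p * D. E m * R (p * D) m a)"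
        using cocD[OF c N0(2)] unfolding N0(1) v_def by auto
      have v0: "v a = 0" if "1 \<le> a" "a < p * D" "\<not> p dvd a" for a
      proof -
        have "a * (p - 1) \<le> (p * D) * (p - 1)" using that(2) by (intro mult_le_mono1) simp
        then have "a * (p - 1) \<le> N" using N0(2) by (rule le_trans)
        then show ?thesis using coc_support[OF c c1 that(1) _ that(3)] that
          by (simp add: v_def bin_mult_p)
      qed
      have "v (p * a) = c (p * D) * bin D a - c (p * a) * bin (S + 1) (D - a)" for a
        using lucas_r0[of "p - 2" "S + 1" "D - a"] p_ge_3
        by (simp add: v_def lucas_0 diff_mult_distrib2[symmetric])
      then show ?thesis using descent[OF E v0] by (simp add: S)
    qed
  qed
  then have "L + 1 \<le> 2 * p - 2 \<or> (\<exists>k i. L + 1 = k * p ^ i \<and> 1 \<le> k \<and> k \<le> p - 1 \<and> 1 \<le> i)"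
    using cp Lp coc_b_range[of L "\<lambda>a. c (p * a)"] by simp
  then show ?thesis
  proof
    assume "L + 1 \<le> 2 * p - 2"
    moreover obtain k where "M = p + k" using \<open>p \<le> M\<close> le_Suc_ex by blast
    ultimately have k: "M = p + k" "k \<le> p - 2" using L by simp_all
    have "N + 1 = p * p + (k + 1) * p - 1"
      unfolding NM k using p_ge_3 by (simp add: algebra_simps)
    then show ?thesis using k p_ge_3 by (intro disjI1 exI[of _ "k + 1"]) auto
  next
    assume "\<exists>k i. L + 1 = k * p ^ i \<and> 1 \<le> k \<and> k \<le> p - 1 \<and> 1 \<le> i"
    then obtain k i where ki: "L + 1 = k * p ^ i" "1 \<le> k" "k \<le> p - 1" "1 \<le> i" by blast
    have "N + 1 = k * p ^ (i + 1) + (p - 1)"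
    proof -
      have "p * (k * p ^ i) = k * p ^ (i + 1)" by simp
      then show ?thesis unfolding NM L ki(1) using p_ge_3 by linarith
    qed
    then show ?thesis using ki by (intro disjI2 exI[of _ k] exI[of _ "i + 1"]) auto
  qed
qed

text \<open>If \<open>p - 1 \<le> N\<close>, the sum \<open>D = p\<close> is in range. The binomial
  coefficient in entry 1 is 1 by Lucas, so the entry reads \<open>p * c p = c 1\<close>, and the
  left side is 0.\<close>

lemma coc_first:
  assumes c: "coc (p * N + (p - 1)) c" and c1: "c 1 \<noteq> 0"
  shows "N \<le> p - 2"
proof (rule ccontr)
  assume "\<not> ?thesis"
  then have "p - 1 \<le> N" by simp
  then obtain M where M: "N = M + (p - 1)" by (metis le_add_diff_inverse2)
  have "p * N + (p - 1) - p * (p - 1) = p * M + (p - 1)" "p * (p - 1) \<le> p * N + (p - 1)"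
    unfolding M by (simp_all add: distrib_left)
  then have "c p * of_nat p = c 1 * bin (p * M + (p - 1)) (p - 1)"
    using coc_low[OF c, of p] p_ge_3 by simp
  then show False using c1 lucas[of "p - 1" "p - 1" M 0] p_ge_3 by simp
qed

end

section \<open>The differential, products and $\mathcal{P}^0$ on cochains\<close>

text \<open>The differential of a generator is what the defining relation would be for
  \<open>m = 0\<close>, so \<open>free_d_relS\<close> also computes the square of the
  differential.\<close>

lemma free_d_flam_relS: "free_d (flam n :: 'p::prime_card free_alg) = relS 0 True True n 0"
  and free_d_fmu_relS: "free_d (fmu n :: 'p free_alg) = relS 0 True False n 0 - relS 0 False True n 0"
  by (simp_all add: relS_def free_d_flam free_d_fmu sum_subtractf right_diff_distrib)

lemma free_gen_conv: "free_gen (Lam n) = flam (n + 1)" "free_gen (Mu n) = fmu n"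
  by (simp_all add: free_gen_def flam_def fmu_def)

lemma free_gen_cases: "(\<And>n. P (flam n)) \<Longrightarrow> (\<And>n. P (fmu n)) \<Longrightarrow> P (free_gen g)"
  by (cases g) (simp_all add: free_gen_conv)

lemma free_d_d_gen: "free_d (free_d (free_gen g :: 'p::prime_card free_alg)) = 0"
proof (rule free_gen_cases[of "\<lambda>x. free_d (free_d x) = 0"])
  show "free_d (free_d (flam n :: 'p free_alg)) = 0" for n
    by (simp add: free_d_flam_relS free_d_relS pDr_def pDl_def)
  show "free_d (free_d (fmu n :: 'p free_alg)) = 0" for n
    by (simp add: free_d_fmu_relS free_d_relS free_d_additive pDr_def pDl_def)
qed

lemma free_d_sgn_gen: "free_d (free_sgn (free_gen g :: 'p::prime_card free_alg)) = - free_sgn (free_d (free_gen g))"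
proof (rule free_gen_cases[of "\<lambda>x. free_d (free_sgn x) = - free_sgn (free_d x)"])
  note sgn = free_sgn_fg[of True, simplified] free_sgn_fg[of False, simplified]
  show "free_d (free_sgn (flam n :: 'p free_alg)) = - free_sgn (free_d (flam n))" for n
    by (simp add: free_d_flam sgn free_d_additive free_sgn_additive free_sgn_mult free_sgn_of_nat)
  show "free_d (free_sgn (fmu n :: 'p free_alg)) = - free_sgn (free_d (fmu n))" for n
    by (simp add: free_d_fmu sgn free_sgn_additive free_sgn_mult free_sgn_of_nat)
       (simp add: sum_negf[symmetric] algebra_simps)
qed

lemma free_alg_induct [case_names zero one gen add scal]:
  fixes x :: "'p::prime_card free_alg"
  assumes "P 0" "P 1" "\<And>g x. P x \<Longrightarrow> P (free_gen g * x)" "\<And>x y. P x \<Longrightarrow> P y \<Longrightarrow> P (x + y)"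
    "\<And>c x. P x \<Longrightarrow> P (fscal c * x)"
  shows "P x"
proof (induction x rule: pm_induct)
  case (single w c)
  have "P (Poly_Mapping.single (Word v) 1)" for v
  proof (induction v)
    case Nil
    then show ?case using assms(2) by (simp flip: zero_lword_def)
  next
    case (Cons g v)
    have "Poly_Mapping.single (Word (g # v)) (1 :: 'p mod_ring) = free_gen g * Poly_Mapping.single (Word v) 1"
      using single_Word_append[of "[g]" v] by (simp add: free_gen_def)
    then show ?case using assms(3)[OF Cons] by simp
  qed
  from assms(5)[OF this[of "letters w"], of c] show ?case by (simp add: fscal_single)
qed (use assms in auto)

lemma free_d_1: "free_d 1 = 0"
  using free_d_single[of 0 1] by simp

lemma free_d_fscal: "free_d (fscal c * x) = fscal c * free_d x"
proof -
  have "free_d (fscal c) = 0" using free_d_single[of 0 c] by (simp add: fscal_def)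
  then show ?thesis by (simp add: free_d_mult free_sgn_fscal)
qed

lemma free_d_sgn: "free_d (free_sgn x) = - free_sgn (free_d x)"
proof (induction x rule: free_alg_induct)
  case (gen g x)
  then show ?case
    by (simp add: free_sgn_mult free_d_mult free_d_sgn_gen free_sgn_additive algebra_simps)
qed (simp_all add: free_sgn_additive free_d_additive free_d_1 free_sgn_mult free_d_fscal free_sgn_fscal)

lemma free_d_d: "free_d (free_d x) = 0"
proof (induction x rule: free_alg_induct)
  case (gen g x)
  then show ?case
    by (simp add: free_d_mult free_d_additive free_d_sgn free_d_d_gen)
qed (simp_all add: free_d_additive free_d_1 free_d_fscal)

lemma lam_d_d: "lam_d (lam_d a) = 0"
  by transfer (simp add: free_d_d lambda_ideal.zero)

lemma lam_sgn_mult: "lam_sgn (a * b) = lam_sgn a * lam_sgn b"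
  by transfer (simp add: free_sgn_mult lambda_ideal.zero)

lemma free_sgn_sgn: "free_sgn (free_sgn x) = x"
proof (induction x rule: pm_induct)
  case (single w c)
  show ?case by (simp add: free_sgn_single mult.assoc[symmetric] power_add[symmetric])
qed (simp_all add: free_sgn_additive)

lemma lam_sgn_sgn: "lam_sgn (lam_sgn a) = a"
  by transfer (simp add: free_sgn_sgn lambda_ideal.zero)

lemma lam_d_sgn: "lam_d (lam_sgn a) = - lam_sgn (lam_d a)"
  by transfer (simp add: free_d_sgn lambda_ideal.zero)

lemma free_P0_fscal: "free_P0 (fscal c) = fscal c"
  by (simp add: fscal_def free_P0_single zero_lword_def)

lemma free_P0_sgn: "free_P0 (free_sgn x) = free_sgn (free_P0 x)"
proof (induction x rule: free_alg_induct)
  case (gen g x)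
  have "free_P0 (free_sgn (free_gen g)) = free_sgn (free_P0 (free_gen g :: 'a free_alg))"
    by (cases g) (simp_all add: free_sgn_fg[of True, simplified] free_sgn_fg[of False, simplified] free_gen_conv free_P0_additive free_P0_flam free_P0_fmu free_sgn_additive)
  with gen show ?case by (simp add: free_P0_mult free_sgn_mult)
qed (simp_all add: free_P0_additive free_sgn_additive free_P0_1 free_P0_mult free_sgn_mult free_sgn_fscal free_P0_fscal)

lemma free_P0_d: "free_P0 (free_d x) = free_d (free_P0 x)"
proof (induction x rule: free_alg_induct)
  case (gen g x)
  have "free_P0 (free_d (free_gen g :: 'a free_alg)) = free_d (free_P0 (free_gen g))"
    by (cases g) (simp_all add: free_gen_conv free_P0_additive free_P0_flam free_P0_fmu
        free_d_flam_relS free_P0_lam_lam free_d_fmu free_P0_mult free_d_additive)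
  with gen show ?case
    by (simp add: free_P0_sgn free_P0_mult free_d_mult free_P0_additive)
qed (simp_all add: free_P0_additive free_d_additive free_P0_1 free_d_1 free_P0_mult free_P0_fscal free_d_fscal)

lemma lam_P0_d: "lam_P0 (lam_d a) = lam_d (lam_P0 a)"
  by transfer (simp add: free_P0_d lambda_ideal.zero)

lemma lam_P0_sgn: "lam_P0 (lam_sgn a) = lam_sgn (lam_P0 a)"
  by transfer (simp add: free_P0_sgn lambda_ideal.zero)

lemma lam_P0_mult: "lam_P0 (a * b) = lam_P0 a * lam_P0 b"
  by transfer (simp add: free_P0_mult lambda_ideal.zero)

lemma lam_P0_lscal: "lam_P0 (lscal c) = lscal c"
  by transfer (simp add: free_P0_fscal lambda_ideal.zero)

lemma lam_P0_lam: "lam_P0 (lam i :: 'p::prime_card lambda) = lam (CARD('p) * i)"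
  by transfer (simp add: free_P0_flam lambda_ideal.zero)

lemma lam_P0_mu: "lam_P0 (mu i) = 0"
  by transfer (simp add: free_P0_fmu lambda_ideal.zero)

lemma lam_sgn_lam: "lam_sgn (lam i) = - lam i"
  by transfer (simp add: free_sgn_fg[of True, simplified] lambda_ideal.zero)

lemma lam_sgn_mu: "lam_sgn (mu i) = mu i"
  by transfer (simp add: free_sgn_fg[of False, simplified] lambda_ideal.zero)

lemma lam_0 [simp]: "lam 0 = 0"
  by transfer (simp add: flam_def lambda_ideal.zero)

lemma lscal_of_nat: "lscal (of_nat n) = of_nat n"
  by (induction n) (simp_all add: lscal_simps)

lemma lookup_dual_act:
  assumes "finite {e. Poly_Mapping.lookup (\<theta> e) h \<noteq> 0}"
  shows "Poly_Mapping.lookup (dual_act h \<theta>) e = Poly_Mapping.lookup (\<theta> e) h"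
  unfolding dual_act_def using assms by (simp add: Abs_poly_mapping_inverse)

lemma P_sel:
  "mdeg P_module (Odd t) = 2 * t + 1" "mdeg P_module (Even t) = 2 * (t + 1)"
  "mbeta P_module (Odd t) = Poly_Mapping.single (Even t) 1" "mbeta P_module (Even t) = 0"
  "mpow (P_module :: (pbasis, 'p::prime_card) A_module) i (Odd t) =
     Poly_Mapping.single (Odd (t + i * (CARD('p) - 1))) (of_nat (t choose i))"
  "mpow (P_module :: (pbasis, 'p::prime_card) A_module) i (Even t) =
     Poly_Mapping.single (Even (t + i * (CARD('p) - 1))) (of_nat ((t + 1) choose i))"
  by (simp_all add: P_module_def)

lemma lin_ext_single:
  fixes f :: "'b \<Rightarrow> 'c \<Rightarrow>\<^sub>0 'p::prime_card mod_ring"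
  shows "lin_ext f (Poly_Mapping.single e c) = Poly_Mapping.map ((*) c) (f e)"
proof -
  have "Poly_Mapping.map ((*) 0) v = 0" for v :: "'c \<Rightarrow>\<^sub>0 'p mod_ring"
    by (rule poly_mapping_eqI) (simp add: lookup_map_zero)
  then show ?thesis unfolding lin_ext_def by (intro pm_ext_single)
qed

lemma map_single: "Poly_Mapping.map ((*) c) (Poly_Mapping.single e d) = Poly_Mapping.single e (c * d)"
  for c :: "'p::prime_card mod_ring"
  by (rule poly_mapping_eqI) (auto simp: lookup_map_zero lookup_single when_def)

lemma map_0: "Poly_Mapping.map ((*) c) 0 = (0 :: _ \<Rightarrow>\<^sub>0 'p::prime_card mod_ring)"
  by (rule poly_mapping_eqI) (simp add: lookup_map_zero)

lemma beta_pow: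
  "lin_ext (mbeta P_module) (mpow (P_module :: (pbasis, 'p::prime_card) A_module) i (Odd t)) =
     Poly_Mapping.single (Even (t + i * (CARD('p) - 1))) (of_nat (t choose i))"
  "lin_ext (mbeta P_module) (mpow (P_module :: (pbasis, 'p::prime_card) A_module) i (Even t)) = 0"
  by (simp_all add: P_sel lin_ext_single map_single map_0)

lemma finite_pow:
  "finite {e. Poly_Mapping.lookup (mpow (P_module :: (pbasis, 'p::prime_card) A_module) i e) h \<noteq> 0}"
  "finite {e. Poly_Mapping.lookup (lin_ext (mbeta P_module) (mpow (P_module :: (pbasis, 'p::prime_card) A_module) i e)) h \<noteq> 0}"
proof -
  define n where "n = (case h of Odd t \<Rightarrow> t | Even t \<Rightarrow> t)"
  have fin: "finite (Odd ` {..n} \<union> Even ` {..n})" by simp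
  have mem: "e \<in> Odd ` {..n} \<union> Even ` {..n}"
    if "Poly_Mapping.lookup (mpow (P_module :: (pbasis, 'p) A_module) i e) h \<noteq> 0 \<or>
      Poly_Mapping.lookup (lin_ext (mbeta P_module) (mpow (P_module :: (pbasis, 'p) A_module) i e)) h \<noteq> 0" for e
    using that
    by (cases e) (auto simp: P_sel lin_ext_single map_single map_0 lookup_single when_def n_def split: if_splits)
  show "finite {e. Poly_Mapping.lookup (mpow (P_module :: (pbasis, 'p) A_module) i e) h \<noteq> 0}"
    "finite {e. Poly_Mapping.lookup (lin_ext (mbeta P_module) (mpow (P_module :: (pbasis, 'p) A_module) i e)) h \<noteq> 0}"
    by (rule finite_subset[OF _ fin]; use mem in blast)+
qed

lemma lookup_dual_pow:
  "Poly_Mapping.lookup (dual_act h (mpow (P_module :: (pbasis, 'p::prime_card) A_module) i)) (Odd t) =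
     (of_nat (t choose i) when Odd (t + i * (CARD('p) - 1)) = h)"
  "Poly_Mapping.lookup (dual_act h (mpow (P_module :: (pbasis, 'p::prime_card) A_module) i)) (Even t) =
     (of_nat ((t + 1) choose i) when Even (t + i * (CARD('p) - 1)) = h)"
  "Poly_Mapping.lookup (dual_act h (\<lambda>e. lin_ext (mbeta P_module) (mpow (P_module :: (pbasis, 'p::prime_card) A_module) i e))) (Odd t) =
     (of_nat (t choose i) when Even (t + i * (CARD('p) - 1)) = h)"
  "Poly_Mapping.lookup (dual_act h (\<lambda>e. lin_ext (mbeta P_module) (mpow (P_module :: (pbasis, 'p::prime_card) A_module) i e))) (Even t) = 0"
  by (simp_all only: lookup_dual_act finite_pow beta_pow) (simp_all add: P_sel lookup_single)

text \<open>P^i raises the exponent of y by \<open>i * (p - 1)\<close>, so the component at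
  \<open>ab^[t]\<close> receives those at \<open>ab^[t + i(p-1)]\<close> through
  \<open>lam i\<close> and those at \<open>b^[t + 1 + i(p-1)]\<close> through \<open>mu i\<close>.
  The latter elements have even degree, so the sign in the differential is 1.\<close>

lemma lookup_cochain_d:
  fixes z :: "pbasis \<Rightarrow>\<^sub>0 'p::prime_card lambda"
  shows "Poly_Mapping.lookup (cochain_d P_module z) (Odd t) =
      lam_d (Poly_Mapping.lookup z (Odd t))
      + (\<Sum>i=1..t. of_nat (t choose i) * (lam_sgn (Poly_Mapping.lookup z (Odd (t + i * (CARD('p) - 1)))) * lam i))
      + (\<Sum>i\<le>t. of_nat (t choose i) * (lam_sgn (Poly_Mapping.lookup z (Even (t + i * (CARD('p) - 1)))) * mu i))"
    (is "?A z")
  and "Poly_Mapping.lookup (cochain_d P_module z) (Even t) =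
      lam_d (Poly_Mapping.lookup z (Even t))
      + (\<Sum>i=1..t + 1. of_nat ((t + 1) choose i) * (lam_sgn (Poly_Mapping.lookup z (Even (t + i * (CARD('p) - 1)))) * lam i))"
    (is "?B z")
proof -
  have "?A z \<and> ?B z"
  proof (induction z rule: pm_induct)
    case (single h a)
    let ?M = "P_module :: (pbasis, 'p) A_module"
    have p1: "1 \<le> CARD('p) - 1"
      using prime_ge_2_nat[OF prime_card[where 'a = 'p]] by simp
    have ile: "i \<le> i * (CARD('p) - 1)" for i using p1 by simp
    define s where "s = lam_sgn a"
    have s_when: "lam_sgn (a when P) = (s when P)" for P
      by (cases P) (simp_all add: s_def lam_sgn_0)
    have d: "cochain_d P_module (Poly_Mapping.single h a) = Poly_Mapping.single h (lam_d a)
     + (\<Sum>i\<le>mdeg ?M h. tensor ((-1) ^ mdeg ?M h * s * mu i)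
          (dual_act h (\<lambda>e. lin_ext (mbeta P_module) (mpow P_module i e))))
     + (\<Sum>i=1..mdeg ?M h. tensor (s * lam i) (dual_act h (mpow P_module i)))"
      unfolding cochain_d_def s_def by (subst pm_ext_single) (simp_all add: lam_d_0 lam_sgn_0 tensor_0)
    \<comment> \<open>The differential sums up to the degree of \<open>h\<close>, the component
      formula up to \<open>n\<close>. Beyond the first bound \<open>X i = h\<close> is impossible,
      beyond the second the binomial coefficient is 0.\<close>
    have L: "(\<Sum>i=1..m. s * lam i * lscal (of_nat (n choose i) when X i = h)) =
        (\<Sum>i=1..n. of_nat (n choose i) * ((s when h = X i) * lam i))"
      if "\<And>i. X i = h \<Longrightarrow> i \<le> m" for m n X
    proof -
      have "(\<Sum>i=1..m. s * lam i * lscal (of_nat (n choose i) when X i = h)) =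
        (\<Sum>i=1..max m n. s * lam i * lscal (of_nat (n choose i) when X i = h))"
        using that by (intro sum.mono_neutral_left) (auto simp: when_def lscal_simps)
      also have "\<dots> = (\<Sum>i=1..max m n. of_nat (n choose i) * ((s when h = X i) * lam i))"
        by (intro sum.cong) (auto simp: when_def lscal_simps lscal_commute lscal_of_nat mult_of_nat_commute)
      also have "\<dots> = (\<Sum>i=1..n. of_nat (n choose i) * ((s when h = X i) * lam i))"
        by (intro sum.mono_neutral_right) (auto simp: binomial_eq_0 not_le)
      finally show ?thesis .
    qed
    have M: "(\<Sum>i\<le>m. (-1) ^ m * s * mu i * lscal (of_nat (n choose i) when Even (X i) = h)) =
        (\<Sum>i\<le>n. of_nat (n choose i) * ((s when h = Even (X i)) * mu i))"
      if "\<And>i. Even (X i) = h \<Longrightarrow> i \<le> m \<and> even m" for m n X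
    proof -
      have "(\<Sum>i\<le>m. (-1) ^ m * s * mu i * lscal (of_nat (n choose i) when Even (X i) = h)) =
        (\<Sum>i\<le>max m n. (-1) ^ m * s * mu i * lscal (of_nat (n choose i) when Even (X i) = h))"
        using that by (intro sum.mono_neutral_left) (auto simp: when_def lscal_simps)
      also have "\<dots> = (\<Sum>i\<le>max m n. of_nat (n choose i) * ((s when h = Even (X i)) * mu i))"
      proof (intro sum.cong refl)
        fix i
        show "(-1) ^ m * s * mu i * lscal (of_nat (n choose i) when Even (X i) = h) =
            of_nat (n choose i) * ((s when h = Even (X i)) * mu i)"
        proof (cases "Even (X i) = h")
          case True
          then have "even m" using that by blast
          then show ?thesis using True by (auto simp: lscal_of_nat mult_of_nat_commute)
        qed (auto simp: when_def lscal_simps)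
      qed
      also have "\<dots> = (\<Sum>i\<le>n. of_nat (n choose i) * ((s when h = Even (X i)) * mu i))"
        by (intro sum.mono_neutral_right) (auto simp: binomial_eq_0 not_le)
      finally show ?thesis .
    qed
    have gen: "i \<le> 2 * (t + k) + 1" "i \<le> 2 * (t + k + 1)" if "i \<le> k" for i k :: nat
      using that by simp_all
    have le1: "i \<le> mdeg ?M (Odd (t + i * (CARD('p) - 1)))" for i
      unfolding P_sel by (rule gen(1)[OF ile])
    have le2: "i \<le> mdeg ?M (Even (t + i * (CARD('p) - 1)))" for i
      unfolding P_sel by (rule gen(2)[OF ile])
    note le = le1 le2
    show ?case
    proof
      have "(\<Sum>i=1..mdeg ?M h. s * lam i * lscal (of_nat (t choose i) when Odd (t + i * (CARD('p) - 1)) = h)) =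
          (\<Sum>i=1..t. of_nat (t choose i) * ((s when h = Odd (t + i * (CARD('p) - 1))) * lam i))"
        by (rule L) (use le in blast)
      moreover have "(\<Sum>i\<le>mdeg ?M h. (-1) ^ mdeg ?M h * s * mu i * lscal (of_nat (t choose i) when Even (t + i * (CARD('p) - 1)) = h)) =
          (\<Sum>i\<le>t. of_nat (t choose i) * ((s when h = Even (t + i * (CARD('p) - 1))) * mu i))"
      proof (rule M)
        fix i assume h: "Even (t + i * (CARD('p) - 1)) = h"
        have "even (mdeg ?M h)" unfolding h[symmetric] P_sel by simp
        then show "i \<le> mdeg ?M h \<and> even (mdeg ?M h)" using le2[of i] unfolding h by simp
      qed
      moreover have "lam_d (a when P) = (lam_d a when P)" for P
        by (cases P) (simp_all add: lam_d_0)
      ultimately show "?A (Poly_Mapping.single h a)"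
        unfolding d
        by (simp only: lookup_add lookup_sum lookup_tensor lookup_dual_pow lookup_single s_when)
           (simp only: add_ac)
      have "(\<Sum>i=1..mdeg ?M h. s * lam i * lscal (of_nat ((t + 1) choose i) when Even (t + i * (CARD('p) - 1)) = h)) =
          (\<Sum>i=1..t + 1. of_nat ((t + 1) choose i) * ((s when h = Even (t + i * (CARD('p) - 1))) * lam i))"
        by (rule L) (use le in blast)
      moreover have "lam_d (a when P) = (lam_d a when P)" for P
        by (cases P) (simp_all add: lam_d_0)
      ultimately show "?B (Poly_Mapping.single h a)"
        unfolding d
        by (simp only: lookup_add lookup_sum lookup_tensor lookup_dual_pow lookup_single s_when)
           (simp only: lscal_simps mult_zero_right sum.neutral_const add_0_right)
    qed
  qed (simp_all add: cochain_d_0 cochain_d_additive lookup_add lam_d_0 lam_sgn_0 lam_d_additive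
      lam_sgn_additive distrib_left distrib_right sum.distrib)
  then show "?A z" "?B z" by auto
qed

text \<open>Leibniz rule for the action of \<Lambda>; it makes \<open>ext_mult\<close> independent
  of representatives.\<close>

lemma cochain_d_lact: "cochain_d M (lact u v) = lact (lam_sgn u) (cochain_d M v) + lact (lam_d u) v"
proof (induction v rule: pm_induct)
  case zero
  then show ?case by (simp add: lact_0 cochain_d_0)
next
  case (single h b)
  have d: "cochain_d M (Poly_Mapping.single h a) = Poly_Mapping.single h (lam_d a)
     + (\<Sum>i\<le>mdeg M h. tensor ((-1) ^ mdeg M h * lam_sgn a * mu i)
          (dual_act h (\<lambda>e. lin_ext (mbeta M) (mpow M i e))))
     + (\<Sum>i=1..mdeg M h. tensor (lam_sgn a * lam i) (dual_act h (mpow M i)))" for a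
    unfolding cochain_d_def by (subst pm_ext_single) (simp_all add: lam_d_0 lam_sgn_0 tensor_0)
  have sgn: "(-1) ^ n * lam_sgn (u * b) * c = lam_sgn u * ((-1) ^ n * lam_sgn b * c)" for n c
    by (cases "even n") (simp_all add: lam_sgn_mult mult.assoc)
  show ?case
    unfolding lact_simps(5) d sgn
    by (simp add: lact_simps lact_sum lact_tensor lam_d_mult lam_sgn_mult single_add mult.assoc add_ac)
next
  case (add x y)
  then show ?case by (simp add: lact_simps cochain_d_additive)
qed

lemma lookup_cochain_d_Fp: "Poly_Mapping.lookup (cochain_d Fp_module x) () = lam_d (Poly_Mapping.lookup x ())"
proof (induction x rule: pm_induct)
  case (single h a)
  have lin: "lin_ext (\<lambda>_. 0) v = (0 :: unit \<Rightarrow>\<^sub>0 'a mod_ring)" for v :: "unit \<Rightarrow>\<^sub>0 'a mod_ring"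
    by (simp add: lin_ext_def pm_ext_def map_0)
  have dual: "dual_act () (\<lambda>e. 0) = (0 :: unit \<Rightarrow>\<^sub>0 'a mod_ring)"
    by (rule poly_mapping_eqI) (simp add: lookup_dual_act)
  have t0: "tensor a 0 = (0 :: unit \<Rightarrow>\<^sub>0 'a lambda)" for a
    by (rule poly_mapping_eqI) (simp add: lookup_tensor lscal_simps)
  have d: "cochain_d Fp_module (Poly_Mapping.single h a) = Poly_Mapping.single h (lam_d a)"
    unfolding cochain_d_def
    by (subst pm_ext_single) (simp_all add: lam_d_0 lam_sgn_0 tensor_0 Fp_module_def lin dual t0)
  show ?case unfolding d by (simp add: lookup_single)
qed (simp_all add: cochain_d_0 cochain_d_additive lookup_add lam_d_0 lam_d_additive)

lemma rep_abs_extP: "\<exists>y. rep_extP (clsP v) = v + cochain_d P_module y"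
proof -
  have "clsP (rep_extP (clsP v)) = clsP v" by (rule Quotient_abs_rep[OF Quotient_extP])
  then have "rep_extP (clsP v) - v \<in> range (cochain_d P_module)" by (simp only: extP.abs_eq_iff)
  then show ?thesis by (auto simp: algebra_simps)
qed

lemma rep_abs_extF: "\<exists>y. Poly_Mapping.lookup (rep_extF (clsF v)) () = Poly_Mapping.lookup v () + lam_d y"
proof -
  have "clsF (rep_extF (clsF v)) = clsF v" by (rule Quotient_abs_rep[OF Quotient_extF])
  then have "rep_extF (clsF v) - v \<in> range (cochain_d Fp_module)" by (simp only: extF.abs_eq_iff)
  then obtain x where "rep_extF (clsF v) - v = cochain_d Fp_module x" by auto
  then have "rep_extF (clsF v) = v + cochain_d Fp_module x" by (simp add: algebra_simps)
  then show ?thesis by (auto simp: lookup_add lookup_cochain_d_Fp)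
qed

lemma clsP_eqI: "u = v + cochain_d P_module y \<Longrightarrow> clsP u = clsP v"
  unfolding extP.abs_eq_iff by simp

lemma clsP_cochain_d: "clsP (cochain_d P_module y) = 0"
  unfolding zero_extP.abs_eq extP.abs_eq_iff by simp

lemma clsP_hom:
  "clsP (u + v) = clsP u + clsP v" "clsP (lact (lscal c) u) = scale_extP c (clsP u)" "clsP 0 = 0"
  by (simp_all add: plus_extP.abs_eq scale_extP.abs_eq zero_extP.abs_eq)

lemmas clsP_sum = additive_diff(4)[of clsP, OF clsP_hom(1)]

text \<open>If the chosen representatives are \<open>U = u + lam_d u'\<close> and \<open>v\<close>
  plus the coboundary of \<open>v'\<close>, their product differs from that of \<open>u\<close> and
  \<open>v\<close> by the coboundary of \<open>lact u' v + lact (lam_sgn U) v'\<close>; the twist by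
  \<open>lam_sgn\<close> undoes the sign in the Leibniz rule.\<close>

lemma ext_mult_cls:
  assumes u: "lam_d u = 0" and v: "cochain_d P_module v = 0"
  shows "clsF (Poly_Mapping.single () u) \<odot> clsP v = clsP (lact u v)"
proof -
  obtain u' where u': "Poly_Mapping.lookup (rep_extF (clsF (Poly_Mapping.single () u))) () = u + lam_d u'"
    using rep_abs_extF[of "Poly_Mapping.single () u"] by auto
  obtain v' where v': "rep_extP (clsP v) = v + cochain_d P_module v'"
    using rep_abs_extP by blast
  define U where "U = u + lam_d u'"
  have dU: "lam_d U = 0" by (simp add: U_def lam_d_additive u lam_d_d)
  have 1: "cochain_d P_module (lact (lam_sgn U) v') = lact U (cochain_d P_module v')"
    by (simp add: cochain_d_lact lam_sgn_sgn lam_d_sgn dU lam_sgn_0)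
       (rule poly_mapping_eqI, simp add: lookup_lact)
  have 2: "cochain_d P_module (lact u' v) = lact (lam_d u') v"
    by (simp add: cochain_d_lact v lact_0)
  have "lact U (v + cochain_d P_module v') = lact u v + (lact (lam_d u') v + lact U (cochain_d P_module v'))"
    by (simp add: lact_simps(1)) (simp add: U_def lact_simps(2))
  also have "\<dots> = lact u v + cochain_d P_module (lact u' v + lact (lam_sgn U) v')"
    by (simp add: cochain_d_additive 1 2)
  finally show ?thesis
    unfolding ext_mult_def u' v' U_def by (rule clsP_eqI)
qed

lemma cochain_P0_add: "cochain_P0 (x + y) = cochain_P0 x + cochain_P0 y"
  unfolding cochain_P0_def
  by (rule pm_ext_add)
     (auto simp: lam_P0_additive single_add additive_diff(1)[of lam_P0, OF lam_P0_additive] split: pbasis.split)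

lemma lam_P0_0: "lam_P0 0 = 0"
  by (rule additive_diff(1)[of lam_P0, OF lam_P0_additive])

lemmas lam_P0_sum = additive_diff(4)[of lam_P0, OF lam_P0_additive]
lemmas cochain_P0_additive = cochain_P0_add additive_diff[of cochain_P0, OF cochain_P0_add]

lemma cochain_P0_single:
  "cochain_P0 (Poly_Mapping.single (Odd t) a :: pbasis \<Rightarrow>\<^sub>0 'p::prime_card lambda) =
     Poly_Mapping.single (Odd (CARD('p) * (t + 1) - 1)) (lam_P0 a)"
  "cochain_P0 (Poly_Mapping.single (Even t) a :: pbasis \<Rightarrow>\<^sub>0 'p lambda) = 0"
  unfolding cochain_P0_def by (subst pm_ext_single; simp add: lam_P0_0 split: pbasis.split)+

lemma lookup_cochain_P0:
  fixes z :: "pbasis \<Rightarrow>\<^sub>0 'p::prime_card lambda"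
  shows "Poly_Mapping.lookup (cochain_P0 z) (Odd (CARD('p) * (t + 1) - 1)) = lam_P0 (Poly_Mapping.lookup z (Odd t))"
    and "\<not> CARD('p) dvd s + 1 \<Longrightarrow> Poly_Mapping.lookup (cochain_P0 z) (Odd s) = 0"
    and "Poly_Mapping.lookup (cochain_P0 z) (Even s) = 0"
proof -
  have c0: "0 < CARD('p)" by simp
  have inj: "CARD('p) * (t + 1) - 1 = CARD('p) * (u + 1) - 1 \<longleftrightarrow> t = u" for t u
  proof -
    have "CARD('p) * (t + 1) - 1 = CARD('p) * (u + 1) - 1 \<longleftrightarrow> CARD('p) * (t + 1) = CARD('p) * (u + 1)"
      using c0 by (metis Suc_eq_plus1 Suc_pred' mult_Suc_right add_gr_0)
    then show ?thesis using c0 by simp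
  qed
  have nd: "CARD('p) dvd CARD('p) * (u + 1) - 1 + 1" for u
    using c0 by simp
  show "Poly_Mapping.lookup (cochain_P0 z) (Odd (CARD('p) * (t + 1) - 1)) = lam_P0 (Poly_Mapping.lookup z (Odd t))"
  proof (induction z rule: pm_induct)
    case (single h a)
    show ?case
      by (cases h) (simp_all only: cochain_P0_single lookup_single when_def pbasis.inject inj pbasis.distinct
          lam_P0_0 lookup_zero if_False split: if_splits, auto simp: lam_P0_0)
  qed (simp_all add: cochain_P0_additive lookup_add lam_P0_additive lam_P0_0)
  show "Poly_Mapping.lookup (cochain_P0 z) (Odd s) = 0" if "\<not> CARD('p) dvd s + 1"
  proof (induction z rule: pm_induct)
    case (single h a)
    show ?case
    proof (cases h)
      case (Odd u)
      have "CARD('p) * (u + 1) - 1 \<noteq> s" using nd[of u] that by metis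
      then show ?thesis unfolding Odd cochain_P0_single lookup_single when_def by simp
    qed (simp add: cochain_P0_single)
  qed (simp_all add: cochain_P0_additive lookup_add)
  show "Poly_Mapping.lookup (cochain_P0 z) (Even s) = 0"
  proof (induction z rule: pm_induct)
    case (single h a)
    show ?case by (cases h) (simp_all add: cochain_P0_single lookup_single)
  qed (simp_all add: cochain_P0_additive lookup_add)
qed

locale odd_card = odd_char p "TYPE('p::prime_card mod_ring)" for p +
  assumes card_p: "CARD('p) = p"
begin

lemma mult_pred: "i * (p - 1) + i = p * i"
  using p_ge_3 by (cases p) simp_all

lemma of_nat_lambda: "(of_nat n :: 'p lambda) = lscal (of_nat n)"
  by (simp add: lscal_of_nat)

lemma lam_P0_of_nat: "lam_P0 (of_nat n :: 'p lambda) = of_nat n"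
  by (simp only: of_nat_lambda lam_P0_lscal)

text \<open>At \<open>ab^[t]\<close> with \<open>p\<close> not dividing \<open>t + 1\<close> both
  sides vanish, since a term that could survive has binomial coefficient 0 by
  \<open>bd_not_dvd\<close>. At \<open>t = p * s + (p - 1)\<close> only \<open>i = p * j\<close>
  contributes, and Lucas identifies these terms with the ones at \<open>s\<close>.\<close>

lemma cochain_P0_d:
  fixes z :: "pbasis \<Rightarrow>\<^sub>0 'p lambda"
  shows "cochain_P0 (cochain_d P_module z) = cochain_d P_module (cochain_P0 z)"
proof (rule poly_mapping_eqI)
  fix h
  have E: "Poly_Mapping.lookup (cochain_P0 z) (Even t) = 0" for t
    by (rule lookup_cochain_P0)
  show "Poly_Mapping.lookup (cochain_P0 (cochain_d P_module z)) h =
      Poly_Mapping.lookup (cochain_d P_module (cochain_P0 z)) h"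
  proof (cases h)
    case (Even t)
    then show ?thesis
      by (simp add: lookup_cochain_P0 lookup_cochain_d lam_d_0 lam_sgn_0)
  next
    case (Odd t)
    show ?thesis
    proof (cases "p dvd t + 1")
      case False
      have "of_nat (t choose i) * (lam_sgn (Poly_Mapping.lookup (cochain_P0 z) (Odd (t + i * (p - 1)))) * lam i) = 0"
        if "1 \<le> i" for i
      proof (cases "p dvd t + i * (p - 1) + 1")
        case True
        have i: "\<not> p dvd i"
        proof
          assume "p dvd i"
          then have "p dvd i * (p - 1)" by simp
          then have "p dvd (t + 1) + i * (p - 1)" using True by (simp add: algebra_simps)
          then show False using False \<open>p dvd i * (p - 1)\<close> by (simp only: dvd_add_left_iff)
        qed
        obtain M where M: "t + i * (p - 1) + 1 = p * M" using True ..
        then have "M \<noteq> 0" by (cases "M = 0") auto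
        then obtain M' where M': "M = M' + 1" by (metis Suc_eq_plus1 not0_implies_Suc)
        have eq: "t + i * (p - 1) = p * M' + (p - 1)" using M p_ge_3 unfolding M' by (simp only: distrib_left)
        have "bin t i = 0" using bd_not_dvd[OF i, of M'] unfolding bd_def eq[symmetric] by simp
        then show ?thesis by (simp only: of_nat_lambda lscal_simps) simp
      next
        case False
        then show ?thesis using lookup_cochain_P0(2)[of "t + i * (p - 1)" z] by (simp add: card_p lam_sgn_0)
      qed
      moreover have "Poly_Mapping.lookup (cochain_P0 x) (Odd t) = 0" for x :: "pbasis \<Rightarrow>\<^sub>0 'p lambda"
        using lookup_cochain_P0(2)[of t x] False by (simp only: card_p) simp
      ultimately show ?thesis
        unfolding Odd lookup_cochain_d card_p E by (simp add: card_p lam_d_0 lam_sgn_0)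
    next
      case True
      obtain M where M: "t + 1 = p * M" using True ..
      then have "M \<noteq> 0" by (cases "M = 0") auto
      then obtain s where s: "M = s + 1" by (metis Suc_eq_plus1 not0_implies_Suc)
      have t: "t = p * s + (p - 1)" using M p_ge_3 unfolding s by (simp only: distrib_left)
      have t': "t = p * (s + 1) - 1" using M s by simp
      define f where "f i = of_nat (t choose i) * (lam_sgn (Poly_Mapping.lookup (cochain_P0 z) (Odd (t + i * (p - 1)))) * lam i)" for i
      have f0: "f i = 0" if "\<not> p dvd i" for i
      proof -
        have "\<not> p dvd t + i * (p - 1) + 1"
        proof
          assume a: "p dvd t + i * (p - 1) + 1"
          have "t + i * (p - 1) + 1 + i = p * (M + i)"
            using M mult_pred[of i] by (simp only: distrib_left)
          then have "p dvd (t + i * (p - 1) + 1) + i" by (simp only: dvd_triv_left)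
          then show False using that a by (simp only: dvd_add_right_iff)
        qed
        then show ?thesis using lookup_cochain_P0(2)[of "t + i * (p - 1)" z] by (simp add: f_def card_p lam_sgn_0)
      qed
      have fp: "f (p * j) = lam_P0 (of_nat (s choose j) * (lam_sgn (Poly_Mapping.lookup z (Odd (s + j * (p - 1)))) * lam j))" for j
      proof -
        have "t + p * j * (p - 1) = p * (s + j * (p - 1) + 1) - 1"
          unfolding t using p_ge_3 by (simp only: distrib_left mult.assoc)
        then have "Poly_Mapping.lookup (cochain_P0 z) (Odd (t + p * j * (p - 1))) =
            lam_P0 (Poly_Mapping.lookup z (Odd (s + j * (p - 1))))"
          using lookup_cochain_P0(1)[of z "s + j * (p - 1)"] by (simp only: card_p)
        moreover have "bin t (p * j) = bin s j"
          unfolding t using lucas_r0[of "p - 1" s j] p_ge_3 by simp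
        then have "(of_nat (t choose (p * j)) :: 'p lambda) = of_nat (s choose j)"
          by (simp only: of_nat_lambda)
        ultimately show ?thesis
          by (simp only: f_def lam_P0_of_nat lam_P0_mult lam_P0_sgn lam_P0_lam card_p)
      qed
      have "(\<Sum>i=1..t. f i) = (\<Sum>i\<in>(*) p ` {1..s}. f i)"
      proof (rule sum.mono_neutral_right)
        have "p * x \<le> t" if "x \<le> s" for x
          unfolding t using mult_le_mono2[OF that, of p] by (rule trans_le_add1)
        then show "(*) p ` {1..s} \<subseteq> {1..t}" using p_ge_3 by auto
        show "\<forall>i\<in>{1..t} - (*) p ` {1..s}. f i = 0"
        proof
          fix i assume i: "i \<in> {1..t} - (*) p ` {1..s}"
          show "f i = 0"
          proof (cases "p dvd i")
            case True
            then obtain j where j: "i = p * j" ..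
            have "1 \<le> j" using i j by (cases "j = 0") auto
            moreover have "j \<le> s"
            proof (rule ccontr)
              assume "\<not> ?thesis"
              then have "p * s + p \<le> p * j" by (intro mult_p_less) simp
              moreover have "i \<le> t" using i by simp
              ultimately show False using j t p_ge_3 by linarith
            qed
            ultimately show ?thesis using i j by auto
          qed (rule f0)
        qed
      qed simp
      also have "\<dots> = (\<Sum>j=1..s. lam_P0 (of_nat (s choose j) * (lam_sgn (Poly_Mapping.lookup z (Odd (s + j * (p - 1)))) * lam j)))"
        using p_ge_3 by (subst sum.reindex) (auto simp: inj_on_def fp)
      finally have S: "(\<Sum>i=1..t. f i) = \<dots>" .
      have "Poly_Mapping.lookup (cochain_P0 (cochain_d P_module z)) (Odd t) = lam_P0 (Poly_Mapping.lookup (cochain_d P_module z) (Odd s))"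
        unfolding t' using lookup_cochain_P0(1)[of "cochain_d P_module z" s] by (simp only: card_p)
      also have "\<dots> = lam_d (lam_P0 (Poly_Mapping.lookup z (Odd s))) + (\<Sum>i=1..t. f i)"
        unfolding S lookup_cochain_d
        by (simp only: card_p lam_P0_additive lam_P0_d lam_P0_sum lam_P0_of_nat lam_P0_mult lam_P0_mu
            mult_zero_right sum.neutral_const add_0_right)
      also have "lam_P0 (Poly_Mapping.lookup z (Odd s)) = Poly_Mapping.lookup (cochain_P0 z) (Odd t)"
        unfolding t' using lookup_cochain_P0(1)[of z s] by (simp only: card_p)
      also have "lam_d \<dots> + (\<Sum>i=1..t. f i) = Poly_Mapping.lookup (cochain_d P_module (cochain_P0 z)) (Odd t)"
        unfolding lookup_cochain_d E f_def card_p by (simp add: lam_sgn_0)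
      finally show ?thesis by (simp only: Odd)
    qed
  qed
qed

lemma ext_P0_cls: "ext_P0 (clsP z :: 'p extP) = clsP (cochain_P0 z)"
proof -
  obtain y where "rep_extP (clsP z) = z + cochain_d P_module y" using rep_abs_extP by blast
  then show ?thesis
    unfolding ext_P0_def by (simp only: cochain_P0_add cochain_P0_d) (rule clsP_eqI, rule refl)
qed

end

section \<open>Coefficients of words of length at most two\<close>

lemma lookup_mult_1:
  fixes x y :: "'p::prime_card free_alg"
  shows "Poly_Mapping.lookup (x * y) (Word [g]) =
    Poly_Mapping.lookup x 0 * Poly_Mapping.lookup y (Word [g]) + Poly_Mapping.lookup x (Word [g]) * Poly_Mapping.lookup y 0"
proof (induction x rule: pm_induct)
  case (single v c)
  show ?case
  proof (induction y rule: pm_induct)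
    case (single w d)
    have "v + w = Word [g] \<longleftrightarrow> v = 0 \<and> w = Word [g] \<or> v = Word [g] \<and> w = 0"
      by (cases v; cases w) (auto simp: zero_lword_def plus_lword_def append_eq_Cons_conv)
    then show ?case
      by (auto simp: mult_single lookup_single when_def zero_lword_def)
  qed (simp_all add: lookup_add distrib_left)
qed (simp_all add: lookup_add distrib_right)

lemma lookup_mult_2:
  fixes x y :: "'p::prime_card free_alg"
  shows "Poly_Mapping.lookup (x * y) (Word [g, h]) =
    Poly_Mapping.lookup x 0 * Poly_Mapping.lookup y (Word [g, h])
    + Poly_Mapping.lookup x (Word [g]) * Poly_Mapping.lookup y (Word [h])
    + Poly_Mapping.lookup x (Word [g, h]) * Poly_Mapping.lookup y 0"
proof (induction x rule: pm_induct)
  case (single v c)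
  show ?case
  proof (induction y rule: pm_induct)
    case (single w d)
    have "v + w = Word [g, h] \<longleftrightarrow> v = 0 \<and> w = Word [g, h] \<or> v = Word [g] \<and> w = Word [h] \<or> v = Word [g, h] \<and> w = 0"
      by (cases v; cases w) (auto simp: zero_lword_def plus_lword_def append_eq_Cons_conv)
    then show ?case
      by (auto simp: mult_single lookup_single when_def zero_lword_def)
  qed (simp_all add: lookup_add distrib_left)
qed (simp_all add: lookup_add distrib_right)

lemma lookup_fscal_mult: "Poly_Mapping.lookup (fscal c * x) w = c * Poly_Mapping.lookup x w"
  by (induction x rule: pm_induct) (auto simp: fscal_single lookup_single when_def lookup_add distrib_left)

lemma free_of_nat: "of_nat n = fscal (of_nat n)"
  by (induction n) (simp_all add: fscal_simps)

lemma lookup_of_nat_mult: "Poly_Mapping.lookup (of_nat n * x :: 'p::prime_card free_alg) w = of_nat n * Poly_Mapping.lookup x w"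
  unfolding free_of_nat lookup_fscal_mult ..

text \<open>\<open>gw True a\<close> is the letter $\lambda_{a-1}$ for $a \ge 1$, and \<open>gw False a\<close> is $\mu_{a-1}$.\<close>

definition gw :: "bool \<Rightarrow> nat \<Rightarrow> lgen" where
  "gw e a = (if e then Lam (a - 1) else Mu a)"

lemma lookup_fg:
  "e \<longrightarrow> 1 \<le> a \<Longrightarrow> Poly_Mapping.lookup (fg e' a' :: 'p::prime_card free_alg) (Word [gw e a]) = (if e' = e \<and> a' = a then 1 else 0)"
  "Poly_Mapping.lookup (fg e' a' :: 'p::prime_card free_alg) 0 = 0"
  "Poly_Mapping.lookup (fg e' a' :: 'p::prime_card free_alg) (Word [g, h]) = 0"
  by (auto simp: fg_def flam_def fmu_def gw_def lookup_single when_def zero_lword_def)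

lemma lookup_fg_fg:
  assumes "e1 \<longrightarrow> 1 \<le> a" "e2 \<longrightarrow> 1 \<le> b"
  shows "Poly_Mapping.lookup (fg e i * fg e' j :: 'p::prime_card free_alg) (Word [gw e1 a, gw e2 b]) =
     (if e = e1 \<and> i = a \<and> e' = e2 \<and> j = b then 1 else 0)"
  using assms by (simp add: lookup_mult_2 lookup_fg)

lemma rels_lookup_1: "r \<in> lambda_rels \<Longrightarrow> Poly_Mapping.lookup r (Word [g]) = 0"
  by (induction rule: lambda_rels.induct)
     (auto simp: lookup_sum lookup_mult_1 lookup_mult_0 lookup_minus fmu_0 flam_0)

lemma ideal_lookup_1: "x \<in> lambda_ideal \<Longrightarrow> Poly_Mapping.lookup x (Word [g]) = 0"
  by (induction rule: lambda_ideal.induct)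
     (simp_all add: lookup_mult_1 lookup_mult_0 lookup_add lambda_rels_0 rels_lookup_1)

text \<open>All relations have length two, so coefficients of words of length zero and one are well
  defined on \<Lambda>; \<open>co0\<close> and \<open>co\<close> read them off the chosen
  representative.\<close>

definition co :: "'p::prime_card lambda \<Rightarrow> lgen \<Rightarrow> 'p mod_ring" where
  "co a g = Poly_Mapping.lookup (rep_lambda a) (Word [g])"

definition co0 :: "'p::prime_card lambda \<Rightarrow> 'p mod_ring" where
  "co0 a = Poly_Mapping.lookup (rep_lambda a) 0"

lemma rep_abs_lambda: "rep_lambda (abs_lambda x) - x \<in> lambda_ideal"
  by (simp only: lambda.abs_eq_iff[symmetric] Quotient_abs_rep[OF Quotient_lambda])

lemma co_abs: "co (abs_lambda x) g = Poly_Mapping.lookup x (Word [g])"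
  using ideal_lookup_1[OF rep_abs_lambda[of x], of g] by (simp add: co_def lookup_minus)

lemma co0_abs: "co0 (abs_lambda x) = Poly_Mapping.lookup x 0"
  using lambda_ideal_0[OF rep_abs_lambda[of x]] by (simp add: co0_def lookup_minus)

lemma lambda_abs_cases: obtains x where "a = abs_lambda x"
  by (metis Quotient_abs_rep[OF Quotient_lambda])

lemma co_add: "co (a + b) g = co a g + co b g"
  by (cases a rule: lambda_abs_cases; cases b rule: lambda_abs_cases)
     (simp add: co_abs plus_lambda.abs_eq lookup_add)

lemmas co_additive = co_add additive_diff[of "\<lambda>a. co a g", OF co_add] for g

lemma co_lscal: "co (lscal c * a) g = c * co a g"
  by (cases a rule: lambda_abs_cases)
     (simp add: co_abs lscal.abs_eq times_lambda.abs_eq lookup_fscal_mult)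

lemma co_mult: "co (a * b) g = co0 a * co b g + co a g * co0 b"
  by (cases a rule: lambda_abs_cases; cases b rule: lambda_abs_cases)
     (simp add: co_abs co0_abs times_lambda.abs_eq lookup_mult_1)

lemma co_of_nat: "co (of_nat n * a) g = of_nat n * co a g"
  by (simp only: lscal_of_nat[symmetric] co_lscal)

lemma co0_lam: "co0 (lam i) = 0" and co0_mu: "co0 (mu i) = 0"
  by (simp_all add: lam_def mu_def co0_abs flam_0 fmu_0)

lemma co_lam_mu:
  "co (lam i) (Lam j) = (if i = j + 1 then 1 else 0)" "co (lam i) (Mu j) = 0"
  "co (mu i) (Mu j) = (if i = j then 1 else 0)" "co (mu i) (Lam j) = 0"
  by (auto simp: lam_def mu_def co_abs flam_def fmu_def lookup_single when_def)

lemma free_sgn_lookup_0: "Poly_Mapping.lookup (free_sgn x) 0 = Poly_Mapping.lookup x 0"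
  by (induction x rule: pm_induct)
     (auto simp: free_sgn_additive lookup_add free_sgn_single lookup_single when_def wdeg_def)

lemma co0_sgn: "co0 (lam_sgn a) = co0 a"
  by (cases a rule: lambda_abs_cases) (simp add: co0_abs lam_sgn.abs_eq free_sgn_lookup_0)

lemma free_d_lookup_0: "Poly_Mapping.lookup (free_d x) 0 = 0"
proof (induction x rule: free_alg_induct)
  case (gen g x)
  then show ?case
    by (cases g) (simp_all add: free_d_mult lookup_add lookup_mult_0 free_gen_conv flam_0 fmu_0
        free_d_flam free_d_fmu lookup_sum lookup_minus)
qed (simp_all add: free_d_additive lookup_add free_d_1 free_d_fscal lookup_fscal_mult)

lemma free_d_lookup_1: "Poly_Mapping.lookup (free_d x) (Word [h]) = 0"
proof (induction x rule: free_alg_induct)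
  case (gen g x)
  have "Poly_Mapping.lookup (free_sgn (free_gen g) :: 'a free_alg) 0 = 0"
    "Poly_Mapping.lookup (free_gen g :: 'a free_alg) 0 = 0"
    by (cases g; simp add: free_gen_def free_sgn_single lookup_single when_def zero_lword_def)+
  with gen show ?case
    by (cases g) (simp_all add: free_d_mult lookup_add lookup_mult_1 free_gen_conv flam_0 fmu_0
        free_d_flam free_d_fmu lookup_sum lookup_minus lookup_mult_0 lookup_of_nat_mult free_d_lookup_0)
qed (simp_all add: free_d_additive lookup_add free_d_1 free_d_fscal lookup_fscal_mult)

lemma co_lam_d: "co (lam_d a) g = 0"
  by (cases a rule: lambda_abs_cases) (simp add: co_abs lam_d.abs_eq free_d_lookup_1)

text \<open>The differential raises the length by one, so coefficients of length one see only the
  constant terms \<open>co0\<close> of \<open>y\<close>, whatever its other components. The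
  independence proof rests on this, as the \<open>y\<close> there is arbitrary.\<close>

lemma co_cochain_d:
  fixes y :: "pbasis \<Rightarrow>\<^sub>0 'p::prime_card lambda"
  assumes "1 \<le> i"
  shows "co (Poly_Mapping.lookup (cochain_d P_module y) (Odd t)) (Lam (i - 1)) =
      of_nat (t choose i) * co0 (Poly_Mapping.lookup y (Odd (t + i * (CARD('p) - 1))))"
    and "co (Poly_Mapping.lookup (cochain_d P_module y) (Even t)) (Lam (i - 1)) =
      of_nat ((t + 1) choose i) * co0 (Poly_Mapping.lookup y (Even (t + i * (CARD('p) - 1))))"
    and "co (Poly_Mapping.lookup (cochain_d P_module y) (Odd t)) (Mu j) =
      of_nat (t choose j) * co0 (Poly_Mapping.lookup y (Even (t + j * (CARD('p) - 1))))"
proof -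
  have 1: "(\<Sum>j=1..n. of_nat (n choose j) * (f j * (if j = i then 1 else 0))) = of_nat (n choose i) * f i" for n and f :: "nat \<Rightarrow> 'p mod_ring"
  proof (cases "i \<le> n")
    case True
    then show ?thesis using assms by (subst sum_eq_single[of _ i]) auto
  next
    case False
    then show ?thesis using assms by (subst sum.neutral) (auto simp: binomial_eq_0)
  qed
  have 2: "(\<Sum>i\<le>n. of_nat (n choose i) * (f i * (if i = j then 1 else 0))) = of_nat (n choose j) * f j" for n and f :: "nat \<Rightarrow> 'p mod_ring"
  proof (cases "j \<le> n")
    case True
    then show ?thesis by (subst sum_eq_single[of _ j]) auto
  next
    case False
    then show ?thesis by (subst sum.neutral) (auto simp: binomial_eq_0)
  qed
  have i: "j = i - 1 + 1 \<longleftrightarrow> j = i" for j using assms by auto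
  note simps = co_mult co_lam_mu co0_lam co0_mu co0_sgn i mult_zero_left mult_zero_right add_0_left add_0_right sum.neutral_const
  show "co (Poly_Mapping.lookup (cochain_d P_module y) (Odd t)) (Lam (i - 1)) =
      of_nat (t choose i) * co0 (Poly_Mapping.lookup y (Odd (t + i * (CARD('p) - 1))))"
    by (simp only: lookup_cochain_d co_additive co_lam_d co_of_nat) (simp only: simps 1)
  show "co (Poly_Mapping.lookup (cochain_d P_module y) (Even t)) (Lam (i - 1)) =
      of_nat ((t + 1) choose i) * co0 (Poly_Mapping.lookup y (Even (t + i * (CARD('p) - 1))))"
    by (simp only: lookup_cochain_d co_additive co_lam_d co_of_nat) (simp only: simps 1)
  show "co (Poly_Mapping.lookup (cochain_d P_module y) (Odd t)) (Mu j) =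
      of_nat (t choose j) * co0 (Poly_Mapping.lookup y (Even (t + j * (CARD('p) - 1))))"
    by (simp only: lookup_cochain_d co_additive co_lam_d co_of_nat) (simp only: simps 2)
qed

section \<open>The ideal of relations in length two\<close>

context odd_card
begin

definition coeff2 :: "'p free_alg \<Rightarrow> bool \<Rightarrow> nat \<Rightarrow> bool \<Rightarrow> nat \<Rightarrow> 'p mod_ring" where
  "coeff2 x e a e' b = Poly_Mapping.lookup x (Word [gw e a, gw e' b])"

lemma coeff2_relS:
  assumes "e1 \<longrightarrow> 1 \<le> a" "e2 \<longrightarrow> 1 \<le> b"
  shows "coeff2 (relS s e e' n m) e1 a e2 b =
    (if e = e1 \<and> e' = e2 \<and> s \<le> a \<and> a + b = n + (p + 1) * m + s then R (a + b - s) m (a - s) else 0)"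
proof -
  have "coeff2 (relS s e e' n m) e1 a e2 b =
      (\<Sum>i\<le>n. bin n i * (if e = e1 \<and> i + p * m + s = a \<and> e' = e2 \<and> n - i + m = b then 1 else 0))"
    unfolding coeff2_def relS_def lookup_sum lookup_of_nat_mult lookup_fg_fg[OF assms] card_p ..
  also have "\<dots> = (if e = e1 \<and> e' = e2 \<and> s \<le> a \<and> a + b = n + (p + 1) * m + s then R (a + b - s) m (a - s) else 0)"
  proof (cases "e = e1 \<and> e' = e2 \<and> p * m + s \<le> a \<and> a + b = n + (p + 1) * m + s \<and> a - (p * m + s) \<le> n")
    case True
    define k where "k = a - (p * m + s)"
    have a: "a = k + p * m + s" "k \<le> n" and b: "b = n - k + m"
      using True by (auto simp: k_def)
    have "(\<Sum>i\<le>n. bin n i * (if e = e1 \<and> i + p * m + s = a \<and> e' = e2 \<and> n - i + m = b then 1 else 0)) =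
        bin n k * (if e = e1 \<and> k + p * m + s = a \<and> e' = e2 \<and> n - k + m = b then 1 else 0)"
      using a by (intro sum_eq_single) auto
    also have "\<dots> = bin n k" using True a b by simp
    finally show ?thesis using True a b by (simp add: R_def)
  next
    case False
    then have "(\<Sum>i\<le>n. bin n i * (if e = e1 \<and> i + p * m + s = a \<and> e' = e2 \<and> n - i + m = b then 1 else 0)) = 0"
      by (intro sum.neutral) auto
    moreover have "R (a + b - s) m (a - s) = 0" if "e = e1" "e' = e2" "s \<le> a" "a + b = n + (p + 1) * m + s"
      using that False by (auto simp: R_def binomial_eq_0)
    ultimately show ?thesis by auto
  qed
  finally show ?thesis .
qed

text \<open>The shape of the coefficients of length two of an element of the ideal. It only involves the sums
  over \<open>m\<close> with $(p + 1) m \le D$, as \<open>R D m\<close> vanishes otherwise.\<close>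

definition ideal2_coeffs where
  "ideal2_coeffs x E F G J \<longleftrightarrow> (
     (\<forall>a\<ge>1. \<forall>b\<ge>1. coeff2 x True a True b = (\<Sum>m=1..a + b. E (a + b) m * R (a + b) m a)) \<and>
     (\<forall>a\<ge>1. \<forall>b. coeff2 x True a False b = (\<Sum>m=1..a + b. F (a + b) m * R (a + b) m a)
        + (\<Sum>m\<le>a + b. G (a + b) m * R (a + b - 1) m (a - 1))) \<and>
     (\<forall>a. \<forall>b\<ge>1. coeff2 x False a True b = - (\<Sum>m=1..a + b. F (a + b) m * R (a + b) m a)) \<and>
     (\<forall>a b. coeff2 x False a False b = (\<Sum>m\<le>a + b. J (a + b) m * (if a = 0 then 0 else R (a + b - 1) m (a - 1)))))"

definition ideal2 :: "'p free_alg \<Rightarrow> bool" where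
  "ideal2 x \<longleftrightarrow> (\<exists>E F G J. ideal2_coeffs x E F G J)"

lemma ideal2_coeffsD:
  assumes "ideal2_coeffs x E F G J"
  shows "\<And>a b. 1 \<le> a \<Longrightarrow> 1 \<le> b \<Longrightarrow> coeff2 x True a True b = (\<Sum>m=1..a + b. E (a + b) m * R (a + b) m a)"
     "\<And>a b. 1 \<le> a \<Longrightarrow> coeff2 x True a False b = (\<Sum>m=1..a + b. F (a + b) m * R (a + b) m a)
        + (\<Sum>m\<le>a + b. G (a + b) m * R (a + b - 1) m (a - 1))"
     "\<And>a b. 1 \<le> b \<Longrightarrow> coeff2 x False a True b = - (\<Sum>m=1..a + b. F (a + b) m * R (a + b) m a)"
     "\<And>a b. coeff2 x False a False b = (\<Sum>m\<le>a + b. J (a + b) m * (if a = 0 then 0 else R (a + b - 1) m (a - 1)))"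
  using assms unfolding ideal2_coeffs_def by blast+

lemma ideal2_add:
  assumes "ideal2 x" "ideal2 y"
  shows "ideal2 (x + y)"
proof -
  have c: "coeff2 (x + y) e a e' b = coeff2 x e a e' b + coeff2 y e a e' b" for e a e' b
    by (simp add: coeff2_def lookup_add)
  obtain E F G J where "ideal2_coeffs x E F G J"
    using assms(1) unfolding ideal2_def by blast
  note 1 = ideal2_coeffsD[OF this]
  obtain E' F' G' J' where "ideal2_coeffs y E' F' G' J'"
    using assms(2) unfolding ideal2_def by blast
  note 2 = ideal2_coeffsD[OF this]
  show ?thesis
    unfolding ideal2_def ideal2_coeffs_def
    by (rule exI[of _ "\<lambda>D m. E D m + E' D m"], rule exI[of _ "\<lambda>D m. F D m + F' D m"],
        rule exI[of _ "\<lambda>D m. G D m + G' D m"], rule exI[of _ "\<lambda>D m. J D m + J' D m"])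
       (intro conjI allI impI; simp only: c 1 2 distrib_right sum.distrib minus_add_distrib; simp only: add_ac)
qed

lemma ideal2_scale:
  assumes "ideal2 x" "\<And>e a e' b. coeff2 y e a e' b = k * coeff2 x e a e' b"
  shows "ideal2 y"
proof -
  obtain E F G J where "ideal2_coeffs x E F G J"
    using assms(1) unfolding ideal2_def by blast
  note 1 = ideal2_coeffsD[OF this]
  show ?thesis
    unfolding ideal2_def ideal2_coeffs_def
    by (rule exI[of _ "\<lambda>D m. k * E D m"], rule exI[of _ "\<lambda>D m. k * F D m"],
        rule exI[of _ "\<lambda>D m. k * G D m"], rule exI[of _ "\<lambda>D m. k * J D m"])
       (intro conjI allI impI; simp only: assms(2) 1 sum_distrib_left mult.assoc distrib_left mult_minus_right)
qed

lemma sum_delta_R: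
  "1 \<le> m \<Longrightarrow> (\<Sum>m'=1..D. (if D = k \<and> m' = m then 1 else 0) * R D m' a) = (if D = k then R D m a else 0)"
  "(\<Sum>m'\<le>D. (if D = k \<and> m' = m then 1 else 0) * R (D - 1) m' b) = (if D = k then R (D - 1) m b else 0)"
proof -
  have m: "D < m \<Longrightarrow> R D m a = 0" "D < m \<Longrightarrow> R (D - 1) m a = 0" for a by (auto simp: R_def)
  show "1 \<le> m \<Longrightarrow> (\<Sum>m'=1..D. (if D = k \<and> m' = m then 1 else 0) * R D m' a) = (if D = k then R D m a else 0)"
    using m by (cases "m \<le> D") (auto simp: if_distrib[of "\<lambda>x. x * _"] if_distribR sum.delta cong: if_cong)
  show "(\<Sum>m'\<le>D. (if D = k \<and> m' = m then 1 else 0) * R (D - 1) m' b) = (if D = k then R (D - 1) m b else 0)"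
    using m by (cases "m \<le> D") (auto simp: if_distrib[of "\<lambda>x. x * _"] if_distribR sum.delta cong: if_cong)
qed

text \<open>A single relation has a fixed sum \<open>k = a + b\<close> and a fixed \<open>m\<close>;
  the flags record the words that it involves: \<open>tt\<close> for \<lambda>\<lambda>,
  \<open>tf\<close> for \<lambda>\<mu> and \<mu>\<lambda> with opposite signs, \<open>tf'\<close>
  for \<lambda>\<mu> with the factor x1, \<open>ff\<close> for \<mu>\<mu>.\<close>

lemma ideal2_relI:
  assumes "\<And>a b. 1 \<le> a \<Longrightarrow> 1 \<le> b \<Longrightarrow> coeff2 x True a True b = (if tt \<and> a + b = k then R (a + b) m a else 0)"
    and "\<And>a b. 1 \<le> a \<Longrightarrow> coeff2 x True a False b = (if tf \<and> a + b = k then R (a + b) m a else 0)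
       + (if tf' \<and> a + b = k then R (a + b - 1) m (a - 1) else 0)"
    and "\<And>a b. 1 \<le> b \<Longrightarrow> coeff2 x False a True b = - (if tf \<and> a + b = k then R (a + b) m a else 0)"
    and "\<And>a b. coeff2 x False a False b = (if ff \<and> 1 \<le> a \<and> a + b = k then R (a + b - 1) m (a - 1) else 0)"
    and m: "tt \<or> tf \<Longrightarrow> 1 \<le> m"
  shows "ideal2 x"
proof -
  define E where "E P D m' = (if P then (if D = k \<and> m' = m then 1 else 0) else (0 :: 'p mod_ring))" for P D m'
  have 1: "(\<Sum>m'=1..D. E P D m' * R D m' a) = (if P \<and> D = k then R D m a else 0)" if "P \<Longrightarrow> 1 \<le> m" for P D a
    using sum_delta_R(1)[of m D k a] that by (cases P) (simp_all add: E_def)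
  have 2: "(\<Sum>m'\<le>D. E P D m' * R (D - 1) m' b) = (if P \<and> D = k then R (D - 1) m b else 0)" for P D b
    using sum_delta_R(2)[of D k m b] by (cases P) (simp_all add: E_def)
  have 3: "(\<Sum>m'\<le>D. E P D m' * (if a = 0 then 0 else R (D - 1) m' b)) = (if P \<and> 1 \<le> a \<and> D = k then R (D - 1) m b else 0)" for P D b and a :: nat
    using 2[of P D b] by (cases "a = 0") auto
  note E1 = 1[of tt, OF m[OF disjI1]] and E2 = 1[of tf, OF m[OF disjI2]]
  show ?thesis
    unfolding ideal2_def ideal2_coeffs_def
    by (rule exI[of _ "E tt"], rule exI[of _ "E tf"], rule exI[of _ "E tf'"], rule exI[of _ "E ff"])
       (intro conjI allI impI; simp only: assms(1-4) E1 E2 2 3)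
qed

lemma ideal2_rel:
  assumes "r \<in> lambda_rels"
  shows "ideal2 r"
  using assms
proof cases
  case (lam_lam m n)
  have r: "r = relS 0 True True n m" using lam_lam by (simp add: relS_def)
  show ?thesis
    by (rule ideal2_relI[where k = "n + (p + 1) * m" and m = m and tt = True and tf = False and tf' = False and ff = False])
       (use lam_lam(2) in \<open>simp_all add: r coeff2_relS del: distrib_right_numeral add_mult_distrib\<close>)
next
  case (lam_mu_mu_lam m n)
  have r: "r = relS 0 True False n m - relS 0 False True n m"
    using lam_mu_mu_lam by (simp add: relS_def sum_subtractf right_diff_distrib)
  have d: "coeff2 (x - y) e a e' b = coeff2 x e a e' b - coeff2 y e a e' b" for x y e a e' b
    by (simp add: coeff2_def lookup_minus)
  show ?thesis
    by (rule ideal2_relI[where k = "n + (p + 1) * m" and m = m and tt = False and tf = True and tf' = False and ff = False])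
       (use lam_mu_mu_lam(2) in \<open>simp_all add: r d coeff2_relS\<close>)
next
  case (lam_mu n m)
  have r: "r = relS 1 True False n m" using lam_mu by (simp add: relS_def)
  show ?thesis
    by (rule ideal2_relI[where k = "n + (p + 1) * m + 1" and m = m and tt = False and tf = False and tf' = True and ff = False])
       (simp_all add: r coeff2_relS)
next
  case (mu_mu n m)
  have r: "r = relS 1 False False n m" using mu_mu by (simp add: relS_def)
  show ?thesis
    by (rule ideal2_relI[where k = "n + (p + 1) * m + 1" and m = m and tt = False and tf = False and tf' = False and ff = True])
       (simp_all add: r coeff2_relS)
qed

text \<open>In \<open>a * r * b\<close> only the constant terms of \<open>a\<close> and
  \<open>b\<close> matter in length two, since a relation \<open>r\<close> has no shorter
  words.\<close>

lemma ideal2: "x \<in> lambda_ideal \<Longrightarrow> ideal2 x"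
proof (induction rule: lambda_ideal.induct)
  case zero
  show ?case unfolding ideal2_def ideal2_coeffs_def
    by (intro exI[of _ "\<lambda>_ _. 0"]) (simp add: coeff2_def)
next
  case (rel r a b)
  show ?case
    by (rule ideal2_scale[OF ideal2_rel[OF rel], where k = "Poly_Mapping.lookup a 0 * Poly_Mapping.lookup b 0"])
       (simp add: coeff2_def lookup_mult_2 lookup_mult_1 lookup_mult_0 rels_lookup_1[OF rel] lambda_rels_0[OF rel])
qed (rule ideal2_add)

end

section \<open>Cocycles of length one in coefficients\<close>

context odd_card
begin

definition len1 :: "'p free_alg \<Rightarrow> bool" where
  "len1 x \<longleftrightarrow> (\<forall>w\<in>Poly_Mapping.keys x. length (letters w) = 1)"

lemma len1_rep: "a \<in> lambda_len 1 \<Longrightarrow> \<exists>x. a = abs_lambda x \<and> len1 x"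
  by (auto simp: lambda_len_def len1_def)

lemma len1_lookup: "len1 x \<Longrightarrow> length (letters w) \<noteq> 1 \<Longrightarrow> Poly_Mapping.lookup x w = 0"
  by (auto simp: len1_def in_keys_iff)

lemma coeff2_add: "coeff2 (x + y) e a e' b = coeff2 x e a e' b + coeff2 y e a e' b"
  and coeff2_diff: "coeff2 (x - y) e a e' b = coeff2 x e a e' b - coeff2 y e a e' b"
  and coeff2_sum: "coeff2 (sum f S) e a e' b = (\<Sum>i\<in>S. coeff2 (f i) e a e' b)"
  and coeff2_of_nat: "coeff2 (of_nat n * x) e a e' b = of_nat n * coeff2 x e a e' b"
  and coeff2_fscal: "coeff2 (fscal c * x) e a e' b = c * coeff2 x e a e' b"
  by (simp_all add: coeff2_def lookup_add lookup_minus lookup_sum lookup_of_nat_mult lookup_fscal_mult)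

lemma sum_keys_delta:
  assumes "len1 x"
  shows "(\<Sum>w\<in>Poly_Mapping.keys x. Poly_Mapping.lookup x w * (if letters w = [g] then k else 0)) =
    Poly_Mapping.lookup x (Word [g]) * k"
proof -
  have "letters w = [g] \<longleftrightarrow> w = Word [g]" for w by (cases w) auto
  then have "(\<Sum>w\<in>Poly_Mapping.keys x. Poly_Mapping.lookup x w * (if letters w = [g] then k else 0)) =
      (\<Sum>w\<in>Poly_Mapping.keys x. if w = Word [g] then Poly_Mapping.lookup x w * k else 0)"
    by (intro sum.cong) auto
  then show ?thesis by (simp add: in_keys_iff)
qed

lemma coeff2_dgen:
  "1 \<le> a \<Longrightarrow> 1 \<le> b \<Longrightarrow> coeff2 (dgen g) True a True b = (if [g] = [Lam (a + b - 1)] then bin (a + b) a else 0)"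
  "1 \<le> a \<Longrightarrow> coeff2 (dgen g) True a False b = (if [g] = [Mu (a + b)] then bin (a + b) a else 0)"
  "1 \<le> b \<Longrightarrow> coeff2 (dgen g) False a True b = (if [g] = [Mu (a + b)] then - bin (a + b) a else 0)"
  "coeff2 (dgen g) False a False b = 0"
proof -
  have L: "dgen (Lam k) = (relS 0 True True (k + 1) 0 :: 'p free_alg)" for k
    by (simp add: relS_def)
  have M: "dgen (Mu n) = (relS 0 True False n 0 - relS 0 False True n 0 :: 'p free_alg)" for n
    by (simp add: relS_def sum_subtractf right_diff_distrib)
  show "1 \<le> a \<Longrightarrow> 1 \<le> b \<Longrightarrow> coeff2 (dgen g) True a True b = (if [g] = [Lam (a + b - 1)] then bin (a + b) a else 0)"
    by (cases g) (auto simp: L M coeff2_diff coeff2_relS simp del: dgen.simps)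
  show "1 \<le> a \<Longrightarrow> coeff2 (dgen g) True a False b = (if [g] = [Mu (a + b)] then bin (a + b) a else 0)"
    by (cases g) (auto simp: L M coeff2_diff coeff2_relS simp del: dgen.simps)
  show "1 \<le> b \<Longrightarrow> coeff2 (dgen g) False a True b = (if [g] = [Mu (a + b)] then - bin (a + b) a else 0)"
    by (cases g) (auto simp: L M coeff2_diff coeff2_relS simp del: dgen.simps)
  show "coeff2 (dgen g) False a False b = 0"
    by (cases g) (auto simp: L M coeff2_diff coeff2_relS simp del: dgen.simps)
qed

lemma coeff2_free_d_sum:
  assumes "len1 x" "\<And>g. coeff2 (dgen g) e a e' b = (if [g] = [g'] then k else 0)"
  shows "coeff2 (free_d x) e a e' b = Poly_Mapping.lookup x (Word [g']) * k"
proof -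
  have "coeff2 (dword (letters w)) e a e' b = (if letters w = [g'] then k else 0)" if w: "w \<in> Poly_Mapping.keys x" for w
  proof -
    obtain g where g: "letters w = [g]"
      using bspec[OF assms(1)[unfolded len1_def] w] by (auto simp: length_Suc_conv)
    have "dword [g] = (dgen g :: 'p free_alg)"
      by (simp flip: zero_lword_def)
    then show ?thesis using assms(2) g by simp
  qed
  then have "coeff2 (free_d x) e a e' b =
      (\<Sum>w\<in>Poly_Mapping.keys x. Poly_Mapping.lookup x w * (if letters w = [g'] then k else 0))"
    by (simp add: free_d_def pm_ext_def coeff2_sum coeff2_fscal)
  then show ?thesis using sum_keys_delta[OF assms(1)] by simp
qed

lemma coeff2_free_d:
  assumes "len1 x"
  shows "1 \<le> a \<Longrightarrow> 1 \<le> b \<Longrightarrow> coeff2 (free_d x) True a True b = Poly_Mapping.lookup x (Word [Lam (a + b - 1)]) * bin (a + b) a"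
  "1 \<le> a \<Longrightarrow> coeff2 (free_d x) True a False b = Poly_Mapping.lookup x (Word [Mu (a + b)]) * bin (a + b) a"
  "1 \<le> b \<Longrightarrow> coeff2 (free_d x) False a True b = Poly_Mapping.lookup x (Word [Mu (a + b)]) * - bin (a + b) a"
  "coeff2 (free_d x) False a False b = 0"
proof -
  show "1 \<le> a \<Longrightarrow> 1 \<le> b \<Longrightarrow> coeff2 (free_d x) True a True b = Poly_Mapping.lookup x (Word [Lam (a + b - 1)]) * bin (a + b) a"
    by (rule coeff2_free_d_sum[OF assms]) (rule coeff2_dgen)
  show "1 \<le> a \<Longrightarrow> coeff2 (free_d x) True a False b = Poly_Mapping.lookup x (Word [Mu (a + b)]) * bin (a + b) a"
    by (rule coeff2_free_d_sum[OF assms]) (rule coeff2_dgen)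
  show "1 \<le> b \<Longrightarrow> coeff2 (free_d x) False a True b = Poly_Mapping.lookup x (Word [Mu (a + b)]) * - bin (a + b) a"
    by (rule coeff2_free_d_sum[OF assms]) (rule coeff2_dgen)
  show "coeff2 (free_d x) False a False b = 0"
    using coeff2_free_d_sum[OF assms, of False a False b undefined 0] by (simp add: coeff2_dgen)
qed

lemma lookup_free_sgn: "Poly_Mapping.lookup (free_sgn x :: 'p free_alg) w = (-1) ^ wdeg CARD('p) w * Poly_Mapping.lookup x w"
  by (induction x rule: pm_induct) (auto simp: free_sgn_additive free_sgn_single lookup_single when_def lookup_add distrib_left)

lemma lookup_free_sgn_gw: "Poly_Mapping.lookup (free_sgn x :: 'p free_alg) (Word [gw e a]) =
    (if e then - Poly_Mapping.lookup x (Word [gw e a]) else Poly_Mapping.lookup x (Word [gw e a]))"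
  by (cases e) (simp_all add: lookup_free_sgn wdeg_def gw_def gdeg_sign)

lemma coeff2_sgn_fg:
  assumes "len1 x" "e2 \<longrightarrow> 1 \<le> b"
  shows "coeff2 (free_sgn x * fg e i) e1 a e2 b =
    (if e = e2 \<and> i = b then (if e1 then - Poly_Mapping.lookup x (Word [gw e1 a]) else Poly_Mapping.lookup x (Word [gw e1 a])) else 0)"
proof -
  have "Poly_Mapping.lookup x 0 = 0" "Poly_Mapping.lookup x (Word [g, h]) = 0" for g h
    using assms(1) by (auto intro!: len1_lookup)
  then show ?thesis
    unfolding coeff2_def lookup_mult_2 using assms(2)
    by (simp add: lookup_fg lookup_free_sgn_gw)
qed

lemma sum_bin_delta:
  "1 \<le> b \<Longrightarrow> (\<Sum>i=1..t. bin t i * (if i = b then f i else 0)) = bin t b * f b"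
  "(\<Sum>i\<le>t. bin t i * (if i = b then f i else 0)) = bin t b * f b"
proof -
  show "1 \<le> b \<Longrightarrow> (\<Sum>i=1..t. bin t i * (if i = b then f i else 0)) = bin t b * f b"
    by (cases "b \<le> t") (auto simp: if_distrib[of "\<lambda>x. _ * x"] sum.delta binomial_eq_0 cong: if_cong)
  show "(\<Sum>i\<le>t. bin t i * (if i = b then f i else 0)) = bin t b * f b"
    by (cases "b \<le> t") (auto simp: if_distrib[of "\<lambda>x. _ * x"] sum.delta binomial_eq_0 cong: if_cong)
qed

text \<open>Coefficients in front of \<open>ab^[t]\<close> for \<open>cO\<close>, and for
  \<open>cE\<close> in front of \<open>b^[t + 1]\<close>, which is indexed by
  \<open>Even t\<close>.\<close>

definition cO :: "(pbasis \<Rightarrow>\<^sub>0 'p lambda) \<Rightarrow> nat \<Rightarrow> bool \<Rightarrow> nat \<Rightarrow> 'p mod_ring" where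
  "cO z t e a = co (Poly_Mapping.lookup z (Odd t)) (gw e a)"

definition cE :: "(pbasis \<Rightarrow>\<^sub>0 'p lambda) \<Rightarrow> nat \<Rightarrow> bool \<Rightarrow> nat \<Rightarrow> 'p mod_ring" where
  "cE z t e a = co (Poly_Mapping.lookup z (Even t)) (gw e a)"

lemma abs_lambda_fg: "abs_lambda (fg True i) = lam i" "abs_lambda (fg False i) = mu i"
  by (simp_all add: lam_def mu_def)

lemma cocycle_reps:
  assumes "z \<in> cocyclesP 1"
  obtains X where "\<And>h. Poly_Mapping.lookup z h = abs_lambda (X h)" "\<And>h. len1 (X h)"
    "\<And>t e a. cO z t e a = Poly_Mapping.lookup (X (Odd t)) (Word [gw e a])"
    "\<And>t e a. cE z t e a = Poly_Mapping.lookup (X (Even t)) (Word [gw e a])"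
proof -
  have "\<forall>h. \<exists>x. Poly_Mapping.lookup z h = abs_lambda x \<and> len1 x"
    using assms len1_rep by (auto simp: cocyclesP_def)
  then obtain X where "\<And>h. Poly_Mapping.lookup z h = abs_lambda (X h) \<and> len1 (X h)" by metis
  then show ?thesis using that[of X] by (simp add: cO_def cE_def co_abs)
qed

text \<open>The component of the coboundary at \<open>ab^[t]\<close>, lifted to the free algebra,
  lies in the ideal; \<open>ideal2\<close> supplies the multipliers for the words
  \<lambda>\<lambda>, \<lambda>\<mu>, \<mu>\<lambda> and \<mu>\<mu>, in this order. \<open>F\<close>
  occurs twice because one relation ties \<lambda>\<mu> to \<mu>\<lambda>.\<close>

lemma cocycle_Odd:
  assumes z: "z \<in> cocyclesP 1"
  obtains E F G J where
    "\<And>a b. 1 \<le> a \<Longrightarrow> 1 \<le> b \<Longrightarrow>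
      cO z t True (a + b) * bin (a + b) a - cO z (t + b * (p - 1)) True a * bin t b =
      (\<Sum>m=1..a + b. E (a + b) m * R (a + b) m a)"
    "\<And>a b. 1 \<le> a \<Longrightarrow>
      cO z t False (a + b) * bin (a + b) a - cE z (t + b * (p - 1)) True a * bin t b =
      (\<Sum>m=1..a + b. F (a + b) m * R (a + b) m a) + (\<Sum>m\<le>a + b. G (a + b) m * R (a + b - 1) m (a - 1))"
    "\<And>a b. 1 \<le> b \<Longrightarrow>
      - (cO z t False (a + b) * bin (a + b) a) + cO z (t + b * (p - 1)) False a * bin t b =
      - (\<Sum>m=1..a + b. F (a + b) m * R (a + b) m a)"
    "\<And>a b. cE z (t + b * (p - 1)) False a * bin t b =
      (\<Sum>m\<le>a + b. J (a + b) m * (if a = 0 then 0 else R (a + b - 1) m (a - 1)))"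
proof -
  obtain X where X: "\<And>h. Poly_Mapping.lookup z h = abs_lambda (X h)" "\<And>h. len1 (X h)"
    "\<And>t e a. cO z t e a = Poly_Mapping.lookup (X (Odd t)) (Word [gw e a])"
    "\<And>t e a. cE z t e a = Poly_Mapping.lookup (X (Even t)) (Word [gw e a])"
    using cocycle_reps[OF z] by metis
  define y where "y = free_d (X (Odd t))
    + (\<Sum>i=1..t. of_nat (t choose i) * (free_sgn (X (Odd (t + i * (p - 1)))) * fg True i))
    + (\<Sum>i\<le>t. of_nat (t choose i) * (free_sgn (X (Even (t + i * (p - 1)))) * fg False i))"
  have "abs_lambda y = Poly_Mapping.lookup (cochain_d P_module z) (Odd t)"
    unfolding y_def lookup_cochain_d card_p X(1)
    by (simp only: abs_lambda_hom abs_lambda_sum abs_lambda_of_nat abs_lambda_fg lam_d.abs_eq lam_sgn.abs_eq)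
  also have "\<dots> = abs_lambda 0"
    using z by (simp add: cocyclesP_def zero_lambda_def)
  finally have "y \<in> lambda_ideal" by (simp add: lambda.abs_eq_iff)
  then obtain E F G J where "ideal2_coeffs y E F G J" using ideal2 unfolding ideal2_def by blast
  note D = ideal2_coeffsD[OF this]
  note c2y = y_def coeff2_add coeff2_sum coeff2_of_nat
  have sO: "coeff2 (free_sgn (X (Odd s)) * fg e i) e1 a e2 b =
      (if e = e2 \<and> i = b then (if e1 then - cO z s e1 a else cO z s e1 a) else 0)"
    and sE: "coeff2 (free_sgn (X (Even s)) * fg e i) e1 a e2 b =
      (if e = e2 \<and> i = b then (if e1 then - cE z s e1 a else cE z s e1 a) else 0)"
    if "e2 \<longrightarrow> 1 \<le> b" for s e i e1 a e2 b
    unfolding X(3,4) by (rule coeff2_sgn_fg[OF X(2) that])+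
  have gw: "Lam (n - 1) = gw True n" "Mu n = gw False n" for n by (simp_all add: gw_def)
  note d = coeff2_free_d[OF X(2), unfolded gw]
  note simps = sO sE d X(3,4)[symmetric] simp_thms if_True if_False mult_zero_right sum.neutral_const sum_bin_delta
    add_0_right add_0_left mult_minus_right
  show ?thesis
  proof (rule that[of E F G J])
    fix a b :: nat
    {
      assume a: "1 \<le> a" and b: "1 \<le> b"
      have "coeff2 y True a True b = cO z t True (a + b) * bin (a + b) a - cO z (t + b * (p - 1)) True a * bin t b"
        unfolding c2y using a b 
        by (simp only: simps) (simp only: diff_conv_add_uminus mult.commute)
      then show "cO z t True (a + b) * bin (a + b) a - cO z (t + b * (p - 1)) True a * bin t b =
        (\<Sum>m=1..a + b. E (a + b) m * R (a + b) m a)"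
        using D(1)[OF a b] by simp
    }
    {
      assume a: "1 \<le> a"
      have "coeff2 y True a False b = cO z t False (a + b) * bin (a + b) a - cE z (t + b * (p - 1)) True a * bin t b"
        unfolding c2y using a 
        by (simp only: simps) (simp only: diff_conv_add_uminus mult.commute)
      then show "cO z t False (a + b) * bin (a + b) a - cE z (t + b * (p - 1)) True a * bin t b =
        (\<Sum>m=1..a + b. F (a + b) m * R (a + b) m a) + (\<Sum>m\<le>a + b. G (a + b) m * R (a + b - 1) m (a - 1))"
        using D(2)[OF a, of b] by simp
    }
    {
      assume b: "1 \<le> b"
      have "coeff2 y False a True b = - (cO z t False (a + b) * bin (a + b) a) + cO z (t + b * (p - 1)) False a * bin t b"
        unfolding c2y using b 
        by (simp only: simps) (simp only: diff_conv_add_uminus mult.commute)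
      then show "- (cO z t False (a + b) * bin (a + b) a) + cO z (t + b * (p - 1)) False a * bin t b =
        - (\<Sum>m=1..a + b. F (a + b) m * R (a + b) m a)"
        using D(3)[OF b, of a] by simp
    }
    have "coeff2 y False a False b = cE z (t + b * (p - 1)) False a * bin t b"
      unfolding c2y
      by (simp only: simps) (simp only: diff_conv_add_uminus mult.commute)
    then show "cE z (t + b * (p - 1)) False a * bin t b =
        (\<Sum>m\<le>a + b. J (a + b) m * (if a = 0 then 0 else R (a + b - 1) m (a - 1)))"
      using D(4)[of a b] by simp
  qed
qed

lemma cocycle_Even:
  assumes z: "z \<in> cocyclesP 1"
  obtains E F where
    "\<And>a b. 1 \<le> a \<Longrightarrow> 1 \<le> b \<Longrightarrow>
      cE z t True (a + b) * bin (a + b) a - cE z (t + b * (p - 1)) True a * bin (t + 1) b =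
      (\<Sum>m=1..a + b. E (a + b) m * R (a + b) m a)"
    "\<And>a b. 1 \<le> b \<Longrightarrow>
      - (cE z t False (a + b) * bin (a + b) a) + cE z (t + b * (p - 1)) False a * bin (t + 1) b =
      - (\<Sum>m=1..a + b. F (a + b) m * R (a + b) m a)"
proof -
  obtain X where X: "\<And>h. Poly_Mapping.lookup z h = abs_lambda (X h)" "\<And>h. len1 (X h)"
    "\<And>t e a. cO z t e a = Poly_Mapping.lookup (X (Odd t)) (Word [gw e a])"
    "\<And>t e a. cE z t e a = Poly_Mapping.lookup (X (Even t)) (Word [gw e a])"
    using cocycle_reps[OF z] by metis
  define y where "y = free_d (X (Even t))
    + (\<Sum>i=1..t + 1. of_nat ((t + 1) choose i) * (free_sgn (X (Even (t + i * (p - 1)))) * fg True i))"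
  have "abs_lambda y = Poly_Mapping.lookup (cochain_d P_module z) (Even t)"
    unfolding y_def lookup_cochain_d card_p X(1)
    by (simp only: abs_lambda_hom abs_lambda_sum abs_lambda_of_nat abs_lambda_fg lam_d.abs_eq lam_sgn.abs_eq)
  also have "\<dots> = abs_lambda 0"
    using z by (simp add: cocyclesP_def zero_lambda_def)
  finally have "y \<in> lambda_ideal" by (simp add: lambda.abs_eq_iff)
  then obtain E F G J where "ideal2_coeffs y E F G J" using ideal2 unfolding ideal2_def by blast
  note D = ideal2_coeffsD[OF this]
  note c2y = y_def coeff2_add coeff2_sum coeff2_of_nat
  have sO: "coeff2 (free_sgn (X (Odd s)) * fg e i) e1 a e2 b =
      (if e = e2 \<and> i = b then (if e1 then - cO z s e1 a else cO z s e1 a) else 0)"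
    and sE: "coeff2 (free_sgn (X (Even s)) * fg e i) e1 a e2 b =
      (if e = e2 \<and> i = b then (if e1 then - cE z s e1 a else cE z s e1 a) else 0)"
    if "e2 \<longrightarrow> 1 \<le> b" for s e i e1 a e2 b
    unfolding X(3,4) by (rule coeff2_sgn_fg[OF X(2) that])+
  have gw: "Lam (n - 1) = gw True n" "Mu n = gw False n" for n by (simp_all add: gw_def)
  note d = coeff2_free_d[OF X(2), unfolded gw]
  note simps = sO sE d X(3,4)[symmetric] simp_thms if_True if_False mult_zero_right sum.neutral_const sum_bin_delta
    add_0_right add_0_left mult_minus_right
  show ?thesis
  proof (rule that[of E F])
    fix a b :: nat
    {
      assume a: "1 \<le> a" and b: "1 \<le> b"
      have "coeff2 y True a True b = cE z t True (a + b) * bin (a + b) a - cE z (t + b * (p - 1)) True a * bin (t + 1) b"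
        unfolding c2y using a b 
        by (simp only: simps) (simp only: diff_conv_add_uminus mult.commute)
      then show "cE z t True (a + b) * bin (a + b) a - cE z (t + b * (p - 1)) True a * bin (t + 1) b =
        (\<Sum>m=1..a + b. E (a + b) m * R (a + b) m a)"
        using D(1)[OF a b] by simp
    }
    {
      assume b: "1 \<le> b"
      have "coeff2 y False a True b = - (cE z t False (a + b) * bin (a + b) a) + cE z (t + b * (p - 1)) False a * bin (t + 1) b"
        unfolding c2y using b 
        by (simp only: simps) (simp only: diff_conv_add_uminus mult.commute)
      then show "- (cE z t False (a + b) * bin (a + b) a) + cE z (t + b * (p - 1)) False a * bin (t + 1) b =
        - (\<Sum>m=1..a + b. F (a + b) m * R (a + b) m a)"
        using D(3)[OF b, of a] by simp
    }
  qed
qed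

end

section \<open>Cochains with $w \le 1$ and fixed total degree\<close>

context odd_card
begin

lemma len1_expand:
  fixes a :: "'p lambda"
  assumes "a \<in> lambda_len 1"
  shows "\<exists>K. \<forall>L\<ge>K. a = (\<Sum>i=1..L. lscal (co a (gw True i)) * lam i) + (\<Sum>i\<le>L. lscal (co a (gw False i)) * mu i)"
proof -
  obtain x where x: "a = abs_lambda x" "len1 x" using len1_rep[OF assms] by blast
  define ind where "ind w = (case letters w of [] \<Rightarrow> 0 | g # _ \<Rightarrow> (case g of Lam n \<Rightarrow> n + 1 | Mu n \<Rightarrow> n))" for w
  define K where "K = Max (insert 0 (ind ` Poly_Mapping.keys x))"
  have K: "ind w \<le> K" if "w \<in> Poly_Mapping.keys x" for w
    unfolding K_def using that by (intro Max_ge) auto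
  show ?thesis
  proof (intro exI[of _ K] allI impI)
    fix L assume L: "K \<le> L"
    define y where "y = (\<Sum>i=1..L. fscal (Poly_Mapping.lookup x (Word [gw True i])) * fg True i)
        + (\<Sum>i\<le>L. fscal (Poly_Mapping.lookup x (Word [gw False i])) * fg False i :: 'p free_alg)"
    have fg: "fg e i = (Poly_Mapping.single (Word [gw e i]) 1 :: 'p free_alg)" if "e \<longrightarrow> 1 \<le> i" for e i
      using that by (cases e) (auto simp: fg_def flam_def fmu_def gw_def)
    have "x = y"
    proof (rule poly_mapping_eqI)
      fix w
      have y: "Poly_Mapping.lookup y w =
          (\<Sum>i=1..L. Poly_Mapping.lookup x (Word [gw True i]) when Word [gw True i] = w)
          + (\<Sum>i\<le>L. Poly_Mapping.lookup x (Word [gw False i]) when Word [gw False i] = w)"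
      proof -
        have w: "c * (1 when P) = (c when P)" for c :: "'p mod_ring" and P by (cases P) simp_all
        have "(\<Sum>i=1..L. Poly_Mapping.lookup x (Word [gw True i]) * Poly_Mapping.lookup (fg True i) w) =
            (\<Sum>i=1..L. Poly_Mapping.lookup x (Word [gw True i]) when Word [gw True i] = w)"
          by (intro sum.cong refl, subst fg) (auto simp only: lookup_single w atLeastAtMost_iff)
        moreover have "(\<Sum>i\<le>L. Poly_Mapping.lookup x (Word [gw False i]) * Poly_Mapping.lookup (fg False i) w) =
            (\<Sum>i\<le>L. Poly_Mapping.lookup x (Word [gw False i]) when Word [gw False i] = w)"
          by (intro sum.cong refl, subst fg) (auto simp only: lookup_single w)
        ultimately show ?thesis unfolding y_def lookup_add lookup_sum lookup_fscal_mult by (simp only:)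
      qed
      show "Poly_Mapping.lookup x w = Poly_Mapping.lookup y w"
      proof (cases "length (letters w) = 1")
        case False
        then have "Word [g] \<noteq> w" for g by auto
        then show ?thesis using len1_lookup[OF x(2) False] by (simp add: y)
      next
        case True
        then obtain g where w: "w = Word [g]" by (cases w) (auto simp: length_Suc_conv)
        have xL: "Poly_Mapping.lookup x w = 0" if "L < ind w"
          using K[of w] that L by (auto simp: in_keys_iff)
        show ?thesis
        proof (cases g)
          case (Lam n)
          have "(\<Sum>i=1..L. Poly_Mapping.lookup x (Word [gw True i]) when Word [gw True i] = w) = Poly_Mapping.lookup x w"
          proof (cases "n + 1 \<le> L")
            case True
            have "(\<Sum>i=1..L. Poly_Mapping.lookup x (Word [gw True i]) when Word [gw True i] = w) =
                (Poly_Mapping.lookup x (Word [gw True (n + 1)]) when Word [gw True (n + 1)] = w)"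
              using True by (intro sum_eq_single) (auto simp: w Lam gw_def when_def)
            then show ?thesis by (simp add: w Lam gw_def)
          next
            case False
            then have "Poly_Mapping.lookup x w = 0" using xL by (simp add: ind_def w Lam)
            moreover have "(\<Sum>i=1..L. Poly_Mapping.lookup x (Word [gw True i]) when Word [gw True i] = w) = 0"
              using False by (intro sum.neutral) (auto simp: w Lam gw_def when_def)
            ultimately show ?thesis by simp
          qed
          moreover have "(\<Sum>i\<le>L. Poly_Mapping.lookup x (Word [gw False i]) when Word [gw False i] = w) = 0"
            by (intro sum.neutral) (auto simp: w Lam gw_def when_def)
          ultimately show ?thesis by (simp add: y)
        next
          case (Mu n)
          have "(\<Sum>i\<le>L. Poly_Mapping.lookup x (Word [gw False i]) when Word [gw False i] = w) = Poly_Mapping.lookup x w"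
          proof (cases "n \<le> L")
            case True
            have "(\<Sum>i\<le>L. Poly_Mapping.lookup x (Word [gw False i]) when Word [gw False i] = w) =
                (Poly_Mapping.lookup x (Word [gw False n]) when Word [gw False n] = w)"
              using True by (intro sum_eq_single) (auto simp: w Mu gw_def when_def)
            then show ?thesis by (simp add: w Mu gw_def)
          next
            case False
            then have "Poly_Mapping.lookup x w = 0" using xL by (simp add: ind_def w Mu)
            moreover have "(\<Sum>i\<le>L. Poly_Mapping.lookup x (Word [gw False i]) when Word [gw False i] = w) = 0"
              using False by (intro sum.neutral) (auto simp: w Mu gw_def when_def)
            ultimately show ?thesis by simp
          qed
          moreover have "(\<Sum>i=1..L. Poly_Mapping.lookup x (Word [gw True i]) when Word [gw True i] = w) = 0"
            by (intro sum.neutral) (auto simp: w Mu gw_def when_def)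
          ultimately show ?thesis by (simp add: y)
        qed
      qed
    qed
    then have "abs_lambda x = abs_lambda y" by simp
    also have "abs_lambda y = (\<Sum>i=1..L. lscal (co a (gw True i)) * lam i) + (\<Sum>i\<le>L. lscal (co a (gw False i)) * mu i)"
      unfolding y_def x(1) co_abs
      by (simp only: abs_lambda_hom abs_lambda_sum abs_lambda_fg lscal.abs_eq)
    finally show "a = (\<Sum>i=1..L. lscal (co a (gw True i)) * lam i) + (\<Sum>i\<le>L. lscal (co a (gw False i)) * mu i)"
      using x by simp
  qed
qed

text \<open>Every term has degree \<open>2 * N\<close>, as \<open>lam i\<close> has degree
  \<open>2i(p-1) - 1\<close> and \<open>ab^[t]\<close> has degree \<open>2t + 1\<close>. In
  \<open>Z1\<close> the total is \<open>2 * N + 1\<close>.\<close>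

definition Z0 :: "nat \<Rightarrow> (nat \<Rightarrow> 'p mod_ring) \<Rightarrow> pbasis \<Rightarrow>\<^sub>0 'p lambda" where
  "Z0 N c = (\<Sum>i | 1 \<le> i \<and> i * (p - 1) \<le> N. ab (lscal (c i) * lam i) (N - i * (p - 1)))"

definition Z1 :: "nat \<Rightarrow> (nat \<Rightarrow> 'p mod_ring) \<Rightarrow> (nat \<Rightarrow> 'p mod_ring) \<Rightarrow> pbasis \<Rightarrow>\<^sub>0 'p lambda" where
  "Z1 N c g = (\<Sum>i | i * (p - 1) \<le> N. ab (lscal (c i) * mu i) (N - i * (p - 1)))
     + (\<Sum>i | 1 \<le> i \<and> i * (p - 1) \<le> N. Poly_Mapping.single (Even (N - i * (p - 1))) (lscal (g i) * lam i))"

lemma index_le: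
  assumes "i * (p - 1) \<le> N"
  shows "i \<le> N"
proof -
  have "i * 1 \<le> i * (p - 1)" using p_ge_3 by (intro mult_le_mono2) simp
  then have "i \<le> i * (p - 1)" by (simp only: mult_1_right)
  then show ?thesis using assms by (rule order.trans)
qed

lemma finite_index: "finite {i. i * (p - 1) \<le> N}" "finite {i. 1 \<le> i \<and> i * (p - 1) \<le> N}"
proof -
  have "{i. i * (p - 1) \<le> N} \<subseteq> {..N}" using index_le by blast
  then show *: "finite {i. i * (p - 1) \<le> N}" by (rule finite_subset) simp
  show "finite {i. 1 \<le> i \<and> i * (p - 1) \<le> N}" by (rule finite_subset[OF _ *]) blast
qed

lemma index_inj: "i * (p - 1) = j * (p - 1) \<longleftrightarrow> i = j"
proof -
  have "p - 1 \<noteq> 0" using p_ge_3 by linarith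
  then show ?thesis unfolding mult_cancel2 by blast
qed

lemma lookup_index_sum:
  assumes "\<And>i. i \<in> S \<Longrightarrow> i * (p - 1) \<le> N"
  shows "(\<Sum>i\<in>S. v i when N - i * (p - 1) = t) = (\<Sum>i\<in>S. v i when t + i * (p - 1) = N)"
proof (intro sum.cong refl)
  have eq: "k \<le> N \<Longrightarrow> (N - k = t) = (t + k = N)" for k by auto
  fix i assume "i \<in> S"
  then show "(v i when N - i * (p - 1) = t) = (v i when t + i * (p - 1) = N)"
    by (simp only: eq[OF assms])
qed

lemma lookup_Z0:
  "Poly_Mapping.lookup (Z0 N c) (Odd t) = (\<Sum>i | 1 \<le> i \<and> i * (p - 1) \<le> N. lscal (c i) * lam i when t + i * (p - 1) = N)"
  "Poly_Mapping.lookup (Z0 N c) (Even t) = 0"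
proof -
  show "Poly_Mapping.lookup (Z0 N c) (Odd t) = (\<Sum>i | 1 \<le> i \<and> i * (p - 1) \<le> N. lscal (c i) * lam i when t + i * (p - 1) = N)"
    unfolding Z0_def ab_def lookup_sum lookup_single pbasis.inject by (rule lookup_index_sum) simp
  show "Poly_Mapping.lookup (Z0 N c) (Even t) = 0"
    by (simp only: Z0_def ab_def lookup_sum lookup_single pbasis.distinct when_simps sum.neutral_const)
qed

lemma lookup_Z1:
  "Poly_Mapping.lookup (Z1 N c g) (Odd t) = (\<Sum>i | i * (p - 1) \<le> N. lscal (c i) * mu i when t + i * (p - 1) = N)"
  "Poly_Mapping.lookup (Z1 N c g) (Even t) = (\<Sum>i | 1 \<le> i \<and> i * (p - 1) \<le> N. lscal (g i) * lam i when t + i * (p - 1) = N)"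
proof -
  have "Poly_Mapping.lookup (Z1 N c g) (Odd t) = (\<Sum>i | i * (p - 1) \<le> N. lscal (c i) * mu i when N - i * (p - 1) = t)"
    by (simp only: Z1_def ab_def lookup_add lookup_sum lookup_single pbasis.inject pbasis.distinct when_simps
        sum.neutral_const add_0_right)
  also have "\<dots> = (\<Sum>i | i * (p - 1) \<le> N. lscal (c i) * mu i when t + i * (p - 1) = N)"
    by (rule lookup_index_sum) simp
  finally show "Poly_Mapping.lookup (Z1 N c g) (Odd t) = \<dots>" .
  have "Poly_Mapping.lookup (Z1 N c g) (Even t) = (\<Sum>i | 1 \<le> i \<and> i * (p - 1) \<le> N. lscal (g i) * lam i when N - i * (p - 1) = t)"
    by (simp only: Z1_def ab_def lookup_add lookup_sum lookup_single pbasis.inject pbasis.distinct when_simps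
        sum.neutral_const add_0_left)
  also have "\<dots> = (\<Sum>i | 1 \<le> i \<and> i * (p - 1) \<le> N. lscal (g i) * lam i when t + i * (p - 1) = N)"
    by (rule lookup_index_sum) simp
  finally show "Poly_Mapping.lookup (Z1 N c g) (Even t) = \<dots>" .
qed

lemma index_sum_at:
  fixes v :: "nat \<Rightarrow> 'b::comm_monoid_add"
  assumes "finite S" "i \<in> S" "t + i * (p - 1) = N"
  shows "(\<Sum>j\<in>S. v j when t + j * (p - 1) = N) = v i"
proof -
  have eq: "j = i" if "t + j * (p - 1) = N" for j
  proof -
    have "t + j * (p - 1) = t + i * (p - 1)" by (rule trans[OF that assms(3)[symmetric]])
    then show ?thesis unfolding add_left_cancel index_inj .
  qed
  have "(\<Sum>j\<in>S. v j when t + j * (p - 1) = N) = (v i when t + i * (p - 1) = N)"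
  proof (rule sum_eq_single[OF assms(1,2)])
    fix j assume "j \<noteq> i"
    then have "t + j * (p - 1) \<noteq> N" using eq by blast
    then show "(v j when t + j * (p - 1) = N) = 0" by (simp only: when_simps)
  qed
  then show ?thesis by (simp only: assms(3) when_simps simp_thms)
qed

lemma lookup_Z0_at:
  assumes "1 \<le> i" "i * (p - 1) \<le> N"
  shows "Poly_Mapping.lookup (Z0 N c) (Odd (N - i * (p - 1))) = lscal (c i) * lam i"
  unfolding lookup_Z0
  by (rule index_sum_at[OF finite_index(2) _ le_add_diff_inverse2[OF assms(2)]]) (use assms in blast)

lemma lookup_Z0_other:
  assumes "\<And>i. 1 \<le> i \<Longrightarrow> t + i * (p - 1) \<noteq> N"
  shows "Poly_Mapping.lookup (Z0 N c) (Odd t) = 0"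
  unfolding lookup_Z0
proof (intro sum.neutral ballI)
  fix i assume "i \<in> {i. 1 \<le> i \<and> i * (p - 1) \<le> N}"
  then have "t + i * (p - 1) \<noteq> N" using assms by blast
  then show "(lscal (c i) * lam i when t + i * (p - 1) = N) = 0" by (simp only: when_simps)
qed

lemma lookup_Z1_at:
  assumes "i * (p - 1) \<le> N"
  shows "Poly_Mapping.lookup (Z1 N c g) (Odd (N - i * (p - 1))) = lscal (c i) * mu i"
    and "1 \<le> i \<Longrightarrow> Poly_Mapping.lookup (Z1 N c g) (Even (N - i * (p - 1))) = lscal (g i) * lam i"
proof -
  show "Poly_Mapping.lookup (Z1 N c g) (Odd (N - i * (p - 1))) = lscal (c i) * mu i"
    unfolding lookup_Z1
    by (rule index_sum_at[OF finite_index(1) _ le_add_diff_inverse2[OF assms]]) (use assms in blast)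
  show "Poly_Mapping.lookup (Z1 N c g) (Even (N - i * (p - 1))) = lscal (g i) * lam i" if "1 \<le> i"
    unfolding lookup_Z1
    by (rule index_sum_at[OF finite_index(2) _ le_add_diff_inverse2[OF assms]]) (use assms that in blast)
qed

lemma Z0_cong:
  assumes "\<And>i. 1 \<le> i \<Longrightarrow> i * (p - 1) \<le> N \<Longrightarrow> c i = c' i"
  shows "Z0 N c = Z0 N c'"
  unfolding Z0_def
proof (rule sum.cong[OF refl])
  fix i assume "i \<in> {i. 1 \<le> i \<and> i * (p - 1) \<le> N}"
  then have "c i = c' i" using assms by blast
  then show "ab (lscal (c i) * lam i) (N - i * (p - 1)) = ab (lscal (c' i) * lam i) (N - i * (p - 1))"
    by (simp only:)
qed

lemma Z1_cong:
  assumes "\<And>i. i * (p - 1) \<le> N \<Longrightarrow> c i = c' i" "\<And>i. 1 \<le> i \<Longrightarrow> i * (p - 1) \<le> N \<Longrightarrow> g i = g' i"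
  shows "Z1 N c g = Z1 N c' g'"
proof -
  have "(\<Sum>i | i * (p - 1) \<le> N. ab (lscal (c i) * mu i) (N - i * (p - 1))) =
      (\<Sum>i | i * (p - 1) \<le> N. ab (lscal (c' i) * mu i) (N - i * (p - 1)))"
  proof (rule sum.cong[OF refl])
    fix i assume "i \<in> {i. i * (p - 1) \<le> N}"
    then have "c i = c' i" using assms by blast
    then show "ab (lscal (c i) * mu i) (N - i * (p - 1)) = ab (lscal (c' i) * mu i) (N - i * (p - 1))"
      by (simp only:)
  qed
  moreover have "(\<Sum>i | 1 \<le> i \<and> i * (p - 1) \<le> N. Poly_Mapping.single (Even (N - i * (p - 1))) (lscal (g i) * lam i)) =
      (\<Sum>i | 1 \<le> i \<and> i * (p - 1) \<le> N. Poly_Mapping.single (Even (N - i * (p - 1))) (lscal (g' i) * lam i))"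
  proof (rule sum.cong[OF refl])
    fix i assume "i \<in> {i. 1 \<le> i \<and> i * (p - 1) \<le> N}"
    then have "g i = g' i" using assms by blast
    then show "Poly_Mapping.single (Even (N - i * (p - 1))) (lscal (g i) * lam i) =
        Poly_Mapping.single (Even (N - i * (p - 1))) (lscal (g' i) * lam i)"
      by (simp only:)
  qed
  ultimately show ?thesis unfolding Z1_def by (simp only:)
qed

lemma when_lincomb:
  "(lscal (s * x + s' * y) * w when P) = lscal s * (lscal x * w when P) + lscal s' * (lscal y * w when P)"
  by (cases P) (simp_all add: lscal_simps distrib_right mult.assoc)

lemma Z0_lincomb: "Z0 N (\<lambda>i. s * c i + s' * c' i) = lact (lscal s) (Z0 N c) + lact (lscal s') (Z0 N c')"
proof (rule poly_mapping_eqI)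
  fix h
  show "Poly_Mapping.lookup (Z0 N (\<lambda>i. s * c i + s' * c' i)) h =
      Poly_Mapping.lookup (lact (lscal s) (Z0 N c) + lact (lscal s') (Z0 N c')) h"
    by (cases h) (simp_all add: lookup_Z0 lookup_add lookup_lact when_lincomb sum.distrib sum_distrib_left)
qed

lemma Z1_lincomb: "Z1 N (\<lambda>i. s * c i + s' * c' i) (\<lambda>i. s * g i + s' * g' i) =
  lact (lscal s) (Z1 N c g) + lact (lscal s') (Z1 N c' g')"
proof (rule poly_mapping_eqI)
  fix h
  show "Poly_Mapping.lookup (Z1 N (\<lambda>i. s * c i + s' * c' i) (\<lambda>i. s * g i + s' * g' i)) h =
      Poly_Mapping.lookup (lact (lscal s) (Z1 N c g) + lact (lscal s') (Z1 N c' g')) h"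
    by (cases h) (simp_all add: lookup_Z1 lookup_add lookup_lact when_lincomb sum.distrib sum_distrib_left)
qed

lemma index_sum_bd:
  fixes v :: "nat \<Rightarrow> 'p lambda"
  assumes v: "\<And>i. m < i \<Longrightarrow> v i = 0"
  shows "(\<Sum>i | Q i \<and> i * (p - 1) \<le> N. v i when t + i * (p - 1) = N) =
    (\<Sum>i | Q i \<and> i \<le> m. v i when t + i * (p - 1) = N)"
proof -
  let ?f = "\<lambda>i. v i when t + i * (p - 1) = N" and ?U = "{i. Q i \<and> i \<le> max N m}"
  have "?U \<subseteq> {..max N m}" by blast
  then have fin: "finite ?U" by (rule finite_subset) simp
  have "sum ?f {i. Q i \<and> i * (p - 1) \<le> N} = sum ?f ?U"
  proof (rule sum.mono_neutral_left[OF fin])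
    show "{i. Q i \<and> i * (p - 1) \<le> N} \<subseteq> ?U" 
    proof
      fix i assume i: "i \<in> {i. Q i \<and> i * (p - 1) \<le> N}"
      then have "i \<le> N" using index_le by blast
      then have "i \<le> max N m" by (rule max.coboundedI1)
      with i show "i \<in> ?U" by blast
    qed
    show "\<forall>i\<in>?U - {i. Q i \<and> i * (p - 1) \<le> N}. ?f i = 0"
    proof
      fix i assume "i \<in> ?U - {i. Q i \<and> i * (p - 1) \<le> N}"
      then have "\<not> i * (p - 1) \<le> N" by blast
      moreover have "i * (p - 1) \<le> t + i * (p - 1)" by (rule le_add2)
      ultimately have "t + i * (p - 1) \<noteq> N" by (metis (no_types))
      then show "?f i = 0" by (simp only: when_simps)
    qed
  qed
  also have "\<dots> = sum ?f {i. Q i \<and> i \<le> m}"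
  proof (rule sum.mono_neutral_right[OF fin])
    show "{i. Q i \<and> i \<le> m} \<subseteq> ?U" by (auto intro: le_max_iff_disj[THEN iffD2])
    show "\<forall>i\<in>?U - {i. Q i \<and> i \<le> m}. ?f i = 0"
    proof
      fix i assume "i \<in> ?U - {i. Q i \<and> i \<le> m}"
      then have "m < i" by auto
      then show "?f i = 0" by (simp only: v zero_when)
    qed
  qed
  finally show ?thesis .
qed

lemma Collect_interval: "{1..m} = {i. 1 \<le> i \<and> i \<le> m}" "{..m} = {i. True \<and> i \<le> m}" for m :: nat
  by auto

lemma sgn_one_when: "lam_sgn (1 when P) = (1 when P :: 'p lambda)"
proof -
  have "lam_sgn 1 = (1 :: 'p lambda)" by (simp add: one_lambda_def lam_sgn.abs_eq)
  then show ?thesis by (cases P) (simp_all add: lam_sgn_0)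
qed

lemma d_one_when: "lam_d (1 when P) = (0 :: 'p lambda)"
proof -
  have "lam_d 1 = (0 :: 'p lambda)" by (simp add: one_lambda_def zero_lambda_def lam_d.abs_eq free_d_1)
  then show ?thesis by (cases P) (simp_all add: lam_d_0)
qed

lemma when_bin: "of_nat n * ((1 when P) * w) = (lscal (of_nat n) * w when P)"
  for w :: "'p lambda"
  by (cases P) (simp_all add: lscal_of_nat)

lemma lscal_bin_0: "m < i \<Longrightarrow> lscal (bin m i) * w = (0 :: 'p lambda)"
  by (simp add: binomial_eq_0 lscal_simps)

lemma when_eq_comm: "(x when h = h') = (x when h' = h)"
  by (cases "h = h'") auto

lemma Z0_bd: "Z0 N (bd N) = cochain_d P_module (ab 1 N)"
proof (rule poly_mapping_eqI)
  fix h
  show "Poly_Mapping.lookup (Z0 N (bd N)) h = Poly_Mapping.lookup (cochain_d P_module (ab 1 N)) h"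
  proof (cases h)
    case (Odd t)
    have "Poly_Mapping.lookup (cochain_d P_module (ab 1 N)) h =
        (\<Sum>i=1..t. lscal (bin t i) * lam i when t + i * (p - 1) = N)"
      unfolding Odd lookup_cochain_d card_p ab_def lookup_single when_eq_comm[of _ "Odd N"] when_eq_comm[of _ "Even N"]
      by (simp only: d_one_when sgn_one_when when_bin pbasis.inject pbasis.distinct when_simps lam_sgn_0
          mult_zero_left mult_zero_right sum.neutral_const add_0_left add_0_right)
    also have "\<dots> = (\<Sum>i | 1 \<le> i \<and> i * (p - 1) \<le> N. lscal (bin t i) * lam i when t + i * (p - 1) = N)"
      unfolding Collect_interval by (rule index_sum_bd[symmetric]) (rule lscal_bin_0)
    also have "\<dots> = Poly_Mapping.lookup (Z0 N (bd N)) h"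
      unfolding Odd lookup_Z0
    proof (intro sum.cong refl)
      fix i
      have "N - i * (p - 1) = t" if "t + i * (p - 1) = N"
        unfolding that[symmetric] by (rule add_diff_cancel_right')
      then show "(lscal (bin t i) * lam i when t + i * (p - 1) = N) = (lscal (bd N i) * lam i when t + i * (p - 1) = N)"
        by (intro when_cong refl) (simp only: bd_def)
    qed
    finally show ?thesis by (rule sym)
  next
    case (Even t)
    then show ?thesis
      by (simp add: lookup_Z0 lookup_cochain_d ab_def lookup_single lam_d_0 lam_sgn_0)
  qed
qed

text \<open>\<open>Even N\<close> stands for \<open>b^[N + 1]\<close>, hence
  \<open>bd (N + 1)\<close> on the \<lambda>-part; on the \<mu>-part \<beta> first lowers the
  exponent to \<open>N\<close>.\<close>

lemma Z1_bd: "Z1 N (bd N) (bd (N + 1)) = cochain_d P_module (Poly_Mapping.single (Even N) 1)"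
proof (rule poly_mapping_eqI)
  fix h
  show "Poly_Mapping.lookup (Z1 N (bd N) (bd (N + 1))) h =
      Poly_Mapping.lookup (cochain_d P_module (Poly_Mapping.single (Even N) 1)) h"
  proof (cases h)
    case (Odd t)
    have "Poly_Mapping.lookup (cochain_d P_module (Poly_Mapping.single (Even N) 1)) h =
        (\<Sum>i\<le>t. lscal (bin t i) * mu i when t + i * (p - 1) = N)"
      unfolding Odd lookup_cochain_d card_p lookup_single when_eq_comm[of _ "Even N"]
      by (simp only: d_one_when sgn_one_when when_bin pbasis.inject pbasis.distinct when_simps lam_sgn_0 lam_d_0
          mult_zero_left mult_zero_right sum.neutral_const add_0_left add_0_right)
    also have "\<dots> = (\<Sum>i | True \<and> i * (p - 1) \<le> N. lscal (bin t i) * mu i when t + i * (p - 1) = N)"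
      unfolding Collect_interval(2) by (rule index_sum_bd[symmetric]) (rule lscal_bin_0)
    also have "\<dots> = Poly_Mapping.lookup (Z1 N (bd N) (bd (N + 1))) h"
      unfolding Odd lookup_Z1 simp_thms
    proof (intro sum.cong refl)
      fix i
      have "N - i * (p - 1) = t" if "t + i * (p - 1) = N"
        unfolding that[symmetric] by (rule add_diff_cancel_right')
      then show "(lscal (bin t i) * mu i when t + i * (p - 1) = N) = (lscal (bd N i) * mu i when t + i * (p - 1) = N)"
        by (intro when_cong refl) (simp only: bd_def)
    qed
    finally show ?thesis by (rule sym)
  next
    case (Even t)
    have "Poly_Mapping.lookup (cochain_d P_module (Poly_Mapping.single (Even N) 1)) h =
        (\<Sum>i=1..t + 1. lscal (bin (t + 1) i) * lam i when t + i * (p - 1) = N)"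
      unfolding Even lookup_cochain_d card_p lookup_single when_eq_comm[of _ "Even N"]
      by (simp only: d_one_when sgn_one_when when_bin pbasis.inject add_0_left)
    also have "\<dots> = (\<Sum>i | 1 \<le> i \<and> i * (p - 1) \<le> N. lscal (bin (t + 1) i) * lam i when t + i * (p - 1) = N)"
      unfolding Collect_interval(1) by (rule index_sum_bd[symmetric]) (rule lscal_bin_0)
    also have "\<dots> = Poly_Mapping.lookup (Z1 N (bd N) (bd (N + 1))) h"
      unfolding Even lookup_Z1
    proof (intro sum.cong refl)
      fix i
      have "N + 1 - i * (p - 1) = t + 1" if "t + i * (p - 1) = N"
        unfolding that[symmetric] by simp
      then show "(lscal (bin (t + 1) i) * lam i when t + i * (p - 1) = N) =
          (lscal (bd (N + 1) i) * lam i when t + i * (p - 1) = N)"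
        by (intro when_cong refl) (simp only: bd_def)
    qed
    finally show ?thesis by (rule sym)
  qed
qed

lemma cochain_P0_Z0: "cochain_P0 (Z0 N c) = Z0 (p * N + (p - 1)) (\<lambda>i. if p dvd i then c (i div p) else 0)"
proof -
  have "cochain_P0 (Z0 N c) = (\<Sum>i | 1 \<le> i \<and> i * (p - 1) \<le> N. ab (lscal (c i) * lam (p * i)) (p * (N - i * (p - 1) + 1) - 1))"
    by (simp only: Z0_def cochain_P0_additive ab_def cochain_P0_single card_p lam_P0_mult lam_P0_lscal lam_P0_lam)
  also have "\<dots> = (\<Sum>i | 1 \<le> i \<and> i * (p - 1) \<le> N.
      ab (lscal (c i) * lam (p * i)) (p * N + (p - 1) - p * i * (p - 1)))"
  proof (intro sum.cong refl)
    fix i assume i: "i \<in> {i. 1 \<le> i \<and> i * (p - 1) \<le> N}"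
    then have "i * (p - 1) \<le> N" by blast
    then obtain T where N: "N = T + i * (p - 1)" by (metis le_add_diff_inverse2)
    have "p * N + (p - 1) = p * T + (p - 1) + p * i * (p - 1)"
      unfolding N by (simp only: distrib_left mult.assoc add_ac)
    then have 1: "p * N + (p - 1) - p * i * (p - 1) = p * T + (p - 1)" by (simp only: add_diff_cancel_right')
    have "N - i * (p - 1) = T" unfolding N by (rule add_diff_cancel_right')
    then have "p * (N - i * (p - 1) + 1) - 1 = p * T + (p - 1)"
      using p_ge_3 by (simp only: distrib_left)
    with 1 show "ab (lscal (c i) * lam (p * i)) (p * (N - i * (p - 1) + 1) - 1) =
        ab (lscal (c i) * lam (p * i)) (p * N + (p - 1) - p * i * (p - 1))"
      by (simp only:)
  qed
  also have "\<dots> = (\<Sum>j\<in>(*) p ` {i. 1 \<le> i \<and> i * (p - 1) \<le> N}.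
      ab (lscal (if p dvd j then c (j div p) else 0) * lam j) (p * N + (p - 1) - j * (p - 1)))"
  proof (subst sum.reindex)
    have p0: "p \<noteq> 0" using p_ge_3 by simp
    then show "inj_on ((*) p) {i. 1 \<le> i \<and> i * (p - 1) \<le> N}" by (simp add: inj_on_def)
    have "(if p dvd p * i then c (p * i div p) else 0) = c i" for i using p0 by simp
    then show "(\<Sum>i | 1 \<le> i \<and> i * (p - 1) \<le> N. ab (lscal (c i) * lam (p * i)) (p * N + (p - 1) - p * i * (p - 1))) =
      sum ((\<lambda>j. ab (lscal (if p dvd j then c (j div p) else 0) * lam j) (p * N + (p - 1) - j * (p - 1))) \<circ> (*) p)
        {i. 1 \<le> i \<and> i * (p - 1) \<le> N}"
      by (simp only: o_def)
  qed
  also have "\<dots> = Z0 (p * N + (p - 1)) (\<lambda>i. if p dvd i then c (i div p) else 0)"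
    unfolding Z0_def
  proof (rule sum.mono_neutral_left)
    show "finite {i. 1 \<le> i \<and> i * (p - 1) \<le> p * N + (p - 1)}" by (rule finite_index)
    have le: "p * i * (p - 1) \<le> p * N + (p - 1) \<longleftrightarrow> i * (p - 1) \<le> N" for i
    proof
      assume a: "p * i * (p - 1) \<le> p * N + (p - 1)"
      show "i * (p - 1) \<le> N"
      proof (rule ccontr)
        assume "\<not> ?thesis"
        then have "p * N + p \<le> p * (i * (p - 1))" by (intro mult_p_less) simp
        then have "p * N + p \<le> p * N + (p - 1)" using a unfolding mult.assoc by (rule order.trans)
        then show False using p_ge_3 by simp
      qed
    next
      assume "i * (p - 1) \<le> N"
      then have "p * (i * (p - 1)) \<le> p * N" by (rule mult_le_mono2)
      then show "p * i * (p - 1) \<le> p * N + (p - 1)" unfolding mult.assoc by (rule trans_le_add1)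
    qed
    show "(*) p ` {i. 1 \<le> i \<and> i * (p - 1) \<le> N} \<subseteq> {i. 1 \<le> i \<and> i * (p - 1) \<le> p * N + (p - 1)}"
    proof
      fix j assume "j \<in> (*) p ` {i. 1 \<le> i \<and> i * (p - 1) \<le> N}"
      then obtain i where i: "j = p * i" "1 \<le> i" "i * (p - 1) \<le> N" by blast
      have "1 \<le> j" using i(1,2) p_ge_3 by simp
      moreover have "j * (p - 1) \<le> p * N + (p - 1)" unfolding i(1) le by (rule i(3))
      ultimately show "j \<in> {i. 1 \<le> i \<and> i * (p - 1) \<le> p * N + (p - 1)}" by blast
    qed
    show "\<forall>i\<in>{i. 1 \<le> i \<and> i * (p - 1) \<le> p * N + (p - 1)} - (*) p ` {i. 1 \<le> i \<and> i * (p - 1) \<le> N}.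
        ab (lscal (if p dvd i then c (i div p) else 0) * lam i) (p * N + (p - 1) - i * (p - 1)) = 0"
    proof
      fix i assume i: "i \<in> {i. 1 \<le> i \<and> i * (p - 1) \<le> p * N + (p - 1)} - (*) p ` {i. 1 \<le> i \<and> i * (p - 1) \<le> N}"
      have "\<not> p dvd i"
      proof
        assume "p dvd i"
        then obtain j where j: "i = p * j" ..
        have "j * (p - 1) \<le> N" using i unfolding j le[symmetric] by blast
        moreover have "1 \<le> j" using i j by (cases "j = 0") simp_all
        ultimately show False using i j by blast
      qed
      then show "ab (lscal (if p dvd i then c (i div p) else 0) * lam i) (p * N + (p - 1) - i * (p - 1)) = 0"
        by (simp add: lscal_simps ab_def)
    qed
  qed
  finally show ?thesis .
qed

lemma lam_relation: "1 \<le> m \<Longrightarrow> (\<Sum>a=1..<D. lscal (R D m a) * (lam a * lam (D - a))) = (0 :: 'p lambda)"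
proof (cases "(p + 1) * m \<le> D")
  case True
  assume m: "1 \<le> m"
  define n where "n = D - (p + 1) * m"
  have D: "D = n + (p + 1) * m" using True by (simp add: n_def)
  have "abs_lambda (relS 0 True True n m :: 'p free_alg) = abs_lambda 0"
    using relS_in(1)[OF m, of n] by (simp add: lambda.abs_eq_iff)
  then have "(\<Sum>i\<le>n. of_nat (n choose i) * (lam (i + p * m) * lam (n - i + m))) = (0 :: 'p lambda)"
    by (simp only: relS_def abs_lambda_sum abs_lambda_hom abs_lambda_of_nat abs_lambda_fg card_p add_0_right zero_lambda_def)
  moreover have "(\<Sum>a=1..<D. lscal (R D m a) * (lam a * lam (D - a))) =
      (\<Sum>a\<in>(\<lambda>i. i + p * m) ` {..n}. lscal (R D m a) * (lam a * lam (D - a)) :: 'p lambda)"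
  proof (rule sum.mono_neutral_right)
    have "1 * 1 \<le> p * m" using m p_ge_3 by (intro mult_le_mono) simp_all
    then have "1 \<le> i + p * m" for i by linarith
    moreover have "i + p * m < D" if "i \<le> n" for i using that m unfolding D by simp
    ultimately show "(\<lambda>i. i + p * m) ` {..n} \<subseteq> {1..<D}"
      unfolding image_subset_iff atLeastLessThan_iff atMost_iff by blast
    show "\<forall>a\<in>{1..<D} - (\<lambda>i. i + p * m) ` {..n}. lscal (R D m a) * (lam a * lam (D - a)) = (0 :: 'p lambda)"
    proof
      fix a assume a: "a \<in> {1..<D} - (\<lambda>i. i + p * m) ` {..n}"
      have "R D m a = 0"
      proof (cases "p * m \<le> a")
        case True
        have "n < a - p * m"
        proof (rule ccontr)
          assume "\<not> ?thesis"
          then have "a - p * m \<in> {..n}" by simp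
          moreover have "a = (a - p * m) + p * m" using True by simp
          ultimately have "a \<in> (\<lambda>i. i + p * m) ` {..n}" by (rule rev_image_eqI)
          then show False using a by blast
        qed
        then have "bin n (a - p * m) = 0" by (simp add: binomial_eq_0)
        then show ?thesis unfolding R_def n_def[symmetric] by (simp only: if_cancel)
      qed (simp add: R_def)
      then show "lscal (R D m a) * (lam a * lam (D - a)) = (0 :: 'p lambda)" by (simp add: lscal_simps)
    qed
  qed simp
  moreover have "\<dots> = (\<Sum>i\<le>n. of_nat (n choose i) * (lam (i + p * m) * lam (n - i + m)))"
  proof (subst sum.reindex)
    show "inj_on (\<lambda>i. i + p * m) {..n}" by (simp add: inj_on_def)
    show "sum ((\<lambda>a. lscal (R D m a) * (lam a * lam (D - a))) \<circ> (\<lambda>i. i + p * m)) {..n} =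
        (\<Sum>i\<le>n. of_nat (n choose i) * (lam (i + p * m) * lam (n - i + m)) :: 'p lambda)"
    proof (intro sum.cong refl)
      fix i assume "i \<in> {..n}"
      then have "D - (i + p * m) = n - i + m" by (simp add: D)
      moreover have "R D m (i + p * m) = bin n i" unfolding D R_def by simp
      ultimately show "((\<lambda>a. lscal (R D m a) * (lam a * lam (D - a))) \<circ> (\<lambda>i. i + p * m)) i =
          (of_nat (n choose i) * (lam (i + p * m) * lam (n - i + m)) :: 'p lambda)"
        by (simp add: lscal_of_nat)
    qed
  qed
  ultimately show ?thesis by simp
qed (simp add: R_def lscal_simps)

text \<open>Converse of \<open>cocycle_coc\<close>: the coefficients of the coboundary are
  combinations of rows, and each row is zero in \<Lambda> by \<open>lam_relation\<close>.\<close>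

lemma coc_cocycle:
  assumes c: "coc N c"
  shows "cochain_d P_module (Z0 N c) = 0"
proof (rule poly_mapping_eqI)
  fix h
  show "Poly_Mapping.lookup (cochain_d P_module (Z0 N c)) h = Poly_Mapping.lookup 0 h"
  proof (cases h)
    case (Even t)
    then show ?thesis by (simp add: lookup_cochain_d lookup_Z0 lam_d_0 lam_sgn_0)
  next
    case (Odd t)
    have d: "Poly_Mapping.lookup (cochain_d P_module (Z0 N c)) h =
        lam_d (Poly_Mapping.lookup (Z0 N c) (Odd t)) +
        (\<Sum>i=1..t. of_nat (t choose i) * (lam_sgn (Poly_Mapping.lookup (Z0 N c) (Odd (t + i * (p - 1)))) * lam i))"
      by (simp add: Odd lookup_cochain_d lookup_Z0(2) card_p lam_sgn_0)
    show ?thesis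
    proof (cases "\<exists>D. t + D * (p - 1) = N")
      case False
      have "Poly_Mapping.lookup (Z0 N c) (Odd (t + i * (p - 1))) = 0" for i
      proof (rule lookup_Z0_other)
        fix j
        show "t + i * (p - 1) + j * (p - 1) \<noteq> N"
          using False by (metis add.assoc add_mult_distrib)
      qed
      from this this[of 0] show ?thesis by (simp add: d lam_d_0 lam_sgn_0)
    next
      case True
      then obtain D where D: "t + D * (p - 1) = N" ..
      then have DN: "D * (p - 1) \<le> N" and t: "N - D * (p - 1) = t" by simp_all
      obtain E where E: "\<And>a. 1 \<le> a \<Longrightarrow> a < D \<Longrightarrow> c D * bin D a - c a * bin t (D - a) = (\<Sum>m=1..D. E m * R D m a)"
        using cocD[OF c DN] unfolding t by blast
      have 1: "lam_d (Poly_Mapping.lookup (Z0 N c) (Odd t)) =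
          (\<Sum>a=1..<D. lscal (c D * bin D a) * (lam a * lam (D - a)))"
      proof (cases "D = 0")
        case True
        then have "Poly_Mapping.lookup (Z0 N c) (Odd t) = 0"
          using D p_ge_3 by (intro lookup_Z0_other) auto
        then show ?thesis using True by (simp add: lam_d_0)
      next
        case False
        have "Poly_Mapping.lookup (Z0 N c) (Odd t) = lscal (c D) * lam D"
          using lookup_Z0_at[of D N c] False DN t by simp
        then have "lam_d (Poly_Mapping.lookup (Z0 N c) (Odd t)) =
            (\<Sum>i\<le>D. lscal (c D * bin D i) * (lam i * lam (D - i)))"
          by (simp add: lam_d_scal lam_d_lam sum_distrib_left lscal_simps lscal_of_nat mult.assoc)
        also have "\<dots> = (\<Sum>a=1..<D. lscal (c D * bin D a) * (lam a * lam (D - a)))"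
          by (rule sum.mono_neutral_right) (auto simp: not_less le_Suc_eq not_less_eq_eq)
        finally show ?thesis .
      qed
      have 2: "(\<Sum>i=1..t. of_nat (t choose i) * (lam_sgn (Poly_Mapping.lookup (Z0 N c) (Odd (t + i * (p - 1)))) * lam i)) =
          (\<Sum>a=1..<D. lscal (- (c a * bin t (D - a))) * (lam a * lam (D - a)))"
      proof -
        have at: "Poly_Mapping.lookup (Z0 N c) (Odd (t + i * (p - 1))) = (if i < D then lscal (c (D - i)) * lam (D - i) else 0)" for i
        proof (cases "i < D")
          case True
          have "(D - i) * (p - 1) \<le> D * (p - 1)" by simp
          then have le: "(D - i) * (p - 1) \<le> N" using DN by (rule order.trans)
          have "N - (D - i) * (p - 1) = t + i * (p - 1)"
            using True unfolding D[symmetric] by (simp add: diff_mult_distrib)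
          then show ?thesis using lookup_Z0_at[of "D - i" N c] True le by simp
        next
          case False
          have "t + i * (p - 1) + j * (p - 1) \<noteq> N" if "1 \<le> j" for j
          proof
            assume "t + i * (p - 1) + j * (p - 1) = N"
            then have "(i + j) * (p - 1) = D * (p - 1)" unfolding D[symmetric] by (simp add: add_mult_distrib)
            then have "i + j = D" unfolding index_inj .
            then show False using False that by simp
          qed
          then show ?thesis using False by (simp add: lookup_Z0_other)
        qed
        define f :: "nat \<Rightarrow> 'p lambda" where "f i = (if 1 \<le> i \<and> i < D then lscal (- (c (D - i) * bin t i)) * (lam (D - i) * lam i) else 0)" for i
        have sgn: "lam_sgn (lscal x * lam i) = - (lscal x * lam i)" for x i
          by (simp add: lam_sgn_scal lam_sgn_lam)
        have neg: "lscal (- x) = - lscal x" for x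
          by (metis add.left_inverse add_eq_0_iff lscal_simps(1,3))
        have "(\<Sum>i=1..t. of_nat (t choose i) * (lam_sgn (Poly_Mapping.lookup (Z0 N c) (Odd (t + i * (p - 1)))) * lam i)) = (\<Sum>i=1..t. f i)"
        proof (intro sum.cong refl)
          fix i assume "i \<in> {1..t}"
          have "of_nat (t choose i) * (lscal x * lam j * lam i) = lscal (x * bin t i) * (lam j * lam i)" for x j
            by (simp only: lscal_of_nat[symmetric] lscal_simps) (metis lscal_commute mult.assoc)
          then show "of_nat (t choose i) * (lam_sgn (Poly_Mapping.lookup (Z0 N c) (Odd (t + i * (p - 1)))) * lam i) = f i"
            using \<open>i \<in> {1..t}\<close> unfolding at by (cases "i < D") (simp_all add: f_def sgn neg lam_sgn_0)
        qed
        also have "\<dots> = (\<Sum>i=1..<D. f i)"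
        proof -
          have "(\<Sum>i=1..t. f i) = (\<Sum>i\<in>{1..t + D}. f i)"
            by (rule sum.mono_neutral_left) (auto simp: f_def binomial_eq_0 neg lscal_simps)
          also have "\<dots> = (\<Sum>i=1..<D. f i)"
            by (rule sum.mono_neutral_right) (auto simp: f_def)
          finally show ?thesis .
        qed
        also have "\<dots> = (\<Sum>a=1..<D. lscal (- (c a * bin t (D - a))) * (lam a * lam (D - a)))"
          by (rule sum.reindex_bij_witness[of _ "\<lambda>a. D - a" "\<lambda>a. D - a"]) (auto simp: f_def)
        finally show ?thesis .
      qed
      have "Poly_Mapping.lookup (cochain_d P_module (Z0 N c)) h =
          (\<Sum>a=1..<D. lscal (\<Sum>m=1..D. E m * R D m a) * (lam a * lam (D - a)))"
        unfolding d 1 2 sum.distrib[symmetric]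
      proof (intro sum.cong refl)
        fix a assume "a \<in> {1..<D}"
        then show "lscal (c D * bin D a) * (lam a * lam (D - a)) + lscal (- (c a * bin t (D - a))) * (lam a * lam (D - a)) =
            lscal (\<Sum>m=1..D. E m * R D m a) * (lam a * lam (D - a))"
          using E[of a] by (simp add: distrib_right[symmetric] lscal_simps(3)[symmetric] flip: diff_conv_add_uminus)
      qed
      also have "\<dots> = (\<Sum>a=1..<D. \<Sum>m=1..D. lscal (E m) * (lscal (R D m a) * (lam a * lam (D - a))))"
        by (simp only: additive_diff(4)[of lscal, OF lscal_simps(3)] sum_distrib_right lscal_simps(4) mult.assoc)
      also have "\<dots> = (\<Sum>m=1..D. lscal (E m) * (\<Sum>a=1..<D. lscal (R D m a) * (lam a * lam (D - a))))"
        by (subst sum.swap) (simp add: sum_distrib_left)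
      also have "\<dots> = 0"
      proof (intro sum.neutral ballI)
        fix m assume "m \<in> {1..D}"
        then have "1 \<le> m" by simp
        then show "lscal (E m) * (\<Sum>a=1..<D. lscal (R D m a) * (lam a * lam (D - a))) = 0"
          by (simp only: lam_relation mult_zero_right)
      qed
      finally show ?thesis by simp
    qed
  qed
qed

end

section \<open>Cocycles with $w = 0$\<close>

context odd_char
begin

definition delta :: "nat \<Rightarrow> nat \<Rightarrow> 'k" where
  "delta q = (\<lambda>i. if i = q then 1 else 0)"

lemma p_pred: obtains t where "p = t + 1" "2 \<le> t"
proof -
  have "p = (p - 1) + 1" "2 \<le> p - 1" using p_ge_3 by simp_all
  then show ?thesis using that by blast
qed

text \<open>This makes \<open>ab^[k p^m - 1]\<close> a cocycle. \<open>bd_mult_p\<close> and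
  \<open>bd_not_dvd\<close> reduce to \<open>m = 0\<close>, where \<open>k - 1 < p - 1\<close>
  leaves no room for a term.\<close>

lemma bd_hat_eq_0:
  assumes "1 \<le> k" "k \<le> p - 1" "1 \<le> s"
  shows "bd (k * p ^ m - 1) s = 0"
  using assms(3)
proof (induction m arbitrary: s)
  case 0
  obtain t where p: "p = t + 1" "2 \<le> t" by (rule p_pred)
  have "t \<le> s * t" using 0 by simp
  then have "k - 1 \<le> s * t" using assms(2) unfolding p by linarith
  then have "k * p ^ 0 - 1 - s * (p - 1) = 0" unfolding p by simp
  then show ?case using 0 unfolding bd_def by (simp only:) (simp add: binomial_eq_0)
next
  case (Suc m)
  have "1 * 1 \<le> k * p ^ m" using assms(1) p_ge_3 by (intro mult_le_mono) simp_all
  then obtain M where M: "k * p ^ m = M + 1" by (metis le_add_diff_inverse2 mult_1_right)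
  have "k * p ^ Suc m = p * (M + 1)" unfolding M[symmetric] by simp
  then have N: "k * p ^ Suc m - 1 = p * M + (p - 1)" using p_ge_3 by (simp only: distrib_left)
  show ?case
  proof (cases "p dvd s")
    case True
    then obtain s' where s': "s = p * s'" ..
    have "1 \<le> s'" using Suc.prems s' by (cases "s' = 0") auto
    then show ?thesis using Suc.IH[of s'] unfolding N s' bd_mult_p M by simp
  next
    case False
    then show ?thesis unfolding N by (rule bd_not_dvd)
  qed
qed

lemma bin_prime_power: "1 \<le> a \<Longrightarrow> a < p ^ j \<Longrightarrow> bin (p ^ j) a = 0"
proof (induction j arbitrary: a)
  case (Suc j)
  show ?case
  proof (cases "p dvd a")
    case True
    then obtain b where b: "a = p * b" ..
    have "1 \<le> b" "b < p ^ j" using Suc.prems unfolding b by (cases "b = 0"; simp)+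
    then have "bin (p ^ j) b = 0" by (rule Suc.IH)
    then show ?thesis unfolding b power_Suc lucas_0 .
  qed (simp add: bin_mult_p)
qed simp

text \<open>\<open>lam q\<close> is a cycle when \<open>q\<close> is a power of \<open>p\<close>, so
  the coboundary of \<open>lam q\<close> times \<open>ab^[t]\<close> comes from that of
  \<open>ab^[t]\<close>. The assumption named \<open>t\<close> leaves only its \<open>lam 1\<close>
  term; \<open>t1\<close> asks that this vanish too, unless \<open>q = p\<close>, where
  \<open>lam p * lam 1 = 0\<close> disposes of it.\<close>

lemma coc_delta:
  assumes q: "q = p ^ j"
    and t: "\<And>s. 2 \<le> s \<Longrightarrow> s * (p - 1) \<le> t \<Longrightarrow> bin (t - s * (p - 1)) s = 0"
    and t1: "q \<noteq> p \<Longrightarrow> p - 1 \<le> t \<Longrightarrow> (of_nat (t - (p - 1)) :: 'k) = 0"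
  shows "coc (t + q * (p - 1)) (delta q)"
  unfolding coc_def
proof (intro allI impI)
  fix D assume D: "D * (p - 1) \<le> t + q * (p - 1)"
  consider "D \<le> q" | s where "D = q + s" "1 \<le> s" by (metis le_add_diff_inverse less_imp_le_nat not_less Suc_leI add_diff_cancel_left' zero_less_diff One_nat_def)
  then show "\<exists>E. \<forall>a. 1 \<le> a \<longrightarrow> a < D \<longrightarrow>
     delta q D * bin D a - delta q a * bin (t + q * (p - 1) - D * (p - 1)) (D - a) = (\<Sum>m=1..D. E m * R D m a)"
  proof cases
    case 1
    have "delta q D * bin D a - delta q a * bin (t + q * (p - 1) - D * (p - 1)) (D - a) = 0" if "1 \<le> a" "a < D" for a
    proof -
      have "delta q a = 0" using that 1 by (simp add: delta_def)
      moreover have "delta q D * bin D a = 0"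
        using that bin_prime_power[of a j] q by (auto simp: delta_def)
      ultimately show ?thesis by simp
    qed
    then show ?thesis by (intro exI[of _ "\<lambda>_. 0"]) simp
  next
    case (2 s)
    have s_le: "s * (p - 1) \<le> t" using D unfolding 2 by (simp add: add_mult_distrib)
    have T: "t + q * (p - 1) - D * (p - 1) = t - s * (p - 1)"
      unfolding 2 by (simp add: add_mult_distrib)
    have D0: "delta q D = 0" using 2 by (simp add: delta_def)
    show ?thesis
    proof (cases "s = 1 \<and> q = p")
      case False
      have "bin (t - s * (p - 1)) s = 0"
      proof (cases "s = 1")
        case True
        then show ?thesis using t1 False s_le by simp
      next
        case False
        then show ?thesis using t[of s] 2(2) s_le by simp
      qed
      then have "delta q D * bin D a - delta q a * bin (t + q * (p - 1) - D * (p - 1)) (D - a) = 0" for a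
        unfolding T D0 using 2(1) by (simp add: delta_def)
      then show ?thesis by (intro exI[of _ "\<lambda>_. 0"]) simp
    next
      case True
      \<comment> \<open>The multiplier of the relation \<open>lam p * lam 1 = 0\<close>, which is
        the row \<open>R (p + 1) 1\<close>.\<close>
      define E where "E m = (if m = (1::nat) then - bin (t - s * (p - 1)) 1 else 0 :: 'k)" for m
      have "(\<Sum>m=1..D. E m * R D m a) = E 1 * R D 1 a" for a
        using 2 True by (intro sum_eq_single) (auto simp: E_def)
      moreover have "R D 1 a = (if a = p then 1 else 0)" if "a < D" for a
        using that True unfolding 2 R_def by auto
      ultimately have "\<forall>a. 1 \<le> a \<longrightarrow> a < D \<longrightarrow>
        delta q D * bin D a - delta q a * bin (t + q * (p - 1) - D * (p - 1)) (D - a) = (\<Sum>m=1..D. E m * R D m a)"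
        unfolding T D0 using True 2 by (auto simp: E_def delta_def)
      then show ?thesis by blast
    qed
  qed
qed

text \<open>The congruences hold with all multipliers 0; such cochains are cocycles before the
  relations are imposed.\<close>

lemma coc_of_zero:
  assumes "\<And>D T a. N = T + D * (p - 1) \<Longrightarrow> 1 \<le> a \<Longrightarrow> a < D \<Longrightarrow> c D * bin D a = c a * bin T (D - a)"
  shows "coc N c"
  unfolding coc_def
proof (intro allI impI)
  fix D assume "D * (p - 1) \<le> N"
  then obtain T where N: "N = T + D * (p - 1)" by (metis le_add_diff_inverse2)
  then have T: "N - D * (p - 1) = T" by simp
  show "\<exists>E. \<forall>a. 1 \<le> a \<longrightarrow> a < D \<longrightarrow>
      c D * bin D a - c a * bin (N - D * (p - 1)) (D - a) = (\<Sum>m=1..D. E m * R D m a)"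
    unfolding T using assms[OF N] by (intro exI[of _ "\<lambda>_. 0"]) simp
qed

lemma K_range:
  assumes "k \<le> p - 2" "i * (p - 1) \<le> p * k + (p - 1)"
  shows "i \<le> k + 1"
proof (rule ccontr)
  assume "\<not> ?thesis"
  obtain t where p: "p = t + 1" "2 \<le> t" by (rule p_pred)
  from \<open>\<not> ?thesis\<close> have "(k + 2) * t \<le> i * t" by (intro mult_le_mono1) simp
  also have "\<dots> \<le> (t + 1) * k + t" using assms(2) unfolding p by simp
  finally show False using assms(1) p(2) unfolding p(1) by (simp add: algebra_simps)
qed

lemma K_T:
  assumes "p * k + (p - 1) = T + D * (p - 1)" "1 \<le> D" "D \<le> k + 1"
  shows "T = p * (k + 1 - D) + (D - 1)"
proof -
  obtain t where p: "p = t + 1" "2 \<le> t" by (rule p_pred)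
  obtain l where k: "k + 1 = D + l" using assms(3) le_Suc_ex by blast
  obtain d where D: "D = d + 1" using assms(2) by (metis le_add_diff_inverse2)
  have kk: "k = d + l" using k D by simp
  show ?thesis using assms(1) unfolding kk D p by (simp add: algebra_simps)
qed

text \<open>In this degree the last digit of \<open>T\<close> is \<open>D - 1\<close>, so Lucas
  removes the higher digit.\<close>

lemma K_bin:
  assumes "p * k + (p - 1) = T + D * (p - 1)" "k \<le> p - 2" "1 \<le> D" "s \<le> D - 1"
  shows "bin T s = bin (D - 1) s" "D \<le> p - 1"
proof -
  have "D * (p - 1) \<le> p * k + (p - 1)" unfolding assms(1) by simp
  then have D: "D \<le> k + 1" by (rule K_range[OF assms(2)])
  then show "D \<le> p - 1" using assms(2) p_ge_3 by simp
  then have "D - 1 < p" "s < p" using assms(4) p_ge_3 by simp_all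
  then show "bin T s = bin (D - 1) s"
    using lucas[of "D - 1" s "k + 1 - D" 0] unfolding K_T[OF assms(1,3) D] by simp
qed

text \<open>After \<open>K_bin\<close> this is the identity
  \<open>D * (D - 1 choose (D - a)) = a * (D choose a)\<close>, divided by
  \<open>a * D\<close>.\<close>

lemma coc_K:
  assumes k: "k \<le> p - 2"
  shows "coc (p * k + (p - 1)) (\<lambda>i. 1 / of_nat i)"
proof (rule coc_of_zero)
  fix D T a assume N: "p * k + (p - 1) = T + D * (p - 1)" and a: "1 \<le> a" "a < D"
  have D: "D \<le> p - 1" "bin T (D - a) = bin (D - 1) (D - a)"
    using K_bin[OF N k, of "D - a"] a by auto
  have nz: "(of_nat D :: 'k) \<noteq> 0" "(of_nat a :: 'k) \<noteq> 0"
    using D a p_ge_3 by (intro of_nat_nz; simp)+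
  obtain a' d where a': "a = Suc a'" "D = Suc d" using a by (metis Suc_diff_1 less_le_trans less_numeral_extra(1) not_less_zero One_nat_def Suc_le_lessD gr0_conv_Suc less_trans)
  have "(d choose (d - a')) = (d choose a')" using a unfolding a' by (simp add: binomial_symmetric[symmetric])
  then have "D * (D - 1 choose (D - a)) = a * (D choose a)"
    unfolding a' using Suc_times_binomial[of a' d] by simp
  then have "of_nat D * bin (D - 1) (D - a) = of_nat a * bin D a" by (metis of_nat_mult)
  then show "1 / of_nat D * bin D a = 1 / of_nat a * bin T (D - a)"
    unfolding D(2) using nz by (simp add: field_simps)
qed

text \<open>The coefficients in \<open>p_hat 0 r\<close> with \<open>i = j + 1\<close>; the cutoff
  \<open>p - r\<close> is the range of the sum there.\<close>

definition pvec :: "nat \<Rightarrow> nat \<Rightarrow> 'k" where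
  "pvec r i = (if i \<le> p - r then bin (r + i - 1) (i - 1) / of_nat i else 0)"

text \<open>In this form the coefficient is a binomial coefficient up to the constant
  \<open>1 / r\<close>, so that \<open>choose_mult\<close> applies.\<close>

lemma pvec_eq: "1 \<le> r \<Longrightarrow> r \<le> p - 2 \<Longrightarrow> 1 \<le> i \<Longrightarrow> i \<le> p - r \<Longrightarrow> pvec r i = bin (r + i - 1) i / of_nat r"
proof -
  assume r: "1 \<le> r" "r \<le> p - 2" and i: "1 \<le> i" "i \<le> p - r"
  obtain i' where i': "i = Suc i'" using i by (cases i) auto
  have nz: "(of_nat r :: 'k) \<noteq> 0" "(of_nat i :: 'k) \<noteq> 0"
    using r i p_ge_3 by (intro of_nat_nz; simp)+
  have "Suc i' * (r + i' choose Suc i') = r * (r + i' choose i')"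
    using binomial_absorb_comp[of "r + i'" i'] binomial_absorption[of i' "r + i'"]
    by (metis Suc_times_binomial_add add.commute add_diff_cancel_right' binomial_symmetric le_add1 le_add2 r(1) Suc_pred' mult.commute less_le_trans zero_less_one One_nat_def add_Suc_right add_Suc)
  then have "of_nat i * bin (r + i - 1) i = of_nat r * bin (r + i - 1) (i - 1)"
    unfolding i' by (metis add_Suc_right diff_Suc_1 of_nat_mult)
  then show ?thesis using nz i by (simp add: pvec_def field_simps)
qed

text \<open>For \<open>D \<le> p - r\<close> the last digit of \<open>T\<close> is
  \<open>r + D - 1\<close> and the identity is \<open>choose_mult\<close>. For
  \<open>D > p - r\<close> the entry at \<open>D\<close> is 0, and for \<open>a \<le> p - r\<close>
  so is the binomial coefficient: if \<open>D \<le> p\<close>, the sum \<open>r + D\<close> carries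
  past \<open>p\<close> and the last digit of \<open>T\<close> drops below \<open>D - a\<close>; if
  \<open>D > p\<close>, then \<open>T \<le> r < D - a\<close>.\<close>

lemma coc_pvec:
  assumes r: "1 \<le> r" "r \<le> p - 2"
  shows "coc (p * p + r - 1) (pvec r)"
proof (rule coc_of_zero)
  fix D T a assume N: "p * p + r - 1 = T + D * (p - 1)" and a: "1 \<le> a" "a < D"
  obtain t where p: "p = t + 1" "2 \<le> t" by (rule p_pred)
  have N': "p * (p + 1) + r = T + 1 + D * t + p" using N r(1) unfolding p by simp
  have r0: "(of_nat r :: 'k) \<noteq> 0" using r p_ge_3 by (intro of_nat_nz) simp_all
  show "pvec r D * bin D a = pvec r a * bin T (D - a)"
  proof (cases "D \<le> p - r")
    case True
    obtain l where l: "p = D + l" using True by (metis diff_le_self le_Suc_ex le_trans)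
    have "T + 1 + D * t + D = p * p + r + D"
      using N' unfolding p by simp
    then have "T + 1 + p * D = p * p + r + D" unfolding p by (simp add: mult.commute)
    then have "T + 1 = p * l + r + D" unfolding l by (simp add: algebra_simps)
    then have T: "T = p * l + (r + D - 1)" using r(1) by simp
    have lt: "r + D - 1 < p" "D - a < p" using True r a p_ge_3 by simp_all
    have "bin T (D - a) = bin (r + D - 1) (D - a)"
      using lucas[OF lt, of l 0] unfolding T by simp
    moreover have "bin (r + D - 1) D * bin D a = bin (r + a - 1) a * bin (r + D - 1) (D - a)"
    proof -
      have "(r + D - 1 choose D) * (D choose (D - a)) = (r + D - 1 choose (D - a)) * (r + D - 1 - (D - a) choose (D - (D - a)))"
        using a r(1) by (intro choose_mult) simp_all
      moreover have "(D choose (D - a)) = (D choose a)" using a by (simp add: binomial_symmetric[symmetric])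
      moreover have "r + D - 1 - (D - a) = r + a - 1" "D - (D - a) = a" using a r(1) by simp_all
      ultimately have "(r + D - 1 choose D) * (D choose a) = (r + D - 1 choose (D - a)) * (r + a - 1 choose a)" by simp
      then show ?thesis by (metis mult.commute of_nat_mult)
    qed
    ultimately show ?thesis
      using pvec_eq[OF r, of D] pvec_eq[OF r, of a] True a by simp
  next
    case False
    then have D0: "pvec r D = 0" by (simp add: pvec_def)
    show ?thesis
    proof (cases "a \<le> p - r")
      case False
      then show ?thesis using D0 by (simp add: pvec_def)
    next
      case True
      have "bin T (D - a) = 0"
      proof (cases "D \<le> p")
        case Dp: True
        obtain l where l: "p = D + l" using Dp le_Suc_ex by blast
        obtain u where u: "D = (p - r) + (u + 1)" using \<open>\<not> D \<le> p - r\<close> by (metis Suc_eq_plus1 less_imp_Suc_add not_le add_Suc_right)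
        then have ru: "r + D = p + (u + 1)" using r by simp
        have "T + 1 + D * t + D = p * p + r + D"
          using N' unfolding p by simp
        then have "T + 1 + p * D = p * p + r + D" unfolding p by (simp add: mult.commute)
        then have "T + 1 = p * l + r + D" unfolding l by (simp add: algebra_simps)
        then have T: "T = p * (l + 1) + u" using ru by simp
        have "u < D - a" using u True by simp
        then show ?thesis
          using lucas_rs[of u "D - a" "l + 1" 0] Dp a unfolding T by simp
      next
        case False
        obtain s where s: "D = p + (s + 1)" using False by (metis Suc_eq_plus1 less_imp_Suc_add not_le add_Suc_right)
        have "T + s * t = r" using N' unfolding s p by (simp add: algebra_simps)
        then have "T \<le> r" by simp
        moreover have "r < D - a" using True s a(1) r by simp
        ultimately show ?thesis by (simp add: binomial_eq_0)
      qed
      then show ?thesis using D0 by simp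
    qed
  qed
qed

end

text \<open>The classes with $w = 0$ before iterating $\mathcal{P}^0$: \<open>K_base k\<close> is $\widehat k_0(k)$ (or $h_0 \widehat h_0(1)$ if
  $k = 0$), \<open>HL_base m k\<close> is $h_m \widehat h_0(k)$, \<open>HR_base m k\<close> is $h_0 \widehat h_m(k)$, \<open>D_base k\<close> is $\widehat d_1(k)$ and
  \<open>P_base r\<close> is $\widehat p_0(r)$, where $\widehat h_m(p - 1)$ stands for $\widehat h_m$. There is no \<open>D_base 1\<close>, since
  $\widehat d_1(1) = h_0 \widehat h_2(1)$. The total degree is $2\,$\<open>base_N b\<close>, and \<open>base_coeffs b\<close> is the vector of coefficients.\<close>

datatype base = K_base nat | HL_base nat nat | HR_base nat nat | D_base nat | P_base nat

section \<open>A spanning set for w = 0\<close>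

context odd_card
begin

definition cl0 :: "nat \<Rightarrow> (nat \<Rightarrow> 'p mod_ring) \<Rightarrow> 'p extP" where
  "cl0 N c = clsP (Z0 N c)"

lemma cl0_lincomb: "cl0 N (\<lambda>i. s * c i + s' * c' i) = scale_extP s (cl0 N c) + scale_extP s' (cl0 N c')"
  unfolding cl0_def Z0_lincomb clsP_hom ..

lemma cl0_scale: "cl0 N (\<lambda>i. s * c i) = scale_extP s (cl0 N c)"
  using cl0_lincomb[of N s c 0 c] by simp

lemma cl0_zero: "cl0 N (\<lambda>i. 0) = 0"
  using cl0_scale[of N 0 "\<lambda>_. 0"] by simp

lemma cl0_bd: "cl0 N (bd N) = 0"
  unfolding cl0_def Z0_bd by (rule clsP_cochain_d)

lemma cl0_cong: "(\<And>i. 1 \<le> i \<Longrightarrow> i * (p - 1) \<le> N \<Longrightarrow> c i = c' i) \<Longrightarrow> cl0 N c = cl0 N c'"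
  unfolding cl0_def by (rule arg_cong[OF Z0_cong])

lemma ext_P0_cl0: "ext_P0 (cl0 N c) = cl0 (p * N + (p - 1)) (\<lambda>i. if p dvd i then c (i div p) else 0)"
  unfolding cl0_def ext_P0_cls cochain_P0_Z0 ..

lemma clsP_cases: obtains z where "x = clsP z"
  by (metis Quotient_abs_rep[OF Quotient_extP])

lemma cochain_P0_lscal: "cochain_P0 (lact (lscal s) z) = lact (lscal s) (cochain_P0 z :: pbasis \<Rightarrow>\<^sub>0 'p lambda)"
proof (induction z rule: pm_induct)
  case (single h a)
  then show ?case by (cases h) (simp_all add: lact_simps cochain_P0_single lam_P0_mult lam_P0_lscal lact_0)
qed (simp_all add: lact_0 lact_simps cochain_P0_additive)

lemma ext_P0_linear:
  "ext_P0 (x + y) = ext_P0 x + ext_P0 (y :: 'p extP)" "ext_P0 (scale_extP s x) = scale_extP s (ext_P0 x)"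
  by (cases x rule: clsP_cases, cases y rule: clsP_cases,
      simp only: ext_P0_cls cochain_P0_add flip: clsP_hom)
     (cases x rule: clsP_cases, simp only: ext_P0_cls cochain_P0_lscal flip: clsP_hom)

lemma ext_P0_zero: "ext_P0 (0 :: 'p extP) = 0"
  using ext_P0_linear(2)[of 0 0] by simp

lemma ext_P0_span: "x \<in> extP.span S \<Longrightarrow> ext_P0 x \<in> extP.span (ext_P0 ` S)" for x :: "'p extP"
proof (induction rule: extP.span_induct_alt)
  case base
  then show ?case by (simp add: ext_P0_zero extP.span_zero)
next
  case (step c x y)
  then show ?case by (simp add: ext_P0_linear extP.span_add extP.span_scale extP.span_base)
qed

lemma ab_cl0: "1 \<le> q \<Longrightarrow> clsP (ab (lam q) t) = cl0 (t + q * (p - 1)) (delta q)"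
proof -
  assume q: "1 \<le> q"
  have "Z0 (t + q * (p - 1)) (delta q) = ab (lscal (delta q q) * lam q) (t + q * (p - 1) - q * (p - 1))"
    unfolding Z0_def
  proof (rule sum_eq_single[OF finite_index(2)])
    show "q \<in> {i. 1 \<le> i \<and> i * (p - 1) \<le> t + q * (p - 1)}" using q le_add2 by blast
    fix i assume "i \<noteq> q"
    then have "delta q i = (0 :: 'p mod_ring)" by (simp add: delta_def)
    then show "ab (lscal (delta q i) * lam i) (t + q * (p - 1) - i * (p - 1)) = (0 :: pbasis \<Rightarrow>\<^sub>0 'p lambda)"
      by (simp only: lscal_simps mult_zero_left ab_def single_zero)
  qed
  also have "\<dots> = ab (lam q) t" by (simp add: delta_def lscal_simps)
  finally show ?thesis by (simp add: cl0_def)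
qed

text \<open>Where the cocycle is \<open>lam q\<close> times \<open>ab^[t]\<close>, the value is kept
  in the form \<open>t + q * (p - 1)\<close> of \<open>coc_delta\<close> and
  \<open>ab_cl0\<close>.\<close>

fun base_N :: "base \<Rightarrow> nat" where
  "base_N (K_base k) = p * k + (p - 1)"
| "base_N (HL_base m k) = (k - 1) + p ^ m * (p - 1)"
| "base_N (HR_base m k) = (k * p ^ m - 1) + 1 * (p - 1)"
| "base_N (D_base k) = (k * p + p - 2) + p * (p - 1)"
| "base_N (P_base r) = p * p + r - 1"

fun base_coeffs :: "base \<Rightarrow> nat \<Rightarrow> 'p mod_ring" where
  "base_coeffs (K_base k) = (\<lambda>i. 1 / of_nat i)"
| "base_coeffs (HL_base m k) = delta (p ^ m)"
| "base_coeffs (HR_base m k) = delta 1"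
| "base_coeffs (D_base k) = delta p"
| "base_coeffs (P_base r) = pvec r"

text \<open>\<open>HR_base\<close> starts at \<open>m = 2\<close> because the products of
  \<open>h_cls e\<close> with \<open>h_hat_k (e + 1) k\<close> vanish; of the products with equal
  subscripts only the one with \<open>k = 1\<close> survives, as \<open>K_base 0\<close>.\<close>

fun valid :: "base \<Rightarrow> bool" where
  "valid (K_base k) \<longleftrightarrow> k \<le> p - 2"
| "valid (HL_base m k) \<longleftrightarrow> 1 \<le> m \<and> 1 \<le> k \<and> k \<le> p - 1"
| "valid (HR_base m k) \<longleftrightarrow> 2 \<le> m \<and> 1 \<le> k \<and> k \<le> p - 1"
| "valid (D_base k) \<longleftrightarrow> 2 \<le> k \<and> k \<le> p - 1"
| "valid (P_base r) \<longleftrightarrow> 1 \<le> r \<and> r \<le> p - 2"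

lemma coc_base: "valid b \<Longrightarrow> coc (base_N b) (base_coeffs b)"
proof (cases b)
  case (K_base k)
  then show "valid b \<Longrightarrow> ?thesis" using coc_K by simp
next
  case (P_base r)
  then show "valid b \<Longrightarrow> ?thesis" using coc_pvec by simp
next
  case (HL_base m k)
  assume "valid b"
  then have k: "1 \<le> k" "k \<le> p - 1" using HL_base by simp_all
  have nle: "\<not> s * (p - 1) \<le> k - 1" if "1 \<le> s" for s
  proof
    assume "s * (p - 1) \<le> k - 1"
    moreover have "1 * (p - 1) \<le> s * (p - 1)" using that by (rule mult_le_mono1)
    ultimately have "p - 1 \<le> k - 1" by (metis mult_1 order.trans)
    then show False using k p_ge_3 by linarith
  qed
  show ?thesis
    unfolding HL_base base_N.simps base_coeffs.simps
  proof (rule coc_delta[OF refl])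
    show "bin (k - 1 - s * (p - 1)) s = 0" if "2 \<le> s" "s * (p - 1) \<le> k - 1" for s
      using nle[of s] that by linarith
    show "(of_nat (k - 1 - (p - 1)) :: 'p mod_ring) = 0"
      using k by simp
  qed
next
  case (HR_base m k)
  assume "valid b"
  then have k: "1 \<le> k" "k \<le> p - 1" using HR_base by simp_all
  note z = bd_hat_eq_0[OF k, of _ m, unfolded bd_def]
  show ?thesis
    unfolding HR_base base_N.simps base_coeffs.simps
  proof (rule coc_delta[of 1 0])
    show "1 = p ^ 0" by simp
    show "bin (k * p ^ m - 1 - s * (p - 1)) s = 0" if "2 \<le> s" for s
      by (rule z) (use that in simp)
    show "(of_nat (k * p ^ m - 1 - (p - 1)) :: 'p mod_ring) = 0"
      using z[of 1] by (simp only: mult_1 choose_one order.refl)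
  qed
next
  case (D_base k)
  assume "valid b"
  then have k: "2 \<le> k" "k \<le> p - 1" using D_base by simp_all
  show ?thesis
    unfolding D_base base_N.simps base_coeffs.simps
  proof (rule coc_delta[of p 1])
    show "p = p ^ 1" by simp
    \<comment> \<open>The upper index has last digit \<open>s - 2\<close>, or is
      \<open>s - 2\<close> itself when \<open>s = p\<close>; either way the coefficient is 0. The
      term \<open>s = 1\<close> is covered by \<open>q = p\<close>.\<close>
    fix s assume s: "2 \<le> s" "s * (p - 1) \<le> k * p + p - 2"
    obtain t where p: "p = t + 1" "2 \<le> t" by (rule p_pred)
    have sk: "s \<le> k + 1"
    proof (rule ccontr)
      assume "\<not> ?thesis"
      then have "(k + 2) * t \<le> s * t" by (intro mult_le_mono1) simp
      then have "(k + 2) * t \<le> k * p + p - 2" using s(2) unfolding p by simp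
      then show False using k p(2) unfolding p(1) by (simp add: algebra_simps)
    qed
    obtain l where l: "k + 1 = s + l" using sk le_Suc_ex by blast
    have "k * p + p = (k + 1) * p" by simp
    then have "k * p + p = s * t + s + l * p" unfolding l p by (simp add: algebra_simps)
    moreover obtain s' where s': "s = s' + 2" using s(1) by (metis le_add_diff_inverse2)
    ultimately have "k * p + p - 2 - s * (p - 1) = p * l + s'"
      unfolding p by (simp add: algebra_simps)
    then show "bin (k * p + p - 2 - s * (p - 1)) s = 0"
    proof (cases "s = p")
      case True
      then have "l = 0" using l k by simp
      then show ?thesis using \<open>k * p + p - 2 - s * (p - 1) = p * l + s'\<close> s' by (simp only:) (simp add: binomial_eq_0)
    next
      case False
      then have "s < p" using sk k p_ge_3 by simp
      then have "bin (p * l + s') (p * 0 + s) = 0" using s' by (intro lucas_rs) simp_all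
      then show ?thesis unfolding \<open>k * p + p - 2 - s * (p - 1) = p * l + s'\<close> by (simp only: mult_0_right add_0_left)
    qed
  qed simp
qed

definition v0 :: "nat \<Rightarrow> base \<Rightarrow> 'p extP" where
  "v0 e b = (ext_P0 ^^ e) (cl0 (base_N b) (base_coeffs b))"

definition basis0 :: "'p extP set" where
  "basis0 = {v0 e b | e b. valid b}"

lemma v0_Suc: "ext_P0 (v0 e b) = v0 (Suc e) b"
  by (simp add: v0_def)

lemma span_basis0_P0: "x \<in> extP.span basis0 \<Longrightarrow> ext_P0 x \<in> extP.span basis0"
proof -
  assume "x \<in> extP.span basis0"
  then have "ext_P0 x \<in> extP.span (ext_P0 ` basis0)" by (rule ext_P0_span)
  moreover have "ext_P0 ` basis0 \<subseteq> basis0" unfolding basis0_def using v0_Suc by blast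
  ultimately show ?thesis using extP.span_mono by blast
qed

lemma span_base: "valid b \<Longrightarrow> cl0 (base_N b) (base_coeffs b) \<in> extP.span basis0"
proof -
  assume "valid b"
  then have "v0 0 b \<in> basis0" unfolding basis0_def by blast
  then show ?thesis by (simp add: v0_def extP.span_base)
qed

text \<open>By \<open>coc_lead\<close> the first nonzero entry is at some \<open>q = p^j\<close>,
  and no entry above it is in range; so \<open>c\<close> is a multiple of \<open>delta q\<close>,
  the vector of an \<open>HL_base\<close>.\<close>

lemma span_lead:
  assumes c: "coc N c" and N: "\<not> p dvd N + 1" and c1: "c 1 = 0"
    and cp: "p * (p - 1) \<le> N \<Longrightarrow> c p = 0"
  shows "cl0 N c \<in> extP.span basis0"
proof (cases "\<exists>q. 1 \<le> q \<and> q * (p - 1) \<le> N \<and> c q \<noteq> 0")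
  case False
  then have "cl0 N c = cl0 N (\<lambda>i. 0)" by (intro cl0_cong) blast
  then show ?thesis by (simp only: cl0_zero extP.span_zero)
next
  case True
  define q where "q = (LEAST q. 1 \<le> q \<and> q * (p - 1) \<le> N \<and> c q \<noteq> 0)"
  have q: "1 \<le> q" "q * (p - 1) \<le> N" "c q \<noteq> 0"
    using LeastI_ex[OF True] unfolding q_def by blast+
  have min: "c a = 0" if "1 \<le> a" "a < q" for a
  proof -
    have "a * (p - 1) \<le> q * (p - 1)" using that(2) by (intro mult_le_mono1) simp
    then have "a * (p - 1) \<le> N" using q(2) by (rule order.trans)
    then show ?thesis using not_less_Least[OF that(2)[unfolded q_def]] that(1) by blast
  qed
  obtain j where j: "2 \<le> j" "q = p ^ j" and lt: "N < (q + 1) * (p - 1)"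
    using coc_lead[OF c N c1 cp q min] by blast
  have "cl0 N c = cl0 N (\<lambda>i. c q * delta q i)"
  proof (rule cl0_cong)
    fix i assume i: "1 \<le> i" "i * (p - 1) \<le> N"
    have "\<not> q + 1 \<le> i"
    proof
      assume "q + 1 \<le> i"
      then have "(q + 1) * (p - 1) \<le> i * (p - 1)" by (rule mult_le_mono1)
      then have "(q + 1) * (p - 1) \<le> N" using i(2) by (rule order.trans)
      then show False using leD[of "(q + 1) * (p - 1)" N] lt by blast
    qed
    then show "c i = c q * delta q i" using min[of i] i(1) by (cases "i = q") (simp_all add: delta_def)
  qed
  also have "\<dots> = scale_extP (c q) (cl0 N (delta q))" by (rule cl0_scale)
  finally have eq: "cl0 N c = scale_extP (c q) (cl0 N (delta q))" .
  obtain k' where k': "N = k' + q * (p - 1)" using q(2) by (metis le_add_diff_inverse2)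
  have "k' < p - 1" using lt unfolding k' add_mult_distrib mult_1 by simp
  then have "valid (HL_base j (k' + 1))" using j p_ge_3 by simp
  moreover have "base_N (HL_base j (k' + 1)) = N" by (simp add: k' j)
  moreover have "base_coeffs (HL_base j (k' + 1)) = delta q" by (simp add: j)
  ultimately have "cl0 N (delta q) \<in> extP.span basis0" using span_base by metis
  then show ?thesis unfolding eq by (rule extP.span_scale)
qed

lemma span_modify:
  assumes x: "cl0 N x \<in> extP.span S" and c: "cl0 N (\<lambda>i. 1 * c i + (- s) * x i) \<in> extP.span S"
  shows "cl0 N c \<in> extP.span S"
proof -
  have "cl0 N (\<lambda>i. 1 * c i + (- s) * x i) = cl0 N c + scale_extP (- s) (cl0 N x)"
    unfolding cl0_lincomb by simp
  then have "cl0 N c = cl0 N (\<lambda>i. 1 * c i + (- s) * x i) + scale_extP s (cl0 N x)"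
    by (simp add: extP.scale_minus_left)
  then show ?thesis using x c by (simp only: extP.span_add extP.span_scale)
qed

lemma bd_at_1: "p - 1 \<le> N \<Longrightarrow> bd N 1 = of_nat (N + 1)"
  using of_nat_shift[of 1 N] by (simp add: bd_def add.commute)

text \<open>Since this entry is nonzero, a vector starting at entry 1 can be traded for one starting
  at entry \<open>p\<close>. \<open>bd_p_P_base\<close> serves the same purpose.\<close>

lemma bd_p_HR_base:
  assumes km: "1 \<le> k" "2 \<le> m"
  shows "bd (base_N (HR_base m k)) p = 1"
proof -
  obtain m' where m': "m = Suc (Suc m')" using km(2) by (metis add_2_eq_Suc le_Suc_ex)
  have "1 * p \<le> k * p ^ m' * p" using km(1) p_ge_3 by (intro mult_le_mono1) simp
  then obtain A where A: "k * p ^ m' * p = A + (p - 1)" by (metis diff_le_self le_add_diff_inverse2 mult_1 order.trans)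
  have "1 * 1 \<le> k * p ^ m" using km(1) p_ge_3 by (intro mult_le_mono) simp_all
  then have "base_N (HR_base m k) + 1 = k * p ^ m + (p - 1)" unfolding base_N.simps by linarith
  moreover have "k * p ^ m = p * (k * p ^ m' * p)" unfolding m' by simp
  ultimately have NA: "base_N (HR_base m k) + 1 = p * A + p * (p - 1) + (p - 1)" unfolding A by (simp only: distrib_left)
  then have "base_N (HR_base m k) - p * (p - 1) = p * A + (p - 2)" using p_ge_3 by linarith
  then have "bd (base_N (HR_base m k)) p = bin (p * A + (p - 2)) (p * 1)" by (simp only: bd_def mult_1_right)
  also have "\<dots> = of_nat A" using lucas_r0[of "p - 2" A 1] p_ge_3 by simp
  also have "\<dots> = of_nat A + of_nat p" by simp
  also have "\<dots> = of_nat (A + (p - 1) + 1)" using p_ge_3 by (simp add: of_nat_diff)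
  also have "\<dots> = 1" unfolding A[symmetric] by simp
  finally show ?thesis .
qed

lemma bd_p_P_base:
  assumes rr: "1 \<le> r" "r \<le> p - 2"
  shows "bd (base_N (P_base r)) p = 1"
proof -
  obtain t where p: "p = t + 1" "2 \<le> t" by (rule p_pred)
  have pp: "p * p = p * (p - 1) + p" unfolding p by simp
  have "p * p + r - 1 - p * (p - 1) = p * 1 + (r - 1 + (p - p))" using rr unfolding pp by simp
  then have "p * p + r - 1 - p * (p - 1) = p * 1 + (r - 1)" by simp
  moreover have "r - 1 < p" using rr by simp
  ultimately show ?thesis unfolding bd_def base_N.simps using lucas_r0[of "r - 1" 1 1] by simp
qed

text \<open>Provides a cocycle to subtract from one that starts at \<open>p\<close>.
  \<open>HL_base 1 k\<close> and \<open>D_base k\<close> start at \<open>p\<close> themselves;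
  \<open>HR_base\<close> and \<open>P_base\<close> start at 1 and are corrected by a multiple of
  \<open>bd N\<close>, which kills entry 1 and leaves a nonzero entry \<open>p\<close>. For large
  \<open>N\<close>, \<open>coc_lead_p\<close> shows that one of these is available.\<close>

lemma lead_p_exists:
  assumes c: "coc N c" and N: "\<not> p dvd N + 1" and c1: "c 1 = 0"
    and pN: "p * (p - 1) \<le> N" and cp: "c p \<noteq> 0"
  shows "\<exists>x. coc N x \<and> cl0 N x \<in> extP.span basis0 \<and> x 1 = 0 \<and> x p \<noteq> 0"
proof -
  obtain t where p: "p = t + 1" "2 \<le> t" by (rule p_pred)
  have pp: "p * p = p * (p - 1) + p" unfolding p by simp
  have p1: "p \<noteq> 1" using p_ge_3 by simp
  have dp: "delta p 1 = (0 :: 'p mod_ring)" "delta p p = (1 :: 'p mod_ring)" using p1 by (simp_all add: delta_def)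
  have N1: "(of_nat (N + 1) :: 'p mod_ring) \<noteq> 0" using N by (simp only: of_nat_eq_0 not_False_eq_True)
  have "1 * (p - 1) \<le> p * (p - 1)" using p_ge_3 by (intro mult_le_mono1) simp
  then have pN1: "p - 1 \<le> N" using pN by (metis mult_1 order.trans)
  note b1 = bd_at_1[OF pN1]
  {
    fix b assume b: "valid b" "base_N b = N" "base_coeffs b = delta p"
    then have ?thesis using coc_base[OF b(1)] span_base[OF b(1)] dp by (intro exI[of _ "delta p"]) simp
  } note direct = this
  {
    fix b s assume b: "valid b" "base_N b = N" and s: "base_coeffs b 1 + s * bd N 1 = 0" "base_coeffs b p + s * bd N p \<noteq> 0"
    define x where "x i = 1 * base_coeffs b i + s * bd N i" for i
    have "coc N x" unfolding x_def using coc_base[OF b(1)] bd_coc b(2) by (intro coc_lincomb) simp_all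
    moreover have "cl0 N x = cl0 N (base_coeffs b)" unfolding x_def cl0_lincomb cl0_bd by simp
    then have "cl0 N x \<in> extP.span basis0" using span_base[OF b(1)] b(2) by simp
    ultimately have ?thesis using s by (intro exI[of _ x]) (simp add: x_def)
  } note mod_bd = this
  have HR_case: ?thesis if km: "1 \<le> k" "k \<le> p - 1" "2 \<le> m" "N + 1 = k * p ^ m + (p - 1)" for k m
  proof -
    have "1 * 1 \<le> k * p ^ m" using km(1) p_ge_3 by (intro mult_le_mono) simp_all
    then have base_N: "base_N (HR_base m k) = N" using km(4) p_ge_3 by simp
    have bp: "bd N p = 1" using bd_p_HR_base[OF km(1,3)] unfolding base_N .
    have "bd N 1 = of_nat k * of_nat p ^ m + of_nat (p - 1)"
      unfolding b1 km(4) by (simp only: of_nat_add of_nat_mult of_nat_power)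
    also have "\<dots> = - 1" using of_nat_p_minus[of 1] p_ge_3 km(3) by simp
    finally have b1': "bd N 1 = - 1" .
    show ?thesis
      using km base_N b1' bp p1 by (intro mod_bd[of "HR_base m k" 1]) (simp_all add: delta_def)
  qed
  show ?thesis
  proof (cases "(p + 2) * (p - 1) \<le> N")
    case False
    have "(p + 2) * (p - 1) + 2 = p * p + p" unfolding p by simp
    then have lt: "N + 2 < p * p + p" using False by linarith
    show ?thesis
    proof (cases "N + 1 < p * p")
      case True
      obtain k' where k': "N = k' + p * (p - 1)" using pN by (metis le_add_diff_inverse2)
      have "k' + 1 < p" using True unfolding k' pp by simp
      then show ?thesis by (intro direct[of "HL_base 1 (k' + 1)"]) (simp_all add: k')
    next
      case False
      then obtain r where r: "N + 1 = p * p + r" using le_Suc_ex[of "p * p" "N + 1"] by auto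
      have "r \<noteq> 0" using N r by (cases "r = 0") auto
      moreover have "r + 1 < p" using lt r by simp
      ultimately have rr: "1 \<le> r" "r \<le> p - 2" by simp_all
      have Nr: "N = p * p + r - 1" using r by simp
      have r0: "(of_nat r :: 'p mod_ring) \<noteq> 0" using rr p_ge_3 by (intro of_nat_nz) simp_all
      have "pvec r 1 = (1 :: 'p mod_ring)" "pvec r p = (0 :: 'p mod_ring)"
        using rr p_ge_3 by (auto simp: pvec_def)
      moreover have "bd N 1 = of_nat r" unfolding b1 r by simp
      moreover have "bd N p = 1" unfolding Nr using bd_p_P_base[OF rr] by (simp only: base_N.simps)
      ultimately show ?thesis
        using rr r0 Nr by (intro mod_bd[of "P_base r" "- (1 / of_nat r)"]) simp_all
    qed
  next
    case True
    from coc_lead_p[OF c N c1 cp True] show ?thesis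
    proof
      assume "\<exists>k. 1 \<le> k \<and> k \<le> p - 1 \<and> N + 1 = p * p + k * p - 1"
      then obtain k where k: "1 \<le> k" "k \<le> p - 1" "N + 1 = p * p + k * p - 1" by blast
      show ?thesis
      \<comment> \<open>\<open>N + 1 = p^2 + p - 1\<close> is the degree of
        \<open>HR_base 2 1\<close>, which takes the place of the missing
        \<open>D_base 1\<close>.\<close>
      proof (cases "k = 1")
        case False
        then have k2: "2 \<le> k" using k by simp
        have "N = k * p + p - 2 + p * (p - 1)"
          using k(3) p_ge_3 unfolding pp by simp
        then show ?thesis using k k2 by (intro direct[of "D_base k"]) simp_all
      next
        case True
        then have "N + 1 = 1 * p ^ 2 + (p - 1)" using k(3) p_ge_3 by (simp add: power2_eq_square)
        then show ?thesis using k by (intro HR_case[of 1 2]) simp_all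
      qed
    next
      assume "\<exists>k m. 1 \<le> k \<and> k \<le> p - 1 \<and> 2 \<le> m \<and> N + 1 = k * p ^ m + (p - 1)"
      then show ?thesis using HR_case by blast
    qed
  qed
qed


theorem span_w0: "coc N c \<Longrightarrow> cl0 N c \<in> extP.span basis0"
proof (induction N arbitrary: c rule: less_induct)
  case (less N)
  show ?case
  proof (cases "p dvd N + 1")
    case True
    then obtain M where M: "N + 1 = p * M" ..
    then have "M \<noteq> 0" by (cases "M = 0") auto
    then obtain N' where N': "M = N' + 1" by (metis Suc_eq_plus1 not0_implies_Suc)
    have N: "N = p * N' + (p - 1)" using M p_ge_3 unfolding N' by (simp only: distrib_left)
    show ?thesis
    proof (cases "c 1 = 0")
      case False
      then have k: "N' \<le> p - 2" using coc_first less.prems unfolding N by blast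
      \<comment> \<open>\<open>coc_low\<close> with \<open>K_bin\<close> gives
        \<open>i * c i = c 1\<close>, and all \<open>i\<close> in range are below
        \<open>p\<close>.\<close>
      have "cl0 N c = cl0 N (\<lambda>i. c 1 * (1 / of_nat i))"
      proof (rule cl0_cong)
        fix i assume i: "1 \<le> i" "i * (p - 1) \<le> N"
        then obtain T where T: "N = T + i * (p - 1)" by (metis le_add_diff_inverse2)
        then have T': "N - i * (p - 1) = T" by simp
        note K = K_bin[OF T[unfolded N] k i(1), of "i - 1"]
        have i0: "(of_nat i :: 'p mod_ring) \<noteq> 0" using K(2) i p_ge_3 by (intro of_nat_nz) simp_all
        show "c i = c 1 * (1 / of_nat i)"
        proof (cases "i = 1")
          case False
          then have "c i * of_nat i = c 1 * bin T (i - 1)"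
            using coc_low[OF less.prems _ i(2)] i(1) unfolding T' by simp
          then show ?thesis using K(1) i0 by (simp add: field_simps)
        qed simp
      qed
      also have "\<dots> = scale_extP (c 1) (cl0 (base_N (K_base N')) (base_coeffs (K_base N')))"
        unfolding cl0_scale by (simp add: N)
      finally show ?thesis using span_base[of "K_base N'"] k extP.span_scale by simp
    next
      case True
      define c' where "c' a = c (p * a)" for a
      have "coc N' c'" unfolding c'_def using coc_descent less.prems True unfolding N by blast
      moreover have "N' < N"
      proof -
        have "1 * N' \<le> p * N'" using p_ge_3 by (intro mult_le_mono1) simp
        then show ?thesis unfolding N using p_ge_3 by linarith
      qed
      ultimately have "ext_P0 (cl0 N' c') \<in> extP.span basis0"
        using less.IH span_basis0_P0 by blast
      moreover have "cl0 N c = ext_P0 (cl0 N' c')"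
        unfolding ext_P0_cl0 N
      proof (rule cl0_cong)
        fix i assume i: "1 \<le> i" "i * (p - 1) \<le> p * N' + (p - 1)"
        show "c i = (if p dvd i then c' (i div p) else 0)"
        proof (cases "p dvd i")
          case False
          then have "c i = 0" using coc_support[OF less.prems True i(1)] i(2) unfolding N by blast
          then show ?thesis using False by simp
        qed (simp add: c'_def)
      qed
      ultimately show ?thesis by simp
    qed
  next
    case False
    show ?thesis
    proof (cases "p - 1 \<le> N")
      case small: False
      have "cl0 N c = cl0 N (\<lambda>i. 0)"
      proof (rule cl0_cong)
        fix i assume i: "1 \<le> i" "i * (p - 1) \<le> N"
        have "1 * (p - 1) \<le> i * (p - 1)" using i(1) by (rule mult_le_mono1)
        then have "p - 1 \<le> N" using i(2) by (metis mult_1 order.trans)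
        then show "c i = 0" using small by blast
      qed
      then show ?thesis by (simp only: cl0_zero extP.span_zero)
    next
      case big: True
      \<comment> \<open>In the field this entry is \<open>N + 1\<close>, so the coboundary of
        \<open>ab^[N]\<close> can clear entry 1.\<close>
      have b1: "bd N 1 \<noteq> 0" unfolding bd_at_1[OF big] using False by (simp only: of_nat_eq_0 not_False_eq_True)
      define c1 where "c1 i = 1 * c i + (- (c 1 / bd N 1)) * bd N i" for i
      have c1: "coc N c1" unfolding c1_def by (rule coc_lincomb[OF less.prems bd_coc])
      have c11: "c1 1 = 0" using b1 by (simp add: c1_def)
      have "cl0 N c1 \<in> extP.span basis0"
      proof (cases "p * (p - 1) \<le> N \<and> c1 p \<noteq> 0")
        case True
        obtain x where x: "coc N x" "cl0 N x \<in> extP.span basis0" "x 1 = 0" "x p \<noteq> 0"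
          using lead_p_exists[OF c1 False c11] True by blast
        show ?thesis
        \<comment> \<open>Subtracting this multiple of \<open>x\<close> clears entry
          \<open>p\<close> and keeps entry 1 zero, so that \<open>span_lead\<close> applies.\<close>
        proof (rule span_modify[OF x(2), where s = "c1 p / x p"])
          show "cl0 N (\<lambda>i. 1 * c1 i + - (c1 p / x p) * x i) \<in> extP.span basis0"
            by (rule span_lead[OF coc_lincomb[OF c1 x(1)] False]) (use c11 x in simp_all)
        qed
      next
        case False
        then show ?thesis using span_lead[OF c1 \<open>\<not> p dvd N + 1\<close> c11] by blast
      qed
      moreover have "cl0 N (bd N) \<in> extP.span basis0" unfolding cl0_bd by (rule extP.span_zero)
      moreover have "c1 = (\<lambda>i. 1 * c i + (- (c 1 / bd N 1)) * bd N i)" by (simp add: c1_def fun_eq_iff)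
      ultimately show ?thesis
        using span_modify[of N "bd N" basis0 c "c 1 / bd N 1"] by simp
    qed
  qed
qed

end

section \<open>Cocycles with $w = 1$\<close>

context odd_char
begin

text \<open>Here \<open>c\<close> and \<open>g\<close> are the coefficients of $\mu_{i-1} ab^{[N - i(p-1)]}$ and $\lambda_{i-1} b^{[N + 1 - i(p-1)]}$;
  the three conditions compare the words $\lambda\mu$ and $\mu\lambda$ in front of $ab^{[T]}$, and $\lambda\lambda$ in front of $b^{[T + 1]}$.\<close>

definition coc1_at :: "nat \<Rightarrow> nat \<Rightarrow> (nat \<Rightarrow> 'k) \<Rightarrow> (nat \<Rightarrow> 'k) \<Rightarrow>
    (nat \<Rightarrow> 'k) \<Rightarrow> (nat \<Rightarrow> 'k) \<Rightarrow> (nat \<Rightarrow> 'k) \<Rightarrow> bool" where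
  "coc1_at D T c g E F G \<longleftrightarrow>
     (\<forall>a. 1 \<le> a \<longrightarrow> a \<le> D \<longrightarrow> c D * bin D a - g a * bin T (D - a) =
        (\<Sum>m=1..D. F m * R D m a) + (\<Sum>m\<le>D. G m * R (D - 1) m (a - 1))) \<and>
     (\<forall>a. a < D \<longrightarrow> - (c D * bin D a) + c a * bin T (D - a) = - (\<Sum>m=1..D. F m * R D m a)) \<and>
     (\<forall>a. 1 \<le> a \<longrightarrow> a < D \<longrightarrow> g D * bin D a - g a * bin (T + 1) (D - a) = (\<Sum>m=1..D. E m * R D m a))"

definition coc1 :: "nat \<Rightarrow> (nat \<Rightarrow> 'k) \<Rightarrow> (nat \<Rightarrow> 'k) \<Rightarrow> bool" where
  "coc1 N c g \<longleftrightarrow> (\<forall>D T. N = T + D * (p - 1) \<longrightarrow> (\<exists>E F G. coc1_at D T c g E F G))"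

lemma coc1_atD:
  assumes "coc1_at D T c g E F G"
  shows "\<And>a. 1 \<le> a \<Longrightarrow> a \<le> D \<Longrightarrow> c D * bin D a - g a * bin T (D - a) =
        (\<Sum>m=1..D. F m * R D m a) + (\<Sum>m\<le>D. G m * R (D - 1) m (a - 1))"
    "\<And>a. a < D \<Longrightarrow> - (c D * bin D a) + c a * bin T (D - a) = - (\<Sum>m=1..D. F m * R D m a)"
    "\<And>a. 1 \<le> a \<Longrightarrow> a < D \<Longrightarrow> g D * bin D a - g a * bin (T + 1) (D - a) = (\<Sum>m=1..D. E m * R D m a)"
  using assms unfolding coc1_at_def by simp_all

lemma coc1_at_lincomb:
  assumes "coc1_at D T c g E F G" "coc1_at D T c' g' E' F' G'"
  shows "coc1_at D T (\<lambda>i. s * c i + s' * c' i) (\<lambda>i. s * g i + s' * g' i)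
    (\<lambda>i. s * E i + s' * E' i) (\<lambda>i. s * F i + s' * F' i) (\<lambda>i. s * G i + s' * G' i)"
proof -
  have lin: "(s * x + s' * x') * u - (s * y + s' * y') * v = s * (x * u - y * v) + s' * (x' * u - y' * v)"
    "- ((s * x + s' * x') * u) + (s * y + s' * y') * v = s * (- (x * u) + y * v) + s' * (- (x' * u) + y' * v)"
    for x x' y y' u v :: 'k by (simp_all add: algebra_simps)
  have sum: "(\<Sum>m\<in>M. (s * A m + s' * B m) * r m) = s * (\<Sum>m\<in>M. A m * r m) + s' * (\<Sum>m\<in>M. B m * r m)"
    for M and A B r :: "nat \<Rightarrow> 'k" by (simp add: sum_distrib_left sum.distrib algebra_simps)
  show ?thesis
    unfolding coc1_at_def sum lin
  proof (intro conjI allI impI)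
    fix a
    show "s * (c D * bin D a - g a * bin T (D - a)) + s' * (c' D * bin D a - g' a * bin T (D - a)) =
        s * (\<Sum>m=1..D. F m * R D m a) + s' * (\<Sum>m=1..D. F' m * R D m a) +
        (s * (\<Sum>m\<le>D. G m * R (D - 1) m (a - 1)) + s' * (\<Sum>m\<le>D. G' m * R (D - 1) m (a - 1)))"
      if "1 \<le> a" "a \<le> D"
      unfolding coc1_atD(1)[OF assms(1) that] coc1_atD(1)[OF assms(2) that] by (simp only: distrib_left ac_simps)
    show "s * (- (c D * bin D a) + c a * bin T (D - a)) + s' * (- (c' D * bin D a) + c' a * bin T (D - a)) =
        - (s * (\<Sum>m=1..D. F m * R D m a) + s' * (\<Sum>m=1..D. F' m * R D m a))" if "a < D"
      unfolding coc1_atD(2)[OF assms(1) that] coc1_atD(2)[OF assms(2) that]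
      by (simp only: minus_add_distrib mult_minus_right)
    show "s * (g D * bin D a - g a * bin (T + 1) (D - a)) + s' * (g' D * bin D a - g' a * bin (T + 1) (D - a)) =
        s * (\<Sum>m=1..D. E m * R D m a) + s' * (\<Sum>m=1..D. E' m * R D m a)" if "1 \<le> a" "a < D"
      unfolding coc1_atD(3)[OF assms(1) that] coc1_atD(3)[OF assms(2) that] ..
  qed
qed

lemma coc1_lincomb:
  assumes "coc1 N c g" "coc1 N c' g'"
  shows "coc1 N (\<lambda>i. s * c i + s' * c' i) (\<lambda>i. s * g i + s' * g' i)"
  unfolding coc1_def
proof (intro allI impI)
  fix D T assume N: "N = T + D * (p - 1)"
  obtain E F G where 1: "coc1_at D T c g E F G" using assms(1) N unfolding coc1_def by blast
  obtain E' F' G' where 2: "coc1_at D T c' g' E' F' G'" using assms(2) N unfolding coc1_def by blast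
  show "\<exists>E F G. coc1_at D T (\<lambda>i. s * c i + s' * c' i) (\<lambda>i. s * g i + s' * g' i) E F G"
    using coc1_at_lincomb[OF 1 2] by blast
qed

lemma sum_split_0: "(\<Sum>m\<le>D. f m) = f 0 + (\<Sum>m=1..D. f m)" for f :: "nat \<Rightarrow> 'k"
proof -
  have "{..D} = insert 0 {1..D}" by auto
  then show ?thesis by simp
qed

text \<open>d^2 = 0 for \<open>b^[N + 1]\<close>. By Pascal's rule \<open>bd (N + 1) a\<close>
  exceeds \<open>bd N a\<close> by a binomial coefficient with lower index \<open>a - 1\<close>;
  \<open>boundary_identity\<close> for \<open>D - 1\<close> expresses its contribution by the
  shifted rows, which are the \<lambda>\<mu>-relations.\<close>

lemma coc1_bd: "coc1 N (bd N) (bd (N + 1))"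
  unfolding coc1_def
proof (intro allI impI)
  fix D T assume N: "N = T + D * (p - 1)"
  define e where "e D m = bin T m * bin (T - m) (D - (p + 1) * m)" for D m
  have T_a: "N - a * (p - 1) = T + (D - a) * (p - 1)" if "a \<le> D" for a
    using that unfolding N by (simp add: diff_mult_distrib)
  have bdN: "bd N a * bin T (D - a) = bin T D * bin D a + (\<Sum>m=1..D. e D m * R D m a)" if "a \<le> D" for a
    using boundary_identity[OF that, of T] unfolding bd_def T_a[OF that] e_def sum_split_0 by simp
  have bdD: "bd N D = bin T D" using T_a[of D] by (simp add: bd_def)
  have bdN1: "bd (N + 1) a * bin T (D - a) = bd N a * bin T (D - a) + (\<Sum>m\<le>D. e (D - 1) m * R (D - 1) m (a - 1))"
    if a: "1 \<le> a" "a \<le> D" for a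
  proof -
    have "N + 1 - a * (p - 1) = Suc (N - a * (p - 1))"
    proof -
      have "a * (p - 1) \<le> D * (p - 1)" using a(2) by (rule mult_le_mono1)
      then have "a * (p - 1) \<le> N" unfolding N by (rule trans_le_add2)
      then show ?thesis by (simp only: Suc_diff_le Suc_eq_plus1[symmetric])
    qed
    moreover have "Suc (N - a * (p - 1)) choose a = (N - a * (p - 1) choose (a - 1)) + (N - a * (p - 1) choose a)"
      using a(1) by (cases a) simp_all
    ultimately have "bd (N + 1) a = bd N a + bin (T + (D - a) * (p - 1)) (a - 1)"
      using T_a[OF a(2)] by (simp add: bd_def)
    moreover have "bin (T + (D - a) * (p - 1)) (a - 1) * bin T (D - a) = (\<Sum>m\<le>D. e (D - 1) m * R (D - 1) m (a - 1))"
    proof -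
      have "D - 1 - (a - 1) = D - a" using a by simp
      then have "bin (T + (D - a) * (p - 1)) (a - 1) * bin T (D - a) = (\<Sum>m\<le>D - 1. e (D - 1) m * R (D - 1) m (a - 1))"
        using boundary_identity[of "a - 1" "D - 1" T] a by (simp add: e_def)
      also have "\<dots> = (\<Sum>m\<le>D. e (D - 1) m * R (D - 1) m (a - 1))"
        by (rule sum.mono_neutral_left) (auto simp: R_def)
      finally show ?thesis .
    qed
    ultimately show ?thesis by (simp add: distrib_right)
  qed
  have "D * (p - 1) \<le> N + 1" unfolding N by simp
  then obtain E where E: "\<And>a. 1 \<le> a \<Longrightarrow> a < D \<Longrightarrow>
      bd (N + 1) D * bin D a - bd (N + 1) a * bin (N + 1 - D * (p - 1)) (D - a) = (\<Sum>m=1..D. E m * R D m a)"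
    using cocD[OF bd_coc] by blast
  have T1: "N + 1 - D * (p - 1) = T + 1" unfolding N by simp
  have "coc1_at D T (bd N) (bd (N + 1)) E (\<lambda>m. - e D m) (\<lambda>m. - e (D - 1) m)"
    unfolding coc1_at_def
  proof (intro conjI allI impI)
    show "bd N D * bin D a - bd (N + 1) a * bin T (D - a) =
      (\<Sum>m=1..D. - e D m * R D m a) + (\<Sum>m\<le>D. - e (D - 1) m * R (D - 1) m (a - 1))"
      if "1 \<le> a" "a \<le> D" for a
      unfolding bdN1[OF that] bdN[OF that(2)] bdD by (simp add: sum_negf)
    show "- (bd N D * bin D a) + bd N a * bin T (D - a) = - (\<Sum>m=1..D. - e D m * R D m a)"
      if "a < D" for a
      unfolding bdN[OF less_imp_le[OF that]] bdD by (simp add: sum_negf)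
    show "bd (N + 1) D * bin D a - bd (N + 1) a * bin (T + 1) (D - a) = (\<Sum>m=1..D. E m * R D m a)"
      if "1 \<le> a" "a < D" for a
      using E[OF that] unfolding T1 .
  qed
  then show "\<exists>E F G. coc1_at D T (bd N) (bd (N + 1)) E F G" by blast
qed

lemma sum_R_zero: "(\<Sum>m=1..D. F m * R D m 0) = 0"
proof (intro sum.neutral ballI)
  fix m assume "m \<in> {1..D}"
  then have "0 < p * m" using p_ge_3 by simp
  then show "F m * R D m 0 = 0" by (simp only: R_less mult_zero_right)
qed

lemma sum_R_self: "(\<Sum>m=1..D. F m * R D m D) = 0"
proof (intro sum.neutral ballI)
  fix m assume m: "m \<in> {1..D}"
  show "F m * R D m D = 0"
  proof (cases "(p + 1) * m \<le> D")
    case True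
    then have "D - (p + 1) * m < D - p * m" using m by simp
    then show ?thesis by (simp add: R_def binomial_eq_0)
  qed (simp add: R_def)
qed

text \<open>Entry 0 of the \<mu>\<lambda>-condition meets no row and gives
  \<open>c D = c 0 * bin T D = 0\<close>. With all \<open>c\<close> zero the sums with
  \<open>F\<close> vanish, and what is left of the other two conditions is
  \<open>coc_b\<close>.\<close>

lemma coc1_normal:
  assumes c: "coc1 N c g" and c0: "c 0 = 0"
  shows "D * (p - 1) \<le> N \<Longrightarrow> c D = 0" "coc_b N g"
proof -
  have cD: "c D = 0" if D: "D * (p - 1) \<le> N" for D
  proof (cases "D = 0")
    case False
    obtain T where "N = T + D * (p - 1)" using D by (metis le_add_diff_inverse2)
    then obtain E F G where "coc1_at D T c g E F G" using c unfolding coc1_def by blast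
    from coc1_atD(2)[OF this, of 0] show ?thesis using False c0 unfolding sum_R_zero by simp
  qed (simp add: c0)
  then show "D * (p - 1) \<le> N \<Longrightarrow> c D = 0" .
  show "coc_b N g"
    unfolding coc_b_def
  proof (intro allI impI)
    fix D assume D: "1 \<le> D" "D * (p - 1) \<le> N"
    obtain T where N: "N = T + D * (p - 1)" using D(2) by (metis le_add_diff_inverse2)
    then obtain E F G where "coc1_at D T c g E F G" using c unfolding coc1_def by blast
    note at = coc1_atD[OF this]
    have T: "N - D * (p - 1) = T" "N + 1 - D * (p - 1) = T + 1" unfolding N by simp_all
    have ca: "c a = 0" if "a \<le> D" for a
    proof -
      have "a * (p - 1) \<le> D * (p - 1)" using that by (rule mult_le_mono1)
      then show ?thesis using D(2) by (intro cD) (rule order.trans)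
    qed
    have F: "(\<Sum>m=1..D. F m * R D m a) = 0" if "a \<le> D" for a
    proof (cases "a = D")
      case False
      then show ?thesis using at(2)[of a] ca[of D] ca[of a] that by simp
    qed (simp only: sum_R_self)
    have "g a * bin T (D - a) = (\<Sum>m\<le>D. - G m * R (D - 1) m (a - 1))" if "1 \<le> a" "a \<le> D" for a
    proof -
      have "- (g a * bin T (D - a)) = (\<Sum>m\<le>D. G m * R (D - 1) m (a - 1))"
        using at(1)[OF that] ca[of D] F[OF that(2)] by simp
      from arg_cong[OF this, of uminus] show ?thesis by (simp add: sum_negf)
    qed
    then show "(\<exists>G. \<forall>a. 1 \<le> a \<longrightarrow> a \<le> D \<longrightarrow>
        g a * bin (N - D * (p - 1)) (D - a) = (\<Sum>m\<le>D. G m * R (D - 1) m (a - 1))) \<and>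
     (\<exists>E. \<forall>a. 1 \<le> a \<longrightarrow> a < D \<longrightarrow>
        g D * bin D a - g a * bin (N + 1 - D * (p - 1)) (D - a) = (\<Sum>m=1..D. E m * R D m a))"
      unfolding T by (intro conjI exI[of _ "\<lambda>m. - G m"] exI[of _ E] allI impI) (simp_all only: at(3))
  qed
qed

end

text \<open>The classes with $w = 1$: \<open>Alpha_h i k\<close> is $\alpha_0 \widehat h_i(k)$ and \<open>Alpha_hat l\<close> is $\widehat\alpha(l)$.\<close>

datatype base1 = Alpha_h nat nat | Alpha_hat nat

context odd_card
begin

lemma cocycle_coc:
  assumes z: "z \<in> cocyclesP 1"
  shows "coc N (\<lambda>i. cO z (N - i * (p - 1)) True i)"
  unfolding coc_def
proof (intro allI impI)
  fix D assume D: "D * (p - 1) \<le> N"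
  then obtain t where N: "N = t + D * (p - 1)" by (metis le_add_diff_inverse2)
  obtain E F G J where E: "\<And>a b. 1 \<le> a \<Longrightarrow> 1 \<le> b \<Longrightarrow>
      cO z t True (a + b) * bin (a + b) a - cO z (t + b * (p - 1)) True a * bin t b =
      (\<Sum>m=1..a + b. E (a + b) m * R (a + b) m a)"
    by (rule cocycle_Odd[OF z, of t]) blast
  have t: "N - D * (p - 1) = t" unfolding N by simp
  show "\<exists>E. \<forall>a. 1 \<le> a \<longrightarrow> a < D \<longrightarrow>
     cO z (N - D * (p - 1)) True D * bin D a - cO z (N - a * (p - 1)) True a * bin (N - D * (p - 1)) (D - a) =
     (\<Sum>m=1..D. E m * R D m a)"
    unfolding t
  proof (intro exI allI impI)
    fix a assume a: "1 \<le> a" "a < D"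
    have "N - a * (p - 1) = t + (D - a) * (p - 1)" using a unfolding N by (simp add: diff_mult_distrib)
    moreover have "a + (D - a) = D" using a by simp
    ultimately show "cO z t True D * bin D a - cO z (N - a * (p - 1)) True a * bin t (D - a) =
        (\<Sum>m=1..D. E D m * R D m a)"
      using E[of a "D - a"] a by simp
  qed
qed

lemma cocycle_coc1:
  assumes z: "z \<in> cocyclesP 1"
  shows "coc1 N (\<lambda>i. cO z (N - i * (p - 1)) False i) (\<lambda>i. cE z (N - i * (p - 1)) True i)"
  unfolding coc1_def
proof (intro allI impI)
  fix D t assume N: "N = t + D * (p - 1)"
  obtain E0 F G J where O: "\<And>a b. 1 \<le> a \<Longrightarrow>
      cO z t False (a + b) * bin (a + b) a - cE z (t + b * (p - 1)) True a * bin t b =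
      (\<Sum>m=1..a + b. F (a + b) m * R (a + b) m a) + (\<Sum>m\<le>a + b. G (a + b) m * R (a + b - 1) m (a - 1))"
    "\<And>a b. 1 \<le> b \<Longrightarrow>
      - (cO z t False (a + b) * bin (a + b) a) + cO z (t + b * (p - 1)) False a * bin t b =
      - (\<Sum>m=1..a + b. F (a + b) m * R (a + b) m a)"
    by (rule cocycle_Odd[OF z, of t]) blast
  obtain E F' where E: "\<And>a b. 1 \<le> a \<Longrightarrow> 1 \<le> b \<Longrightarrow>
      cE z t True (a + b) * bin (a + b) a - cE z (t + b * (p - 1)) True a * bin (t + 1) b =
      (\<Sum>m=1..a + b. E (a + b) m * R (a + b) m a)"
    by (rule cocycle_Even[OF z, of t]) blast
  have t: "N - D * (p - 1) = t" unfolding N by simp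
  have Na: "N - a * (p - 1) = t + (D - a) * (p - 1)" if "a \<le> D" for a
    using that unfolding N by (simp add: diff_mult_distrib)
  have "coc1_at D t (\<lambda>i. cO z (N - i * (p - 1)) False i) (\<lambda>i. cE z (N - i * (p - 1)) True i) (E D) (F D) (G D)"
    unfolding coc1_at_def t
  proof (intro conjI allI impI)
    show "cO z t False D * bin D a - cE z (N - a * (p - 1)) True a * bin t (D - a) =
        (\<Sum>m=1..D. F D m * R D m a) + (\<Sum>m\<le>D. G D m * R (D - 1) m (a - 1))" if "1 \<le> a" "a \<le> D" for a
      using O(1)[OF that(1), of "D - a"] unfolding Na[OF that(2)] le_add_diff_inverse[OF that(2)] .
    show "- (cO z t False D * bin D a) + cO z (N - a * (p - 1)) False a * bin t (D - a) =
        - (\<Sum>m=1..D. F D m * R D m a)" if "a < D" for a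
      using O(2)[of "D - a" a] that unfolding Na[OF less_imp_le[OF that]] le_add_diff_inverse[OF less_imp_le[OF that]] by simp
    show "cE z t True D * bin D a - cE z (N - a * (p - 1)) True a * bin (t + 1) (D - a) =
        (\<Sum>m=1..D. E D m * R D m a)" if "1 \<le> a" "a < D" for a
      using E[OF that(1), of "D - a"] that unfolding Na[OF less_imp_le[OF that(2)]] le_add_diff_inverse[OF less_imp_le[OF that(2)]] by simp
  qed
  then show "\<exists>E F G. coc1_at D t (\<lambda>i. cO z (N - i * (p - 1)) False i) (\<lambda>i. cE z (N - i * (p - 1)) True i) E F G"
    by blast
qed

text \<open>Relations among the words \<mu>\<mu> carry a factor x1, so \<open>mu 0\<close> cannot
  occur in front of \<open>b^[t + 1]\<close>; the \<mu>\<lambda>-condition for sum 1 then excludes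
  \<open>mu 1\<close>. In general the coefficient of \<open>mu D\<close> is the multiplier
  \<open>J D 0\<close>, which is 0 by the entry \<open>a = 1\<close>.\<close>

lemma cocycle_mu_b:
  assumes z: "z \<in> cocyclesP 1"
  shows "cE z t False D = 0"
proof -
  have zero: "cE z t False 0 = 0" for t
  proof -
    obtain E F G J where J: "\<And>a b. cE z (t + b * (p - 1)) False a * bin t b =
        (\<Sum>m\<le>a + b. J (a + b) m * (if a = 0 then 0 else R (a + b - 1) m (a - 1)))"
      by (rule cocycle_Odd[OF z, of t]) blast
    from J[of 0 0] show ?thesis by simp
  qed
  have one: "cE z t False 1 = 0" for t
  proof -
    obtain E F where F: "\<And>a b. 1 \<le> b \<Longrightarrow>
      - (cE z t False (a + b) * bin (a + b) a) + cE z (t + b * (p - 1)) False a * bin (t + 1) b =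
      - (\<Sum>m=1..a + b. F (a + b) m * R (a + b) m a)"
      by (rule cocycle_Even[OF z, of t]) blast
    from F[of 1 0] show ?thesis unfolding zero sum_R_zero by simp
  qed
  show ?thesis
  proof (cases "D = 0")
    case False
    obtain E F G J where J: "\<And>a b. cE z (t + b * (p - 1)) False a * bin t b =
        (\<Sum>m\<le>a + b. J (a + b) m * (if a = 0 then 0 else R (a + b - 1) m (a - 1)))"
      by (rule cocycle_Odd[OF z, of t]) blast
    have D: "1 + (D - 1) = D" using False by simp
    have "0 = (\<Sum>m\<le>D. J D m * R (D - 1) m 0)"
      using J[of "D - 1" 1] unfolding one D by simp
    also have "\<dots> = J D 0" by (rule sum_R_bottom)
    finally have J0: "J D 0 = 0" by simp
    have "cE z t False D = (\<Sum>m\<le>D. J D m * R (D - 1) m (D - 1))"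
      using J[of 0 D] False by simp
    also have "\<dots> = J D 0" by (rule sum_R_top)
    finally show ?thesis using J0 by simp
  qed (simp only: zero)
qed

definition cl1 :: "nat \<Rightarrow> (nat \<Rightarrow> 'p mod_ring) \<Rightarrow> (nat \<Rightarrow> 'p mod_ring) \<Rightarrow> 'p extP" where
  "cl1 N c g = clsP (Z1 N c g)"

lemma cl1_lincomb: "cl1 N (\<lambda>i. s * c i + s' * c' i) (\<lambda>i. s * g i + s' * g' i) =
    scale_extP s (cl1 N c g) + scale_extP s' (cl1 N c' g')"
  unfolding cl1_def Z1_lincomb clsP_hom ..

lemma cl1_zero: "cl1 N (\<lambda>i. 0) (\<lambda>i. 0) = 0"
  using cl1_lincomb[of N 0 "\<lambda>_. 0" 0 "\<lambda>_. 0" "\<lambda>_. 0" "\<lambda>_. 0"] by simp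

lemma cl1_bd: "cl1 N (bd N) (bd (N + 1)) = 0"
  unfolding cl1_def Z1_bd by (rule clsP_cochain_d)

lemma cl1_cong:
  "(\<And>i. i * (p - 1) \<le> N \<Longrightarrow> c i = c' i) \<Longrightarrow> (\<And>i. 1 \<le> i \<Longrightarrow> i * (p - 1) \<le> N \<Longrightarrow> g i = g' i) \<Longrightarrow>
    cl1 N c g = cl1 N c' g'"
  unfolding cl1_def by (rule arg_cong[OF Z1_cong])

fun base1_N :: "base1 \<Rightarrow> nat" where
  "base1_N (Alpha_h i k) = k * p ^ i - 1"
| "base1_N (Alpha_hat l) = p + l"

fun base1_coeffs :: "base1 \<Rightarrow> nat \<Rightarrow> 'p mod_ring" where
  "base1_coeffs (Alpha_h i k) = delta 0"
| "base1_coeffs (Alpha_hat l) = (\<lambda>i. delta 0 i + of_nat (l + 1) * delta 1 i)"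

fun valid1 :: "base1 \<Rightarrow> bool" where
  "valid1 (Alpha_h i k) \<longleftrightarrow> 1 \<le> i \<and> 1 \<le> k \<and> k \<le> p - 1"
| "valid1 (Alpha_hat l) \<longleftrightarrow> l < p - 2"

definition v1 :: "base1 \<Rightarrow> 'p extP" where
  "v1 b = cl1 (base1_N b) (base1_coeffs b) (\<lambda>_. 0)"

definition basis1 :: "'p extP set" where
  "basis1 = {v1 b | b. valid1 b}"

lemma base1_coeffs_0: "base1_coeffs b 0 = 1"
  by (cases b) (simp_all add: delta_def)

lemma base1_N_pos: "valid1 b \<Longrightarrow> p - 1 \<le> base1_N b"
proof (cases b)
  case (Alpha_h i k)
  assume "valid1 b"
  then have "1 \<le> i" "1 \<le> k" using Alpha_h by simp_all
  then have "1 * p \<le> k * p ^ i" using p_ge_3 by (intro mult_le_mono) (simp_all add: self_le_power)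
  then show ?thesis using Alpha_h by simp
next
  case (Alpha_hat l)
  then show ?thesis by simp
qed

text \<open>Once the coboundary of \<open>b^[N + 1]\<close> has removed the letters \<mu> from a
  basis cocycle, its first \<lambda>-coefficient is \<open>- (N + 2)\<close>; this must be nonzero
  for the comparison in \<open>span_w1\<close>.\<close>

lemma bd_succ_at_1: "valid1 b \<Longrightarrow> bd (base1_N b + 1) 1 \<noteq> 0"
proof -
  assume v: "valid1 b"
  have "p - 1 \<le> base1_N b + 1" using base1_N_pos[OF v] by simp
  then have eq: "bd (base1_N b + 1) 1 = of_nat (base1_N b + 2)" using bd_at_1[of "base1_N b + 1"] by simp
  have "\<not> p dvd base1_N b + 2"
  proof (cases b)
    case (Alpha_h i k)
    have "1 * p \<le> k * p ^ i" using v Alpha_h p_ge_3 by (intro mult_le_mono) (simp_all add: self_le_power)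
    then have "base1_N b + 2 = k * p ^ i + 1" using Alpha_h p_ge_3 by simp
    moreover have "p dvd k * p ^ i" using v Alpha_h by (simp add: dvd_power)
    moreover have "\<not> p dvd 1" using p_ge_3 by simp
    ultimately show ?thesis by (simp only: dvd_add_right_iff not_False_eq_True)
  next
    case (Alpha_hat l)
    then have "base1_N b + 2 = p + (l + 2)" by simp
    moreover have "\<not> p dvd l + 2" using v Alpha_hat p_ge_3 by (auto dest: dvd_imp_le)
    ultimately show ?thesis by (simp only: dvd_add_right_iff dvd_refl not_False_eq_True)
  qed
  then show ?thesis unfolding eq of_nat_eq_0 .
qed

text \<open>The given cocycle and the basis cocycle of the same \<open>N\<close>, which exists by
  \<open>coc_b_range\<close>, are both freed of the letters \<mu>; then
  \<open>coc_b_determined\<close> makes them proportional. The assumption \<open>coc_x\<close> is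
  discharged by \<open>coc1_valid\<close>.\<close>

theorem span_w1:
  assumes coc_x: "\<And>b. valid1 b \<Longrightarrow> coc1 (base1_N b) (base1_coeffs b) (\<lambda>_. 0)"
    and cg: "coc1 N c g"
  shows "cl1 N c g \<in> extP.span basis1"
proof -
  define c' where "c' i = 1 * c i + (- c 0) * bd N i" for i
  define g' where "g' i = 1 * g i + (- c 0) * bd (N + 1) i" for i
  have "coc1 N (\<lambda>i. 1 * c i + (- c 0) * bd N i) (\<lambda>i. 1 * g i + (- c 0) * bd (N + 1) i)"
    by (rule coc1_lincomb[OF cg coc1_bd])
  then have cg': "coc1 N c' g'" by (simp only: c'_def[abs_def] g'_def[abs_def])
  have eq: "cl1 N c' g' = cl1 N c g"
    unfolding c'_def[abs_def] g'_def[abs_def] cl1_lincomb cl1_bd by simp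
  have c'0: "c' 0 = 0" by (simp add: c'_def bd_def)
  note normal = coc1_normal[OF cg' c'0]
  have "cl1 N c' g' \<in> extP.span basis1"
  proof (cases "g' 1 = 0 \<or> N < p - 1")
    case True
    have "cl1 N c' g' = cl1 N (\<lambda>_. 0) (\<lambda>_. 0)"
    proof (rule cl1_cong)
      fix i assume i: "1 \<le> i" "i * (p - 1) \<le> N"
      have "1 * (p - 1) \<le> i * (p - 1)" using i(1) by (rule mult_le_mono1)
      then have "\<not> N < p - 1" using i(2) by (metis mult_1 order.trans not_less)
      then show "g' i = 0" using coc_b_determined[OF normal(2) i] True by simp
    qed (rule normal(1))
    then show ?thesis by (simp only: cl1_zero extP.span_zero)
  next
    case False
    then have g1: "g' 1 \<noteq> 0" and N: "p - 1 \<le> N" by simp_all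
    have "\<exists>b. valid1 b \<and> base1_N b = N"
      using coc_b_range[OF normal(2) g1 N]
    proof
      assume le: "N + 1 \<le> 2 * p - 2"
      show ?thesis
      proof (cases "N + 1 = p")
        case True
        then have "base1_N (Alpha_h 1 1) = N" "valid1 (Alpha_h 1 1)" using p_ge_3 by simp_all
        then show ?thesis by blast
      next
        case False
        then have "p \<le> N" using N p_ge_3 by simp
        then obtain l where "N = p + l" using le_Suc_ex by blast
        then show ?thesis using le p_ge_3 by (intro exI[of _ "Alpha_hat l"]) simp
      qed
    next
      assume "\<exists>k i. N + 1 = k * p ^ i \<and> 1 \<le> k \<and> k \<le> p - 1 \<and> 1 \<le> i"
      then obtain k i where ki: "N + 1 = k * p ^ i" "1 \<le> k" "k \<le> p - 1" "1 \<le> i" by blast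
      then have "base1_N (Alpha_h i k) = N" by (simp flip: ki(1))
      then show ?thesis using ki by (intro exI[of _ "Alpha_h i k"]) simp
    qed
    then obtain b where b: "valid1 b" "base1_N b = N" by blast
    define x where "x i = 1 * base1_coeffs b i + (- 1) * bd N i" for i
    define y where "y i = 1 * 0 + (- 1) * bd (N + 1) i" for i
    have "coc1 N (\<lambda>i. 1 * base1_coeffs b i + (- 1) * bd N i) (\<lambda>i. 1 * 0 + (- 1) * bd (N + 1) i)"
      using coc_x[OF b(1)] unfolding b(2) by (rule coc1_lincomb[OF _ coc1_bd])
    then have xy: "coc1 N x y" by (simp only: x_def[abs_def] y_def[abs_def])
    have x0: "x 0 = 0" by (simp add: x_def bd_def base1_coeffs_0)
    note nx = coc1_normal[OF xy x0]
    have y1: "y 1 \<noteq> 0" using bd_succ_at_1[OF b(1)] by (simp add: y_def b(2))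
    have clx: "cl1 N x y = v1 b"
      unfolding x_def[abs_def] y_def[abs_def] cl1_lincomb cl1_bd by (simp add: v1_def b(2))
    define s where "s = g' 1 / y 1"
    have "cl1 N c' g' = cl1 N (\<lambda>i. s * x i + 0 * x i) (\<lambda>i. s * y i + 0 * y i)"
    proof (rule cl1_cong)
      show "c' i = s * x i + 0 * x i" if "i * (p - 1) \<le> N" for i
        using normal(1)[OF that] nx(1)[OF that] by simp
      show "g' i = s * y i + 0 * y i" if "1 \<le> i" "i * (p - 1) \<le> N" for i
        using coc_b_determined[OF normal(2) that] coc_b_determined[OF nx(2) that] y1 by (simp add: s_def)
    qed
    also have "\<dots> = scale_extP s (v1 b)" unfolding cl1_lincomb clx by simp
    finally have "cl1 N c' g' = scale_extP s (v1 b)" .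
    moreover have "v1 b \<in> basis1" using b unfolding basis1_def by blast
    ultimately show ?thesis by (simp add: extP.span_scale extP.span_base)
  qed
  then show ?thesis unfolding eq .
qed

lemma len1_bound:
  assumes "a = (\<Sum>i=1..K. lscal (co a (gw True i)) * lam i) + (\<Sum>i\<le>K. lscal (co a (gw False i)) * mu i :: 'p lambda)"
    and i: "K < i"
  shows "co a (gw e i) = 0"
proof -
  have "co a (gw e i) = co ((\<Sum>i=1..K. lscal (co a (gw True i)) * lam i) + (\<Sum>i\<le>K. lscal (co a (gw False i)) * mu i)) (gw e i)"
    using assms(1) by simp
  also have "\<dots> = 0"
    using i by (cases e) (simp_all add: co_additive co_lscal gw_def co_lam_mu sum.neutral)
  finally show ?thesis .
qed

lemma expand_bound:
  assumes z: "\<And>h. Poly_Mapping.lookup z h \<in> lambda_len 1"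
  obtains K where "\<And>h. Poly_Mapping.lookup z h = (\<Sum>i=1..K. lscal (co (Poly_Mapping.lookup z h) (gw True i)) * lam i)
      + (\<Sum>i\<le>K. lscal (co (Poly_Mapping.lookup z h) (gw False i)) * mu i :: 'p lambda)"
    "\<And>h e i. K < i \<Longrightarrow> co (Poly_Mapping.lookup z h) (gw e i) = 0"
proof -
  obtain Kf where Kf: "\<And>h L. Kf h \<le> L \<Longrightarrow> Poly_Mapping.lookup z h =
      (\<Sum>i=1..L. lscal (co (Poly_Mapping.lookup z h) (gw True i)) * lam i)
      + (\<Sum>i\<le>L. lscal (co (Poly_Mapping.lookup z h) (gw False i)) * mu i)"
    using len1_expand[OF z] by metis
  define K where "K = Max (insert 0 (Kf ` Poly_Mapping.keys z))"
  have 1: "Poly_Mapping.lookup z h = (\<Sum>i=1..K. lscal (co (Poly_Mapping.lookup z h) (gw True i)) * lam i)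
      + (\<Sum>i\<le>K. lscal (co (Poly_Mapping.lookup z h) (gw False i)) * mu i)" for h
  proof (cases "h \<in> Poly_Mapping.keys z")
    case True
    then have "Kf h \<le> K" unfolding K_def by (intro Max_ge) auto
    then show ?thesis by (rule Kf)
  next
    case False
    then have "Poly_Mapping.lookup z h = 0" by (simp add: in_keys_iff)
    moreover have "co (0 :: 'p lambda) g = 0" for g by (rule co_additive(2))
    ultimately show ?thesis by (simp add: lscal_simps)
  qed
  show ?thesis by (rule that[OF 1]) (rule len1_bound[OF 1])
qed

lemma sum_when_le: "(\<Sum>N\<le>B. x when k = N) = (x when k \<le> B)" for x :: "'p lambda" and k B :: nat
proof (cases "k \<le> B")
  case True
  then have "(\<Sum>N\<le>B. x when k = N) = (x when k = k)" by (intro sum_eq_single) auto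
  then show ?thesis using True by simp
qed (auto intro!: sum.neutral simp: when_def)

lemma sum_over_N:
  fixes v :: "nat \<Rightarrow> 'p lambda"
  assumes v: "\<And>i. K < i \<Longrightarrow> v i = 0" and t: "(\<forall>i. v i = 0) \<or> t + K * (p - 1) \<le> B"
  shows "(\<Sum>N\<le>B. \<Sum>i | Q i \<and> i * (p - 1) \<le> N. v i when t + i * (p - 1) = N) = (\<Sum>i | Q i \<and> i \<le> K. v i)"
proof -
  have "(\<Sum>N\<le>B. \<Sum>i | Q i \<and> i * (p - 1) \<le> N. v i when t + i * (p - 1) = N) =
      (\<Sum>N\<le>B. \<Sum>i | Q i \<and> i \<le> K. v i when t + i * (p - 1) = N)"
    by (intro sum.cong refl index_sum_bd v)
  also have "\<dots> = (\<Sum>i | Q i \<and> i \<le> K. \<Sum>N\<le>B. v i when t + i * (p - 1) = N)"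
    by (rule sum.swap)
  also have "\<dots> = (\<Sum>i | Q i \<and> i \<le> K. v i)"
  proof (intro sum.cong refl)
    fix i assume i: "i \<in> {i. Q i \<and> i \<le> K}"
    show "(\<Sum>N\<le>B. v i when t + i * (p - 1) = N) = v i"
      unfolding sum_when_le
    proof (cases "v i = 0")
      case False
      then have "t + K * (p - 1) \<le> B" using t by blast
      moreover have "t + i * (p - 1) \<le> t + K * (p - 1)" using i by (intro add_left_mono mult_le_mono1) simp
      ultimately have "t + i * (p - 1) \<le> B" by (metis order.trans)
      then show "(v i when t + i * (p - 1) \<le> B) = v i" by (simp only: when_simps)
    qed (simp only: zero_when)
  qed
  finally show ?thesis .
qed

text \<open>Regroups the finite expansion of every component by \<open>N = t + i * (p - 1)\<close>;
  the terms with w = 2, letters \<mu> in front of b, are absent by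
  \<open>cocycle_mu_b\<close>.\<close>

theorem cocycle_decomposition:
  assumes z: "z \<in> cocyclesP 1"
  shows "\<exists>B. z = (\<Sum>N\<le>B. Z0 N (\<lambda>i. cO z (N - i * (p - 1)) True i)
    + Z1 N (\<lambda>i. cO z (N - i * (p - 1)) False i) (\<lambda>i. cE z (N - i * (p - 1)) True i))"
proof -
  have mem: "\<And>h. Poly_Mapping.lookup z h \<in> lambda_len 1" using z by (simp add: cocyclesP_def)
  obtain K where K: "\<And>h. Poly_Mapping.lookup z h = (\<Sum>i=1..K. lscal (co (Poly_Mapping.lookup z h) (gw True i)) * lam i)
      + (\<Sum>i\<le>K. lscal (co (Poly_Mapping.lookup z h) (gw False i)) * mu i)"
    "\<And>h e i. K < i \<Longrightarrow> co (Poly_Mapping.lookup z h) (gw e i) = 0"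
    by (rule expand_bound[OF mem]) blast
  define ind where "ind h = (case h of Odd t \<Rightarrow> t | Even t \<Rightarrow> t)" for h
  \<comment> \<open>Chosen so that every \<open>t + i * (p - 1)\<close> with a nonzero coefficient
    is at most \<open>B\<close>.\<close>
  define B where "B = Max (insert 0 (ind ` Poly_Mapping.keys z)) + K * (p - 1)"
  have B: "ind h + K * (p - 1) \<le> B" if "h \<in> Poly_Mapping.keys z" for h
    unfolding B_def using that by (intro add_right_mono Max_ge) auto
  have co0: "co (0 :: 'p lambda) g = 0" for g by (rule co_additive(2))
  have t_Odd: "(\<forall>e i. cO z t e i = 0) \<or> t + K * (p - 1) \<le> B" for t
  proof (cases "Odd t \<in> Poly_Mapping.keys z")
    case True
    then show ?thesis using B[OF True] by (simp only: ind_def pbasis.case simp_thms)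
  qed (simp add: cO_def in_keys_iff co0)
  have t_Even: "(\<forall>e i. cE z t e i = 0) \<or> t + K * (p - 1) \<le> B" for t
  proof (cases "Even t \<in> Poly_Mapping.keys z")
    case True
    then show ?thesis using B[OF True] by (simp only: ind_def pbasis.case simp_thms)
  qed (simp add: cE_def in_keys_iff co0)
  have at: "N - i * (p - 1) = t" if "t + i * (p - 1) = N" for N i t
    unfolding that[symmetric] by (rule add_diff_cancel_right')
  have shift: "(f (N - i * (p - 1)) i when t + i * (p - 1) = N) = (f t i when t + i * (p - 1) = N)"
    for f :: "nat \<Rightarrow> nat \<Rightarrow> 'p lambda" and N i t
    by (intro when_cong refl) (simp only: at)
  have fO: "lscal (cO z t e i) * w = 0" "lscal (cE z t e i) * w = 0" if "K < i" for t e i and w :: "'p lambda"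
    using K(2)[OF that] by (simp_all add: cO_def cE_def lscal_simps)
  have "z = (\<Sum>N\<le>B. Z0 N (\<lambda>i. cO z (N - i * (p - 1)) True i)
    + Z1 N (\<lambda>i. cO z (N - i * (p - 1)) False i) (\<lambda>i. cE z (N - i * (p - 1)) True i))" (is "z = ?S")
  proof (rule poly_mapping_eqI)
    fix h
    show "Poly_Mapping.lookup z h = Poly_Mapping.lookup ?S h"
    proof (cases h)
      case (Odd t)
      have "(\<Sum>N\<le>B. \<Sum>i | 1 \<le> i \<and> i * (p - 1) \<le> N. lscal (cO z t True i) * lam i when t + i * (p - 1) = N) =
          (\<Sum>i | 1 \<le> i \<and> i \<le> K. lscal (cO z t True i) * lam i)"
        by (rule sum_over_N[OF fO(1)]) (use t_Odd[of t] in \<open>auto simp only: lscal_simps mult_zero_left\<close>)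
      moreover have "(\<Sum>N\<le>B. \<Sum>i | True \<and> i * (p - 1) \<le> N. lscal (cO z t False i) * mu i when t + i * (p - 1) = N) =
          (\<Sum>i | True \<and> i \<le> K. lscal (cO z t False i) * mu i)"
        by (rule sum_over_N[OF fO(1)]) (use t_Odd[of t] in \<open>auto simp only: lscal_simps mult_zero_left\<close>)
      ultimately have "Poly_Mapping.lookup ?S h = (\<Sum>i | 1 \<le> i \<and> i \<le> K. lscal (cO z t True i) * lam i)
          + (\<Sum>i | True \<and> i \<le> K. lscal (cO z t False i) * mu i)"
        unfolding Odd lookup_sum lookup_add lookup_Z0 lookup_Z1 sum.distrib
          shift[of "\<lambda>s i. lscal (cO z s True i) * lam i"] shift[of "\<lambda>s i. lscal (cO z s False i) * mu i"]
        by (simp only: simp_thms)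
      then show ?thesis
        using K(1)[of h] unfolding Collect_interval[symmetric] cO_def Odd by (simp only:)
    next
      case (Even t)
      have "(\<Sum>N\<le>B. \<Sum>i | 1 \<le> i \<and> i * (p - 1) \<le> N. lscal (cE z t True i) * lam i when t + i * (p - 1) = N) =
          (\<Sum>i | 1 \<le> i \<and> i \<le> K. lscal (cE z t True i) * lam i)"
        by (rule sum_over_N[OF fO(2)]) (use t_Even[of t] in \<open>auto simp only: lscal_simps mult_zero_left\<close>)
      then have "Poly_Mapping.lookup ?S h = (\<Sum>i | 1 \<le> i \<and> i \<le> K. lscal (cE z t True i) * lam i)"
        unfolding Even lookup_sum lookup_add lookup_Z0 lookup_Z1 sum.distrib
          shift[of "\<lambda>s i. lscal (cE z s True i) * lam i"]
        by (simp only: sum.neutral_const add_0_left)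
      moreover have "(\<Sum>i\<le>K. lscal (co (Poly_Mapping.lookup z h) (gw False i)) * mu i) = 0"
        using cocycle_mu_b[OF z] by (simp only: Even cE_def lscal_simps mult_zero_left sum.neutral_const)
      ultimately show ?thesis
        using K(1)[of h] unfolding Collect_interval[symmetric] cE_def Even by (simp only: add_0_right)
    qed
  qed
  then show ?thesis by blast
qed

theorem cocycle_in_span:
  assumes coc_x: "\<And>b. valid1 b \<Longrightarrow> coc1 (base1_N b) (base1_coeffs b) (\<lambda>_. 0)"
    and z: "z \<in> cocyclesP 1"
  shows "clsP z \<in> extP.span (basis0 \<union> basis1)"
proof -
  obtain B where B: "z = (\<Sum>N\<le>B. Z0 N (\<lambda>i. cO z (N - i * (p - 1)) True i)
    + Z1 N (\<lambda>i. cO z (N - i * (p - 1)) False i) (\<lambda>i. cE z (N - i * (p - 1)) True i))"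
    using cocycle_decomposition[OF z] by blast
  have "clsP z = (\<Sum>N\<le>B. cl0 N (\<lambda>i. cO z (N - i * (p - 1)) True i)
    + cl1 N (\<lambda>i. cO z (N - i * (p - 1)) False i) (\<lambda>i. cE z (N - i * (p - 1)) True i))"
    by (subst B) (simp only: clsP_sum clsP_hom cl0_def cl1_def)
  moreover have "cl0 N (\<lambda>i. cO z (N - i * (p - 1)) True i)
    + cl1 N (\<lambda>i. cO z (N - i * (p - 1)) False i) (\<lambda>i. cE z (N - i * (p - 1)) True i) \<in> extP.span (basis0 \<union> basis1)" for N
  proof (rule extP.span_add)
    show "cl0 N (\<lambda>i. cO z (N - i * (p - 1)) True i) \<in> extP.span (basis0 \<union> basis1)"
      using span_w0[OF cocycle_coc[OF z]] extP.span_mono[of basis0 "basis0 \<union> basis1"] by blast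
    show "cl1 N (\<lambda>i. cO z (N - i * (p - 1)) False i) (\<lambda>i. cE z (N - i * (p - 1)) True i) \<in> extP.span (basis0 \<union> basis1)"
      using span_w1[OF coc_x cocycle_coc1[OF z]] extP.span_mono[of basis1 "basis0 \<union> basis1"] by blast
  qed
  ultimately show ?thesis by (simp only: extP.span_sum)
qed

end

section \<open>Products and their values\<close>

context odd_card
begin

lemma lam_d_mu_0: "lam_d (mu 0) = (0 :: 'p lambda)"
  by (simp add: lam_d_mu)

text \<open>The third kind of relation with \<open>n = m = 0\<close>; because of it the differential
  of \<open>mu 1\<close> has the single term \<open>- (mu 0 * lam 1)\<close>.\<close>

lemma lam_1_mu_0: "lam 1 * mu 0 = (0 :: 'p lambda)"
proof -
  have "abs_lambda (relS 1 True False 0 0 :: 'p free_alg) = abs_lambda 0"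
    using relS_in(3)[of 0 0] by (simp add: lambda.abs_eq_iff)
  then have "(\<Sum>i\<le>0. of_nat (0 choose i) * (lam (i + p * 0 + 1) * mu (0 - i + 0))) = (0 :: 'p lambda)"
    by (simp only: relS_def abs_lambda_sum abs_lambda_hom abs_lambda_of_nat abs_lambda_fg card_p zero_lambda_def)
  then show ?thesis by simp
qed

lemma lam_d_mu_1: "lam_d (mu 1) = (- (mu 0 * lam 1) :: 'p lambda)"
  using lam_1_mu_0 by (simp add: lam_d_mu)

lemma lam_d_lam_prime_power: "lam_d (lam (p ^ i)) = (0 :: 'p lambda)"
  unfolding lam_d_lam
proof (intro sum.neutral ballI)
  fix a assume "a \<in> {..p ^ i}"
  then consider "a = 0" | "a = p ^ i" | "1 \<le> a" "a < p ^ i" by fastforce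
  then show "of_nat (p ^ i choose a) * (lam a * lam (p ^ i - a)) = (0 :: 'p lambda)"
  proof cases
    case 3
    then show ?thesis using bin_prime_power[OF 3] by (simp only: of_nat_lambda lscal_simps mult_zero_left)
  qed simp_all
qed

lemma lact_ab: "lact x (ab y t) = ab (x * y) t"
  by (simp add: ab_def lact_simps)

lemma lact_zero_left: "lact 0 x = 0"
  by (rule poly_mapping_eqI) (simp add: lookup_lact)

lemma hat_cocycle:
  assumes "1 \<le> k" "k \<le> p - 1"
  shows "cochain_d P_module (ab (1 :: 'p lambda) (k * p ^ j - 1)) = 0"
proof -
  have "cochain_d P_module (ab (1 :: 'p lambda) (k * p ^ j - 1)) = Z0 (k * p ^ j - 1) (\<lambda>_. 0)"
    unfolding Z0_bd[symmetric] by (rule Z0_cong) (rule bd_hat_eq_0[OF assms])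
  then show ?thesis by (simp add: Z0_def lscal_simps ab_def)
qed

lemma h_hat_eq: "h_hat j = (h_hat_k j (p - 1) :: 'p extP)"
  by (simp add: h_hat_def h_hat_k_def card_p)

lemma products:
  assumes "1 \<le> k" "k \<le> p - 1"
  shows "alpha0 \<odot> h_hat_k j k = (clsP (ab (mu 0) (k * p ^ j - 1)) :: 'p extP)"
    and "h_cls i \<odot> h_hat_k j k = (clsP (ab (lam (p ^ i)) (k * p ^ j - 1)) :: 'p extP)"
  unfolding alpha0_def h_cls_def h_hat_k_def card_p
    ext_mult_cls[OF lam_d_mu_0 hat_cocycle[OF assms]] ext_mult_cls[OF lam_d_lam_prime_power hat_cocycle[OF assms]]
  by (simp_all add: lact_ab)

lemma ext_P0_ab: "ext_P0 (clsP (ab (lam q) t)) = (clsP (ab (lam (p * q)) (p * (t + 1) - 1)) :: 'p extP)"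
  unfolding ext_P0_cls ab_def cochain_P0_single lam_P0_lam card_p ..

lemma ext_P0_iter_ab:
  assumes "1 \<le> n"
  shows "(ext_P0 ^^ e) (clsP (ab (lam q) (n - 1))) = (clsP (ab (lam (p ^ e * q)) (p ^ e * n - 1)) :: 'p extP)"
proof (induction e)
  case (Suc e)
  have "1 * 1 \<le> p ^ e * n" using assms p_ge_3 by (intro mult_le_mono) simp_all
  then have "p ^ e * n - 1 + 1 = p ^ e * n" by linarith
  then show ?case using Suc by (simp only: funpow.simps o_apply ext_P0_ab) (simp only: power_Suc mult.assoc)
qed simp

text \<open>P^0 raises both subscripts of a product by one, so every product with an
  \<open>h_cls\<close> is an iterate of one in which a subscript is 0.\<close>

lemma h_product_shift:
  assumes "1 \<le> k" "k \<le> p - 1"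
  shows "h_cls (e + a) \<odot> h_hat_k (e + b) k =
    ((ext_P0 ^^ e) (clsP (ab (lam (p ^ a)) (k * p ^ b - 1))) :: 'p extP)"
proof -
  have "1 * 1 \<le> k * p ^ b" using assms p_ge_3 by (intro mult_le_mono) simp_all
  then have "(ext_P0 ^^ e) (clsP (ab (lam (p ^ a)) (k * p ^ b - 1))) =
      (clsP (ab (lam (p ^ e * p ^ a)) (p ^ e * (k * p ^ b) - 1)) :: 'p extP)"
    by (intro ext_P0_iter_ab) simp
  moreover have "p ^ e * (k * p ^ b) = k * p ^ (e + b)" by (simp add: power_add)
  ultimately show ?thesis by (simp only: products[OF assms] power_add)
qed

lemma h_left_value: "1 \<le> k \<Longrightarrow> k \<le> p - 1 \<Longrightarrow> h_cls (e + m) \<odot> h_hat_k e k = v0 e (HL_base m k)"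
  using h_product_shift[of k e m 0] p_ge_3 by (simp add: v0_def ab_cl0)

lemma h_right_value: "1 \<le> k \<Longrightarrow> k \<le> p - 1 \<Longrightarrow> h_cls e \<odot> h_hat_k (e + m) k = v0 e (HR_base m k)"
  using h_product_shift[of k e 0 m] ab_cl0[of 1 "k * p ^ m - 1"] by (simp add: v0_def)

lemma one_index: "N < 2 * (p - 1) \<Longrightarrow> 1 \<le> i \<Longrightarrow> i * (p - 1) \<le> N \<Longrightarrow> i = 1"
proof (rule ccontr)
  assume "N < 2 * (p - 1)" "1 \<le> i" "i * (p - 1) \<le> N" "i \<noteq> 1"
  then have "2 * (p - 1) \<le> i * (p - 1)" by (intro mult_le_mono1) simp
  then show False using \<open>i * (p - 1) \<le> N\<close> \<open>N < 2 * (p - 1)\<close> by linarith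
qed

lemma no_index: "N < p - 1 \<Longrightarrow> i * (p - 1) \<le> N \<Longrightarrow> i = 0"
proof (rule ccontr)
  assume "N < p - 1" "i * (p - 1) \<le> N" "i \<noteq> 0"
  then have "1 * (p - 1) \<le> i * (p - 1)" by (intro mult_le_mono1) simp
  then show False using \<open>i * (p - 1) \<le> N\<close> \<open>N < p - 1\<close> by linarith
qed

text \<open>With \<open>N = p - 1\<close> only \<open>i = 1\<close> is in range, where
  \<open>delta 1\<close> and \<open>1 / i\<close> agree.\<close>

lemma h_same_value: "h_cls e \<odot> h_hat_k e 1 = v0 e (K_base 0)"
proof -
  have "clsP (ab (lam (p ^ 0)) (1 * p ^ 0 - 1)) = cl0 (0 + 1 * (p - 1)) (delta 1)"
    using ab_cl0[of 1 0] by simp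
  also have "\<dots> = cl0 (base_N (K_base 0)) (base_coeffs (K_base 0))"
  proof -
    have "cl0 (p - 1) (delta 1) = cl0 (p - 1) (\<lambda>i. 1 / of_nat i)"
    proof (rule cl0_cong)
      fix i assume i: "1 \<le> i" "i * (p - 1) \<le> p - 1"
      have "i = 1" by (rule one_index[OF _ i]) (use p_ge_3 in simp)
      then show "delta 1 i = (1 / of_nat i :: 'p mod_ring)" by (simp add: delta_def)
    qed
    then show ?thesis by simp
  qed
  finally show ?thesis
    using h_product_shift[of 1 e 0 0] p_ge_3 by (simp add: v0_def)
qed

lemma d_hat_value: "d_hat (e + 1) k = v0 e (D_base k)"
  using ab_cl0[of p "k * p + p - 2"] p_ge_3 by (simp add: v0_def d_hat_def card_p)

lemma Z0_sum:
  assumes c: "\<And>i. m + 1 < i \<Longrightarrow> i * (p - 1) \<le> N \<Longrightarrow> c i = 0"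
    and t: "\<And>j. j \<le> m \<Longrightarrow> N = t j + (j + 1) * (p - 1)"
  shows "Z0 N c = (\<Sum>j\<le>m. ab (lscal (c (j + 1)) * lam (j + 1)) (t j))"
proof -
  let ?f = "\<lambda>i. ab (lscal (c i) * lam i) (N - i * (p - 1))"
  have img: "Suc ` {..m} = {1..m + 1}" by (simp add: image_Suc_atMost)
  have "Z0 N c = (\<Sum>i\<in>Suc ` {..m}. ?f i)"
    unfolding Z0_def
  proof (rule sum.mono_neutral_right[OF finite_index(2)])
    show "Suc ` {..m} \<subseteq> {i. 1 \<le> i \<and> i * (p - 1) \<le> N}"
    proof
      fix i assume "i \<in> Suc ` {..m}"
      then obtain j where j: "i = j + 1" "j \<le> m" by auto
      have "i * (p - 1) \<le> N" unfolding t[OF j(2)] j(1) by (rule le_add2)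
      then show "i \<in> {i. 1 \<le> i \<and> i * (p - 1) \<le> N}" using j(1) by simp
    qed
    show "\<forall>i\<in>{i. 1 \<le> i \<and> i * (p - 1) \<le> N} - Suc ` {..m}. ?f i = 0"
    proof
      fix i assume "i \<in> {i. 1 \<le> i \<and> i * (p - 1) \<le> N} - Suc ` {..m}"
      then have "m + 1 < i" "i * (p - 1) \<le> N" unfolding img by auto
      then have "c i = 0" by (rule c)
      then show "?f i = 0" by (simp only: lscal_simps mult_zero_left ab_def single_zero)
    qed
  qed
  also have "\<dots> = (\<Sum>j\<le>m. ?f (Suc j))" by (simp add: sum.reindex)
  also have "\<dots> = (\<Sum>j\<le>m. ab (lscal (c (j + 1)) * lam (j + 1)) (t j))"
  proof (intro sum.cong refl)
    fix j assume "j \<in> {..m}"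
    then have "N - (j + 1) * (p - 1) = t j" using t[of j] by simp
    then show "?f (Suc j) = ab (lscal (c (j + 1)) * lam (j + 1)) (t j)" by (simp only: Suc_eq_plus1)
  qed
  finally show ?thesis .
qed

lemma k_hat_value:
  assumes "k \<le> p - 2"
  shows "k_hat e k = v0 e (K_base k)"
proof -
  have "Z0 (base_N (K_base k)) (base_coeffs (K_base k)) =
      (\<Sum>j\<le>k. ab (lscal (1 / of_nat (j + 1)) * lam (j + 1)) ((k - j) * p + j))"
    unfolding base_N.simps base_coeffs.simps
  proof (rule Z0_sum)
    show "1 / of_nat i = (0 :: 'p mod_ring)" if "k + 1 < i" "i * (p - 1) \<le> p * k + (p - 1)" for i
      using K_range[OF assms that(2)] that(1) by simp
    fix j assume "j \<le> k"
    then obtain l where k: "k = j + l" using le_Suc_ex by blast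
    obtain t where p: "p = t + 1" "2 \<le> t" by (rule p_pred)
    show "p * k + (p - 1) = (k - j) * p + j + (j + 1) * (p - 1)" unfolding k p by (simp add: algebra_simps)
  qed
  then show ?thesis by (simp only: v0_def k_hat_def cl0_def card_p)
qed

lemma p_hat_value:
  assumes r: "1 \<le> r" "r \<le> p - 2"
  shows "p_hat e r = v0 e (P_base r)"
proof -
  have "Z0 (base_N (P_base r)) (base_coeffs (P_base r)) =
      (\<Sum>j\<le>p - 1 - r. ab (lscal (pvec r (j + 1)) * lam (j + 1)) ((p - j - 1) * p + r + j))"
    unfolding base_N.simps base_coeffs.simps
  proof (rule Z0_sum)
    show "pvec r i = (0 :: 'p mod_ring)" if "p - 1 - r + 1 < i" for i
      using that r by (simp add: pvec_def)
    fix j assume "j \<le> p - 1 - r"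
    then have "j + 1 \<le> p" using r by simp
    then obtain l where p: "p = l + j + 1" by (metis add.assoc le_add_diff_inverse2)
    obtain r' where r': "r = r' + 1" using r(1) by (metis le_add_diff_inverse2)
    show "p * p + r - 1 = (p - j - 1) * p + r + j + (j + 1) * (p - 1)"
      unfolding p r' by (simp add: algebra_simps)
  qed
  also have "\<dots> = (\<Sum>j\<le>p - 1 - r. ab (lscal (of_nat ((r + j) choose j) / of_nat (j + 1)) * lam (j + 1))
        ((p - j - 1) * p + r + j))"
  proof (intro sum.cong refl)
    fix j assume "j \<in> {..p - 1 - r}"
    then have "j + 1 \<le> p - r" using r by simp
    then have "pvec r (j + 1) = (of_nat ((r + j) choose j) / of_nat (j + 1) :: 'p mod_ring)"
      by (simp add: pvec_def)
    then show "ab (lscal (pvec r (j + 1)) * lam (j + 1)) ((p - j - 1) * p + r + j) =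
        (ab (lscal (of_nat ((r + j) choose j) / of_nat (j + 1)) * lam (j + 1)) ((p - j - 1) * p + r + j) :: pbasis \<Rightarrow>\<^sub>0 'p lambda)"
      by (simp only:)
  qed
  finally show ?thesis by (simp only: v0_def p_hat_def cl0_def card_p)
qed

text \<open>With \<open>bd_adjacent_1\<close>: the coboundary of
  \<open>ab^[kp - 1 + (p - 1)]\<close> is minus \<open>lam 1\<close> times
  \<open>ab^[kp - 1]\<close>, plus a single \<open>lam p\<close> term if \<open>k = p\<close>. The
  case \<open>k < p\<close> yields \<open>h_vanish_succ\<close>; the case \<open>k = p\<close>
  identifies \<open>d_hat (e + 1) 1\<close> with a product.\<close>

lemma bd_adjacent:
  assumes k: "1 \<le> k" "k \<le> p" and i: "2 \<le> i" "i * (p - 1) \<le> k * p - 1 + (p - 1)"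
  shows "bd (k * p - 1 + (p - 1)) i = (if i = p \<and> k = p then 1 else 0)"
proof -
  obtain t where p: "p = t + 1" "2 \<le> t" by (rule p_pred)
  obtain s where s: "i = s + 1" "1 \<le> s" using i(1) by (metis add_le_cancel_right le_add_diff_inverse2 one_add_one order.trans one_le_numeral)
  have st: "s * t \<le> k * p - 1" using i(2) unfolding s p by simp
  have eq: "bd (k * p - 1 + (p - 1)) i = bin (k * p - 1 - s * t) (s + 1)"
  proof -
    have "k * p - 1 + (p - 1) - (s + 1) * (p - 1) = k * p - 1 - s * (p - 1)" by simp
    then have "bd (k * p - 1 + (p - 1)) i = bin (k * p - 1 - s * (p - 1)) (s + 1)"
      by (simp only: bd_def s(1))
    moreover have "p - 1 = t" using p(1) by simp
    ultimately show ?thesis by (simp only:)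
  qed
  have kp: "k * p = k * t + k" unfolding p by simp
  show ?thesis
  proof (cases "s \<le> k")
    case False
    have "s = k + 1"
    proof (rule ccontr)
      assume "s \<noteq> k + 1"
      then have "(k + 2) * t \<le> s * t" using False by (intro mult_le_mono1) simp
      then have "(k + 2) * t \<le> k * t + k - 1" using st kp by linarith
      then show False using k p by simp
    qed
    then have "t + 1 \<le> k" using st k unfolding kp by simp
    then have "k = p" using k p by simp
    then show ?thesis using s \<open>s = k + 1\<close> unfolding eq unfolding kp p by (simp add: binomial_eq_0)
  next
    case True
    then obtain l where l: "k = s + l" using le_Suc_ex by blast
    obtain s' where s': "s = s' + 1" using s(2) by (metis le_add_diff_inverse2)
    have v: "k * p - 1 - s * t = p * l + s'" unfolding kp l s' p by (simp add: algebra_simps)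
    consider "s + 1 < p" | "s + 1 = p" | "s = p" using l k by linarith
    then show ?thesis
    proof cases
      case 1
      then have "bin (p * l + s') (p * 0 + (s + 1)) = 0" using s' by (intro lucas_rs) simp_all
      then show ?thesis using 1 s unfolding eq v by simp
    next
      case 2
      then have "bin (p * l + s') (p * 1) = bin l 1" using s' by (intro lucas_r0) simp
      then have "bd (k * p - 1 + (p - 1)) i = of_nat l" unfolding eq v 2 by simp
      moreover have "l = (if k = p then 1 else 0)" using 2 l k by simp
      ultimately show ?thesis using 2 s by simp
    next
      case 3
      then have "l = 0" using l k by simp
      then show ?thesis using 3 s s' unfolding eq v by (simp add: binomial_eq_0)
    qed
  qed
qed

lemma bd_adjacent_1: "1 \<le> k \<Longrightarrow> bd (k * p - 1 + (p - 1)) 1 = - 1"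
proof -
  assume "1 \<le> k"
  then have "1 * 1 \<le> k * p" using p_ge_3 by (intro mult_le_mono) simp_all
  then have "k * p - 1 + (p - 1) + 1 = k * p + (p - 1)" by linarith
  then have "bd (k * p - 1 + (p - 1)) 1 = of_nat (k * p + (p - 1))"
    by (simp only: bd_at_1[of "k * p - 1 + (p - 1)"] le_add2)
  also have "\<dots> = - 1" using of_nat_p_minus[of 1] p_ge_3 by simp
  finally show ?thesis .
qed

lemma d_hat_1_value: "d_hat (e + 1) 1 = v0 e (HR_base 2 1)"
proof -
  obtain t where p: "p = t + 1" "2 \<le> t" by (rule p_pred)
  have N: "1 * p + p - 2 + p * (p - 1) = p * p - 1 + (p - 1)" unfolding p by simp
  have "cl0 (p * p - 1 + (p - 1)) (delta p) = cl0 (p * p - 1 + (p - 1)) (\<lambda>i. 1 * delta 1 i + 1 * bd (p * p - 1 + (p - 1)) i)"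
  proof (rule cl0_cong)
    fix i assume i: "1 \<le> i" "i * (p - 1) \<le> p * p - 1 + (p - 1)"
    show "delta p i = 1 * delta 1 i + 1 * bd (p * p - 1 + (p - 1)) i"
    proof (cases "i = 1")
      case True
      then show ?thesis using bd_adjacent_1[of p] p_ge_3 by (simp add: delta_def)
    next
      case False
      then have "2 \<le> i" using i by simp
      then show ?thesis using bd_adjacent[of p i] i False p_ge_3 by (simp add: delta_def)
    qed
  qed
  also have "\<dots> = cl0 (p * p - 1 + (p - 1)) (delta 1)" unfolding cl0_lincomb cl0_bd by simp
  finally have "cl0 (base_N (D_base 1)) (base_coeffs (D_base 1)) = cl0 (base_N (HR_base 2 1)) (base_coeffs (HR_base 2 1))"
    using N by (simp add: power2_eq_square)
  then show ?thesis unfolding d_hat_value v0_def by (simp only:)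
qed

lemma ext_P0_iter_zero: "(ext_P0 ^^ e) (0 :: 'p extP) = 0"
  by (induction e) (simp_all add: ext_P0_zero)

lemma h_vanish_succ:
  assumes k: "1 \<le> k" "k \<le> p - 1"
  shows "h_cls e \<odot> h_hat_k (e + 1) k = (0 :: 'p extP)"
proof -
  have kp: "k \<le> p" "k \<noteq> p" using k p_ge_3 by simp_all
  have "cl0 (k * p - 1 + (p - 1)) (delta 1) = cl0 (k * p - 1 + (p - 1)) (\<lambda>i. (- 1) * bd (k * p - 1 + (p - 1)) i)"
  proof (rule cl0_cong)
    fix i assume i: "1 \<le> i" "i * (p - 1) \<le> k * p - 1 + (p - 1)"
    show "delta 1 i = (- 1) * bd (k * p - 1 + (p - 1)) i"
    proof (cases "i = 1")
      case True
      then show ?thesis using bd_adjacent_1[OF k(1)] by (simp add: delta_def)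
    next
      case False
      then have "2 \<le> i" using i by simp
      then show ?thesis using bd_adjacent[OF k(1) kp(1)] i False kp by (simp add: delta_def)
    qed
  qed
  also have "\<dots> = 0" unfolding cl0_scale cl0_bd by simp
  finally have "cl0 (k * p - 1 + (p - 1)) (delta 1) = 0" .
  then have "clsP (ab (lam (p ^ 0)) (k * p ^ 1 - 1)) = (0 :: 'p extP)" using ab_cl0[of 1 "k * p - 1"] by simp
  then show ?thesis using h_product_shift[OF k, of e 0 1] ext_P0_iter_zero by simp
qed

text \<open>The coboundary of \<open>ab^[k - 1 + (p - 1)]\<close> is \<open>k - 1\<close> times
  \<open>lam 1\<close> in front of \<open>ab^[k - 1]\<close>, and \<open>k - 1\<close> is
  invertible. For \<open>k = 1\<close> this coboundary is 0.\<close>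

lemma h_vanish_same:
  assumes k: "2 \<le> k" "k \<le> p - 1"
  shows "h_cls e \<odot> h_hat_k e k = (0 :: 'p extP)"
proof -
  define N where "N = k - 1 + (p - 1)"
  have k0: "(of_nat (k - 1) :: 'p mod_ring) \<noteq> 0" using k p_ge_3 by (intro of_nat_nz) simp_all
  have "N + 1 = p + (k - 1)" using k p_ge_3 by (simp add: N_def)
  then have b1: "bd N 1 = of_nat (p + (k - 1))" using bd_at_1[of N] by (simp add: N_def)
  have "cl0 N (delta 1) = cl0 N (\<lambda>i. (1 / of_nat (k - 1)) * bd N i)"
  proof (rule cl0_cong)
    fix i assume i: "1 \<le> i" "i * (p - 1) \<le> N"
    have "N < 2 * (p - 1)" using k p_ge_3 unfolding N_def by linarith
    from one_index[OF this i] have "i = 1" .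
    then show "delta 1 i = (1 / of_nat (k - 1)) * bd N i" using b1 k0 by (simp add: delta_def)
  qed
  also have "\<dots> = 0" unfolding cl0_scale cl0_bd by simp
  finally have "cl0 N (delta 1) = 0" .
  then have "clsP (ab (lam (p ^ 0)) (k * p ^ 0 - 1)) = (0 :: 'p extP)" using ab_cl0[of 1 "k - 1"] by (simp add: N_def)
  then show ?thesis using h_product_shift[of k e 0 0] k ext_P0_iter_zero by simp
qed

lemma ab_mu:
  assumes "q * (p - 1) \<le> N"
  shows "Z1 N (delta q) (\<lambda>_. 0) = (ab (mu q) (N - q * (p - 1)) :: pbasis \<Rightarrow>\<^sub>0 'p lambda)"
proof -
  have "(\<Sum>i | i * (p - 1) \<le> N. ab (lscal (delta q i) * mu i) (N - i * (p - 1))) =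
      (ab (lscal (delta q q) * mu q) (N - q * (p - 1)) :: pbasis \<Rightarrow>\<^sub>0 'p lambda)"
  proof (rule sum_eq_single[OF finite_index(1)])
    show "q \<in> {i. i * (p - 1) \<le> N}" using assms by blast
    fix i assume "i \<noteq> q"
    then have "delta q i = (0 :: 'p mod_ring)" by (simp add: delta_def)
    then show "ab (lscal (delta q i) * mu i) (N - i * (p - 1)) = (0 :: pbasis \<Rightarrow>\<^sub>0 'p lambda)"
      by (simp only: lscal_simps mult_zero_left ab_def single_zero)
  qed
  then show ?thesis unfolding Z1_def by (simp add: delta_def lscal_simps)
qed

text \<open>For \<open>k < p\<close> the coboundary of \<open>b^[k]\<close> is \<open>mu 0\<close>
  in front of \<open>ab^[k - 1]\<close>.\<close>

lemma alpha0_vanish: "1 \<le> k \<Longrightarrow> k \<le> p - 1 \<Longrightarrow> alpha0 \<odot> h_hat_k 0 k = (0 :: 'p extP)"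
proof -
  assume k: "1 \<le> k" "k \<le> p - 1"
  have lt: "k - 1 < p - 1" using k p_ge_3 by simp
  have "alpha0 \<odot> h_hat_k 0 k = cl1 (k - 1) (delta 0) (\<lambda>_. 0)"
    unfolding products(1)[OF k] cl1_def using ab_mu[of 0 "k - 1"] by simp
  also have "\<dots> = cl1 (k - 1) (bd (k - 1)) (bd (k - 1 + 1))"
  proof (rule cl1_cong)
    show "delta 0 i = bd (k - 1) i" if "i * (p - 1) \<le> k - 1" for i
      using no_index[OF lt that] by (simp add: delta_def bd_def)
    show "0 = bd (k - 1 + 1) i" if "1 \<le> i" "i * (p - 1) \<le> k - 1" for i
      using no_index[OF lt that(2)] that(1) by simp
  qed
  finally show ?thesis by (simp only: cl1_bd)
qed

lemma alpha0_value: "1 \<le> k \<Longrightarrow> k \<le> p - 1 \<Longrightarrow> alpha0 \<odot> h_hat_k i k = v1 (Alpha_h i k)"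
  using ab_mu[of 0 "k * p ^ i - 1"] by (simp add: v1_def cl1_def products)

lemma Alpha_hat_cochain:
  "Z1 (base1_N (Alpha_hat l)) (base1_coeffs (Alpha_hat l)) (\<lambda>_. 0) = (ab (mu 0) (p + l) + ab (of_nat (l + 1) * mu 1) (l + 1) :: pbasis \<Rightarrow>\<^sub>0 'p lambda)"
proof -
  have sub: "p + l - (p - 1) = l + 1" using p_ge_3 by simp
  have "Z1 (p + l) (\<lambda>i. 1 * delta 0 i + of_nat (l + 1) * delta 1 i) (\<lambda>i. 1 * 0 + of_nat (l + 1) * 0) =
      (lact (lscal 1) (ab (mu 0) (p + l)) + lact (lscal (of_nat (l + 1))) (ab (mu 1) (l + 1)) :: pbasis \<Rightarrow>\<^sub>0 'p lambda)"
    unfolding Z1_lincomb using ab_mu[of 0 "p + l"] ab_mu[of 1 "p + l"] sub by simp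
  then show ?thesis by (simp add: lact_ab lscal_simps lscal_of_nat)
qed

lemma alpha_hat_value: "alpha_hat l = v1 (Alpha_hat l)"
  unfolding v1_def cl1_def Alpha_hat_cochain alpha_hat_def card_p ..

text \<open>For \<open>Alpha_hat l\<close> the coboundary of \<open>ab^[p + l]\<close> is
  \<open>l + 1\<close> times \<open>lam 1\<close> in front of \<open>ab^[l + 1]\<close>. The
  coefficient \<open>l + 1\<close> of the second summand is the one for which the differential
  \<open>- (mu 0 * lam 1)\<close> of \<open>mu 1\<close> cancels this.\<close>

lemma valid1_cocycle: "valid1 b \<Longrightarrow> cochain_d P_module (Z1 (base1_N b) (base1_coeffs b) (\<lambda>_. 0) :: pbasis \<Rightarrow>\<^sub>0 'p lambda) = 0"
proof (cases b)
  case (Alpha_h i k)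
  assume "valid1 b"
  then have k: "1 \<le> k" "k \<le> p - 1" using Alpha_h by simp_all
  have "Z1 (base1_N b) (base1_coeffs b) (\<lambda>_. 0) = lact (mu 0) (ab (1 :: 'p lambda) (k * p ^ i - 1))"
    using ab_mu[of 0 "k * p ^ i - 1"] by (simp add: Alpha_h lact_ab)
  then show ?thesis
    by (simp only: cochain_d_lact hat_cocycle[OF k] lam_d_mu_0 lact_0 lact_zero_left add_0_left)
next
  case (Alpha_hat l)
  assume "valid1 b"
  then have l: "l + 1 < p - 1" using Alpha_hat by simp
  have "Z0 (p + l) (bd (p + l)) = Z0 (p + l) (\<lambda>i. of_nat (l + 1) * delta 1 i)"
  proof (rule Z0_cong)
    fix i assume i: "1 \<le> i" "i * (p - 1) \<le> p + l"
    have "p + l < 2 * (p - 1)" using l by linarith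
    from one_index[OF this i] have "i = 1" .
    moreover have "bd (p + l) 1 = of_nat (l + 1)" using bd_at_1[of "p + l"] by (simp add: add.assoc)
    ultimately show "bd (p + l) i = of_nat (l + 1) * delta 1 i" by (simp add: delta_def)
  qed
  also have "\<dots> = ab (of_nat (l + 1) * lam 1) (l + 1)"
  proof -
    have "p + l - (p - 1) = l + 1" using p_ge_3 by simp
    moreover have "p + l = l + 1 + (0 + 1) * (p - 1)" using p_ge_3 by simp
    ultimately show ?thesis
      unfolding lscal_of_nat[symmetric]
      using Z0_sum[of 0 "p + l" "\<lambda>i. of_nat (l + 1) * delta 1 i" "\<lambda>_. l + 1"]
      by (simp add: delta_def)
  qed
  finally have d0: "cochain_d P_module (ab (1 :: 'p lambda) (p + l)) = ab (of_nat (l + 1) * lam 1) (l + 1)"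
    unfolding Z0_bd .
  have "Z0 (l + 1) (bd (l + 1)) = Z0 (l + 1) (\<lambda>_. 0)"
    by (rule Z0_cong) (use no_index[OF l] in auto)
  then have d1: "cochain_d P_module (ab (1 :: 'p lambda) (l + 1)) = 0"
    unfolding Z0_bd by (simp add: Z0_def lscal_simps ab_def)
  have sgn: "lam_sgn (of_nat (l + 1) * mu 1) = (of_nat (l + 1) * mu 1 :: 'p lambda)"
    "lam_d (of_nat (l + 1) * mu 1) = (- (of_nat (l + 1) * (mu 0 * lam 1)) :: 'p lambda)"
    unfolding lscal_of_nat[symmetric] lam_sgn_scal lam_d_scal lam_sgn_mu lam_d_mu_1 by simp_all
  have "Z1 (base1_N b) (base1_coeffs b) (\<lambda>_. 0) = lact (mu 0) (ab (1 :: 'p lambda) (p + l)) + lact (of_nat (l + 1) * mu 1) (ab 1 (l + 1))"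
    unfolding Alpha_hat Alpha_hat_cochain by (simp add: lact_ab)
  then have "cochain_d P_module (Z1 (base1_N b) (base1_coeffs b) (\<lambda>_. 0) :: pbasis \<Rightarrow>\<^sub>0 'p lambda) =
      ab (mu 0 * (of_nat (l + 1) * lam 1)) (l + 1) + ab (- (of_nat (l + 1) * (mu 0 * lam 1))) (l + 1)"
    by (simp only: cochain_d_additive cochain_d_lact d0 d1 lam_d_mu_0 lam_sgn_mu sgn lact_0 lact_zero_left
      add_0_left add_0_right) (simp only: lact_ab mult_1_right)
  also have "\<dots> = ab (mu 0 * (of_nat (l + 1) * lam 1) - of_nat (l + 1) * (mu 0 * lam 1)) (l + 1)"
    by (simp add: ab_def flip: single_add)
  also have "\<dots> = 0"
    unfolding of_nat_left by (simp add: ab_def)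
  finally show ?thesis .
qed

end

section \<open>Spanning and linear independence\<close>

context odd_char
begin

lemma coc1_cong:
  assumes c: "\<And>i. i * (p - 1) \<le> N \<Longrightarrow> c i = c' i"
    and g: "\<And>i. 1 \<le> i \<Longrightarrow> i * (p - 1) \<le> N \<Longrightarrow> g i = g' i"
    and coc: "coc1 N c g"
  shows "coc1 N c' g'"
  unfolding coc1_def
proof (intro allI impI)
  fix D T assume N: "N = T + D * (p - 1)"
  obtain E F G where at: "coc1_at D T c g E F G" using coc N unfolding coc1_def by blast
  have le: "a * (p - 1) \<le> N" if "a \<le> D" for a
    unfolding N using mult_le_mono1[OF that] by (rule trans_le_add2)
  have P0_coeffs: "c' a = c a" if "a \<le> D" for a using c[OF le[OF that]] ..
  have gg: "g' a = g a" if "1 \<le> a" "a \<le> D" for a using g[OF that(1) le[OF that(2)]] ..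
  have "coc1_at D T c' g' E F G"
    unfolding coc1_at_def
  proof (intro conjI allI impI)
    fix a
    show "c' D * bin D a - g' a * bin T (D - a) =
        (\<Sum>m=1..D. F m * R D m a) + (\<Sum>m\<le>D. G m * R (D - 1) m (a - 1))" if "1 \<le> a" "a \<le> D"
      unfolding gg[OF that] P0_coeffs[OF order.refl] by (rule coc1_atD(1)[OF at that])
    show "- (c' D * bin D a) + c' a * bin T (D - a) = - (\<Sum>m=1..D. F m * R D m a)" if "a < D"
      unfolding P0_coeffs[OF less_imp_le[OF that]] P0_coeffs[OF order.refl] by (rule coc1_atD(2)[OF at that])
    show "g' D * bin D a - g' a * bin (T + 1) (D - a) = (\<Sum>m=1..D. E m * R D m a)" if "1 \<le> a" "a < D"
    proof -
      have "1 \<le> D" using that by simp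
      then show ?thesis
        unfolding gg[OF that(1) less_imp_le[OF that(2)]] gg[OF \<open>1 \<le> D\<close> order.refl] by (intro coc1_atD(3)[OF at that])
    qed
  qed
  then show "\<exists>E F G. coc1_at D T c' g' E F G" by blast
qed

lemma bd_iter_p:
  shows "bd (p ^ e * (M + 1) - 1) (p ^ e * j) = bd M j"
proof (induction e)
  case (Suc e)
  have "1 * 1 \<le> p ^ e * (M + 1)" using p_ge_3 by (intro mult_le_mono) simp_all
  then obtain X where X: "p ^ e * (M + 1) = X + 1" by (metis le_add_diff_inverse2 mult_1)
  have "p ^ Suc e * (M + 1) = p * X + p" unfolding power_Suc mult.assoc X by simp
  then have "p ^ Suc e * (M + 1) - 1 = p * X + (p - 1)" using p_ge_3 by simp
  then have "bd (p ^ Suc e * (M + 1) - 1) (p ^ Suc e * j) = bd (p * X + (p - 1)) (p * (p ^ e * j))"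
    by (simp only: power_Suc mult.assoc)
  also have "\<dots> = bd X (p ^ e * j)" by (rule bd_mult_p)
  also have "X = p ^ e * (M + 1) - 1" using X by simp
  finally show ?case using Suc by simp
qed simp

lemma unit_decomp:
  assumes "p ^ e * u = p ^ e' * u'" "\<not> p dvd u" "\<not> p dvd u'"
  shows "e = e'" "u = u'"
proof -
  have le: "e \<le> e'" if "p ^ e * u = p ^ e' * u'" "\<not> p dvd u'" for e e' u u'
  proof (rule ccontr)
    assume "\<not> ?thesis"
    then obtain d where d: "e = e' + Suc d" by (metis add_Suc_right less_imp_Suc_add not_le)
    then have "p ^ e' * (p * (p ^ d * u)) = p ^ e' * u'" using that(1) by (simp add: power_add mult_ac)
    then have "p * (p ^ d * u) = u'" using p_ge_3 by simp
    then show False using that(2) by auto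
  qed
  show e: "e = e'" using le[OF assms(1,3)] le[OF assms(1)[symmetric] assms(2)] by simp
  show "u = u'" using assms(1) p_ge_3 unfolding e by simp
qed

lemma not_dvd_small: "1 \<le> k \<Longrightarrow> k \<le> p - 1 \<Longrightarrow> \<not> p dvd k"
  using p_ge_3 by (auto dest: dvd_imp_le)

end

text \<open>Formal names of the basis elements, \<open>e\<close> counting the applications of P^0.
  Independence is proved for families over these names, which also shows that different names give
  different classes.\<close>

datatype index = I0 nat base | I1 base1

section \<open>Degrees of the basis cochains, and the span as Ext^1\<close>

context odd_card
begin

lemma lambda_bi_len: "x \<in> lambda_bi s t \<Longrightarrow> x \<in> lambda_len s"
  by (auto simp: lambda_bi_def lambda_len_def)

lemma lambda_bi_0: "(0 :: 'p lambda) \<in> lambda_bi s t"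
  unfolding lambda_bi_def zero_lambda_def by (rule imageI) simp

lemma lscal_lam_bi: "1 \<le> i \<Longrightarrow> lscal c * lam i \<in> (lambda_bi 1 (2 * i * (p - 1) - 1) :: 'p lambda set)"
proof -
  assume i: "1 \<le> i"
  have "lscal c * lam i = abs_lambda (Poly_Mapping.single (Word [Lam (i - 1)]) c :: 'p free_alg)"
    using i by (simp add: lam.abs_eq lscal.abs_eq times_lambda.abs_eq flam_def fscal_single)
  then show ?thesis
    unfolding lambda_bi_def using i by (auto simp: wdeg_def gdeg_def card_p split: if_splits)
qed

lemma lscal_mu_bi: "lscal c * mu i \<in> (lambda_bi 1 (2 * i * (p - 1)) :: 'p lambda set)"
proof -
  have "lscal c * mu i = abs_lambda (Poly_Mapping.single (Word [Mu i]) c :: 'p free_alg)"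
    by (simp add: mu.abs_eq lscal.abs_eq times_lambda.abs_eq fmu_def fscal_single)
  then show ?thesis
    unfolding lambda_bi_def by (auto simp: wdeg_def gdeg_def card_p split: if_splits)
qed

lemma lookup_Z0_cases:
  "Poly_Mapping.lookup (Z0 N c) (Odd t) = 0 \<or>
    (\<exists>i\<ge>1. t + i * (p - 1) = N \<and> Poly_Mapping.lookup (Z0 N c) (Odd t) = lscal (c i) * lam i)"
proof (cases "\<exists>i\<ge>1. t + i * (p - 1) = N")
  case True
  then obtain i where i: "1 \<le> i" "t + i * (p - 1) = N" by blast
  have "i * (p - 1) \<le> N" "N - i * (p - 1) = t" unfolding i(2)[symmetric] by simp_all
  then show ?thesis using lookup_Z0_at[OF i(1), of N c] i by metis
next
  case False
  then show ?thesis using lookup_Z0_other[of t N c] by blast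
qed

lemma lookup_Z1_cases:
  "Poly_Mapping.lookup (Z1 N c (\<lambda>_. 0)) (Odd t) = 0 \<or>
    (\<exists>i. t + i * (p - 1) = N \<and> Poly_Mapping.lookup (Z1 N c (\<lambda>_. 0)) (Odd t) = lscal (c i) * mu i)"
proof (cases "\<exists>i. t + i * (p - 1) = N")
  case True
  then obtain i where i: "t + i * (p - 1) = N" by blast
  have "i * (p - 1) \<le> N" "N - i * (p - 1) = t" unfolding i[symmetric] by simp_all
  then show ?thesis using lookup_Z1_at(1)[of i N c] i by metis
next
  case False
  have "(lscal (c i) * mu i when t + i * (p - 1) = N) = 0" for i
  proof -
    have "t + i * (p - 1) \<noteq> N" using False by blast
    then show ?thesis by (simp only: when_simps)
  qed
  then show ?thesis unfolding lookup_Z1(1) by (intro disjI1 sum.neutral ballI)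
qed

lemma lookup_Z1_Even: "Poly_Mapping.lookup (Z1 N c (\<lambda>_. 0)) (Even t) = 0"
  unfolding lookup_Z1(2) by (intro sum.neutral ballI) (simp only: lscal_simps mult_zero_left zero_when)

lemma Z0_bi: "Poly_Mapping.lookup (Z0 N c) (Odd t) \<noteq> 0 \<Longrightarrow> 2 * t + 1 \<le> 2 * N"
  "Poly_Mapping.lookup (Z0 N c) (Odd t) \<in> lambda_bi 1 (2 * N - (2 * t + 1))"
proof -
  have deg: "2 * t + 1 \<le> 2 * N" "2 * i * (p - 1) - 1 = 2 * N - (2 * t + 1)"
    if i: "1 \<le> i" "t + i * (p - 1) = N" for i
  proof -
    have "1 * 1 \<le> i * (p - 1)" using i(1) p_ge_3 by (intro mult_le_mono) simp_all
    moreover obtain X where X: "i * (p - 1) = X" by blast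
    ultimately have "1 \<le> X" by (simp only: X mult_1)
    then show "2 * t + 1 \<le> 2 * N" using i(2) unfolding X by simp
    show "2 * i * (p - 1) - 1 = 2 * N - (2 * t + 1)"
      unfolding i(2)[symmetric] mult.assoc X by simp
  qed
  show "Poly_Mapping.lookup (Z0 N c) (Odd t) \<noteq> 0 \<Longrightarrow> 2 * t + 1 \<le> 2 * N"
    using lookup_Z0_cases[of N c t] deg(1) by blast
  show "Poly_Mapping.lookup (Z0 N c) (Odd t) \<in> lambda_bi 1 (2 * N - (2 * t + 1))"
    using lookup_Z0_cases[of N c t] lscal_lam_bi deg(2) lambda_bi_0 by metis
qed

lemma Z1_bi: "Poly_Mapping.lookup (Z1 N c (\<lambda>_. 0)) (Odd t) \<noteq> 0 \<Longrightarrow> 2 * t + 1 \<le> 2 * N + 1"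
  "Poly_Mapping.lookup (Z1 N c (\<lambda>_. 0)) (Odd t) \<in> lambda_bi 1 (2 * N + 1 - (2 * t + 1))"
proof -
  have deg: "2 * t + 1 \<le> 2 * N + 1" "2 * i * (p - 1) = 2 * N + 1 - (2 * t + 1)"
    if i: "t + i * (p - 1) = N" for i
  proof -
    obtain X where X: "i * (p - 1) = X" by blast
    show "2 * t + 1 \<le> 2 * N + 1" unfolding i[symmetric] X by simp
    show "2 * i * (p - 1) = 2 * N + 1 - (2 * t + 1)" unfolding i[symmetric] mult.assoc X by simp
  qed
  show "Poly_Mapping.lookup (Z1 N c (\<lambda>_. 0)) (Odd t) \<noteq> 0 \<Longrightarrow> 2 * t + 1 \<le> 2 * N + 1"
    using lookup_Z1_cases[of N c t] deg(1) by blast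
  show "Poly_Mapping.lookup (Z1 N c (\<lambda>_. 0)) (Odd t) \<in> lambda_bi 1 (2 * N + 1 - (2 * t + 1))"
    using lookup_Z1_cases[of N c t] lscal_mu_bi deg(2) lambda_bi_0 by metis
qed

lemma Z0_Ext_bi:
  assumes "cochain_d P_module (Z0 N c) = 0"
  shows "cl0 N c \<in> Ext_P_bi 1 (1 + 2 * N)"
  unfolding Ext_P_bi_def cl0_def
proof (intro imageI CollectI conjI assms exI[of _ "2 * N"] refl ballI)
  fix h assume h: "h \<in> Poly_Mapping.keys (Z0 N c)"
  then have "Poly_Mapping.lookup (Z0 N c) h \<noteq> 0" by (simp add: in_keys_iff)
  then obtain t where t: "h = Odd t" using lookup_Z0(2) by (cases h) auto
  have "mdeg (P_module :: (pbasis, 'p) A_module) h = 2 * t + 1" by (simp only: t P_sel)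
  then show "mdeg (P_module :: (pbasis, 'p) A_module) h \<le> 2 * N"
    "Poly_Mapping.lookup (Z0 N c) h \<in> lambda_bi 1 (2 * N - mdeg (P_module :: (pbasis, 'p) A_module) h)"
    using Z0_bi(1)[OF \<open>Poly_Mapping.lookup (Z0 N c) h \<noteq> 0\<close>[unfolded t]] Z0_bi(2)[of N c t] by (simp_all only: t)
qed

lemma Z1_Ext_bi:
  assumes "cochain_d P_module (Z1 N c (\<lambda>_. 0)) = 0"
  shows "cl1 N c (\<lambda>_. 0) \<in> Ext_P_bi 1 (1 + (2 * N + 1))"
  unfolding Ext_P_bi_def cl1_def
proof (intro imageI CollectI conjI assms exI[of _ "2 * N + 1"] refl ballI)
  let ?z = "Z1 N c (\<lambda>_. 0)"
  fix h assume h: "h \<in> Poly_Mapping.keys ?z"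
  then have "Poly_Mapping.lookup ?z h \<noteq> 0" by (simp add: in_keys_iff)
  then obtain t where t: "h = Odd t" using lookup_Z1_Even by (cases h) auto
  have "mdeg (P_module :: (pbasis, 'p) A_module) h = 2 * t + 1" by (simp only: t P_sel)
  then show "mdeg (P_module :: (pbasis, 'p) A_module) h \<le> 2 * N + 1"
    "Poly_Mapping.lookup ?z h \<in> lambda_bi 1 (2 * N + 1 - mdeg (P_module :: (pbasis, 'p) A_module) h)"
    using Z1_bi(1)[OF \<open>Poly_Mapping.lookup ?z h \<noteq> 0\<close>[unfolded t]] Z1_bi(2)[of N c t] by (simp_all only: t)
qed

lemma Z1_cocycles:
  assumes "cochain_d P_module (Z1 N c (\<lambda>_. 0)) = 0"
  shows "Z1 N c (\<lambda>_. 0) \<in> cocyclesP 1"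
proof -
  have "Poly_Mapping.lookup (Z1 N c (\<lambda>_. 0)) h \<in> lambda_len 1" for h
  proof (cases h)
    case (Odd t)
    then show ?thesis using lambda_bi_len[OF Z1_bi(2)] by simp
  next
    case (Even t)
    then show ?thesis using lambda_bi_len[OF lambda_bi_0] by (simp add: lookup_Z1_Even)
  qed
  then show ?thesis using assms by (simp add: cocyclesP_def)
qed

lemma Ext_bi_subset: "Ext_P_bi s u \<subseteq> (Ext_P s :: 'p extP set)"
proof -
  have "Poly_Mapping.lookup z h \<in> lambda_len s"
    if "\<forall>h\<in>Poly_Mapping.keys z. Poly_Mapping.lookup z h \<in> lambda_bi s (f h)"
    for z :: "pbasis \<Rightarrow>\<^sub>0 'p lambda" and h f
  proof (cases "h \<in> Poly_Mapping.keys z")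
    case True
    then show ?thesis using that lambda_bi_len by blast
  next
    case False
    then show ?thesis using lambda_bi_len[OF lambda_bi_0] by (simp add: in_keys_iff)
  qed
  then show ?thesis unfolding Ext_P_bi_def Ext_P_def cocyclesP_def by fast
qed

lemma lambda_len_add:
  assumes "a \<in> lambda_len s" "b \<in> lambda_len s"
  shows "a + b \<in> (lambda_len s :: 'p lambda set)"
proof -
  obtain x where x: "a = abs_lambda x" "\<forall>w\<in>Poly_Mapping.keys x. length (letters w) = s"
    using assms(1) unfolding lambda_len_def by blast
  obtain y where y: "b = abs_lambda y" "\<forall>w\<in>Poly_Mapping.keys y. length (letters w) = s"
    using assms(2) unfolding lambda_len_def by blast
  have "\<forall>w\<in>Poly_Mapping.keys (x + y). length (letters w) = s"
    using x(2) y(2) keys_add[of x y] by blast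
  then show ?thesis unfolding x(1) y(1) abs_lambda_hom[symmetric] lambda_len_def by blast
qed

lemma lambda_len_lscal: "a \<in> lambda_len s \<Longrightarrow> lscal c * a \<in> (lambda_len s :: 'p lambda set)"
proof -
  assume "a \<in> lambda_len s"
  then obtain x where x: "a = abs_lambda x" "\<forall>w\<in>Poly_Mapping.keys x. length (letters w) = s"
    unfolding lambda_len_def by blast
  have "Poly_Mapping.keys (fscal c * x) \<subseteq> Poly_Mapping.keys x"
    by (auto simp: in_keys_iff lookup_fscal_mult)
  then have "\<forall>w\<in>Poly_Mapping.keys (fscal c * x). length (letters w) = s" using x(2) by blast
  then show ?thesis unfolding x(1) lscal.abs_eq times_lambda.abs_eq lambda_len_def by blast
qed

lemma Ext_P_subspace: "extP.subspace (Ext_P s :: 'p extP set)"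
proof (rule extP.subspaceI)
  have "0 \<in> (cocyclesP s :: (pbasis \<Rightarrow>\<^sub>0 'p lambda) set)"
    using lambda_bi_len[OF lambda_bi_0] by (simp add: cocyclesP_def cochain_d_0)
  then show "0 \<in> (Ext_P s :: 'p extP set)" unfolding Ext_P_def clsP_hom(3)[symmetric] by (rule imageI)
next
  fix x y :: "'p extP" assume "x \<in> Ext_P s" "y \<in> Ext_P s"
  then obtain u v where "x = clsP u" "u \<in> cocyclesP s" "y = clsP v" "v \<in> cocyclesP s"
    unfolding Ext_P_def by blast
  moreover from this have "u + v \<in> cocyclesP s"
    by (simp add: cocyclesP_def cochain_d_additive lookup_add lambda_len_add)
  ultimately show "x + y \<in> Ext_P s" unfolding Ext_P_def by (metis clsP_hom(1) imageI)
next
  fix c and x :: "'p extP" assume "x \<in> Ext_P s"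
  then obtain u where "x = clsP u" "u \<in> cocyclesP s" unfolding Ext_P_def by blast
  moreover from this have "lact (lscal c) u \<in> cocyclesP s"
    by (simp add: cocyclesP_def cochain_d_scal lact_0 lookup_lact lambda_len_lscal)
  ultimately show "scale_extP c x \<in> Ext_P s" unfolding Ext_P_def by (metis clsP_hom(2) imageI)
qed

text \<open>The conditions are read back through \<open>cocycle_coc1\<close> from the explicit
  cocycle, so that no multipliers have to be exhibited.\<close>

lemma coc1_valid:
  assumes v: "valid1 b"
  shows "coc1 (base1_N b) (base1_coeffs b) (\<lambda>_. 0)"
proof (rule coc1_cong[OF _ _ cocycle_coc1[OF Z1_cocycles[OF valid1_cocycle[OF v]]]])
  fix i assume i: "i * (p - 1) \<le> base1_N b"
  show "cO (Z1 (base1_N b) (base1_coeffs b) (\<lambda>_. 0)) (base1_N b - i * (p - 1)) False i = base1_coeffs b i"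
    unfolding cO_def lookup_Z1_at(1)[OF i] co_lscal by (simp add: gw_def co_lam_mu)
  show "cE (Z1 (base1_N b) (base1_coeffs b) (\<lambda>_. 0)) (base1_N b - i * (p - 1)) True i = 0"
    unfolding cE_def lookup_Z1_Even by (rule co_additive(2))
qed

text \<open>Half the degree and the vector of coefficients after \<open>e\<close> applications of
  P^0, each of which multiplies \<open>N + 1\<close> and all positions by \<open>p\<close>.\<close>

definition P0_degree :: "nat \<Rightarrow> nat \<Rightarrow> nat" where
  "P0_degree e N = p ^ e * (N + 1) - 1"

definition P0_coeffs :: "nat \<Rightarrow> (nat \<Rightarrow> 'p mod_ring) \<Rightarrow> nat \<Rightarrow> 'p mod_ring" where
  "P0_coeffs e c i = (if p ^ e dvd i then c (i div p ^ e) else 0)"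

lemma P0_degree_Suc: "P0_degree (Suc e) N = p * P0_degree e N + (p - 1)" and P0_degree_plus: "P0_degree e N + 1 = p ^ e * (N + 1)"
proof -
  have "1 * 1 \<le> p ^ e * (N + 1)" using p_ge_3 by (intro mult_le_mono) simp_all
  then show 1: "P0_degree e N + 1 = p ^ e * (N + 1)" unfolding P0_degree_def by linarith
  have "p ^ Suc e * (N + 1) = p * P0_degree e N + p" unfolding power_Suc mult.assoc 1[symmetric] by simp
  then show "P0_degree (Suc e) N = p * P0_degree e N + (p - 1)" using p_ge_3 unfolding P0_degree_def[of "Suc e"] by simp
qed

lemma P0_coeffs_Suc: "P0_coeffs (Suc e) c = (\<lambda>i. if p dvd i then P0_coeffs e c (i div p) else 0)"
proof
  fix i
  show "P0_coeffs (Suc e) c i = (if p dvd i then P0_coeffs e c (i div p) else 0)"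
  proof (cases "p dvd i")
    case True
    then obtain j where "i = p * j" ..
    then show ?thesis using p_ge_3 by (simp add: P0_coeffs_def)
  next
    case False
    then have "\<not> p ^ Suc e dvd i" by (metis dvd_mult_left power_Suc)
    then show ?thesis using False by (simp add: P0_coeffs_def)
  qed
qed

lemma cl0_iter:
  assumes "coc N c"
  shows "(ext_P0 ^^ e) (cl0 N c) = cl0 (P0_degree e N) (P0_coeffs e c)" "cochain_d P_module (Z0 (P0_degree e N) (P0_coeffs e c)) = 0"
proof (induction e)
  case 0
  have "P0_degree 0 N = N" "P0_coeffs 0 c = c" by (simp_all add: P0_degree_def P0_coeffs_def fun_eq_iff)
  then show "(ext_P0 ^^ 0) (cl0 N c) = cl0 (P0_degree 0 N) (P0_coeffs 0 c)" "cochain_d P_module (Z0 (P0_degree 0 N) (P0_coeffs 0 c)) = 0"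
    using coc_cocycle[OF assms] by simp_all
next
  case (Suc e)
  show "(ext_P0 ^^ Suc e) (cl0 N c) = cl0 (P0_degree (Suc e) N) (P0_coeffs (Suc e) c)"
    by (simp only: funpow.simps o_apply Suc ext_P0_cl0 P0_degree_Suc P0_coeffs_Suc)
  show "cochain_d P_module (Z0 (P0_degree (Suc e) N) (P0_coeffs (Suc e) c)) = 0"
    unfolding P0_degree_Suc P0_coeffs_Suc cochain_P0_Z0[symmetric] cochain_P0_d[symmetric] Suc by (rule cochain_P0_additive(2))
qed

lemma v0_eq: "valid b \<Longrightarrow> v0 e b = cl0 (P0_degree e (base_N b)) (P0_coeffs e (base_coeffs b))"
  unfolding v0_def by (rule cl0_iter(1)[OF coc_base])

fun valid_index :: "index \<Rightarrow> bool" where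
  "valid_index (I0 e b) = valid b"
| "valid_index (I1 b) = valid1 b"

fun basis_class :: "index \<Rightarrow> 'p extP" where
  "basis_class (I0 e b) = v0 e b"
| "basis_class (I1 b) = v1 b"

fun basis_cochain :: "index \<Rightarrow> pbasis \<Rightarrow>\<^sub>0 'p lambda" where
  "basis_cochain (I0 e b) = Z0 (P0_degree e (base_N b)) (P0_coeffs e (base_coeffs b))"
| "basis_cochain (I1 b) = Z1 (base1_N b) (base1_coeffs b) (\<lambda>_. 0)"

lemma basis_class_cochain: "valid_index x \<Longrightarrow> basis_class x = clsP (basis_cochain x)"
  by (cases x) (simp_all add: v0_eq cl0_def v1_def cl1_def)

lemma basis_class_bi: "valid_index x \<Longrightarrow> \<exists>u. basis_class x \<in> Ext_P_bi 1 u"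
proof (cases x)
  case (I0 e b)
  assume "valid_index x"
  then have "valid b" using I0 by simp
  then show ?thesis using Z0_Ext_bi[OF cl0_iter(2)[OF coc_base]] v0_eq I0 by (metis basis_class.simps(1))
next
  case (I1 b)
  assume "valid_index x"
  then have "valid1 b" using I1 by simp
  then show ?thesis using Z1_Ext_bi[OF valid1_cocycle] I1 by (metis basis_class.simps(2) v1_def)
qed

lemma basis_class_range: "basis_class ` {x. valid_index x} = basis0 \<union> basis1"
proof
  show "basis_class ` {x. valid_index x} \<subseteq> basis0 \<union> basis1"
  proof
    fix v assume "v \<in> basis_class ` {x. valid_index x}"
    then obtain x where "valid_index x" "v = basis_class x" by blast
    then show "v \<in> basis0 \<union> basis1" unfolding basis0_def basis1_def by (cases x) auto
  qed
  show "basis0 \<union> basis1 \<subseteq> basis_class ` {x. valid_index x}"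
  proof
    fix v assume "v \<in> basis0 \<union> basis1"
    then consider e b where "v = basis_class (I0 e b)" "valid_index (I0 e b)" | b where "v = basis_class (I1 b)" "valid_index (I1 b)"
      unfolding basis0_def basis1_def by auto
    then show "v \<in> basis_class ` {x. valid_index x}" by cases blast+
  qed
qed

theorem basis_class_span: "extP.span (basis_class ` {x. valid_index x}) = Ext_P 1"
proof
  show "extP.span (basis_class ` {x. valid_index x}) \<subseteq> Ext_P 1"
  proof (rule extP.span_minimal[OF _ Ext_P_subspace])
    show "basis_class ` {x. valid_index x} \<subseteq> Ext_P 1" using basis_class_bi Ext_bi_subset by blast
  qed
  show "Ext_P 1 \<subseteq> extP.span (basis_class ` {x. valid_index x})"
    unfolding basis_class_range Ext_P_def using cocycle_in_span[OF coc1_valid] by blast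
qed

end

section \<open>Linear independence\<close>

context odd_card
begin

text \<open>Quotient and remainder of \<open>base_N b + 1\<close> modulo \<open>p\<close>; together they determine \<open>b\<close> up to the coincidence below.\<close>

fun base_quot :: "base \<Rightarrow> nat" where
  "base_quot (K_base k) = k + 1"
| "base_quot (HL_base m k) = (p - 1) * p ^ (m - 1)"
| "base_quot (HR_base m k) = k * p ^ (m - 1)"
| "base_quot (D_base k) = p + k - 1"
| "base_quot (P_base r) = p"

fun base_rem :: "base \<Rightarrow> nat" where
  "base_rem (K_base k) = 0"
| "base_rem (HL_base m k) = k"
| "base_rem (HR_base m k) = p - 1"
| "base_rem (D_base k) = p - 1"
| "base_rem (P_base r) = r"

lemma base_N_quot_rem: "valid b \<Longrightarrow> base_N b + 1 = p * base_quot b + base_rem b \<and> base_rem b < p"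
proof (cases b)
  case (K_base k)
  then show "valid b \<Longrightarrow> ?thesis" using p_ge_3 by simp
next
  case (HL_base m k)
  assume "valid b"
  then obtain m' where "m = Suc m'" "1 \<le> k" "k \<le> p - 1" using HL_base by (cases m) auto
  then show ?thesis using HL_base p_ge_3 by simp
next
  case (HR_base m k)
  assume "valid b"
  then obtain m' where m: "m = Suc m'" "1 \<le> k" "k \<le> p - 1" using HR_base by (cases m) auto
  have "1 * 1 \<le> k * p ^ m" using m p_ge_3 by (intro mult_le_mono) simp_all
  then have "k * p ^ m - 1 + 1 * (p - 1) + 1 = k * p ^ m + (p - 1)" by linarith
  then show ?thesis using HR_base m p_ge_3 by (simp add: mult.left_commute)
next
  case (D_base k)
  assume "valid b"
  then obtain k' where k: "k = k' + 2" using D_base by (metis valid.simps(4) le_add_diff_inverse2)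
  obtain t where p: "p = t + 1" "2 \<le> t" by (rule p_pred)
  have "(k' + 2) * p + p - 2 + p * (p - 1) + 1 = p * (p + (k' + 2) - 1) + (p - 1)"
    unfolding p(1) by (simp add: algebra_simps)
  moreover have "p - 1 < p" using p_ge_3 by simp
  ultimately show ?thesis unfolding D_base k base_N.simps base_quot.simps base_rem.simps by (rule conjI)
next
  case (P_base r)
  assume "valid b"
  then show ?thesis using P_base p_ge_3 by auto
qed

lemma base_N_eq:
  assumes "valid b" "valid b'" "base_N b = base_N b'"
  shows "base_quot b = base_quot b'" "base_rem b = base_rem b'"
proof -
  have eq: "p * base_quot b + base_rem b = p * base_quot b' + base_rem b'" using assms base_N_quot_rem by metis
  have lt: "base_rem b < p" "base_rem b' < p" using assms base_N_quot_rem by blast+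
  show "base_quot b = base_quot b'" using arg_cong[OF eq, of "\<lambda>x. x div p"] lt by simp
  show "base_rem b = base_rem b'" using arg_cong[OF eq, of "\<lambda>x. x mod p"] lt by simp
qed

lemma mult_power_inj:
  assumes "k * p ^ i = k' * p ^ i'" "1 \<le> k" "k \<le> p - 1" "1 \<le> k'" "k' \<le> p - 1"
  shows "k = k'" "i = i'"
  using unit_decomp[of i k i' k'] assms not_dvd_small by (simp_all add: mult.commute)

lemma mult_power_neq:
  assumes "1 \<le> k" "k \<le> p - 1"
  shows "2 \<le> k' \<Longrightarrow> k' \<le> p - 1 \<Longrightarrow> k * p ^ i \<noteq> p + k' - 1" "k \<noteq> 1 \<Longrightarrow> k * p ^ i \<noteq> p"
proof -
  show "k * p ^ i \<noteq> p + k' - 1" if k': "2 \<le> k'" "k' \<le> p - 1"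
  proof
    assume eq: "k * p ^ i = p + k' - 1"
    show False
    proof (cases i)
      case 0
      then show ?thesis using eq assms k' by simp
    next
      case (Suc j)
      then have "p dvd k * p ^ i" by simp
      then have "p dvd p + (k' - 1)" using eq k' by simp
      then have "p dvd k' - 1" by simp
      moreover have "1 \<le> k' - 1" "k' - 1 \<le> p - 1" using k' by linarith+
      ultimately show ?thesis using not_dvd_small by blast
    qed
  qed
  show "k * p ^ i \<noteq> p" if "k \<noteq> 1"
    using mult_power_inj(1)[of k i 1 1] that assms p_ge_3 by auto
qed

text \<open>In the exceptional pair both sides have \<open>N + 1 = (p - 1) * p^m + (p - 1)\<close>;
  quotient and remainder modulo \<open>p\<close> separate all other pairs.\<close>

lemma coincidence:
  assumes v: "valid b" "valid b'" and eq: "base_N b = base_N b'" and neq: "b \<noteq> b'"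
  shows "\<exists>m\<ge>2. b = HL_base m (p - 1) \<and> b' = HR_base m (p - 1) \<or> b' = HL_base m (p - 1) \<and> b = HR_base m (p - 1)"
proof -
  note qr = base_N_eq[OF v eq]
  have p1: "1 \<le> p - 1" "p - 1 \<le> p - 1" "p - 1 \<noteq> 1" using p_ge_3 by simp_all
  have LR: "\<exists>m\<ge>2. b = HL_base m (p - 1) \<and> b' = HR_base m (p - 1)" if b: "b = HL_base m k" "b' = HR_base m' k'"
    "base_quot b = base_quot b'" "base_rem b = base_rem b'" "valid b" "valid b'" for b b' m m' k k'
  proof -
    have "(p - 1) * p ^ (m - 1) = k' * p ^ (m' - 1)" "1 \<le> k'" "k' \<le> p - 1" using b by simp_all
    from mult_power_inj[OF this(1) p1(1,2) this(2,3)] have "k' = p - 1" "m = m'" using b by simp_all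
    then show ?thesis using b by auto
  qed
  have L: "\<not> (b = HL_base m k \<and> b' = D_base k')" "\<not> (b = HL_base m k \<and> b' = P_base k')"
    if "base_quot b = base_quot b'" "valid b" "valid b'" for b b' m k k'
    using that mult_power_neq[OF p1(1,2)] p1(3) by auto
  have Rt: "\<not> (b = HR_base m k \<and> b' = D_base k')" "\<not> (b = HR_base m k \<and> b' = P_base k')" "\<not> (b = D_base k \<and> b' = P_base k')"
    if "base_quot b = base_quot b'" "base_rem b = base_rem b'" "valid b" "valid b'" for b b' m k k'
    using that mult_power_neq(1) p_ge_3 by auto
  have K: "\<exists>k'. b' = K_base k'" if "b = K_base k" "base_rem b = base_rem b'" "valid b'" for b b' k
    using that p_ge_3 by (cases b') auto
  show ?thesis
  proof (cases b)
    case (K_base k)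
    then obtain k' where "b' = K_base k'" using K qr v by blast
    then show ?thesis using K_base qr neq by simp
  next
    case (HL_base m k)
    show ?thesis
    proof (cases b')
      case (HL_base m' k')
      have "(p - 1) * p ^ (m - 1) = (p - 1) * p ^ (m' - 1)" using qr(1) HL_base \<open>b = HL_base m k\<close> by simp
      from mult_power_inj(2)[OF this p1(1,2) p1(1,2)] show ?thesis
        using neq qr(2) v HL_base \<open>b = HL_base m k\<close> by auto
    next
      case (HR_base m' k')
      then show ?thesis using LR[OF HL_base HR_base qr v] by blast
    next
      case (K_base k')
      then show ?thesis using K[OF K_base qr(2)[symmetric] v(1)] HL_base by simp
    qed (use L[OF qr(1) v] HL_base in auto)
  next
    case (HR_base m k)
    show ?thesis
    proof (cases b')
      case (HR_base m' k')
      have "k * p ^ (m - 1) = k' * p ^ (m' - 1)" using qr(1) HR_base \<open>b = HR_base m k\<close> by simp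
      from mult_power_inj[OF this] show ?thesis
        using neq v HR_base \<open>b = HR_base m k\<close> by auto
    next
      case (HL_base m' k')
      then show ?thesis using LR[OF HL_base HR_base qr[symmetric] v(2,1)] by blast
    next
      case (K_base k')
      then show ?thesis using K[OF K_base qr(2)[symmetric] v(1)] HR_base by simp
    qed (use Rt[OF qr v] HR_base in auto)
  next
    case (D_base k)
    show ?thesis
    proof (cases b')
      case (D_base k')
      then show ?thesis using neq qr(1) \<open>b = D_base k\<close> p_ge_3 by simp
    next
      case (K_base k')
      then show ?thesis using K[OF K_base qr(2)[symmetric] v(1)] D_base by simp
    next
      case (HL_base m' k')
      then show ?thesis using L(1)[OF qr(1)[symmetric] v(2,1)] D_base by blast
    next
      case (HR_base m' k')
      then show ?thesis using Rt(1)[OF qr[symmetric] v(2,1)] D_base by blast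
    qed (use Rt[OF qr v] D_base in auto)
  next
    case (P_base k)
    show ?thesis
    proof (cases b')
      case (P_base k')
      then show ?thesis using neq qr(2) \<open>b = P_base k\<close> by simp
    next
      case (K_base k')
      then show ?thesis using K[OF K_base qr(2)[symmetric] v(1)] P_base by simp
    next
      case (HL_base m' k')
      then show ?thesis using L(2)[OF qr(1)[symmetric] v(2,1)] P_base by blast
    next
      case (HR_base m' k')
      then show ?thesis using Rt(2)[OF qr[symmetric] v(2,1)] P_base by blast
    next
      case (D_base k')
      then show ?thesis using Rt(3)[OF qr[symmetric] v(2,1)] P_base by blast
    qed
  qed
qed

text \<open>\<open>e\<close> is the p-adic valuation of the degree parameter plus one, except that
  \<open>K_base k\<close> contributes one more factor \<open>p\<close>, its \<open>N + 1\<close>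
  being \<open>p * (k + 1)\<close>. Mixed pairs are excluded by the part prime to \<open>p\<close>:
  it is \<open>k + 1 < p\<close> for \<open>K_base k\<close> and at least \<open>p\<close> for the
  others.\<close>

lemma P0_degree_inj:
  assumes v: "valid b" "valid b'" and eq: "P0_degree e (base_N b) = P0_degree e' (base_N b')"
  shows "e = e'" "base_N b = base_N b'"
proof -
  have eq': "p ^ e * (base_N b + 1) = p ^ e' * (base_N b' + 1)" using eq P0_degree_plus by metis
  have ndvd: "\<not> p dvd base_N b + 1" if b: "valid b" "\<not> (\<exists>k. b = K_base k)" for b
  proof -
    have "1 \<le> base_rem b" using b p_ge_3 by (cases b) auto
    then have "\<not> p dvd base_rem b" using base_N_quot_rem[OF b(1)] by (auto dest: dvd_imp_le)
    then show ?thesis using base_N_quot_rem[OF b(1)] dvd_add_right_iff[OF dvd_triv_left, of p "base_quot b" "base_rem b"] by simp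
  qed
  have K_base: "p ^ e * (base_N (K_base k) + 1) = p ^ Suc e * (k + 1)" "valid (K_base k) \<Longrightarrow> \<not> p dvd k + 1" for e k
    using p_ge_3 not_dvd_small[of "k + 1"] by (simp_all add: algebra_simps)
  have large: "p \<le> base_N b + 1" if b: "valid b" for b
  proof -
    have "1 \<le> base_quot b" using b p_ge_3 by (cases b) auto
    then have "p * 1 \<le> p * base_quot b" by (rule mult_le_mono2)
    then show ?thesis using base_N_quot_rem[OF b] by linarith
  qed
  have mixed: False if b: "valid (K_base k)" "valid b" "\<not> (\<exists>k. b = K_base k)"
    "p ^ Suc e * (k + 1) = p ^ e' * (base_N b + 1)" for k e e' b
  proof -
    have "k + 1 = base_N b + 1" by (rule unit_decomp(2)[OF b(4) K_base(2)[OF b(1)] ndvd[OF b(2,3)]])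
    then show False using large[OF b(2)] b(1) p_ge_3 by simp
  qed
  have "e = e' \<and> base_N b + 1 = base_N b' + 1"
  proof (cases "\<exists>k. b = K_base k")
    case True
    then obtain k where k: "b = K_base k" by blast
    show ?thesis
    proof (cases "\<exists>k. b' = K_base k")
      case True
      then obtain k' where k': "b' = K_base k'" by blast
      show ?thesis
        using unit_decomp[OF eq'[unfolded k k' K_base] K_base(2) K_base(2)] v k k' by simp
    next
      case False
      then show ?thesis using mixed[OF v(1)[unfolded k] v(2) False eq'[unfolded k K_base]] by blast
    qed
  next
    case False
    show ?thesis
    proof (cases "\<exists>k. b' = K_base k")
      case True
      then obtain k' where k': "b' = K_base k'" by blast
      show ?thesis using mixed[OF v(2)[unfolded k'] v(1) False eq'[symmetric, unfolded k' K_base]] by blast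
    next
      case False
      then show ?thesis using unit_decomp[OF eq' ndvd[OF v(1) \<open>\<not> (\<exists>k. b = K_base k)\<close>] ndvd[OF v(2) False]] by blast
    qed
  qed
  then show "e = e'" "base_N b = base_N b'" by simp_all
qed

lemma base1_N_inj:
  assumes v: "valid1 b" "valid1 b'" and eq: "base1_N b = base1_N b'"
  shows "b = b'"
proof -
  have Alpha_h: "base1_N (Alpha_h i k) + 1 = k * p ^ i" if "valid1 (Alpha_h i k)" for i k
  proof -
    have "1 * 1 \<le> k * p ^ i" using that p_ge_3 by (intro mult_le_mono) simp_all
    then show ?thesis unfolding base1_N.simps by linarith
  qed
  have Alpha_hat: "\<not> p dvd base1_N (Alpha_hat l) + 1" if "valid1 (Alpha_hat l)" for l
  proof -
    have "l + 1 \<le> p - 1" using that by simp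
    then have "\<not> p dvd l + 1" by (intro not_dvd_small) simp
    then have "\<not> p dvd p + (l + 1)" by (simp only: dvd_add_right_iff dvd_refl not_False_eq_True)
    then show ?thesis by (simp only: base1_N.simps add.assoc not_False_eq_True)
  qed
  have mixed: "base1_N (Alpha_h i k) \<noteq> base1_N (Alpha_hat l)" if "valid1 (Alpha_h i k)" "valid1 (Alpha_hat l)" for i k l
  proof
    assume "base1_N (Alpha_h i k) = base1_N (Alpha_hat l)"
    then have "\<not> p dvd k * p ^ i" using Alpha_hat[OF that(2)] Alpha_h[OF that(1)] by (simp only: not_False_eq_True)
    moreover have "p dvd k * p ^ i" using that(1) by (simp add: dvd_power)
    ultimately show False by contradiction
  qed
  show ?thesis
  proof (cases b)
    case b: (Alpha_h i k)
    show ?thesis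
    proof (cases b')
      case b': (Alpha_h i' k')
      have "k * p ^ i = k' * p ^ i'" using Alpha_h v eq unfolding b b' by metis
      from mult_power_inj[OF this] show ?thesis using v unfolding b b' by simp
    next
      case b': (Alpha_hat l)
      then show ?thesis using mixed v eq unfolding b by blast
    qed
  next
    case b: (Alpha_hat l)
    show ?thesis
    proof (cases b')
      case b': (Alpha_h i' k')
      show ?thesis using mixed v eq unfolding b b' by metis
    next
      case b': (Alpha_hat l')
      then show ?thesis using eq unfolding b by simp
    qed
  qed
qed

lemma le_base_N:
  assumes "valid b"
  shows "p - 1 \<le> base_N b" "b = HR_base m k \<or> b = P_base r \<Longrightarrow> p * (p - 1) \<le> base_N b"
proof -
  have "1 \<le> base_quot b" using assms p_ge_3 by (cases b) auto
  then have "p * 1 \<le> p * base_quot b" by (rule mult_le_mono2)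
  then show "p - 1 \<le> base_N b" using base_N_quot_rem[OF assms] by linarith
  assume b: "b = HR_base m k \<or> b = P_base r"
  then have "p \<le> base_quot b"
  proof
    assume b: "b = HR_base m k"
    then have "1 \<le> k" "1 \<le> m - 1" using assms by auto
    then have "1 * p \<le> k * p ^ (m - 1)" using p_ge_3 by (intro mult_le_mono) (simp_all add: self_le_power)
    then show ?thesis by (simp add: b)
  qed simp
  then have "p * p \<le> p * base_quot b" by (rule mult_le_mono2)
  moreover have "p * p = p * (p - 1) + p" using p_ge_3 by (cases p) simp_all
  ultimately show "p * (p - 1) \<le> base_N b" using base_N_quot_rem[OF assms] p_ge_3 by linarith
qed

text \<open>At such a position a linear relation shows that the coboundary of \<open>ab^[N]\<close>
  occurs with coefficient 0. Position 1 works, since \<open>N + 1\<close> is invertible, unless a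
  basis vector of this degree starts there (\<open>HR_base\<close> or \<open>P_base\<close>); then
  position \<open>p\<close> does. For \<open>K_base\<close> the entry at 1 is 0, as
  \<open>p dvd N + 1\<close>.\<close>

lemma boundary_test:
  assumes v: "valid b" and b: "\<not> (\<exists>k. b = K_base k)"
  shows "\<exists>j\<ge>1. j * (p - 1) \<le> base_N b \<and> bd (base_N b) j \<noteq> 0 \<and>
    (\<forall>b'. valid b' \<longrightarrow> base_N b' = base_N b \<longrightarrow> base_coeffs b' j = 0)"
proof (cases "\<exists>b'. valid b' \<and> base_N b' = base_N b \<and> (\<exists>m k r. b' = HR_base m k \<or> b' = P_base r)")
  case True
  then obtain b' m k r where b': "valid b'" "base_N b' = base_N b" "b' = HR_base m k \<or> b' = P_base r" by blast
  have p1: "p \<noteq> 1" using p_ge_3 by simp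
  have bd: "bd (base_N b') p = 1"
    using b'(3)
  proof
    assume h: "b' = HR_base m k"
    then show ?thesis using bd_p_HR_base[of k m] b'(1) by (simp del: base_N.simps)
  next
    assume h: "b' = P_base r"
    then show ?thesis using bd_p_P_base[of r] b'(1) by (simp del: base_N.simps)
  qed
  have self: "base_coeffs b' p = 0" using b'(1,3) p1 p_ge_3 by (auto simp: delta_def pvec_def)
  have "base_coeffs b'' p = 0" if b'': "valid b''" "base_N b'' = base_N b'" for b''
  proof (cases "b'' = b'")
    case False
    then obtain n where n: "2 \<le> n" "b'' = HL_base n (p - 1) \<or> b'' = HR_base n (p - 1)"
      using coincidence[OF b''(1) b'(1) b''(2)] by blast
    have "p ^ 1 \<noteq> p ^ n" using n(1) p_ge_3 by (simp only: power_inject_exp)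
    then show ?thesis using n(2) p1 by (auto simp: delta_def)
  qed (simp add: self)
  moreover have "p * (p - 1) \<le> base_N b'" using le_base_N(2)[OF b'(1,3)] .
  ultimately show ?thesis using bd b'(2) p_ge_3 by (intro exI[of _ p]) simp
next
  case False
  have base_rem: "1 \<le> base_rem b" using v b p_ge_3 by (cases b) auto
  have "\<not> p dvd base_rem b" using base_N_quot_rem[OF v] base_rem by (auto dest: dvd_imp_le)
  then have nd: "\<not> p dvd base_N b + 1"
    using base_N_quot_rem[OF v] dvd_add_right_iff[OF dvd_triv_left, of p "base_quot b" "base_rem b"] by simp
  have "bd (base_N b) 1 = of_nat (base_N b + 1)" by (rule bd_at_1[OF le_base_N(1)[OF v]])
  then have bd: "bd (base_N b) 1 \<noteq> 0" using nd by (simp only: of_nat_eq_0 not_False_eq_True)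
  have "base_coeffs b' 1 = 0" if b': "valid b'" "base_N b' = base_N b" for b'
  proof (cases b')
    case (K_base k)
    then show ?thesis using base_N_eq(2)[OF b'(1) v b'(2)] base_rem by simp
  next
    case (HL_base m k)
    then have "1 < p ^ m" using b'(1) p_ge_3 by (intro one_less_power) simp_all
    then have "1 \<noteq> p ^ m" by linarith
    then show ?thesis by (simp only: HL_base base_coeffs.simps delta_def if_False)
  next
    case (D_base k)
    then show ?thesis using p_ge_3 by (simp add: delta_def)
  qed (use False b' in blast)+
  then show ?thesis using bd le_base_N(1)[OF v] by (intro exI[of _ 1]) simp
qed

text \<open>The coincident pair is separated because \<open>HL_base m\<close> is supported at
  \<open>p^m\<close> and \<open>HR_base m\<close> at 1. For \<open>K_base\<close> the coboundary
  vanishes at the chosen position 1, which replaces \<open>boundary_test\<close> there.\<close>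

lemma lead_test:
  assumes v: "valid b"
  shows "\<exists>j\<ge>1. j * (p - 1) \<le> base_N b \<and> base_coeffs b j = 1 \<and>
    (\<forall>b'. valid b' \<longrightarrow> base_N b' = base_N b \<longrightarrow> b' \<noteq> b \<longrightarrow> base_coeffs b' j = 0) \<and> ((\<exists>k. b = K_base k) \<longrightarrow> bd (base_N b) j = 0)"
proof -
  define j where "j = (case b of HL_base m k \<Rightarrow> p ^ m | D_base k \<Rightarrow> p | _ \<Rightarrow> 1)"
  have j1: "1 \<le> j" using p_ge_3 by (cases b) (simp_all add: j_def)
  have le: "j * (p - 1) \<le> base_N b"
  proof (cases b)
    case (HL_base m k)
    show ?thesis unfolding j_def HL_base base.case base_N.simps by (rule le_add2)
  next
    case (D_base k)
    show ?thesis unfolding j_def D_base base.case base_N.simps by (rule le_add2)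
  qed (use le_base_N(1)[OF v] in \<open>simp_all add: j_def del: base_N.simps\<close>)
  have lead: "base_coeffs b j = 1"
    using v p_ge_3 by (cases b) (auto simp: j_def delta_def pvec_def)
  have other: "base_coeffs b' j = 0" if b': "valid b'" "base_N b' = base_N b" "b' \<noteq> b" for b'
  proof -
    obtain m where m: "2 \<le> m" "b' = HL_base m (p - 1) \<and> b = HR_base m (p - 1) \<or> b = HL_base m (p - 1) \<and> b' = HR_base m (p - 1)"
      using coincidence[OF b'(1) v b'(2,3)] by blast
    have "1 < p ^ m" using m(1) p_ge_3 by (intro one_less_power) simp_all
    then have "1 \<noteq> p ^ m" "p ^ m \<noteq> 1" by linarith+
    then show ?thesis using m(2) by (elim disjE conjE) (simp_all only: j_def base.case base_coeffs.simps delta_def if_False)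
  qed
  have "bd (base_N b) j = 0" if "b = K_base k" for k
  proof -
    have "bd (base_N b) 1 = of_nat (base_N b + 1)" by (rule bd_at_1[OF le_base_N(1)[OF v]])
    moreover have "p dvd base_N b + 1" using base_N_quot_rem[OF v] that by simp
    ultimately show ?thesis using that by (simp only: j_def base.case of_nat_eq_0)
  qed
  then show ?thesis using j1 le lead other by blast
qed

lemma co_Z0:
  assumes "1 \<le> i" "i * (p - 1) \<le> M"
  shows "co (Poly_Mapping.lookup (Z0 N c) (Odd (M - i * (p - 1)))) (Lam (i - 1)) = (if N = M then c i else 0)"
proof (cases "N = M")
  case True
  show ?thesis unfolding True lookup_Z0_at[OF assms] using assms(1) by (simp add: co_lscal co_lam_mu)
next
  case False
  have "M - i * (p - 1) + i * (p - 1) = M" using assms(2) by simp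
  then have neq: "i' \<noteq> i" if "M - i * (p - 1) + i' * (p - 1) = N" for i'
    using False that by metis
  consider "Poly_Mapping.lookup (Z0 N c) (Odd (M - i * (p - 1))) = 0"
    | i' where "1 \<le> i'" "i' \<noteq> i" "Poly_Mapping.lookup (Z0 N c) (Odd (M - i * (p - 1))) = lscal (c i') * lam i'"
    using lookup_Z0_cases[of N c "M - i * (p - 1)"] neq by blast
  then show ?thesis
  proof cases
    case 1
    then show ?thesis using False by (simp only: co_additive(2) if_False)
  next
    case 2
    then show ?thesis using False assms by (simp add: co_lscal co_lam_mu)
  qed
qed

lemma co_Z0_other:
  "co (Poly_Mapping.lookup (Z0 N c) (Odd t)) (Mu j) = 0" "co (Poly_Mapping.lookup (Z0 N c) (Even t)) g = 0"
proof -
  show "co (Poly_Mapping.lookup (Z0 N c) (Odd t)) (Mu j) = 0"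
    using lookup_Z0_cases[of N c t] by (auto simp: co_additive(2) co_lscal co_lam_mu)
  show "co (Poly_Mapping.lookup (Z0 N c) (Even t)) g = 0"
    unfolding lookup_Z0(2) by (rule co_additive(2))
qed

lemma co_Z1:
  assumes "i * (p - 1) \<le> M"
  shows "co (Poly_Mapping.lookup (Z1 N c (\<lambda>_. 0)) (Odd (M - i * (p - 1)))) (Mu i) = (if N = M then c i else 0)"
proof (cases "N = M")
  case True
  show ?thesis unfolding True lookup_Z1_at(1)[OF assms] by (simp add: co_lscal co_lam_mu)
next
  case False
  have "M - i * (p - 1) + i * (p - 1) = M" using assms by simp
  then have neq: "i' \<noteq> i" if "M - i * (p - 1) + i' * (p - 1) = N" for i'
    using False that by metis
  consider "Poly_Mapping.lookup (Z1 N c (\<lambda>_. 0)) (Odd (M - i * (p - 1))) = 0"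
    | i' where "i' \<noteq> i" "Poly_Mapping.lookup (Z1 N c (\<lambda>_. 0)) (Odd (M - i * (p - 1))) = lscal (c i') * mu i'"
    using lookup_Z1_cases[of N c "M - i * (p - 1)"] neq by blast
  then show ?thesis
  proof cases
    case 1
    then show ?thesis using False by (simp only: co_additive(2) if_False)
  next
    case 2
    then show ?thesis using False by (simp add: co_lscal co_lam_mu)
  qed
qed

lemma co_Z1_other:
  "co (Poly_Mapping.lookup (Z1 N c (\<lambda>_. 0)) (Odd t)) (Lam j) = 0"
  "co (Poly_Mapping.lookup (Z1 N c (\<lambda>_. 0)) (Even t)) g = 0"
proof -
  show "co (Poly_Mapping.lookup (Z1 N c (\<lambda>_. 0)) (Odd t)) (Lam j) = 0"
    using lookup_Z1_cases[of N c t] by (auto simp: co_additive(2) co_lscal co_lam_mu)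
  show "co (Poly_Mapping.lookup (Z1 N c (\<lambda>_. 0)) (Even t)) g = 0"
    unfolding lookup_Z1_Even by (rule co_additive(2))
qed

text \<open>A linear relation equates a combination of basis cochains with the coboundary of some
  \<open>y\<close>. In each degree the tests of length one remove the contribution of
  \<open>y\<close>, which enters only through \<open>y0\<close> and \<open>y1\<close>, and isolate
  one coefficient.\<close>

theorem basis_class_independent:
  assumes S: "finite S" "\<And>x. x \<in> S \<Longrightarrow> valid_index x" and sum: "(\<Sum>x\<in>S. scale_extP (s x) (basis_class x)) = 0"
    and x: "x \<in> S"
  shows "s x = 0"
proof -
  have "(\<Sum>x\<in>S. scale_extP (s x) (basis_class x)) = clsP (\<Sum>x\<in>S. lact (lscal (s x)) (basis_cochain x))"
    unfolding clsP_sum clsP_hom by (intro sum.cong refl) (simp add: basis_class_cochain S(2))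
  then have "clsP (\<Sum>x\<in>S. lact (lscal (s x)) (basis_cochain x)) = clsP 0" using sum by (simp add: clsP_hom)
  then obtain y where y: "(\<Sum>x\<in>S. lact (lscal (s x)) (basis_cochain x)) = cochain_d P_module y"
    unfolding extP.abs_eq_iff by auto
  have coeff: "(\<Sum>x\<in>S. s x * co (Poly_Mapping.lookup (basis_cochain x) h) g) =
      co (Poly_Mapping.lookup (cochain_d P_module y) h) g" for h g
    unfolding y[symmetric] lookup_sum lookup_lact co_additive co_lscal ..
  define y0 where "y0 M = co0 (Poly_Mapping.lookup y (Odd M))" for M
  define y1 where "y1 M = co0 (Poly_Mapping.lookup y (Even M))" for M
  have eq0: "(\<Sum>x\<in>S. s x * (case x of I0 e b \<Rightarrow> if P0_degree e (base_N b) = M then P0_coeffs e (base_coeffs b) i else 0 | I1 b \<Rightarrow> 0)) =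
      bd M i * y0 M" if i: "1 \<le> i" "i * (p - 1) \<le> M" for i M
  proof -
    have "co (Poly_Mapping.lookup (basis_cochain x) (Odd (M - i * (p - 1)))) (Lam (i - 1)) =
        (case x of I0 e b \<Rightarrow> if P0_degree e (base_N b) = M then P0_coeffs e (base_coeffs b) i else 0 | I1 b \<Rightarrow> 0)" for x
      by (cases x) (simp_all only: basis_cochain.simps co_Z0[OF i] co_Z1_other index.case)
    then show ?thesis
      using coeff[of "Odd (M - i * (p - 1))" "Lam (i - 1)"] co_cochain_d(1)[OF i(1), of y "M - i * (p - 1)"] i(2)
      by (simp only: card_p bd_def y0_def le_add_diff_inverse2)
  qed
  have eq1: "(\<Sum>x\<in>S. s x * (case x of I0 e b \<Rightarrow> 0 | I1 b \<Rightarrow> if base1_N b = M then base1_coeffs b i else 0)) =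
      bd M i * y1 M" if i: "i * (p - 1) \<le> M" for i M
  proof -
    have "co (Poly_Mapping.lookup (basis_cochain x) (Odd (M - i * (p - 1)))) (Mu i) =
        (case x of I0 e b \<Rightarrow> 0 | I1 b \<Rightarrow> if base1_N b = M then base1_coeffs b i else 0)" for x
      by (cases x) (simp_all only: basis_cochain.simps co_Z0_other co_Z1[OF i] index.case)
    then show ?thesis
      using coeff[of "Odd (M - i * (p - 1))" "Mu i"] co_cochain_d(3)[of 1 y "M - i * (p - 1)" i] i
      by (simp only: card_p bd_def y1_def le_add_diff_inverse2 order.refl)
  qed
  \<comment> \<open>No basis cochain has a component at b, so the coboundary has none in length one;
    at \<open>i = 1\<close> this kills \<open>y1\<close>, by \<open>bd_succ_at_1\<close>.\<close>
  have eqE: "bd (M + 1) i * y1 M = 0" if i: "1 \<le> i" "i * (p - 1) \<le> M" for i M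
  proof -
    have "co (Poly_Mapping.lookup (basis_cochain x) (Even (M - i * (p - 1)))) (Lam (i - 1)) = 0" for x
      by (cases x) (simp_all only: basis_cochain.simps co_Z0_other co_Z1_other)
    moreover have "M + 1 - i * (p - 1) = M - i * (p - 1) + 1" using i(2) by simp
    ultimately show ?thesis
      using coeff[of "Even (M - i * (p - 1))" "Lam (i - 1)"] co_cochain_d(2)[OF i(1), of y "M - i * (p - 1)"] i(2)
      by (simp only: card_p bd_def y1_def le_add_diff_inverse2 mult_zero_right sum.neutral_const)
  qed
  show ?thesis
  proof (cases x)
    case (I1 b)
    then have b: "valid1 b" using S(2)[OF x] by simp
    have "bd (base1_N b + 1) 1 * y1 (base1_N b) = 0" using eqE[of 1 "base1_N b"] base1_N_pos[OF b] by simp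
    then have "y1 (base1_N b) = 0" using bd_succ_at_1[OF b] by simp
    then have "0 = (\<Sum>x\<in>S. s x * (case x of I0 e b' \<Rightarrow> 0 | I1 b' \<Rightarrow> if base1_N b' = base1_N b then base1_coeffs b' 0 else 0))"
      using eq1[of 0 "base1_N b"] by simp
    also have "\<dots> = s x * (case x of I0 e b' \<Rightarrow> 0 | I1 b' \<Rightarrow> if base1_N b' = base1_N b then base1_coeffs b' 0 else 0)"
    proof (rule sum_eq_single[OF S(1) x])
      fix z assume z: "z \<in> S" "z \<noteq> x"
      have "base1_N b' \<noteq> base1_N b" if "z = I1 b'" for b'
        using base1_N_inj[of b' b] b S(2)[OF z(1)] z(2) that I1 by auto
      then show "s z * (case z of I0 e b' \<Rightarrow> 0 | I1 b' \<Rightarrow> if base1_N b' = base1_N b then base1_coeffs b' 0 else 0) = 0"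
        by (cases z) simp_all
    qed
    also have "\<dots> = s x" by (simp add: I1 base1_coeffs_0)
    finally show ?thesis by simp
  next
    case (I0 e b)
    then have b: "valid b" using S(2)[OF x] by simp
    \<comment> \<open>At positions divisible by \<open>p^e\<close> the equation reduces to one in
      the degree before P^0 was applied: \<open>bd_iter_p\<close> does this for the coboundary,
      \<open>P0_degree_inj\<close> for the basis vectors.\<close>
    have test: "(\<Sum>z\<in>S. s z * (case z of I0 e' b' \<Rightarrow> if e' = e \<and> base_N b' = base_N b then base_coeffs b' j else 0 | I1 b' \<Rightarrow> 0)) =
        bd (base_N b) j * y0 (P0_degree e (base_N b))" if j: "1 \<le> j" "j * (p - 1) \<le> base_N b" for j
    proof -
      have pos: "0 < p ^ e" using p_ge_3 by simp
      have le: "p ^ e * j * (p - 1) \<le> P0_degree e (base_N b)"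
      proof -
        have "p ^ e * (j * (p - 1)) + 1 \<le> p ^ e * (base_N b) + p ^ e"
          using mult_le_mono2[OF j(2), of "p ^ e"] pos by linarith
        then have "p ^ e * (j * (p - 1)) + 1 \<le> P0_degree e (base_N b) + 1" unfolding P0_degree_plus by (simp only: distrib_left mult_1_right)
        then show ?thesis by (simp only: add_le_cancel_right mult.assoc)
      qed
      have "1 \<le> p ^ e" using pos by linarith
      then have "1 * 1 \<le> p ^ e * j" using j(1) by (rule mult_le_mono)
      then have "1 \<le> p ^ e * j" by (simp only: mult_1)
      from eq0[OF this le]
      have "(\<Sum>z\<in>S. s z * (case z of I0 e' b' \<Rightarrow> if P0_degree e' (base_N b') = P0_degree e (base_N b) then P0_coeffs e' (base_coeffs b') (p ^ e * j) else 0 | I1 b' \<Rightarrow> 0)) =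
        bd (base_N b) j * y0 (P0_degree e (base_N b))" unfolding P0_degree_def bd_iter_p .
      moreover have "(case z of I0 e' b' \<Rightarrow> if P0_degree e' (base_N b') = P0_degree e (base_N b) then P0_coeffs e' (base_coeffs b') (p ^ e * j) else 0 | I1 b' \<Rightarrow> 0) =
          (case z of I0 e' b' \<Rightarrow> if e' = e \<and> base_N b' = base_N b then base_coeffs b' j else 0 | I1 b' \<Rightarrow> 0)" if "z \<in> S" for z
      proof (cases z)
        case z: (I0 e' b')
        have "valid b'" using S(2)[OF that] z by simp
        then have "P0_degree e' (base_N b') = P0_degree e (base_N b) \<longleftrightarrow> e' = e \<and> base_N b' = base_N b" using P0_degree_inj[OF _ b] by metis
        then show ?thesis using pos by (simp add: z P0_coeffs_def)
      qed simp
      ultimately show ?thesis by simp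
    qed
    obtain j where j: "1 \<le> j" "j * (p - 1) \<le> base_N b" "base_coeffs b j = 1"
        "\<forall>b'. valid b' \<longrightarrow> base_N b' = base_N b \<longrightarrow> b' \<noteq> b \<longrightarrow> base_coeffs b' j = 0" "(\<exists>k. b = K_base k) \<longrightarrow> bd (base_N b) j = 0"
      using lead_test[OF b] by blast
    have "bd (base_N b) j * y0 (P0_degree e (base_N b)) = 0"
    proof (cases "\<exists>k. b = K_base k")
      case True
      then show ?thesis using j(5) by simp
    next
      case False
      obtain i where i: "1 \<le> i" "i * (p - 1) \<le> base_N b" "bd (base_N b) i \<noteq> 0"
          "\<forall>b'. valid b' \<longrightarrow> base_N b' = base_N b \<longrightarrow> base_coeffs b' i = 0"
        using boundary_test[OF b False] by blast
      have "(\<Sum>z\<in>S. s z * (case z of I0 e' b' \<Rightarrow> if e' = e \<and> base_N b' = base_N b then base_coeffs b' i else 0 | I1 b' \<Rightarrow> 0)) = 0"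
      proof (intro sum.neutral ballI)
        fix z assume "z \<in> S"
        then have "valid_index z" by (rule S(2))
        then show "s z * (case z of I0 e' b' \<Rightarrow> if e' = e \<and> base_N b' = base_N b then base_coeffs b' i else 0 | I1 b' \<Rightarrow> 0) = 0"
          using i(4) by (cases z) auto
      qed
      then show ?thesis using test[OF i(1,2)] i(3) by simp
    qed
    then have "0 = (\<Sum>z\<in>S. s z * (case z of I0 e' b' \<Rightarrow> if e' = e \<and> base_N b' = base_N b then base_coeffs b' j else 0 | I1 b' \<Rightarrow> 0))"
      using test[OF j(1,2)] by simp
    also have "\<dots> = s x * (case x of I0 e' b' \<Rightarrow> if e' = e \<and> base_N b' = base_N b then base_coeffs b' j else 0 | I1 b' \<Rightarrow> 0)"
    proof (rule sum_eq_single[OF S(1) x])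
      fix z assume z: "z \<in> S" "z \<noteq> x"
      then have "valid_index z" using S(2) by blast
      then show "s z * (case z of I0 e' b' \<Rightarrow> if e' = e \<and> base_N b' = base_N b then base_coeffs b' j else 0 | I1 b' \<Rightarrow> 0) = 0"
        using j(4) z(2) I0 by (cases z) auto
    qed
    also have "\<dots> = s x" by (simp add: I0 j(3))
    finally show ?thesis by simp
  qed
qed

end

section \<open>Basis and relations\<close>

context odd_card
begin

text \<open>Independence applied to two names with coefficients 1 and -1.\<close>

lemma basis_class_inj: "inj_on basis_class {x. valid_index x}"
proof (rule inj_onI, rule ccontr)
  fix x y assume xy: "x \<in> {x. valid_index x}" "y \<in> {x. valid_index x}" "basis_class x = basis_class y" "x \<noteq> y"
  have "(\<Sum>z\<in>{x, y}. scale_extP (if z = x then 1 else - 1) (basis_class z)) = 0"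
    using xy(3,4) by (simp add: extP.scale_minus_left)
  from basis_class_independent[OF _ _ this, of x] xy show False by auto
qed

theorem basis_class_basis: "extP.independent (basis_class ` {x. valid_index x})"
  unfolding extP.independent_explicit_module
proof (intro allI impI)
  fix t u v assume t: "finite t" "t \<subseteq> basis_class ` {x. valid_index x}" "(\<Sum>v\<in>t. scale_extP (u v) v) = 0" "v \<in> t"
  obtain S where S: "S \<subseteq> {x. valid_index x}" "finite S" "t = basis_class ` S"
    using finite_subset_image[OF t(1,2)] by blast
  have "inj_on basis_class S" using basis_class_inj S(1) by (rule inj_on_subset)
  then have "(\<Sum>x\<in>S. scale_extP (u (basis_class x)) (basis_class x)) = 0"
    using t(3) unfolding S(3) by (simp add: sum.reindex)
  then have "u (basis_class x) = 0" if "x \<in> S" for x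
    using basis_class_independent[OF S(2) _ _ that, of "\<lambda>x. u (basis_class x)"] S(1) by blast
  then show "u v = 0" using t(4) S(3) by blast
qed

text \<open>\<open>Hhat j\<close> is treated as \<open>Hhat_k j (p - 1)\<close>; nothing is confused
  on \<open>decomposables\<close>, where \<open>k < p - 1\<close>.\<close>

fun rfactor_params :: "rfactor \<Rightarrow> nat \<times> nat" where
  "rfactor_params (Hhat j) = (j, p - 1)"
| "rfactor_params (Hhat_k j k) = (j, k)"

lemma rfactor_val_params: "rfactor_val r = (h_hat_k (fst (rfactor_params r)) (snd (rfactor_params r)) :: 'p extP)"
  by (cases r) (simp_all add: h_hat_eq)

text \<open>The exponent of P^0 is the smaller of the two subscripts, as in
  \<open>h_product_shift\<close>.\<close>

definition h_index :: "nat \<Rightarrow> nat \<Rightarrow> nat \<Rightarrow> index" where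
  "h_index i j k = (if j = i then I0 i (K_base 0) else if i < j then I0 i (HR_base (j - i) k) else I0 j (HL_base (i - j) k))"

lemma h_value:
  assumes k: "1 \<le> k" "k \<le> p - 1" and ij: "j \<noteq> i + 1" "j = i \<Longrightarrow> k = 1"
  shows "valid_index (h_index i j k)" "h_cls i \<odot> h_hat_k j k = basis_class (h_index i j k)"
proof -
  consider "j = i" | m where "j = i + m" "2 \<le> m" | m where "i = j + m" "1 \<le> m"
  proof (cases i j rule: linorder_cases)
    case less
    then obtain m where "j = i + m" using less_imp_le le_Suc_ex by blast
    then show ?thesis using that(2)[of m] less ij(1) by linarith
  next
    case equal
    then show ?thesis using that(1) by simp
  next
    case greater
    then obtain m where "i = j + m" using less_imp_le le_Suc_ex by blast
    then show ?thesis using that(3)[of m] greater by linarith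
  qed
  then have "valid_index (h_index i j k) \<and> h_cls i \<odot> h_hat_k j k = basis_class (h_index i j k)"
  proof cases
    case 1
    then show ?thesis using ij(2) h_same_value[of i] by (simp add: h_index_def)
  next
    case 2
    then show ?thesis using h_right_value[OF k, of i m] k by (simp add: h_index_def)
  next
    case 3
    then show ?thesis using h_left_value[OF k, of j m] k by (simp add: h_index_def)
  qed
  then show "valid_index (h_index i j k)" "h_cls i \<odot> h_hat_k j k = basis_class (h_index i j k)" by simp_all
qed

fun product_index :: "lfactor \<times> rfactor \<Rightarrow> index" where
  "product_index (Alpha0, r) = I1 (Alpha_h (fst (rfactor_params r)) (snd (rfactor_params r)))"
| "product_index (H i, r) = h_index i (fst (rfactor_params r)) (snd (rfactor_params r))"

text \<open>With \<open>Hhat j\<close> read as \<open>k = p - 1\<close>, the six families of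
  relations become three conditions.\<close>

definition vanishes :: "lfactor \<times> rfactor \<Rightarrow> bool" where
  "vanishes w \<longleftrightarrow> (case fst w of Alpha0 \<Rightarrow> fst (rfactor_params (snd w)) = 0
     | H i \<Rightarrow> fst (rfactor_params (snd w)) = i + 1 \<or> fst (rfactor_params (snd w)) = i \<and> 2 \<le> snd (rfactor_params (snd w)))"

abbreviation decomposables :: "(lfactor \<times> rfactor) set" where
  "decomposables \<equiv> {(u, v). \<forall>j k. v = Hhat_k j k \<longrightarrow> 1 \<le> k \<and> k < p - 1}"

lemma decomposable_params:
  assumes "w \<in> decomposables"
  shows "1 \<le> snd (rfactor_params (snd w))" "snd (rfactor_params (snd w)) \<le> p - 1"
  using assms p_ge_3 by (cases w; cases "snd w"; auto)+

lemma formal_val_vanishes: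
  assumes w: "w \<in> decomposables" "vanishes w"
  shows "formal_val w = (0 :: 'p extP)"
proof (cases w)
  case (Pair u r)
  note k = decomposable_params[OF w(1), unfolded Pair snd_conv]
  show ?thesis
    using w(2) alpha0_vanish[OF k] h_vanish_succ[OF k] h_vanish_same[OF _ k(2)]
    by (cases u) (auto simp: Pair vanishes_def formal_val_def rfactor_val_params)
qed

lemma formal_val_index:
  assumes w: "w \<in> decomposables" "\<not> vanishes w"
  shows "valid_index (product_index w)" "formal_val w = basis_class (product_index w)"
proof -
  obtain u r where uw: "w = (u, r)" by (cases w)
  note k = decomposable_params[OF w(1), unfolded uw snd_conv]
  have "valid_index (product_index w) \<and> formal_val w = basis_class (product_index w)"
  proof (cases u)
    case Alpha0
    then have "1 \<le> fst (rfactor_params r)" using w(2) by (simp add: uw vanishes_def)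
    then show ?thesis using k alpha0_value[OF k] by (simp add: uw Alpha0 formal_val_def rfactor_val_params)
  next
    case (H i)
    then have ij: "fst (rfactor_params r) \<noteq> i + 1" "fst (rfactor_params r) = i \<Longrightarrow> snd (rfactor_params r) = 1"
      using w(2) k by (auto simp: uw vanishes_def)
    show ?thesis using h_value[OF k ij] by (simp add: uw H formal_val_def rfactor_val_params)
  qed
  then show "valid_index (product_index w)" "formal_val w = basis_class (product_index w)" by simp_all
qed

lemma rfactor_params_inj: "(u, r) \<in> decomposables \<Longrightarrow> (u', r') \<in> decomposables \<Longrightarrow> rfactor_params r = rfactor_params r' \<Longrightarrow> r = r'"
  by (cases r; cases r') auto

lemma h_index_inj:
  assumes "h_index i j k = h_index i' j' k'" "j = i \<Longrightarrow> k = 1" "j' = i' \<Longrightarrow> k' = 1"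
  shows "i = i'" "j = j'" "k = k'"
proof -
  have "i = i' \<and> j = j' \<and> k = k'"
    using assms by (auto simp: h_index_def split: if_splits)
  then show "i = i'" "j = j'" "k = k'" by simp_all
qed

lemma product_index_inj: "inj_on product_index {w \<in> decomposables. \<not> vanishes w}"
proof (rule inj_onI)
  fix w w' assume w: "w \<in> {w \<in> decomposables. \<not> vanishes w}" "w' \<in> {w \<in> decomposables. \<not> vanishes w}"
    and eq: "product_index w = product_index w'"
  obtain u r u' r' where uw: "w = (u, r)" "w' = (u', r')" by (cases w; cases w')
  have d: "(u, r) \<in> decomposables" "(u', r') \<in> decomposables" "\<not> vanishes (u, r)" "\<not> vanishes (u', r')"
    using w unfolding uw by blast+
  note k = decomposable_params[OF d(1), unfolded snd_conv] decomposable_params[OF d(2), unfolded snd_conv]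
  show "w = w'"
  proof (cases u)
    case A: Alpha0
    show ?thesis
    proof (cases u')
      case Alpha0
      then have "rfactor_params r = rfactor_params r'" using eq A by (simp add: uw prod_eq_iff)
      then show ?thesis using rfactor_params_inj[OF d(1,2)] A Alpha0 uw by simp
    next
      case (H i)
      then show ?thesis using eq A by (simp add: uw h_index_def split: if_splits)
    qed
  next
    case Hi: (H i)
    show ?thesis
    proof (cases u')
      case Alpha0
      then show ?thesis using eq Hi by (simp add: uw h_index_def split: if_splits)
    next
      case (H i')
      have s: "fst (rfactor_params r) = i \<Longrightarrow> snd (rfactor_params r) = 1" "fst (rfactor_params r') = i' \<Longrightarrow> snd (rfactor_params r') = 1"
        using d(3,4) k by (auto simp: Hi H vanishes_def)
      have "h_index i (fst (rfactor_params r)) (snd (rfactor_params r)) = h_index i' (fst (rfactor_params r')) (snd (rfactor_params r'))"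
        using eq by (simp add: uw Hi H)
      from h_index_inj[OF this s] have "i = i'" "rfactor_params r = rfactor_params r'" by (simp_all add: prod_eq_iff)
      then show ?thesis using rfactor_params_inj[OF d(1,2)] Hi H uw by simp
    qed
  qed
qed

lemma vanishing_eq:
  "{(H i, Hhat (i + 1)) | i. True}
      \<union> {(H i, Hhat_k (i + 1) k) | i k. 1 \<le> k \<and> k < p - 1}
      \<union> {(H i, Hhat i) | i. True}
      \<union> {(H i, Hhat_k i k) | i k. 2 \<le> k \<and> k < p - 1}
      \<union> {(Alpha0, Hhat 0)}
      \<union> {(Alpha0, Hhat_k 0 k) | k. 1 \<le> k \<and> k < p - 1} = {w \<in> decomposables. vanishes w}" (is "?A = ?B")
proof (rule Set.set_eqI)
  fix w :: "lfactor \<times> rfactor"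
  obtain u r where w: "w = (u, r)" by (cases w)
  \<comment> \<open>Puts \<open>Hhat i\<close>, that is \<open>k = p - 1\<close>, among the cases
    with \<open>2 \<le> k\<close>.\<close>
  have "2 \<le> p - 1" using p_ge_3 by simp
  then show "w \<in> ?A \<longleftrightarrow> w \<in> ?B"
    unfolding w by (cases u; cases r) (auto simp: vanishes_def)
qed

text \<open>By \<open>product_index_inj\<close> the products that do not vanish are different basis
  elements, so their coefficients in a linear relation are 0.\<close>

theorem relations:
  fixes c :: "lfactor \<times> rfactor \<Rightarrow>\<^sub>0 'p mod_ring"
  assumes c: "Poly_Mapping.keys c \<subseteq> decomposables"
    and sum: "(\<Sum>w\<in>Poly_Mapping.keys c. scale_extP (Poly_Mapping.lookup c w) (formal_val w)) = 0"
  shows "Poly_Mapping.keys c \<subseteq> {w \<in> decomposables. vanishes w}"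
proof
  let ?S = "{w \<in> Poly_Mapping.keys c. \<not> vanishes w}"
  have S: "?S \<subseteq> {w \<in> decomposables. \<not> vanishes w}" using c by blast
  have inj: "inj_on product_index ?S" using product_index_inj S by (rule inj_on_subset)
  have "(\<Sum>w\<in>Poly_Mapping.keys c. scale_extP (Poly_Mapping.lookup c w) (formal_val w)) =
      (\<Sum>w\<in>?S. scale_extP (Poly_Mapping.lookup c w) (formal_val w))"
  proof (rule sum.mono_neutral_right)
    show "\<forall>w\<in>Poly_Mapping.keys c - ?S. scale_extP (Poly_Mapping.lookup c w) (formal_val w) = 0"
    proof
      fix w assume "w \<in> Poly_Mapping.keys c - ?S"
      then have "formal_val w = (0 :: 'p extP)" using c by (intro formal_val_vanishes) auto
      then show "scale_extP (Poly_Mapping.lookup c w) (formal_val w) = 0" by simp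
    qed
  qed auto
  also have "\<dots> = (\<Sum>w\<in>?S. scale_extP (Poly_Mapping.lookup c (inv_into ?S product_index (product_index w))) (basis_class (product_index w)))"
  proof (rule sum.cong[OF refl])
    fix w assume w: "w \<in> ?S"
    then have "formal_val w = basis_class (product_index w)" using S by (intro formal_val_index(2)) auto
    then show "scale_extP (Poly_Mapping.lookup c w) (formal_val w) =
        scale_extP (Poly_Mapping.lookup c (inv_into ?S product_index (product_index w))) (basis_class (product_index w))"
      using inv_into_f_f[OF inj w] by (simp only:)
  qed
  also have "\<dots> = (\<Sum>x\<in>product_index ` ?S. scale_extP (Poly_Mapping.lookup c (inv_into ?S product_index x)) (basis_class x))"
    by (simp only: sum.reindex[OF inj] o_def)
  finally have zero: "(\<Sum>x\<in>product_index ` ?S. scale_extP (Poly_Mapping.lookup c (inv_into ?S product_index x)) (basis_class x)) = 0"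
    using sum by simp
  fix w assume w: "w \<in> Poly_Mapping.keys c"
  show "w \<in> {w \<in> decomposables. vanishes w}"
  proof (rule ccontr)
    assume "\<not> ?thesis"
    then have wS: "w \<in> ?S" using w c by blast
    have "Poly_Mapping.lookup c (inv_into ?S product_index (product_index w)) = 0"
    proof (rule basis_class_independent[OF _ _ zero])
      show "valid_index x" if "x \<in> product_index ` ?S" for x using that S formal_val_index(1) by blast
    qed (use wS in auto)
    then show False using w unfolding inv_into_f_f[OF inj wS] by (simp add: in_keys_iff)
  qed
qed

text \<open>An equality of sets: \<open>d_hat (e + 1) 1\<close> is also
  \<open>h_cls e \<odot> h_hat_k (e + 2) 1\<close>, so the list names this class twice, while among
  the valid names it is only \<open>HR_base 2 1\<close>.\<close>

lemma basis_eq: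
  "{alpha0 \<odot> h_hat i | i. 1 \<le> i}
      \<union> {alpha0 \<odot> h_hat_k i k | i k. 1 \<le> i \<and> 1 \<le> k \<and> k < p - 1}
      \<union> {alpha_hat l | l. l < p - 2}
      \<union> {h_cls i \<odot> h_hat_k i 1 | i. True}
      \<union> {h_cls i \<odot> h_hat j | i j. j \<noteq> i \<and> j \<noteq> i + 1}
      \<union> {h_cls i \<odot> h_hat_k j k | i j k. j \<noteq> i \<and> j \<noteq> i + 1 \<and> 1 \<le> k \<and> k < p - 1}
      \<union> {d_hat i k | i k. 1 \<le> i \<and> 1 \<le> k \<and> k \<le> p - 1}
      \<union> {k_hat i k | i k. 1 \<le> k \<and> k < p - 1}
      \<union> {p_hat i r | i r. 1 \<le> r \<and> r < p - 1} = basis_class ` {x. valid_index x}" (is "?B = _")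
proof
  have p1: "1 \<le> p - 1" "p - 1 \<le> p - 1" "1 < p - 1" using p_ge_3 by simp_all
  have mem: "v \<in> basis_class ` {x. valid_index x}" if "valid_index x" "v = basis_class x" for x v using that by blast
  have Alpha_h: "alpha0 \<odot> h_hat_k i k \<in> basis_class ` {x. valid_index x}" if "1 \<le> i" "1 \<le> k" "k \<le> p - 1" for i k
    by (rule mem[of "I1 (Alpha_h i k)"]) (use that alpha0_value in simp_all)
  have h: "h_cls i \<odot> h_hat_k j k \<in> basis_class ` {x. valid_index x}" if "1 \<le> k" "k \<le> p - 1" "j \<noteq> i + 1" "j = i \<Longrightarrow> k = 1" for i j k
    using h_value[OF that] by (rule mem)
  have d: "d_hat i k \<in> basis_class ` {x. valid_index x}" if i: "1 \<le> i" and k: "1 \<le> k" "k \<le> p - 1" for i k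
  proof -
    obtain e where e: "i = e + 1" using i by (metis le_add_diff_inverse2)
    show ?thesis
    proof (cases "k = 1")
      case True
      show ?thesis by (rule mem[of "I0 e (HR_base 2 1)"]) (use p1 d_hat_1_value in \<open>simp_all add: e True\<close>)
    next
      case False
      show ?thesis by (rule mem[of "I0 e (D_base k)"]) (use k False d_hat_value in \<open>simp_all add: e\<close>)
    qed
  qed
  have kh: "k_hat i k \<in> basis_class ` {x. valid_index x}" if "k < p - 1" for i k
    by (rule mem[of "I0 i (K_base k)"]) (use that k_hat_value in simp_all)
  have ph: "p_hat i r \<in> basis_class ` {x. valid_index x}" if "1 \<le> r" "r < p - 1" for i r
    by (rule mem[of "I0 i (P_base r)"]) (use that p_hat_value in simp_all)
  have ah: "alpha_hat l \<in> basis_class ` {x. valid_index x}" if "l < p - 2" for l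
    by (rule mem[of "I1 (Alpha_hat l)"]) (use that alpha_hat_value in simp_all)
  show "?B \<subseteq> basis_class ` {x. valid_index x}"
    unfolding h_hat_eq
  proof (intro Un_least subsetI; elim CollectE exE conjE; hypsubst)
    show "alpha0 \<odot> h_hat_k i (p - 1) \<in> basis_class ` {x. valid_index x}" if "1 \<le> i" for i using Alpha_h that p1 by blast
    show "alpha0 \<odot> h_hat_k i k \<in> basis_class ` {x. valid_index x}" if "1 \<le> i" "1 \<le> k" "k < p - 1" for i k using Alpha_h that by simp
    show "alpha_hat l \<in> basis_class ` {x. valid_index x}" if "l < p - 2" for l using that by (rule ah)
    show "h_cls i \<odot> h_hat_k i 1 \<in> basis_class ` {x. valid_index x}" for i using h[of 1 i i] p1 by simp
    show "h_cls i \<odot> h_hat_k j (p - 1) \<in> basis_class ` {x. valid_index x}" if "j \<noteq> i" "j \<noteq> i + 1" for i j using h[of "p - 1" j i] p1 that by simp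
    show "h_cls i \<odot> h_hat_k j k \<in> basis_class ` {x. valid_index x}" if "j \<noteq> i" "j \<noteq> i + 1" "1 \<le> k" "k < p - 1" for i j k
      using h[of k j i] that by simp
    show "d_hat i k \<in> basis_class ` {x. valid_index x}" if "1 \<le> i" "1 \<le> k" "k \<le> p - 1" for i k using that by (rule d)
    show "k_hat i k \<in> basis_class ` {x. valid_index x}" if "1 \<le> k" "k < p - 1" for i k using that(2) by (rule kh)
    show "p_hat i r \<in> basis_class ` {x. valid_index x}" if "1 \<le> r" "r < p - 1" for i r using that by (rule ph)
  qed
  have hB: "h_cls i \<odot> h_hat_k j k \<in> ?B" if "j \<noteq> i" "j \<noteq> i + 1" "1 \<le> k" "k \<le> p - 1" for i j k
  proof (cases "k = p - 1")
    case True
    then show ?thesis using that unfolding True h_hat_eq[symmetric] by blast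
  next
    case False
    then have "k < p - 1" using that by simp
    then show ?thesis using that by blast
  qed
  have aB: "alpha0 \<odot> h_hat_k i k \<in> ?B" if "1 \<le> i" "1 \<le> k" "k \<le> p - 1" for i k
  proof (cases "k = p - 1")
    case True
    then show ?thesis using that unfolding True h_hat_eq[symmetric] by blast
  next
    case False
    then have "k < p - 1" using that by simp
    then show ?thesis using that by blast
  qed
  show "basis_class ` {x. valid_index x} \<subseteq> ?B"
  proof
    fix v assume "v \<in> basis_class ` {x. valid_index x}"
    then obtain x where x: "valid_index x" "v = basis_class x" by blast
    show "v \<in> ?B"
    proof (cases x)
      case (I1 b)
      show ?thesis
      proof (cases b)
        case (Alpha_h i k)
        have k: "1 \<le> i" "1 \<le> k" "k \<le> p - 1" using x I1 Alpha_h by simp_all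
        show ?thesis using aB[OF k] by (simp only: alpha0_value[OF k(2,3)] x(2) I1 Alpha_h basis_class.simps)
      next
        case (Alpha_hat l)
        have "v = alpha_hat l" "l < p - 2" using x I1 Alpha_hat alpha_hat_value by simp_all
        then show ?thesis by blast
      qed
    next
      case (I0 e b)
      show ?thesis
      proof (cases b)
        case (K_base k)
        show ?thesis
        proof (cases "k = 0")
          case True
          have "v = h_cls e \<odot> h_hat_k e 1" using x(2) I0 K_base True h_same_value by simp
          then show ?thesis by blast
        next
          case False
          have k: "k \<le> p - 2" using x I0 K_base by simp
          have "v = k_hat e k" using x(2) I0 K_base k_hat_value[OF k] by simp
          moreover have "1 \<le> k" "k < p - 1" using False k p1 by linarith+
          ultimately show ?thesis by blast
        qed
      next
        case (HL_base m k)
        have k: "1 \<le> m" "1 \<le> k" "k \<le> p - 1" using x I0 HL_base by simp_all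
        have "v = h_cls (e + m) \<odot> h_hat_k e k" by (simp only: h_left_value[OF k(2,3)] x(2) I0 HL_base basis_class.simps)
        moreover have "e \<noteq> e + m" "e \<noteq> e + m + 1" using k(1) by simp_all
        ultimately show ?thesis using hB[OF _ _ k(2,3)] by (simp only: not_False_eq_True)
      next
        case (HR_base m k)
        have k: "2 \<le> m" "1 \<le> k" "k \<le> p - 1" using x I0 HR_base by simp_all
        have "v = h_cls e \<odot> h_hat_k (e + m) k" by (simp only: h_right_value[OF k(2,3)] x(2) I0 HR_base basis_class.simps)
        moreover have "e + m \<noteq> e" "e + m \<noteq> e + 1" using k(1) by simp_all
        ultimately show ?thesis using hB[OF _ _ k(2,3)] by (simp only: not_False_eq_True)
      next
        case (D_base k)
        have "1 \<le> e + 1" "1 \<le> k" "k \<le> p - 1" using x I0 D_base by simp_all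
        moreover have "v = d_hat (e + 1) k" by (simp only: d_hat_value x(2) I0 D_base basis_class.simps)
        ultimately show ?thesis by blast
      next
        case (P_base r)
        have r: "1 \<le> r" "r \<le> p - 2" using x I0 P_base by simp_all
        have "v = p_hat e r" by (simp only: p_hat_value[OF r] x(2) I0 P_base basis_class.simps)
        moreover have "r < p - 1" using r p1 by linarith
        ultimately show ?thesis using r(1) by blast
      qed
    qed
  qed
qed

theorem basis_and_relations:
    "(let basis = ({alpha0 \<odot> h_hat i | i. 1 \<le> i}
          \<union> {alpha0 \<odot> h_hat_k i k | i k. 1 \<le> i \<and> 1 \<le> k \<and> k < p - 1}
          \<union> {alpha_hat l | l. l < p - 2}
          \<union> {h_cls i \<odot> h_hat_k i 1 | i. True}
          \<union> {h_cls i \<odot> h_hat j | i j. j \<noteq> i \<and> j \<noteq> i + 1}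
          \<union> {h_cls i \<odot> h_hat_k j k | i j k. j \<noteq> i \<and> j \<noteq> i + 1 \<and> 1 \<le> k \<and> k < p - 1}
          \<union> {d_hat i k | i k. 1 \<le> i \<and> 1 \<le> k \<and> k \<le> p - 1}
          \<union> {k_hat i k | i k. 1 \<le> k \<and> k < p - 1}
          \<union> {p_hat i r | i r. 1 \<le> r \<and> r < p - 1} :: 'p extP set)
      in (\<forall>x\<in>basis. \<exists>u. x \<in> Ext_P_bi 1 u) \<and> extP.independent basis \<and> extP.span basis = Ext_P 1)
    \<and> (\<forall>i\<ge>1. alpha0 \<odot> h_hat i = (clsP (ab (mu 0) ((p - 1) * p ^ i - 1)) :: 'p extP))
    \<and> (\<forall>i\<ge>1. \<forall>k. 1 \<le> k \<and> k < p - 1 \<longrightarrow>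
      alpha0 \<odot> h_hat_k i k = (clsP (ab (mu 0) (k * p ^ i - 1)) :: 'p extP))
    \<and> (\<forall>i. h_cls i \<odot> h_hat_k i 1 = (clsP (ab (lam (p ^ i)) (p ^ i - 1)) :: 'p extP))
    \<and> (\<forall>i j. j \<noteq> i \<and> j \<noteq> i + 1 \<longrightarrow>
      h_cls i \<odot> h_hat j = (clsP (ab (lam (p ^ i)) ((p - 1) * p ^ j - 1)) :: 'p extP))
    \<and> (\<forall>i j k. j \<noteq> i \<and> j \<noteq> i + 1 \<and> 1 \<le> k \<and> k < p - 1 \<longrightarrow>
      h_cls i \<odot> h_hat_k j k = (clsP (ab (lam (p ^ i)) (k * p ^ j - 1)) :: 'p extP))
    \<and> (let decomposables = {(u, v). \<forall>j k. v = Hhat_k j k \<longrightarrow> 1 \<le> k \<and> k < p - 1};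
          vanishing = {(H i, Hhat (i + 1)) | i. True}
            \<union> {(H i, Hhat_k (i + 1) k) | i k. 1 \<le> k \<and> k < p - 1}
            \<union> {(H i, Hhat i) | i. True}
            \<union> {(H i, Hhat_k i k) | i k. 2 \<le> k \<and> k < p - 1}
            \<union> {(Alpha0, Hhat 0)}
            \<union> {(Alpha0, Hhat_k 0 k) | k. 1 \<le> k \<and> k < p - 1}
      in (\<forall>w\<in>vanishing. formal_val w = (0 :: 'p extP)) \<and>
         (\<forall>c :: lfactor \<times> rfactor \<Rightarrow>\<^sub>0 'p mod_ring.
            Poly_Mapping.keys c \<subseteq> decomposables \<longrightarrow>
            (\<Sum>w\<in>Poly_Mapping.keys c. scale_extP (Poly_Mapping.lookup c w) (formal_val w)) = 0 \<longrightarrow>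
            Poly_Mapping.keys c \<subseteq> vanishing))"
  unfolding Let_def basis_eq vanishing_eq
proof (intro conjI)
  have p1: "1 \<le> p - 1" "p - 1 \<le> p - 1" "1 < p - 1" using p_ge_3 by simp_all
  show "\<forall>x\<in>basis_class ` {x. valid_index x}. \<exists>u. x \<in> Ext_P_bi 1 u" using basis_class_bi by blast
  show "extP.independent (basis_class ` {x. valid_index x})" by (rule basis_class_basis)
  show "extP.span (basis_class ` {x. valid_index x}) = Ext_P 1" by (rule basis_class_span)
  show "\<forall>i\<ge>1. alpha0 \<odot> h_hat i = (clsP (ab (mu 0) ((p - 1) * p ^ i - 1)) :: 'p extP)"
    unfolding h_hat_eq using products(1)[OF p1(1,2)] by blast
  show "\<forall>i\<ge>1. \<forall>k. 1 \<le> k \<and> k < p - 1 \<longrightarrow>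
      alpha0 \<odot> h_hat_k i k = (clsP (ab (mu 0) (k * p ^ i - 1)) :: 'p extP)"
    using products(1) less_imp_le by blast
  show "\<forall>i. h_cls i \<odot> h_hat_k i 1 = (clsP (ab (lam (p ^ i)) (p ^ i - 1)) :: 'p extP)"
    using products(2)[of 1] p1(1) by (simp only: mult_1 order.refl simp_thms)
  show "\<forall>i j. j \<noteq> i \<and> j \<noteq> i + 1 \<longrightarrow>
      h_cls i \<odot> h_hat j = (clsP (ab (lam (p ^ i)) ((p - 1) * p ^ j - 1)) :: 'p extP)"
    unfolding h_hat_eq using products(2)[OF p1(1,2)] by blast
  show "\<forall>i j k. j \<noteq> i \<and> j \<noteq> i + 1 \<and> 1 \<le> k \<and> k < p - 1 \<longrightarrow>
      h_cls i \<odot> h_hat_k j k = (clsP (ab (lam (p ^ i)) (k * p ^ j - 1)) :: 'p extP)"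
    using products(2) less_imp_le by blast
  show "\<forall>w\<in>{w \<in> decomposables. vanishes w}. formal_val w = (0 :: 'p extP)"
    using formal_val_vanishes by blast
  show "\<forall>c :: lfactor \<times> rfactor \<Rightarrow>\<^sub>0 'p mod_ring.
        Poly_Mapping.keys c \<subseteq> decomposables \<longrightarrow>
        (\<Sum>w\<in>Poly_Mapping.keys c. scale_extP (Poly_Mapping.lookup c w) (formal_val w)) = 0 \<longrightarrow>
        Poly_Mapping.keys c \<subseteq> {w \<in> decomposables. vanishes w}"
    using relations by blast
qed

end

theorem theorem3p2:
  fixes p :: nat
  assumes "p = CARD('p::prime_card)" and "odd p"
  shows
    "(let basis = ({alpha0 \<odot> h_hat i | i. 1 \<le> i}
          \<union> {alpha0 \<odot> h_hat_k i k | i k. 1 \<le> i \<and> 1 \<le> k \<and> k < p - 1}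
          \<union> {alpha_hat l | l. l < p - 2}
          \<union> {h_cls i \<odot> h_hat_k i 1 | i. True}
          \<union> {h_cls i \<odot> h_hat j | i j. j \<noteq> i \<and> j \<noteq> i + 1}
          \<union> {h_cls i \<odot> h_hat_k j k | i j k. j \<noteq> i \<and> j \<noteq> i + 1 \<and> 1 \<le> k \<and> k < p - 1}
          \<union> {d_hat i k | i k. 1 \<le> i \<and> 1 \<le> k \<and> k \<le> p - 1}
          \<union> {k_hat i k | i k. 1 \<le> k \<and> k < p - 1}
          \<union> {p_hat i r | i r. 1 \<le> r \<and> r < p - 1} :: 'p extP set)
      in (\<forall>x\<in>basis. \<exists>u. x \<in> Ext_P_bi 1 u) \<and> extP.independent basis \<and> extP.span basis = Ext_P 1)
    \<and> (\<forall>i\<ge>1. alpha0 \<odot> h_hat i = (clsP (ab (mu 0) ((p - 1) * p ^ i - 1)) :: 'p extP))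
    \<and> (\<forall>i\<ge>1. \<forall>k. 1 \<le> k \<and> k < p - 1 \<longrightarrow>
      alpha0 \<odot> h_hat_k i k = (clsP (ab (mu 0) (k * p ^ i - 1)) :: 'p extP))
    \<and> (\<forall>i. h_cls i \<odot> h_hat_k i 1 = (clsP (ab (lam (p ^ i)) (p ^ i - 1)) :: 'p extP))
    \<and> (\<forall>i j. j \<noteq> i \<and> j \<noteq> i + 1 \<longrightarrow>
      h_cls i \<odot> h_hat j = (clsP (ab (lam (p ^ i)) ((p - 1) * p ^ j - 1)) :: 'p extP))
    \<and> (\<forall>i j k. j \<noteq> i \<and> j \<noteq> i + 1 \<and> 1 \<le> k \<and> k < p - 1 \<longrightarrow>
      h_cls i \<odot> h_hat_k j k = (clsP (ab (lam (p ^ i)) (k * p ^ j - 1)) :: 'p extP))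
    \<and> (let decomposables = {(u, v). \<forall>j k. v = Hhat_k j k \<longrightarrow> 1 \<le> k \<and> k < p - 1};
          vanishing = {(H i, Hhat (i + 1)) | i. True}
            \<union> {(H i, Hhat_k (i + 1) k) | i k. 1 \<le> k \<and> k < p - 1}
            \<union> {(H i, Hhat i) | i. True}
            \<union> {(H i, Hhat_k i k) | i k. 2 \<le> k \<and> k < p - 1}
            \<union> {(Alpha0, Hhat 0)}
            \<union> {(Alpha0, Hhat_k 0 k) | k. 1 \<le> k \<and> k < p - 1}
      in (\<forall>w\<in>vanishing. formal_val w = (0 :: 'p extP)) \<and>
         (\<forall>c :: lfactor \<times> rfactor \<Rightarrow>\<^sub>0 'p mod_ring.
            Poly_Mapping.keys c \<subseteq> decomposables \<longrightarrow>
            (\<Sum>w\<in>Poly_Mapping.keys c. scale_extP (Poly_Mapping.lookup c w) (formal_val w)) = 0 \<longrightarrow>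
            Poly_Mapping.keys c \<subseteq> vanishing))"
proof -
  have "odd_card TYPE('p) p"
  proof unfold_locales
    show "prime p" using prime_card[where 'a = 'p] assms(1) by simp
    show "odd p" by (rule assms(2))
    show "CHAR('p mod_ring) = p" using assms(1) by simp
    show "CARD('p) = p" using assms(1) by simp
  qed
  then show ?thesis by (rule odd_card.basis_and_relations)
qed

end
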